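(* Let $n\geqslant 3$, $0<\alpha\leqslant 2$, let $A$ be an arbitrary proper subset of $\mathbb R^n$ with $c_\alpha(A)>0$, and let $\mu\in\mathcal E^+$. Then $$E(\mu,\lambda^A)=E(\mu^A,\lambda)\quad\text{for all }\lambda\in\mathcal E^+.$$ This identity determines $\mu^A$ uniquely: if $\nu\in\mathfrak M^+$ satisfies $E(\mu,\lambda^A)=E(\nu,\lambda)$ for all $\lambda\in\mathcal E^+$, then $\nu=\mu^A$.
   Context: For a Radon measure $\nu$ on $\mathbb R^n$, the potential is $U^\nu(x)=\int|x-y|^{\alpha-n}\,d\nu(y)$; the mutual energy is $E(\nu,\nu_1)=\int|x-y|^{\alpha-n}\,d(\nu\otimes\nu_1)(x,y)$ and the energy is $E(\nu)=E(\nu,\nu)$. $\mathfrak M^+$ is the cone of all positive Radon measures $\mu$ on $\mathbb R^n$ such that $U^\mu$ is not identically infinite (standing convention). The signed Radon measures of finite energy form a pre-Hilbert space $\mathcal E$ with inner product $E(\nu,\nu_1)$ and norm $\|\nu\|=\sqrt{E(\nu)}$; the corresponding topology is called strong. $\mathcal E^+$ is the cone of positive measures in $\mathcal E$. For $Q\subset\mathbb R^n$, $\mathcal E^+_Q$ is the cone of all $\nu\in\mathcal E^+$ carried by $Q$, i.e. such that $Q$ is $\nu$-measurable and $Q^c$ is $\nu$-negligible. The inner capacity is $c_\alpha(Q)=1/\inf E(\nu)$, where $\nu$ ranges over all $\nu\in\mathcal E^+_Q$ with $\nu(\mathbb R^n)=1$ ($\inf\varnothing=+\infty$, $1/(+\infty)=0$,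 $1/0=+\infty$). For $\lambda\in\mathcal E^+$, $\lambda^A\in\mathcal E^+$ denotes the orthogonal projection of $\lambda$ onto $\mathcal E'_A$, the closure of $\mathcal E^+_A$ in the strong topology; i.e. $\lambda^A$ is the unique element of $\mathcal E'_A$ with $\|\lambda-\lambda^A\|=\min_{\nu\in\mathcal E'_A}\|\lambda-\nu\|$. The measure $\mu^A$ is defined likewise. *)

theory Defs
  imports "HOL-Analysis.Analysis"
begin

text \<open>
  \<open>\<real>\<^sup>n\<close> is rendered as an arbitrary type \<open>'a\<close> of class \<open>euclidean_space\<close>, with \<open>n = DIM('a)\<close>.
\<close>

text \<open>
  Positive Radon measures. On a Euclidean space every Borel measure that is finite on compact
  sets is regular, so regularity is not demanded separately.
\<close>

definition radon :: "'a::euclidean_space measure \<Rightarrow> bool" where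
  "radon \<mu> \<longleftrightarrow> sets \<mu> = sets borel \<and> (\<forall>K. compact K \<longrightarrow> emeasure \<mu> K < \<infinity>)"

text \<open>
  The diagonal is treated separately, because \<open>0 powr a = 0\<close> in HOL whereas the Riesz
  kernel (with \<open>\<alpha> < n\<close>) is infinite there.
\<close>

definition riesz_kernel :: "real \<Rightarrow> 'a::euclidean_space \<Rightarrow> 'a \<Rightarrow> ennreal" where
  "riesz_kernel \<alpha> x y =
     (if x = y then \<infinity> else ennreal (norm (x - y) powr (\<alpha> - real DIM('a))))"

definition potential :: "real \<Rightarrow> 'a::euclidean_space measure \<Rightarrow> 'a \<Rightarrow> ennreal" where
  "potential \<alpha> \<nu> x = (\<integral>\<^sup>+ y. riesz_kernel \<alpha> x y \<partial>\<nu>)"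

definition mutual_energy ::
    "real \<Rightarrow> 'a::euclidean_space measure \<Rightarrow> 'a measure \<Rightarrow> ennreal" where
  "mutual_energy \<alpha> \<nu> \<nu>\<^sub>1 = (\<integral>\<^sup>+ z. riesz_kernel \<alpha> (fst z) (snd z) \<partial>(\<nu> \<Otimes>\<^sub>M \<nu>\<^sub>1))"

definition energy :: "real \<Rightarrow> 'a::euclidean_space measure \<Rightarrow> ennreal" where
  "energy \<alpha> \<nu> = mutual_energy \<alpha> \<nu> \<nu>"

definition M_plus :: "real \<Rightarrow> 'a::euclidean_space measure set" where
  "M_plus \<alpha> = {\<mu>. radon \<mu> \<and> (\<exists>x. potential \<alpha> \<mu> x \<noteq> \<infinity>)}"

definition E_plus :: "real \<Rightarrow> 'a::euclidean_space measure set" where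
  "E_plus \<alpha> = {\<mu>. radon \<mu> \<and> energy \<alpha> \<mu> < \<infinity>}"

text \<open>
  A signed Radon measure may have infinite positive and negative parts, so it is not a set
  function on all Borel sets. It is represented by its Hahn--Jordan decomposition
  \<open>(\<nu>\<^sup>+, \<nu>\<^sup>-)\<close>, i.e. by a pair of mutually singular positive Radon measures; this
  representation is unique.
\<close>

type_synonym 'a signed_measure = "'a measure \<times> 'a measure"

definition signed_radon :: "'a::euclidean_space signed_measure \<Rightarrow> bool" where
  "signed_radon \<nu> \<longleftrightarrow> radon (fst \<nu>) \<and> radon (snd \<nu>) \<and>
     (\<exists>S\<in>sets borel. emeasure (fst \<nu>) (- S) = 0 \<and> emeasure (snd \<nu>) S = 0)"

definition of_positive :: "'a::euclidean_space measure \<Rightarrow> 'a signed_measure" where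
  "of_positive \<mu> = (\<mu>, null_measure borel)"

text \<open>
  Signed Radon measures of finite energy: the kernel is integrable with respect to
  \<open>\<bar>\<nu>\<bar> \<otimes> \<bar>\<nu>\<bar>\<close>, where \<open>\<bar>\<nu>\<bar> = \<nu>\<^sup>+ + \<nu>\<^sup>-\<close>.
\<close>

definition E_space :: "real \<Rightarrow> 'a::euclidean_space signed_measure set" where
  "E_space \<alpha> = {\<nu>. signed_radon \<nu> \<and> energy \<alpha> (fst \<nu>) < \<infinity> \<and> energy \<alpha> (snd \<nu>) < \<infinity> \<and>
     mutual_energy \<alpha> (fst \<nu>) (snd \<nu>) < \<infinity>}"

text \<open>
  The mutual energy of signed measures. On \<open>E_space \<alpha>\<close> all four terms are finite
  (Cauchy--Schwarz), so the convention \<open>enn2real \<infinity> = 0\<close> is never in effect.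
\<close>

definition E_inner ::
    "real \<Rightarrow> 'a::euclidean_space signed_measure \<Rightarrow> 'a signed_measure \<Rightarrow> real" where
  "E_inner \<alpha> \<nu> \<nu>\<^sub>1 =
     enn2real (mutual_energy \<alpha> (fst \<nu>) (fst \<nu>\<^sub>1)) + enn2real (mutual_energy \<alpha> (snd \<nu>) (snd \<nu>\<^sub>1))
   - enn2real (mutual_energy \<alpha> (fst \<nu>) (snd \<nu>\<^sub>1)) - enn2real (mutual_energy \<alpha> (snd \<nu>) (fst \<nu>\<^sub>1))"

text \<open>
  The strong distance \<open>\<parallel>\<nu> - \<nu>\<^sub>1\<parallel>\<close>, with \<open>E(\<nu> - \<nu>\<^sub>1)\<close> expanded by bilinearity.
\<close>

definition strong_dist ::
    "real \<Rightarrow> 'a::euclidean_space signed_measure \<Rightarrow> 'a signed_measure \<Rightarrow> real" where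
  "strong_dist \<alpha> \<nu> \<nu>\<^sub>1 = sqrt (E_inner \<alpha> \<nu> \<nu> - 2 * E_inner \<alpha> \<nu> \<nu>\<^sub>1 + E_inner \<alpha> \<nu>\<^sub>1 \<nu>\<^sub>1)"

text \<open>
  The set \<open>Q\<close> is arbitrary, so \<open>\<nu>\<close>-measurability and \<open>\<nu>\<close>-negligibility refer to the
  completion of \<open>\<nu>\<close>.
\<close>

definition carried_by :: "'a::euclidean_space measure \<Rightarrow> 'a set \<Rightarrow> bool" where
  "carried_by \<nu> Q \<longleftrightarrow> Q \<in> sets (completion \<nu>) \<and> - Q \<in> null_sets (completion \<nu>)"

definition E_plus_on :: "real \<Rightarrow> 'a::euclidean_space set \<Rightarrow> 'a measure set" where
  "E_plus_on \<alpha> Q = {\<nu> \<in> E_plus \<alpha>. carried_by \<nu> Q}"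

text \<open>
  In \<open>ennreal\<close>: \<open>Inf {} = \<infinity>\<close>, \<open>1 / \<infinity> = 0\<close> and \<open>1 / 0 = \<infinity>\<close>.
\<close>

definition inner_capacity :: "real \<Rightarrow> 'a::euclidean_space set \<Rightarrow> ennreal" where
  "inner_capacity \<alpha> Q = 1 / (INF \<nu> \<in> {\<nu> \<in> E_plus_on \<alpha> Q. emeasure \<nu> UNIV = 1}. energy \<alpha> \<nu>)"

text \<open>
  The closure of \<open>E_plus_on \<alpha> A\<close> in the strong topology of the whole pre-Hilbert space
  of signed measures.
\<close>

definition E_closure :: "real \<Rightarrow> 'a::euclidean_space set \<Rightarrow> 'a signed_measure set" where
  "E_closure \<alpha> A =
     {\<kappa> \<in> E_space \<alpha>. \<forall>\<epsilon>>0. \<exists>\<nu>\<in>E_plus_on \<alpha> A. strong_dist \<alpha> \<kappa> (of_positive \<nu>) < \<epsilon>}"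

text \<open>
  The orthogonal projection \<open>l\<^sup>A\<close> of \<open>l\<close> onto the closure.
\<close>

definition inner_balayage ::
    "real \<Rightarrow> 'a::euclidean_space set \<Rightarrow> 'a measure \<Rightarrow> 'a measure" where
  "inner_balayage \<alpha> A l =
     (THE \<kappa>. \<kappa> \<in> E_plus \<alpha> \<and> of_positive \<kappa> \<in> E_closure \<alpha> A \<and>
        (\<forall>\<nu>\<in>E_closure \<alpha> A.
           strong_dist \<alpha> (of_positive l) (of_positive \<kappa>) \<le> strong_dist \<alpha> (of_positive l) \<nu>))"

end

theory Submission
  imports Defs "HOL-Probability.Probability" "HOL-Real_Asymp.Real_Asymp" "HOL-Complex_Analysis.Great_Picard"
begin

text \<open>
  The Riesz kernel is a mixture of heat kernels, so mutual energy is the \<open>L\<^sup>2\<close> inner product of the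
  heat transforms \<open>\<Phi> \<mu>\<close>. Together with weak compactness and Fatou's lemma this makes the cone
  \<open>\<E>\<^sup>+\<close> strongly complete, and a minimizing sequence yields a projection \<open>P\<close> of \<open>\<lambda>\<close> onto the closure
  of \<open>\<E>\<^sup>+\<^sub>A\<close>. The variational inequalities only say that \<open>E(\<nu>, P) \<ge> E(\<nu>, \<lambda>)\<close> for all \<open>\<nu>\<close> in \<open>\<E>\<^sup>+\<^sub>A\<close>
  and \<open>E(P, P) = E(P, \<lambda>)\<close>. The first one makes the excess of \<open>U\<^sup>\<lambda>\<close> over \<open>U\<^sup>P\<close> vanish almost everywhere
  for every \<open>\<nu>\<close> in \<open>\<E>\<^sup>+\<^sub>A\<close>.

  Equality needs \<open>\<alpha> \<le> 2\<close>. The kernel satisfies an identity \<open>\<kappa> = h + \<theta> * \<kappa>\<close> with a sub-Markovian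
  \<open>\<theta>\<close>, so the quadratic form of \<open>1 - \<theta>\<close> contracts positive parts, and it is for \<open>\<alpha> \<le> 2\<close> that \<open>h\<close>
  is, suitably normalized, an approximate identity. This gives a domination
  principle in quantitative form: for \<open>g = (U\<^sup>P - U\<^sup>L)\<^sup>+\<close> the square of \<open>\<integral>g d\<mu>\<^sub>1 - \<integral>g d\<mu>\<^sub>2\<close> is at
  most \<open>(\<integral>g dP)\<close> times the squared strong distance of \<open>\<mu>\<^sub>1\<close> and \<open>\<mu>\<^sub>2\<close>. Hence null sets of
  potential differences survive strong limits, and \<open>U\<^sup>P \<le> U\<^sup>\<lambda>\<close> \<open>P\<close>-almost everywhere implies
  the same \<open>\<nu>\<close>-almost everywhere, so that \<open>E(\<nu>, P) = E(\<nu>, \<lambda>)\<close> on \<open>\<E>\<^sup>+\<^sub>A\<close>.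

  Approximating the projections by elements of \<open>\<E>\<^sup>+\<^sub>A\<close> gives \<open>E(\<mu>, \<lambda>\<^sup>A) = E(\<mu>\<^sup>A, \<lambda>\<^sup>A) = E(\<mu>\<^sup>A, \<lambda>)\<close>.
  Uniqueness holds because a measure is determined by its mutual energies with \<open>\<E>\<^sup>+\<close>.
\<close>

section \<open>Heat kernels and the Riesz kernel\<close>

text \<open>The minimizer \<open>P\<close> lies only in the strong closure of the cone and need not
  be carried by \<open>A\<close>, so inequalities known almost everywhere for measures on
  \<open>A\<close> at first say nothing about \<open>P\<close>. The domination inequality is
  therefore stated for integrals instead of exceptional sets, and it is used twice, with the two
  potentials exchanged. For \<open>(U^L - U^P)^+\<close> it carries a zero integral from the
  approximating measures to \<open>P\<close>; then \<open>E(P, P) = E(P, L)\<close> makes the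
  integral of \<open>(U^P - U^L)^+\<close> against \<open>P\<close> vanish, and the second use, with
  the zero measure for comparison, spreads this to every measure of finite energy. The inequality
  comes from the operator \<open>1 - \<Theta>\<close>: applied to a potential it leaves a smoothing
  of the measure by the weight \<open>hw\<close>. Division by the mass \<open>H\<close> of that
  weight near time 0, and the limit \<rho> to 0, return integration against the measure itself, so
  that the quadratic form turns into energies.\<close>

definition halfline :: "real measure" where
  "halfline = density lborel (indicator {0<..})"

lemma sets_halfline [simp, measurable_cong]: "sets halfline = sets borel"
  by (simp add: halfline_def)

lemma space_halfline [simp]: "space halfline = UNIV"
  by (simp add: halfline_def)

interpretation halfline: sigma_finite_measure halfline
proof -
  have "AE x in lborel. indicator {0<..} (x::real) \<noteq> (\<infinity>::ennreal)"
    by (auto simp: indicator_def)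
  then show "sigma_finite_measure halfline"
    unfolding halfline_def
    by (subst sigma_finite_measure.sigma_finite_iff_density_finite) (auto simp: lborel.sigma_finite_measure_axioms)
qed

lemma AE_halfline: "AE t in halfline. 0 < t"
  unfolding halfline_def by (subst AE_density) (auto simp: indicator_def split: if_splits)

lemma nn_integral_halfline:
  "f \<in> borel_measurable borel \<Longrightarrow>
    (\<integral>\<^sup>+t. f t \<partial>halfline) = (\<integral>\<^sup>+t. f t * indicator {0<..} t \<partial>lborel)"
  unfolding halfline_def by (subst nn_integral_density) (auto simp: mult.commute)

text \<open>The carrier of \<open>halfline\<close> is the whole real line, so weights may take junk
  values at nonpositive times; identities valid for positive times only enter through this
  almost-everywhere form.\<close>

lemma nn_integral_halfline_cong:
  "(\<And>t. 0 < t \<Longrightarrow> f t = g t) \<Longrightarrow> (\<integral>\<^sup>+t. f t \<partial>halfline) = (\<integral>\<^sup>+t. g t \<partial>halfline)"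
  using AE_halfline by (intro nn_integral_cong_AE) auto

lemma nn_integral_halfline_mono:
  "(\<And>t. 0 < t \<Longrightarrow> f t \<le> g t) \<Longrightarrow> (\<integral>\<^sup>+t. f t \<partial>halfline) \<le> (\<integral>\<^sup>+t. g t \<partial>halfline)"
  using AE_halfline by (intro nn_integral_mono_AE) auto

lemma nn_integral_halfline_scale:
  assumes [measurable]: "f \<in> borel_measurable borel" and r: "0 < r"
  shows "(\<integral>\<^sup>+t. f t \<partial>halfline) = (\<integral>\<^sup>+t. ennreal r * f (r * t) \<partial>halfline)"
proof -
  have "(\<integral>\<^sup>+t. f t \<partial>halfline) = (\<integral>\<^sup>+t. f t * indicator {0<..} t \<partial>lborel)"
    by (rule nn_integral_halfline) simp
  also have "\<dots> = ennreal r * (\<integral>\<^sup>+t. f (0 + r * t) * indicator {0<..} (0 + r * t) \<partial>lborel)"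
    using r by (subst nn_integral_real_affine[where c=r and t=0]) auto
  also have "\<dots> = ennreal r * (\<integral>\<^sup>+t. f (r * t) * indicator {0<..} t \<partial>lborel)"
    using r by (intro arg_cong2[where f="(*)"] refl nn_integral_cong)
      (auto simp: indicator_def zero_less_mult_iff)
  also have "\<dots> = ennreal r * (\<integral>\<^sup>+t. f (r * t) \<partial>halfline)"
    by (subst nn_integral_halfline) auto
  also have "\<dots> = (\<integral>\<^sup>+t. ennreal r * f (r * t) \<partial>halfline)"
    by (subst nn_integral_cmult) auto
  finally show ?thesis .
qed

lemma nn_integral_Gamma:
  assumes "0 < b" "0 < a"
  shows "(\<integral>\<^sup>+t. ennreal (t powr (b - 1) * exp (- a * t)) \<partial>halfline) = ennreal (Gamma b / a powr b)"
proof -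
  have 1: "(\<integral>\<^sup>+t. ennreal (t powr (b - 1) * exp (- t)) \<partial>halfline) = ennreal (Gamma b)"
  proof -
    have "(\<integral>\<^sup>+t. ennreal (t powr (b - 1) * exp (- t)) \<partial>halfline)
        = (\<integral>\<^sup>+t. ennreal (t powr (b - 1) * exp (- t)) * indicator {0<..} t \<partial>lborel)"
      by (rule nn_integral_halfline) simp
    also have "\<dots> = (\<integral>\<^sup>+t. ennreal (indicator {0..} t * t powr (b - 1) / exp t) \<partial>lborel)"
      by (intro nn_integral_cong) (auto simp: indicator_def exp_minus field_simps)
    finally show ?thesis using Gamma_conv_nn_integral_real[OF \<open>0 < b\<close>] by simp
  qed
  have "ennreal (Gamma b) = (\<integral>\<^sup>+t. ennreal a * ennreal ((a * t) powr (b - 1) * exp (- (a * t))) \<partial>halfline)"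
    unfolding 1[symmetric] using \<open>0 < a\<close> by (intro nn_integral_halfline_scale) auto
  also have "\<dots> = (\<integral>\<^sup>+t. ennreal (a powr b) * ennreal (t powr (b - 1) * exp (- a * t)) \<partial>halfline)"
    using \<open>0 < a\<close> by (intro nn_integral_halfline_cong)
      (auto simp: powr_mult powr_diff field_simps simp flip: ennreal_mult)
  also have "\<dots> = ennreal (a powr b) * (\<integral>\<^sup>+t. ennreal (t powr (b - 1) * exp (- a * t)) \<partial>halfline)"
    by (rule nn_integral_cmult) simp
  finally have *: "ennreal (Gamma b) = ennreal (a powr b) * (\<integral>\<^sup>+t. ennreal (t powr (b - 1) * exp (- a * t)) \<partial>halfline)" .
  have "ennreal (Gamma b / a powr b) = ennreal (Gamma b) * ennreal (1 / a powr b)"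
    using \<open>0 < b\<close> Gamma_real_pos[of b] by (simp flip: ennreal_mult)
  also have "\<dots> = (ennreal (1 / a powr b) * ennreal (a powr b)) * (\<integral>\<^sup>+t. ennreal (t powr (b - 1) * exp (- a * t)) \<partial>halfline)"
    unfolding * by (simp only: ac_simps)
  also have "ennreal (1 / a powr b) * ennreal (a powr b) = 1"
    using \<open>0 < a\<close> by (simp flip: ennreal_mult)
  finally show ?thesis by simp
qed

text \<open>Inversion \<open>t = 1 / u\<close> turns the Gamma integral into this one. The change of
  variables is done for absolutely integrable real functions, hence the detour through
  \<open>has_integral\<close> on both sides.\<close>

lemma nn_integral_inverse_Gamma:
  assumes "0 < b" "0 < a"
  shows "(\<integral>\<^sup>+t. ennreal (t powr (- b - 1) * exp (- a / t)) \<partial>halfline) = ennreal (Gamma b / a powr b)"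
proof -
  define f :: "real \<Rightarrow> real" where "f = (\<lambda>u. u powr (b - 1) * exp (- a * u))"
  have f0: "0 \<le> f u" for u by (simp add: f_def)
  have "f \<in> borel_measurable borel" by (simp add: f_def)
  have "(\<integral>\<^sup>+t. ennreal (f t) * indicator {0<..} t \<partial>lborel) = ennreal (Gamma b / a powr b)"
    unfolding f_def by (subst nn_integral_halfline[symmetric], measurable) (rule nn_integral_Gamma[OF assms])
  then have "(\<integral>\<^sup>+t. ennreal (indicator {0<..} t * f t) \<partial>lborel) = ennreal (Gamma b / a powr b)"
    by (subst (asm) nn_integral_cong[where v="\<lambda>t. ennreal (indicator {0<..} t * f t)"])
      (auto simp: indicator_def)
  then have "((\<lambda>t. indicator {0<..} t * f t) has_integral (Gamma b / a powr b)) UNIV"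
    using assms \<open>f \<in> borel_measurable borel\<close> f0 Gamma_real_pos[of b]
    by (intro nn_integral_has_integral) (auto simp: f0 measurable_completion)
  moreover have "(\<lambda>t. indicator {0<..} t * f t) = (\<lambda>t. if t \<in> {0<..} then f t else 0)"
    by (auto simp: indicator_def)
  ultimately have hf: "(f has_integral (Gamma b / a powr b)) {0<..}"
    using has_integral_restrict_UNIV[of "{0<..}" f] by metis
  define g :: "real \<Rightarrow> real" where "g = (\<lambda>t. 1 / t)"
  have img: "g ` {0<..} = {0<..}"
  proof (intro equalityI subsetI)
    fix u :: real assume "u \<in> {0<..}"
    then show "u \<in> g ` {0<..}" by (intro image_eqI[where x="1/u"]) (auto simp: g_def)
  qed (auto simp: g_def)
  have "(\<lambda>x. \<bar>- 1 / x\<^sup>2\<bar> * f (g x)) absolutely_integrable_on {0<..} \<and>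
      integral {0<..} (\<lambda>x. \<bar>- 1 / x\<^sup>2\<bar> * f (g x)) = Gamma b / a powr b"
  proof (rule iffD2[OF has_absolute_integral_change_of_variables_1'[where f=f and g=g and g'="\<lambda>x. - 1 / x\<^sup>2"]])
    show "{0<..} \<in> sets (lebesgue :: real measure)" by simp
    show "(g has_field_derivative - 1 / x\<^sup>2) (at x within {0<..})" if "x \<in> {0<..}" for x
      using that unfolding g_def by (auto intro!: derivative_eq_intros simp: power2_eq_square)
    show "inj_on g {0<..}" by (auto simp: g_def inj_on_def)
    show "f absolutely_integrable_on g ` {0<..} \<and> integral (g ` {0<..}) f = Gamma b / a powr b"
      unfolding img using hf f0
      by (auto intro!: nonnegative_absolutely_integrable_1 simp: has_integral_integrable_integral)
  qed
  then have "((\<lambda>x. \<bar>- 1 / x\<^sup>2\<bar> * f (g x)) has_integral (Gamma b / a powr b)) {0<..}"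
    using absolutely_integrable_on_def has_integral_integrable_integral by blast
  then have "((\<lambda>t. t powr (- b - 1) * exp (- a / t)) has_integral (Gamma b / a powr b)) {0<..}"
  proof (rule has_integral_eq[rotated])
    fix x :: real assume "x \<in> {0<..}"
    then have "0 < x" by simp
    then show "\<bar>- 1 / x\<^sup>2\<bar> * f (g x) = x powr (- b - 1) * exp (- a / x)"
      by (simp add: f_def g_def powr_diff powr_divide powr_minus power2_eq_square field_simps)
  qed
  then have "(\<integral>\<^sup>+t. ennreal (indicator {0<..} t * (t powr (- b - 1) * exp (- a / t))) \<partial>lborel) = ennreal (Gamma b / a powr b)"
    by (rule nn_integral_has_integral_lebesgue[rotated]) auto
  then show ?thesis
    by (subst nn_integral_halfline)
      (auto simp: indicator_def cong: nn_integral_cong if_cong elim!: back_subst[where P="\<lambda>x. x = _"] intro!: nn_integral_cong)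
qed

text \<open>The kernel of \<open>exp (t * \<Delta> / 4)\<close>; this time scale removes the factor
  4 from the exponent. At \<open>t = 0\<close> the value is 0, by
  \<open>0 powr a = 0\<close>.\<close>

definition heat :: "real \<Rightarrow> 'a::euclidean_space \<Rightarrow> 'a \<Rightarrow> real" where
  "heat t x y = (pi * t) powr (- (real DIM('a) / 2)) * exp (- (norm (x - y))\<^sup>2 / t)"

lemma heat_nonneg [simp]: "0 \<le> heat t x y"
  by (simp add: heat_def)

lemma heat_commute: "heat t x y = heat t y x"
  by (simp add: heat_def norm_minus_commute)

lemma borel_measurable_heat [measurable (raw)]:
  assumes [measurable]: "f \<in> borel_measurable M" "g \<in> borel_measurable M" "h \<in> borel_measurable M"
  shows "(\<lambda>x. heat (f x) (g x) (h x)) \<in> borel_measurable M"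
  unfolding heat_def by measurable

lemma sqrt_power_powr: "0 < t \<Longrightarrow> sqrt t ^ n = t powr (real n / 2)"
  by (subst powr_realpow[symmetric], simp, subst powr_half_sqrt[symmetric]) (simp_all add: powr_powr)

lemma nn_integral_gauss:
  "(\<integral>\<^sup>+x. ennreal (exp (- (norm (x::'a::euclidean_space))\<^sup>2)) \<partial>lborel) = ennreal (pi powr (real DIM('a) / 2))"
proof -
  have 1: "(\<integral>\<^sup>+x. ennreal (exp (- (x::real)\<^sup>2)) \<partial>lborel) = ennreal (sqrt pi)"
  proof -
    \<comment> \<open>Standard deviation \<open>1 / sqrt 2\<close> is the one for which the normal
      density is \<open>exp (- x\<^sup>2) / sqrt pi\<close>; its total mass 1 gives the Gaussian
      integral.\<close>
    interpret prob_space "density lborel (normal_density 0 (1 / sqrt 2))"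
      by (rule prob_space_normal_density) simp
    have "1 = (\<integral>\<^sup>+x. ennreal (normal_density 0 (1 / sqrt 2) x) \<partial>lborel)"
      using emeasure_space_1 by (simp add: emeasure_density)
    also have "\<dots> = (\<integral>\<^sup>+x. ennreal (1 / sqrt pi) * ennreal (exp (- x\<^sup>2)) \<partial>lborel)"
      by (intro nn_integral_cong) (simp add: normal_density_def power_divide flip: ennreal_mult)
    also have "\<dots> = ennreal (1 / sqrt pi) * (\<integral>\<^sup>+x. ennreal (exp (- x\<^sup>2)) \<partial>lborel)"
      by (rule nn_integral_cmult) simp
    finally have "ennreal (sqrt pi) * 1 = (ennreal (sqrt pi) * ennreal (1 / sqrt pi)) * (\<integral>\<^sup>+x. ennreal (exp (- x\<^sup>2)) \<partial>lborel)"
      by (simp only: mult.assoc)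
    also have "ennreal (sqrt pi) * ennreal (1 / sqrt pi) = 1"
      by (simp flip: ennreal_mult)
    finally show ?thesis by simp
  qed
  have "(\<integral>\<^sup>+x. ennreal (exp (- (norm (x::'a))\<^sup>2)) \<partial>lborel)
      = (\<integral>\<^sup>+x. (\<Prod>b\<in>(Basis::'a set). ennreal (exp (- (x \<bullet> b)\<^sup>2))) \<partial>lborel)"
  proof (intro nn_integral_cong)
    fix x :: 'a
    have "(norm x)\<^sup>2 = (\<Sum>b\<in>Basis. (x \<bullet> b)\<^sup>2)"
      unfolding power2_norm_eq_inner by (subst euclidean_inner) (simp add: power2_eq_square)
    then show "ennreal (exp (- (norm x)\<^sup>2)) = (\<Prod>b\<in>Basis. ennreal (exp (- (x \<bullet> b)\<^sup>2)))"
      by (simp add: prod_ennreal exp_sum flip: sum_negf)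
  qed
  also have "\<dots> = (\<Prod>b\<in>(Basis::'a set). \<integral>\<^sup>+x. ennreal (exp (- x\<^sup>2)) \<partial>lborel)"
    by (rule nn_integral_lborel_prod) auto
  also have "\<dots> = ennreal (sqrt pi ^ DIM('a))"
    by (simp add: 1 ennreal_power)
  also have "sqrt pi ^ DIM('a) = pi powr (real DIM('a) / 2)"
    by (simp add: sqrt_power_powr)
  finally show ?thesis .
qed

lemma nn_integral_lborel_affine:
  fixes f :: "'a::euclidean_space \<Rightarrow> ennreal"
  assumes [measurable]: "f \<in> borel_measurable borel" and c: "0 < c"
  shows "(\<integral>\<^sup>+z. f z \<partial>lborel) = (\<integral>\<^sup>+z. ennreal (c ^ DIM('a)) * f (x + c *\<^sub>R z) \<partial>lborel)"
  using c by (subst lborel_affine[of c x]) (simp_all add: nn_integral_density nn_integral_distr)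

text \<open>Rescaling by \<open>sqrt t\<close> moves all dependence on \<open>t\<close> into the
  argument of \<open>f\<close>. The weight is then one fixed probability density, so limits as
  \<open>t\<close> tends to 0 follow from dominated convergence or Fatou's lemma.\<close>

lemma nn_integral_heat_affine:
  fixes f :: "'a::euclidean_space \<Rightarrow> ennreal"
  assumes [measurable]: "f \<in> borel_measurable borel" and t: "0 < t"
  shows "(\<integral>\<^sup>+z. ennreal (heat t x z) * f z \<partial>lborel) = (\<integral>\<^sup>+z. ennreal (heat 1 0 z) * f (x + sqrt t *\<^sub>R z) \<partial>lborel)"
proof -
  have "(\<integral>\<^sup>+z. ennreal (heat t x z) * f z \<partial>lborel)
      = (\<integral>\<^sup>+z. ennreal (sqrt t ^ DIM('a)) * (ennreal (heat t x (x + sqrt t *\<^sub>R z)) * f (x + sqrt t *\<^sub>R z)) \<partial>lborel)"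
    using t by (intro nn_integral_lborel_affine) auto
  also have "\<dots> = (\<integral>\<^sup>+z. ennreal (heat 1 0 z) * f (x + sqrt t *\<^sub>R z) \<partial>lborel)"
  proof (intro nn_integral_cong)
    fix z :: 'a
    have "sqrt t ^ DIM('a) * heat t x (x + sqrt t *\<^sub>R z) = heat 1 0 z"
      using t by (simp add: heat_def powr_mult sqrt_power_powr powr_minus power_mult_distrib)
    then show "ennreal (sqrt t ^ DIM('a)) * (ennreal (heat t x (x + sqrt t *\<^sub>R z)) * f (x + sqrt t *\<^sub>R z)) =
        ennreal (heat 1 0 z) * f (x + sqrt t *\<^sub>R z)"
      using t by (simp add: mult.assoc[symmetric] flip: ennreal_mult)
  qed
  finally show ?thesis .
qed

lemma nn_integral_heat:
  fixes x :: "'a::euclidean_space"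
  assumes "0 < t"
  shows "(\<integral>\<^sup>+z. ennreal (heat t x z) \<partial>lborel) = 1"
proof -
  have "(\<integral>\<^sup>+z. ennreal (heat t x z) \<partial>lborel) = (\<integral>\<^sup>+z. ennreal (heat 1 0 (z::'a)) \<partial>lborel)"
    using nn_integral_heat_affine[where f="\<lambda>_. 1" and x=x, OF _ assms] by simp
  also have "\<dots> = ennreal (pi powr (- (real DIM('a) / 2))) * (\<integral>\<^sup>+z. ennreal (exp (- (norm (z::'a))\<^sup>2)) \<partial>lborel)"
    by (subst nn_integral_cmult[symmetric]) (auto simp: heat_def simp flip: ennreal_mult intro!: nn_integral_cong)
  also have "\<dots> = 1"
    by (simp add: nn_integral_gauss powr_minus flip: ennreal_mult)
  finally show ?thesis .
qed

text \<open>Completing the square in \<open>z\<close>: the product is a Gaussian in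
  \<open>z\<close>, centred at a weighted mean of \<open>x\<close> and \<open>y\<close> with time
  \<open>s * t / (s + t)\<close>, times a factor free of \<open>z\<close>. Integration in
  \<open>z\<close> leaves that factor, which is the semigroup law.\<close>

lemma heat_mult:
  fixes x y z :: "'a::euclidean_space"
  assumes "0 < s" "0 < t"
  shows "heat s x z * heat t z y
    = heat (s + t) x y * heat (s * t / (s + t)) ((1 / (s + t)) *\<^sub>R (t *\<^sub>R x + s *\<^sub>R y)) z"
proof -
  define a b where "a = x - z" and "b = z - y"
  have eq: "(1 / (s + t)) *\<^sub>R (t *\<^sub>R x + s *\<^sub>R y) - z = (1 / (s + t)) *\<^sub>R (t *\<^sub>R a - s *\<^sub>R b)"
  proof -
    have "z = (1 / (s + t)) *\<^sub>R ((s + t) *\<^sub>R z)" using assms by simp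
    then have "(1 / (s + t)) *\<^sub>R (t *\<^sub>R x + s *\<^sub>R y) - z = (1 / (s + t)) *\<^sub>R (t *\<^sub>R x + s *\<^sub>R y - (s + t) *\<^sub>R z)"
      by (metis scaleR_diff_right)
    then show ?thesis by (simp add: a_def b_def algebra_simps)
  qed
  have xy: "x - y = a + b" by (simp add: a_def b_def)
  have st: "s + t \<noteq> 0" "s * t / (s + t) > 0" using assms by auto
  have id: "(norm a)\<^sup>2 / s + (norm b)\<^sup>2 / t
      = (norm (a + b))\<^sup>2 / (s + t) + (norm ((1 / (s + t)) *\<^sub>R (t *\<^sub>R a - s *\<^sub>R b)))\<^sup>2 / (s * t / (s + t))"
  proof -
    define p q r where "p = a \<bullet> a" and "q = b \<bullet> b" and "r = a \<bullet> b"
    have n1: "(norm (a + b))\<^sup>2 = p + q + 2 * r"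
      by (simp add: power2_norm_eq_inner inner_simps p_def q_def r_def inner_commute)
    have n2: "(norm ((1 / (s + t)) *\<^sub>R (t *\<^sub>R a - s *\<^sub>R b)))\<^sup>2 = (t\<^sup>2 * p + s\<^sup>2 * q - 2 * s * t * r) / (s + t)\<^sup>2"
    proof -
      have "(norm (t *\<^sub>R a - s *\<^sub>R b))\<^sup>2 = t\<^sup>2 * p + s\<^sup>2 * q - 2 * s * t * r"
        unfolding power2_norm_eq_inner
        by (simp add: inner_simps p_def q_def r_def inner_commute power2_eq_square algebra_simps)
      then show ?thesis by (simp add: power_divide power_mult_distrib)
    qed
    have n3: "(norm a)\<^sup>2 = p" "(norm b)\<^sup>2 = q" by (simp_all add: power2_norm_eq_inner p_def q_def)
    have "(p + q + 2 * r) / (s + t) + (t\<^sup>2 * p + s\<^sup>2 * q - 2 * s * t * r) / (s + t)\<^sup>2 / (s * t / (s + t))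
        = (s * t * (p + q + 2 * r) + (t\<^sup>2 * p + s\<^sup>2 * q - 2 * s * t * r)) / (s * t * (s + t))"
      using assms by (simp add: add_divide_distrib power2_eq_square)
    also have "s * t * (p + q + 2 * r) + (t\<^sup>2 * p + s\<^sup>2 * q - 2 * s * t * r) = (s + t) * (t * p + s * q)"
      by (simp add: power2_eq_square algebra_simps)
    also have "(s + t) * (t * p + s * q) / (s * t * (s + t)) = (t * p + s * q) / (s * t)"
      using st by simp
    also have "\<dots> = p / s + q / t" using assms by (simp add: field_simps)
    finally show ?thesis unfolding n1 n2 n3 by simp
  qed
  have c: "(pi * s) powr k * (pi * t) powr k = (pi * (s + t)) powr k * (pi * (s * t / (s + t))) powr k" for k
  proof -
    have "(pi * s) * (pi * t) = (pi * (s + t)) * (pi * (s * t / (s + t)))" using st by simp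
    then show ?thesis using assms st by (metis powr_mult)
  qed
  have e: "exp (- (norm a)\<^sup>2 / s) * exp (- (norm b)\<^sup>2 / t) = exp (- (norm (a + b))\<^sup>2 / (s + t))
     * exp (- (norm ((1 / (s + t)) *\<^sub>R (t *\<^sub>R a - s *\<^sub>R b)))\<^sup>2 / (s * t / (s + t)))"
    using id by (simp add: exp_add[symmetric])
  show ?thesis
proof -
    let ?k = "- (real DIM('a) / 2)" and ?w = "norm ((1 / (s + t)) *\<^sub>R (t *\<^sub>R a - s *\<^sub>R b))"
    have "heat s x z * heat t z y = ((pi * s) powr ?k * (pi * t) powr ?k) * (exp (- (norm a)\<^sup>2 / s) * exp (- (norm b)\<^sup>2 / t))"
      by (simp add: heat_def a_def b_def)
    also have "\<dots> = ((pi * (s + t)) powr ?k * exp (- (norm (a + b))\<^sup>2 / (s + t))) *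
        ((pi * (s * t / (s + t))) powr ?k * exp (- ?w\<^sup>2 / (s * t / (s + t))))"
      unfolding e c[of ?k] by (simp only: ac_simps)
    also have "\<dots> = heat (s + t) x y * heat (s * t / (s + t)) ((1 / (s + t)) *\<^sub>R (t *\<^sub>R x + s *\<^sub>R y)) z"
      unfolding heat_def eq xy ..
    finally show ?thesis .
  qed
qed

lemma heat_semigroup:
  fixes x y :: "'a::euclidean_space"
  assumes "0 < s" "0 < t"
  shows "(\<integral>\<^sup>+z. ennreal (heat s x z) * ennreal (heat t z y) \<partial>lborel) = ennreal (heat (s + t) x y)"
proof -
  have "(\<integral>\<^sup>+z. ennreal (heat s x z) * ennreal (heat t z y) \<partial>lborel)
    = (\<integral>\<^sup>+z. ennreal (heat (s + t) x y) * ennreal (heat (s * t / (s + t)) ((1 / (s + t)) *\<^sub>R (t *\<^sub>R x + s *\<^sub>R y)) z) \<partial>lborel)"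
    by (intro nn_integral_cong) (simp add: heat_mult[OF assms] flip: ennreal_mult)
  also have "\<dots> = ennreal (heat (s + t) x y) * (\<integral>\<^sup>+z. ennreal (heat (s * t / (s + t)) ((1 / (s + t)) *\<^sub>R (t *\<^sub>R x + s *\<^sub>R y)) z) \<partial>lborel)"
    by (rule nn_integral_cmult) measurable
  also have "\<dots> = ennreal (heat (s + t) x y)"
    using assms by (subst nn_integral_heat) auto
  finally show ?thesis .
qed

text \<open>The exponential grows with time, while the prefactor falls by at most
  \<open>2 powr (real DIM('a) / 2)\<close> as long as the time at most doubles.\<close>

lemma heat_le_heat:
  fixes x y :: "'a::euclidean_space"
  assumes "0 < u" "u \<le> v" "v \<le> 2 * u"
  shows "heat u x y \<le> 2 powr (real DIM('a) / 2) * heat v x y"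
proof -
  define k where "k = real DIM('a) / 2"
  have k: "0 \<le> k" by (simp add: k_def)
  have "(pi * u) powr (- k) \<le> 2 powr k * (pi * v) powr (- k)"
  proof -
    have "(pi * (2 * u)) powr (- k) \<le> (pi * v) powr (- k)"
      using assms k by (intro powr_mono2') auto
    then have "2 powr k * ((pi * (2 * u)) powr (- k)) \<le> 2 powr k * (pi * v) powr (- k)" by simp
    moreover have "2 powr k * ((pi * (2 * u)) powr (- k)) = (pi * u) powr (- k)"
      using assms by (simp add: powr_mult powr_minus field_simps)
    ultimately show ?thesis by simp
  qed
  moreover have "exp (- (norm (x - y))\<^sup>2 / u) \<le> exp (- (norm (x - y))\<^sup>2 / v)"
    using assms by (auto intro!: divide_left_mono)
  ultimately have "(pi * u) powr (- k) * exp (- (norm (x - y))\<^sup>2 / u) \<le> (2 powr k * (pi * v) powr (- k)) * exp (- (norm (x - y))\<^sup>2 / v)"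
    by (intro mult_mono) auto
  then show ?thesis by (simp add: heat_def k_def mult.assoc)
qed

text \<open>All kernels below have this form, so that identities between kernels on space reduce to
  identities between weights on the half-line.\<close>

definition mix :: "(real \<Rightarrow> real) \<Rightarrow> 'a::euclidean_space \<Rightarrow> 'a \<Rightarrow> ennreal" where
  "mix w x y = (\<integral>\<^sup>+t. ennreal (w t) * ennreal (heat t x y) \<partial>halfline)"

lemma mix_commute: "mix w x y = mix w y x"
  by (simp add: mix_def heat_commute)

lemma borel_measurable_mix [measurable (raw)]:
  fixes f g :: "'b \<Rightarrow> 'a::euclidean_space"
  assumes [measurable]: "w \<in> borel_measurable borel" "f \<in> borel_measurable M" "g \<in> borel_measurable M"
  shows "(\<lambda>x. mix w (f x) (g x)) \<in> borel_measurable M"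
  unfolding mix_def by measurable

lemma nn_integral_swap:
  assumes "sigma_finite_measure M" "sigma_finite_measure N"
    and "(\<lambda>(x, y). f x y) \<in> borel_measurable (M \<Otimes>\<^sub>M N)"
  shows "(\<integral>\<^sup>+x. \<integral>\<^sup>+y. f x y \<partial>N \<partial>M) = (\<integral>\<^sup>+y. \<integral>\<^sup>+x. f x y \<partial>M \<partial>N)"
  using assms by (intro pair_sigma_finite.Fubini'[symmetric]) (auto simp: pair_sigma_finite_def)

text \<open>The semigroup law turns composition of kernels into addition of times, that is, into
  convolution of the weights.\<close>

lemma mix_convolve:
  fixes x y :: "'a::euclidean_space"
  assumes [measurable]: "v \<in> borel_measurable borel" "w \<in> borel_measurable borel"
  shows "(\<integral>\<^sup>+z. mix v x z * mix w z y \<partial>lborel)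
    = (\<integral>\<^sup>+s. \<integral>\<^sup>+t. ennreal (v s) * ennreal (w t) * ennreal (heat (s + t) x y) \<partial>halfline \<partial>halfline)"
proof -
  have "(\<integral>\<^sup>+z. mix v x z * mix w z y \<partial>lborel)
     = (\<integral>\<^sup>+z. \<integral>\<^sup>+s. \<integral>\<^sup>+t. (ennreal (v s) * ennreal (heat s x z)) * (ennreal (w t) * ennreal (heat t z y)) \<partial>halfline \<partial>halfline \<partial>lborel)"
    unfolding mix_def
    by (intro nn_integral_cong, subst nn_integral_multc[symmetric], measurable, intro nn_integral_cong)
       (subst nn_integral_cmult, auto)
  also have "\<dots> = (\<integral>\<^sup>+s. \<integral>\<^sup>+z. \<integral>\<^sup>+t. (ennreal (v s) * ennreal (heat s x z)) * (ennreal (w t) * ennreal (heat t z y)) \<partial>halfline \<partial>lborel \<partial>halfline)"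
    by (rule nn_integral_swap) (auto intro: lborel.sigma_finite_measure_axioms halfline.sigma_finite_measure_axioms)
  also have "\<dots> = (\<integral>\<^sup>+s. \<integral>\<^sup>+t. \<integral>\<^sup>+z. (ennreal (v s) * ennreal (heat s x z)) * (ennreal (w t) * ennreal (heat t z y)) \<partial>lborel \<partial>halfline \<partial>halfline)"
    by (intro nn_integral_cong nn_integral_swap)
      (auto intro: lborel.sigma_finite_measure_axioms halfline.sigma_finite_measure_axioms)
  also have "\<dots> = (\<integral>\<^sup>+s. \<integral>\<^sup>+t. ennreal (v s) * ennreal (w t) * ennreal (heat (s + t) x y) \<partial>halfline \<partial>halfline)"
  proof (intro nn_integral_halfline_cong)
    fix s t :: real assume st: "0 < s" "0 < t"
    have "(\<integral>\<^sup>+z. (ennreal (v s) * ennreal (heat s x z)) * (ennreal (w t) * ennreal (heat t z y)) \<partial>lborel)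
       = (\<integral>\<^sup>+z. (ennreal (v s) * ennreal (w t)) * (ennreal (heat s x z) * ennreal (heat t z y)) \<partial>lborel)"
      by (simp only: ac_simps)
    also have "\<dots> = ennreal (v s) * ennreal (w t) * ennreal (heat (s + t) x y)"
      by (subst nn_integral_cmult) (auto simp: heat_semigroup[OF st])
    finally show "(\<integral>\<^sup>+z. (ennreal (v s) * ennreal (heat s x z)) * (ennreal (w t) * ennreal (heat t z y)) \<partial>lborel)
       = ennreal (v s) * ennreal (w t) * ennreal (heat (s + t) x y)" .
  qed
  finally show ?thesis .
qed

text \<open>The case of a convolution whose first weight is a point mass at \<open>s\<close>:
  smoothing a kernel by heat shifts its times.\<close>

lemma heat_mix:
  fixes x y :: "'a::euclidean_space"
  assumes [measurable]: "w \<in> borel_measurable borel" and s: "0 < s"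
  shows "(\<integral>\<^sup>+z. ennreal (heat s x z) * mix w z y \<partial>lborel)
    = (\<integral>\<^sup>+t. ennreal (w t) * ennreal (heat (s + t) x y) \<partial>halfline)"
proof -
  have "(\<integral>\<^sup>+z. ennreal (heat s x z) * mix w z y \<partial>lborel)
     = (\<integral>\<^sup>+z. \<integral>\<^sup>+t. ennreal (heat s x z) * (ennreal (w t) * ennreal (heat t z y)) \<partial>halfline \<partial>lborel)"
    unfolding mix_def by (intro nn_integral_cong) (subst nn_integral_cmult, auto)
  also have "\<dots> = (\<integral>\<^sup>+t. \<integral>\<^sup>+z. ennreal (heat s x z) * (ennreal (w t) * ennreal (heat t z y)) \<partial>lborel \<partial>halfline)"
    by (rule nn_integral_swap) (auto intro: lborel.sigma_finite_measure_axioms halfline.sigma_finite_measure_axioms)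
  also have "\<dots> = (\<integral>\<^sup>+t. ennreal (w t) * ennreal (heat (s + t) x y) \<partial>halfline)"
  proof (intro nn_integral_halfline_cong)
    fix t :: real assume t: "0 < t"
    have "(\<integral>\<^sup>+z. ennreal (heat s x z) * (ennreal (w t) * ennreal (heat t z y)) \<partial>lborel)
       = (\<integral>\<^sup>+z. ennreal (w t) * (ennreal (heat s x z) * ennreal (heat t z y)) \<partial>lborel)"
      by (simp only: ac_simps)
    also have "\<dots> = ennreal (w t) * ennreal (heat (s + t) x y)"
      by (subst nn_integral_cmult) (auto simp: heat_semigroup[OF s t])
    finally show "(\<integral>\<^sup>+z. ennreal (heat s x z) * (ennreal (w t) * ennreal (heat t z y)) \<partial>lborel)
       = ennreal (w t) * ennreal (heat (s + t) x y)" .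
  qed
  finally show ?thesis .
qed

lemma mix_mono: "(\<And>t. 0 < t \<Longrightarrow> v t \<le> w t) \<Longrightarrow> mix v x y \<le> mix w x y"
  unfolding mix_def by (intro nn_integral_halfline_mono mult_right_mono ennreal_leI) auto

text \<open>The upper bound makes \<open>hw\<close> small of order \<rho> away from time 0; the
  lower one bounds its mass near time 0 from below.\<close>

lemma one_minus_exp_bounds:
  fixes r :: real assumes "0 \<le> r" shows "1 - exp (- r) \<le> r" "r \<le> 1 \<Longrightarrow> r / 2 \<le> 1 - exp (- r)"
proof -
  show "1 - exp (- r) \<le> r" using exp_ge_add_one_self[of "-r"] by simp
  assume "r \<le> 1"
  have "exp (- r) \<le> 1 / (1 + r)"
    using exp_ge_add_one_self[of r] assms by (simp add: exp_minus inverse_eq_divide frac_le)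
  also have "\<dots> \<le> 1 - r / 2" using assms \<open>r \<le> 1\<close> by (simp add: field_simps mult_left_le)
  finally show "r / 2 \<le> 1 - exp (- r)" by simp
qed

text \<open>
  Subordination: the Riesz kernel is \<open>mix (\<kappa> 0)\<close>, and \<open>mix (\<kappa> \<eta>)\<close> is the Green kernel of
  \<open>(\<eta> - \<Delta> / 4)\<close> to the power \<open>\<beta>\<close>, up to a constant. Apart from the killing factor \<open>exp (- \<eta> * s)\<close>, the weight \<open>\<theta> \<rho> \<eta>\<close> is an
  inverse Gamma density in \<open>s\<close>. It is chosen so that
  \<open>\<kappa> \<eta> = hw \<rho> \<eta> + \<theta> \<rho> \<eta> * \<kappa> \<eta>\<close> with \<open>*\<close> the convolution on the half-line: the sub-Markovian
  operator with kernel \<open>mix (\<theta> \<rho> \<eta>)\<close> makes every potential smaller.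
\<close>

locale riesz =
  fixes \<alpha> :: real and n :: "'a::euclidean_space itself"
  assumes dim: "DIM('a) \<ge> 3" and \<alpha>_pos: "0 < \<alpha>" and \<alpha>_le: "\<alpha> \<le> 2"
begin

definition \<beta> :: real where "\<beta> = \<alpha> / 2"
definition m :: real where "m = real DIM('a) / 2"
text \<open>Normalizes the inverse Gamma integral with exponent \<open>m - \<beta>\<close> so that
  \<open>mix (\<kappa> 0)\<close> is the Riesz kernel itself and not a multiple of it.\<close>

definition c\<^sub>0 :: real where "c\<^sub>0 = pi powr m / Gamma (m - \<beta>)"
definition \<kappa> :: "real \<Rightarrow> real \<Rightarrow> real" where "\<kappa> \<eta> t = c\<^sub>0 * t powr (\<beta> - 1) * exp (- \<eta> * t)"
definition \<theta> :: "real \<Rightarrow> real \<Rightarrow> real \<Rightarrow> real" where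
  "\<theta> \<rho> \<eta> s = \<rho> powr \<beta> / Gamma \<beta> * s powr (- \<beta> - 1) * exp (- \<rho> / s) * exp (- \<eta> * s)"
definition hw :: "real \<Rightarrow> real \<Rightarrow> real \<Rightarrow> real" where "hw \<rho> \<eta> t = \<kappa> \<eta> t * (1 - exp (- \<rho> / t))"

lemma \<beta>: "0 < \<beta>" "\<beta> \<le> 1" and m: "1 < m" "\<beta> < m"
  using dim \<alpha>_pos \<alpha>_le by (auto simp: \<beta>_def m_def)

lemma c\<^sub>0_pos: "0 < c\<^sub>0"
  using m by (simp add: c\<^sub>0_def Gamma_real_pos)

lemma \<kappa>_nonneg [simp]: "0 \<le> \<kappa> \<eta> t" and \<theta>_nonneg [simp]: "0 \<le> \<theta> \<rho> \<eta> t"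
  using c\<^sub>0_pos Gamma_real_pos[OF \<beta>(1)] by (auto simp: \<kappa>_def \<theta>_def)

lemma hw_nonneg: "0 < \<rho> \<Longrightarrow> 0 < t \<Longrightarrow> 0 \<le> hw \<rho> \<eta> t"
  unfolding hw_def by (intro mult_nonneg_nonneg) auto

lemma hw_le: "0 < t \<Longrightarrow> hw \<rho> \<eta> t \<le> \<kappa> \<eta> t"
  unfolding hw_def by (intro mult_left_le) auto

text \<open>First order in \<rho> at every fixed time: only times near 0 can survive division by
  \<open>H\<close>.\<close>

lemma hw_le':
  assumes "0 < t" "0 < \<rho>"
  shows "hw \<rho> \<eta> t \<le> \<rho> / t * \<kappa> \<eta> t"
proof -
  have "(1 - exp (- (\<rho> / t))) * \<kappa> \<eta> t \<le> \<rho> / t * \<kappa> \<eta> t"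
    using one_minus_exp_bounds(1)[of "\<rho> / t"] assms by (intro mult_right_mono) auto
  then show ?thesis by (simp add: hw_def mult.commute)
qed

lemma measurable_weights [measurable]:
  "\<kappa> \<eta> \<in> borel_measurable borel" "\<theta> \<rho> \<eta> \<in> borel_measurable borel" "hw \<rho> \<eta> \<in> borel_measurable borel"
  unfolding \<kappa>_def[abs_def] \<theta>_def[abs_def] hw_def[abs_def] by measurable

text \<open>Off the diagonal this is an inverse Gamma integral with exponent
  \<open>b = m - \<beta>\<close>; on the diagonal it is the divergent integral of a pure
  power.\<close>

lemma riesz_kernel_eq_mix:
  fixes x y :: 'a
  shows "riesz_kernel \<alpha> x y = mix (\<kappa> 0) x y"
proof -
  define b where "b = m - \<beta>"
  have b: "0 < b" using m by (simp add: b_def)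
  define C where "C = c\<^sub>0 * pi powr (- m)"
  have C: "0 < C" using c\<^sub>0_pos by (simp add: C_def)
  have C_Gamma: "C * Gamma b = 1"
    using Gamma_real_pos[OF b] by (simp add: C_def c\<^sub>0_def b_def powr_minus)
  have *: "mix (\<kappa> 0) x y = ennreal C * (\<integral>\<^sup>+t. ennreal (t powr (- b - 1) * exp (- (norm (x - y))\<^sup>2 / t)) \<partial>halfline)"
  proof -
    have "mix (\<kappa> 0) x y = (\<integral>\<^sup>+t. ennreal C * ennreal (t powr (- b - 1) * exp (- (norm (x - y))\<^sup>2 / t)) \<partial>halfline)"
      unfolding mix_def
    proof (rule nn_integral_halfline_cong)
      fix t :: real assume t: "0 < t"
      have "t powr (\<beta> - 1) * t powr (- m) = t powr (- b - 1)"
        unfolding powr_add[symmetric] by (simp add: b_def algebra_simps)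
      then have "\<kappa> 0 t * heat t x y = C * (t powr (- b - 1) * exp (- (norm (x - y))\<^sup>2 / t))"
        using t by (simp add: \<kappa>_def heat_def C_def powr_mult m_def[symmetric] ac_simps)
      then show "ennreal (\<kappa> 0 t) * ennreal (heat t x y) = ennreal C * ennreal (t powr (- b - 1) * exp (- (norm (x - y))\<^sup>2 / t))"
        using C by (simp flip: ennreal_mult)
    qed
    also have "\<dots> = ennreal C * (\<integral>\<^sup>+t. ennreal (t powr (- b - 1) * exp (- (norm (x - y))\<^sup>2 / t)) \<partial>halfline)"
      by (rule nn_integral_cmult) simp
    finally show ?thesis .
  qed
  show ?thesis
  proof (cases "x = y")
    case False
    then have r: "0 < (norm (x - y))\<^sup>2" by simp
    have "((norm (x - y))\<^sup>2) powr b = norm (x - y) powr (2 * b)"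
      using False by (simp add: powr_powr flip: powr_numeral)
    moreover have "norm (x - y) powr (\<alpha> - real DIM('a)) = 1 / norm (x - y) powr (2 * b)"
    proof -
      have "\<alpha> - real DIM('a) = - (2 * b)" by (simp add: b_def \<beta>_def m_def)
      then show ?thesis by (simp only: powr_minus_divide)
    qed
    ultimately have "C * (Gamma b / ((norm (x - y))\<^sup>2) powr b) = norm (x - y) powr (\<alpha> - real DIM('a))"
      using C_Gamma by simp
    then show ?thesis
      unfolding * nn_integral_inverse_Gamma[OF b r] riesz_kernel_def using False C Gamma_real_pos[OF b]
      by (simp flip: ennreal_mult)
  next
    case True
    \<comment> \<open>The integrand is homogeneous, so doubling the time gives
      \<open>I = 2 powr (- b) * I\<close>; since \<open>I\<close> is positive and the factor is
      below 1, \<open>I\<close> is infinite.\<close>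
    define I where "I = (\<integral>\<^sup>+t. ennreal (t powr (- b - 1)) \<partial>halfline)"
    have "I = (\<integral>\<^sup>+t. ennreal 2 * ennreal ((2 * t) powr (- b - 1)) \<partial>halfline)"
      unfolding I_def by (rule nn_integral_halfline_scale) auto
    also have "\<dots> = (\<integral>\<^sup>+t. ennreal (2 powr (- b)) * ennreal (t powr (- b - 1)) \<partial>halfline)"
    proof (intro nn_integral_halfline_cong)
      fix t :: real assume "0 < t"
      then have "2 * (2 * t) powr (- b - 1) = 2 powr (- b) * t powr (- b - 1)"
        by (simp add: powr_mult powr_diff powr_minus field_simps)
      then show "ennreal 2 * ennreal ((2 * t) powr (- b - 1)) = ennreal (2 powr (- b)) * ennreal (t powr (- b - 1))"
        by (metis ennreal_mult powr_ge_zero zero_le_numeral)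
    qed
    also have "\<dots> = ennreal (2 powr (- b)) * I"
      unfolding I_def by (rule nn_integral_cmult) simp
    finally have I: "I = ennreal (2 powr (- b)) * I" .
    have "ennreal (Gamma b / 1 powr b) \<le> I"
      unfolding I_def using b
      by (subst nn_integral_inverse_Gamma[symmetric]) (auto intro!: nn_integral_halfline_mono ennreal_leI mult_left_le)
    then have "0 < I" using Gamma_real_pos[OF b] by (auto simp: less_le_trans[rotated])
    have "I = \<infinity>"
    proof (rule ccontr)
      assume "I \<noteq> \<infinity>"
      then obtain i where i: "I = ennreal i" "0 \<le> i" by (cases I) auto
      have "i = 2 powr (- b) * i" using I i by (simp flip: ennreal_mult)
      moreover have "0 < i" using \<open>0 < I\<close> i by simp
      moreover have "2 powr (- b) < 1" using b by (simp add: powr_less_one)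
      ultimately show False by simp
    qed
    then show ?thesis using True C unfolding * by (simp add: riesz_kernel_def I_def[symmetric] ennreal_mult_top)
  qed
qed

text \<open>Without killing the weight is an inverse Gamma density of mass 1, and the factor
  \<open>exp (- \<eta> * s)\<close> only decreases it.\<close>

lemma nn_integral_\<theta>_le:
  assumes "0 < \<rho>" "0 \<le> \<eta>"
  shows "(\<integral>\<^sup>+s. ennreal (\<theta> \<rho> \<eta> s) \<partial>halfline) \<le> 1"
proof -
  have G: "0 < Gamma \<beta>" using \<beta> by (simp add: Gamma_real_pos)
  have "(\<integral>\<^sup>+s. ennreal (\<theta> \<rho> \<eta> s) \<partial>halfline)
      \<le> (\<integral>\<^sup>+s. ennreal (\<rho> powr \<beta> / Gamma \<beta>) * ennreal (s powr (- \<beta> - 1) * exp (- \<rho> / s)) \<partial>halfline)"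
  proof (rule nn_integral_halfline_mono)
    fix t :: real assume t: "0 < t"
    have "\<theta> \<rho> \<eta> t \<le> \<rho> powr \<beta> / Gamma \<beta> * (t powr (- \<beta> - 1) * exp (- \<rho> / t))"
      unfolding \<theta>_def mult.assoc using G t assms by (intro mult_left_mono mult_left_le) auto
    then show "ennreal (\<theta> \<rho> \<eta> t) \<le> ennreal (\<rho> powr \<beta> / Gamma \<beta>) * ennreal (t powr (- \<beta> - 1) * exp (- \<rho> / t))"
      using G by (simp add: ennreal_leI flip: ennreal_mult)
  qed
  also have "\<dots> = ennreal (\<rho> powr \<beta> / Gamma \<beta>) * ennreal (Gamma \<beta> / \<rho> powr \<beta>)"
    by (subst nn_integral_cmult, simp, subst nn_integral_inverse_Gamma[OF \<beta>(1) \<open>0 < \<rho>\<close>]) simp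
  also have "\<dots> = 1" using G assms by (simp flip: ennreal_mult)
  finally show ?thesis .
qed

text \<open>The convolution of the two weights, tested against \<open>f\<close>. In terms of the
  total time \<open>\<tau> = s + t\<close> and the ratio \<open>v = t / s\<close>, the killing
  factors combine to one in \<tau>, and what depends on \<open>v\<close> is a Gamma integral with
  rate \<open>\<rho> / \<tau>\<close>, whose value cancels the normalization of \<theta>.\<close>

lemma \<theta>_\<kappa>_convolution:
  assumes [measurable]: "f \<in> borel_measurable borel" and \<rho>: "0 < \<rho>"
  shows "(\<integral>\<^sup>+s. \<integral>\<^sup>+t. ennreal (\<theta> \<rho> \<eta> s) * ennreal (\<kappa> \<eta> t) * f (s + t) \<partial>halfline \<partial>halfline)
    = (\<integral>\<^sup>+t. ennreal (\<kappa> \<eta> t * exp (- \<rho> / t)) * f t \<partial>halfline)"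
proof -
  have G: "0 < Gamma \<beta>" using \<beta> by (simp add: Gamma_real_pos)
  \<comment> \<open>The inner variable becomes the ratio \<open>v = t / s\<close>.\<close>
  have "(\<integral>\<^sup>+s. \<integral>\<^sup>+t. ennreal (\<theta> \<rho> \<eta> s) * ennreal (\<kappa> \<eta> t) * f (s + t) \<partial>halfline \<partial>halfline)
    = (\<integral>\<^sup>+s. \<integral>\<^sup>+v. ennreal s * (ennreal (\<theta> \<rho> \<eta> s) * ennreal (\<kappa> \<eta> (s * v)) * f (s + s * v)) \<partial>halfline \<partial>halfline)"
    by (intro nn_integral_halfline_cong nn_integral_halfline_scale) auto
  also have "\<dots> = (\<integral>\<^sup>+v. \<integral>\<^sup>+s. ennreal s * (ennreal (\<theta> \<rho> \<eta> s) * ennreal (\<kappa> \<eta> (s * v)) * f (s + s * v)) \<partial>halfline \<partial>halfline)"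
    by (rule nn_integral_swap) (auto intro: halfline.sigma_finite_measure_axioms)
  \<comment> \<open>For fixed \<open>v\<close> the other variable becomes the total time,
    \<open>\<tau> = s * (1 + v)\<close>.\<close>
  also have "\<dots> = (\<integral>\<^sup>+v. \<integral>\<^sup>+\<tau>. ennreal (1 / (1 + v)) * (ennreal (1 / (1 + v) * \<tau>) *
      (ennreal (\<theta> \<rho> \<eta> (1 / (1 + v) * \<tau>)) * ennreal (\<kappa> \<eta> (1 / (1 + v) * \<tau> * v)) * f (1 / (1 + v) * \<tau> + 1 / (1 + v) * \<tau> * v))) \<partial>halfline \<partial>halfline)"
    by (intro nn_integral_halfline_cong nn_integral_halfline_scale) auto
  also have "\<dots> = (\<integral>\<^sup>+v. \<integral>\<^sup>+\<tau>. ennreal (\<kappa> \<eta> \<tau> * exp (- \<rho> / \<tau>) * ((\<rho> / \<tau>) powr \<beta> / Gamma \<beta>)) * ennreal (v powr (\<beta> - 1) * exp (- (\<rho> / \<tau>) * v)) * f \<tau> \<partial>halfline \<partial>halfline)"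
  proof (intro nn_integral_halfline_cong)
    fix v \<tau> :: real assume v: "0 < v" and \<tau>: "0 < \<tau>"
    define r where "r = 1 / (1 + v)"
    have r: "0 < r" "r * (1 + v) = 1" using v by (auto simp: r_def)
    have sum: "r * \<tau> + r * \<tau> * v = \<tau>"
    proof -
      have "r * \<tau> + r * \<tau> * v = (r * (1 + v)) * \<tau>" by (simp add: algebra_simps)
      then show ?thesis using r by simp
    qed
    have p1: "(r * \<tau>) powr (- \<beta> - 1) * (r * \<tau> * v) powr (\<beta> - 1) * (r * r * \<tau>) = \<tau> powr (\<beta> - 1) * \<tau> powr (- \<beta>) * v powr (\<beta> - 1)"
      using r v \<tau> by (simp add: powr_mult powr_diff powr_minus field_simps)
    \<comment> \<open>Since \<open>1 / r = 1 + v\<close>, this factor splits into one in \<tau> and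
      the exponential of the Gamma integral in \<open>v\<close>.\<close>
    have e1: "exp (- \<rho> / (r * \<tau>)) = exp (- \<rho> / \<tau>) * exp (- (\<rho> / \<tau>) * v)"
      using v \<tau> unfolding r_def exp_add[symmetric] by (simp add: field_simps)
    have e2: "exp (- \<eta> * (r * \<tau>)) * exp (- \<eta> * (r * \<tau> * v)) = exp (- \<eta> * \<tau>)"
    proof -
      have "- \<eta> * (r * \<tau>) + - \<eta> * (r * \<tau> * v) = - \<eta> * (r * \<tau> + r * \<tau> * v)" by (simp add: algebra_simps)
      then show ?thesis unfolding exp_add[symmetric] sum by simp
    qed
    have "r * (r * \<tau> * (\<theta> \<rho> \<eta> (r * \<tau>) * \<kappa> \<eta> (r * \<tau> * v)))
       = \<rho> powr \<beta> / Gamma \<beta> * c\<^sub>0 * ((r * \<tau>) powr (- \<beta> - 1) * (r * \<tau> * v) powr (\<beta> - 1) * (r * r * \<tau>))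
          * exp (- \<rho> / (r * \<tau>)) * (exp (- \<eta> * (r * \<tau>)) * exp (- \<eta> * (r * \<tau> * v)))"
      by (simp add: \<theta>_def \<kappa>_def ac_simps)
    also have "\<dots> = \<kappa> \<eta> \<tau> * exp (- \<rho> / \<tau>) * ((\<rho> / \<tau>) powr \<beta> / Gamma \<beta>) * (v powr (\<beta> - 1) * exp (- (\<rho> / \<tau>) * v))"
      unfolding p1 e1 e2 using \<rho> \<tau> by (simp add: \<kappa>_def powr_divide powr_minus field_simps)
    finally have eq: "r * (r * \<tau> * (\<theta> \<rho> \<eta> (r * \<tau>) * \<kappa> \<eta> (r * \<tau> * v)))
       = \<kappa> \<eta> \<tau> * exp (- \<rho> / \<tau>) * ((\<rho> / \<tau>) powr \<beta> / Gamma \<beta>) * (v powr (\<beta> - 1) * exp (- (\<rho> / \<tau>) * v))" .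
    have "ennreal r * (ennreal (r * \<tau>) * (ennreal (\<theta> \<rho> \<eta> (r * \<tau>)) * ennreal (\<kappa> \<eta> (r * \<tau> * v)) * f (r * \<tau> + r * \<tau> * v)))
       = ennreal (r * (r * \<tau> * (\<theta> \<rho> \<eta> (r * \<tau>) * \<kappa> \<eta> (r * \<tau> * v)))) * f \<tau>"
      unfolding sum using r \<tau> by (simp add: ennreal_mult mult.assoc)
    also have "\<dots> = ennreal (\<kappa> \<eta> \<tau> * exp (- \<rho> / \<tau>) * ((\<rho> / \<tau>) powr \<beta> / Gamma \<beta>)) * ennreal (v powr (\<beta> - 1) * exp (- (\<rho> / \<tau>) * v)) * f \<tau>"
      unfolding eq using G by (subst ennreal_mult) auto
    finally show "ennreal (1 / (1 + v)) * (ennreal (1 / (1 + v) * \<tau>) *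
      (ennreal (\<theta> \<rho> \<eta> (1 / (1 + v) * \<tau>)) * ennreal (\<kappa> \<eta> (1 / (1 + v) * \<tau> * v)) * f (1 / (1 + v) * \<tau> + 1 / (1 + v) * \<tau> * v)))
      = ennreal (\<kappa> \<eta> \<tau> * exp (- \<rho> / \<tau>) * ((\<rho> / \<tau>) powr \<beta> / Gamma \<beta>)) * ennreal (v powr (\<beta> - 1) * exp (- (\<rho> / \<tau>) * v)) * f \<tau>"
      unfolding r_def .
  qed
  also have "\<dots> = (\<integral>\<^sup>+\<tau>. \<integral>\<^sup>+v. ennreal (\<kappa> \<eta> \<tau> * exp (- \<rho> / \<tau>) * ((\<rho> / \<tau>) powr \<beta> / Gamma \<beta>)) * ennreal (v powr (\<beta> - 1) * exp (- (\<rho> / \<tau>) * v)) * f \<tau> \<partial>halfline \<partial>halfline)"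
    by (rule nn_integral_swap) (auto intro: halfline.sigma_finite_measure_axioms)
  also have "\<dots> = (\<integral>\<^sup>+\<tau>. ennreal (\<kappa> \<eta> \<tau> * exp (- \<rho> / \<tau>)) * f \<tau> \<partial>halfline)"
  proof (intro nn_integral_halfline_cong)
    fix \<tau> :: real assume \<tau>: "0 < \<tau>"
    then have a: "0 < \<rho> / \<tau>" using \<rho> by simp
    have "(\<integral>\<^sup>+v. ennreal (\<kappa> \<eta> \<tau> * exp (- \<rho> / \<tau>) * ((\<rho> / \<tau>) powr \<beta> / Gamma \<beta>)) * ennreal (v powr (\<beta> - 1) * exp (- (\<rho> / \<tau>) * v)) * f \<tau> \<partial>halfline)
       = ennreal (\<kappa> \<eta> \<tau> * exp (- \<rho> / \<tau>) * ((\<rho> / \<tau>) powr \<beta> / Gamma \<beta>)) * ennreal (Gamma \<beta> / (\<rho> / \<tau>) powr \<beta>) * f \<tau>"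
      by (subst nn_integral_multc, simp, subst nn_integral_cmult, simp, subst nn_integral_Gamma[OF \<beta>(1) a]) simp
    also have "ennreal (\<kappa> \<eta> \<tau> * exp (- \<rho> / \<tau>) * ((\<rho> / \<tau>) powr \<beta> / Gamma \<beta>)) * ennreal (Gamma \<beta> / (\<rho> / \<tau>) powr \<beta>)
       = ennreal (\<kappa> \<eta> \<tau> * exp (- \<rho> / \<tau>))"
      using G \<tau> \<rho> by (subst ennreal_mult[symmetric]) auto
    finally show "(\<integral>\<^sup>+v. ennreal (\<kappa> \<eta> \<tau> * exp (- \<rho> / \<tau>) * ((\<rho> / \<tau>) powr \<beta> / Gamma \<beta>)) * ennreal (v powr (\<beta> - 1) * exp (- (\<rho> / \<tau>) * v)) * f \<tau> \<partial>halfline)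
       = ennreal (\<kappa> \<eta> \<tau> * exp (- \<rho> / \<tau>)) * f \<tau>" .
  qed
  finally show ?thesis .
qed

text \<open>The weight identity lifted to space. It is stated as a sum, since the kernel is infinite
  on the diagonal and cannot be subtracted there.\<close>

lemma mix_\<kappa>_eq:
  fixes x y :: 'a
  assumes "0 < \<rho>"
  shows "mix (\<kappa> \<eta>) x y = mix (hw \<rho> \<eta>) x y + (\<integral>\<^sup>+z. mix (\<theta> \<rho> \<eta>) x z * mix (\<kappa> \<eta>) z y \<partial>lborel)"
proof -
  have "(\<integral>\<^sup>+z. mix (\<theta> \<rho> \<eta>) x z * mix (\<kappa> \<eta>) z y \<partial>lborel)
    = (\<integral>\<^sup>+t. ennreal (\<kappa> \<eta> t * exp (- \<rho> / t)) * ennreal (heat t x y) \<partial>halfline)"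
    using \<theta>_\<kappa>_convolution[of "\<lambda>t. ennreal (heat t x y)" \<rho> \<eta>] assms by (subst mix_convolve) auto
  moreover have "mix (\<kappa> \<eta>) x y = (\<integral>\<^sup>+t. ennreal (hw \<rho> \<eta> t) * ennreal (heat t x y)
      + ennreal (\<kappa> \<eta> t * exp (- \<rho> / t)) * ennreal (heat t x y) \<partial>halfline)"
    unfolding mix_def
  proof (rule nn_integral_halfline_cong)
    fix t :: real assume "0 < t"
    then have "\<kappa> \<eta> t = hw \<rho> \<eta> t + \<kappa> \<eta> t * exp (- \<rho> / t)" "0 \<le> hw \<rho> \<eta> t"
      using assms by (auto simp: hw_nonneg) (auto simp: hw_def algebra_simps)
    then have "ennreal (\<kappa> \<eta> t) = ennreal (hw \<rho> \<eta> t) + ennreal (\<kappa> \<eta> t * exp (- \<rho> / t))"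
      by (metis ennreal_plus \<kappa>_nonneg exp_ge_zero mult_nonneg_nonneg)
    then show "ennreal (\<kappa> \<eta> t) * ennreal (heat t x y) = ennreal (hw \<rho> \<eta> t) * ennreal (heat t x y)
      + ennreal (\<kappa> \<eta> t * exp (- \<rho> / t)) * ennreal (heat t x y)"
      by (simp add: distrib_right)
  qed
  ultimately show ?thesis
    unfolding mix_def by (subst (asm) nn_integral_add) auto
qed

lemma nn_integral_mix_\<theta>_le:
  fixes x :: 'a
  assumes "0 < \<rho>" "0 \<le> \<eta>"
  shows "(\<integral>\<^sup>+y. mix (\<theta> \<rho> \<eta>) x y \<partial>lborel) \<le> 1"
proof -
  have "(\<integral>\<^sup>+y. mix (\<theta> \<rho> \<eta>) x y \<partial>lborel)
     = (\<integral>\<^sup>+t. \<integral>\<^sup>+y. ennreal (\<theta> \<rho> \<eta> t) * ennreal (heat t x y) \<partial>lborel \<partial>halfline)"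
    unfolding mix_def
    by (rule nn_integral_swap) (auto intro: halfline.sigma_finite_measure_axioms lborel.sigma_finite_measure_axioms)
  also have "\<dots> = (\<integral>\<^sup>+t. ennreal (\<theta> \<rho> \<eta> t) \<partial>halfline)"
    by (intro nn_integral_halfline_cong) (subst nn_integral_cmult, auto simp: nn_integral_heat)
  finally show ?thesis using nn_integral_\<theta>_le[OF assms] by simp
qed

end

lemma ennreal_divide_left_mono:
  fixes a b c :: ennreal assumes "b \<le> c" shows "a / c \<le> a / b"
proof -
  have "inverse c \<le> inverse b"
  proof (cases "b = 0 \<or> c = \<top>")
    case False
    then obtain r s where "b = ennreal r" "c = ennreal s" "0 < r" "0 < s"
      using assms by (cases b; cases c) (auto simp: top_unique less_le)
    then show ?thesis using assms by (simp add: inverse_ennreal)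
  qed auto
  then show ?thesis unfolding divide_ennreal_def by (rule mult_left_mono) simp
qed

section \<open>Heat smoothing of the Riesz kernel, and the approximate identity in time\<close>

context riesz begin

lemma \<kappa>_half: "0 < t \<Longrightarrow> \<kappa> 0 t = 2 powr (1 - \<beta>) * \<kappa> 0 (2 * t)"
  by (simp add: \<kappa>_def powr_mult powr_diff)

text \<open>Supplies the dominating functions for limits of heat averages of potentials. For
  \<open>t \<ge> s\<close> the time \<open>s + t\<close> is compared with \<open>2 * t\<close>. For
  \<open>t < s\<close> it is compared with \<open>2 * s\<close>, and the weight on
  \<open>{0<..s}\<close> with the weight on \<open>{2 * s..4 * s}\<close>, which is of the same
  order.\<close>

lemma heat_\<kappa>_le:
  obtains C :: real where "0 < C" and "\<And>s (x::'a) y. 0 < s \<Longrightarrow>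
    (\<integral>\<^sup>+t. ennreal (\<kappa> 0 t) * ennreal (heat (s + t) x y) \<partial>halfline) \<le> ennreal C * riesz_kernel \<alpha> x y"
proof
  define D where "D = 2 powr m"
  have D: "1 \<le> D" using m by (simp add: D_def ge_one_powr_ge_zero)
  define C1 where "C1 = D * 2 powr (1 - \<beta>)"
  \<comment> \<open>\<open>D\<close> is spent twice, to reach time \<open>2 * s\<close> and to move
    from there to the times in \<open>{2 * s..4 * s}\<close>; the rest is the quotient of
    \<open>s powr \<beta> / \<beta>\<close> by
    \<open>2 * s * (4 * s) powr (\<beta> - 1)\<close>.\<close>
  define C2 where "C2 = D * D * (4 powr (1 - \<beta>)) / (2 * \<beta>)"
  show "0 < C1 + C2" using D \<beta> by (auto simp: C1_def C2_def intro!: add_pos_pos divide_pos_pos mult_pos_pos)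
  fix s :: real and x y :: 'a assume s: "0 < s"
  have dh: "heat u x y \<le> D * heat v x y" if "0 < u" "u \<le> v" "v \<le> 2 * u" for u v
    using heat_le_heat[OF that, of x y] by (simp add: D_def m_def)
  have c: "c\<^sub>0 > 0" by (rule c\<^sub>0_pos)
  have m1: "(\<lambda>t. ennreal (\<kappa> 0 (2 * t)) * ennreal (heat (2 * t) x y)) \<in> borel_measurable halfline"
    by measurable
  have m2: "(\<lambda>t. (ennreal (\<kappa> 0 t) * indicator {0<..s} t)) \<in> borel_measurable halfline"
    by measurable
  have s1: "(\<integral>\<^sup>+t. ennreal (\<kappa> 0 t) * ennreal (heat (s + t) x y) \<partial>halfline)
    \<le> (\<integral>\<^sup>+t. ennreal (D * 2 powr (1 - \<beta>)) * (ennreal (\<kappa> 0 (2 * t)) * ennreal (heat (2 * t) x y))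
        + ennreal (D * heat (2 * s) x y) * (ennreal (\<kappa> 0 t) * indicator {0<..s} t) \<partial>halfline)"
  proof (rule nn_integral_halfline_mono)
    fix t :: real assume t: "0 < t"
    show "ennreal (\<kappa> 0 t) * ennreal (heat (s + t) x y)
      \<le> ennreal (D * 2 powr (1 - \<beta>)) * (ennreal (\<kappa> 0 (2 * t)) * ennreal (heat (2 * t) x y))
        + ennreal (D * heat (2 * s) x y) * (ennreal (\<kappa> 0 t) * indicator {0<..s} t)"
    proof (cases "s \<le> t")
      case True
      have "\<kappa> 0 t * heat (s + t) x y \<le> \<kappa> 0 t * (D * heat (2 * t) x y)"
        using True s t by (intro mult_left_mono dh) auto
      also have "\<dots> = (D * 2 powr (1 - \<beta>)) * (\<kappa> 0 (2 * t) * heat (2 * t) x y)"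
        by (simp add: \<kappa>_half[OF t])
      finally have "ennreal (\<kappa> 0 t) * ennreal (heat (s + t) x y)
        \<le> ennreal (D * 2 powr (1 - \<beta>)) * (ennreal (\<kappa> 0 (2 * t)) * ennreal (heat (2 * t) x y))"
        using D by (simp add: ennreal_leI flip: ennreal_mult)
      then show ?thesis by (simp add: add_increasing2)
    next
      case False
      have "\<kappa> 0 t * heat (s + t) x y \<le> \<kappa> 0 t * (D * heat (2 * s) x y)"
        using False s t by (intro mult_left_mono dh) auto
      then have "ennreal (\<kappa> 0 t) * ennreal (heat (s + t) x y) \<le> ennreal (D * heat (2 * s) x y) * (ennreal (\<kappa> 0 t) * indicator {0<..s} t)"
      proof -
        assume "\<kappa> 0 t * heat (s + t) x y \<le> \<kappa> 0 t * (D * heat (2 * s) x y)"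
        then have "ennreal (\<kappa> 0 t * heat (s + t) x y) \<le> ennreal ((D * heat (2 * s) x y) * \<kappa> 0 t)"
          by (intro ennreal_leI) (simp only: mult.commute)
        then show ?thesis using False t D by (simp add: ennreal_mult)
      qed
      then show ?thesis by (simp add: add_increasing)
    qed
  qed
  have s2: "(\<integral>\<^sup>+t. ennreal (D * 2 powr (1 - \<beta>)) * (ennreal (\<kappa> 0 (2 * t)) * ennreal (heat (2 * t) x y))
        + ennreal (D * heat (2 * s) x y) * (ennreal (\<kappa> 0 t) * indicator {0<..s} t) \<partial>halfline)
    = ennreal (D * 2 powr (1 - \<beta>)) * (\<integral>\<^sup>+t. ennreal (\<kappa> 0 (2 * t)) * ennreal (heat (2 * t) x y) \<partial>halfline)
      + ennreal (D * heat (2 * s) x y) * (\<integral>\<^sup>+t. ennreal (\<kappa> 0 t) * indicator {0<..s} t \<partial>halfline)"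
    unfolding nn_integral_cmult[OF m1, symmetric] nn_integral_cmult[OF m2, symmetric]
    by (rule nn_integral_add) (intro borel_measurable_times_ennreal borel_measurable_const m1 m2)+
  have s3: "ennreal (D * 2 powr (1 - \<beta>)) * (\<integral>\<^sup>+t. ennreal (\<kappa> 0 (2 * t)) * ennreal (heat (2 * t) x y) \<partial>halfline)
      + ennreal (D * heat (2 * s) x y) * (\<integral>\<^sup>+t. ennreal (\<kappa> 0 t) * indicator {0<..s} t \<partial>halfline)
    \<le> ennreal C1 * riesz_kernel \<alpha> x y + ennreal C2 * riesz_kernel \<alpha> x y"
  proof (rule add_mono)
    have "(\<integral>\<^sup>+t. ennreal (\<kappa> 0 (2 * t)) * ennreal (heat (2 * t) x y) \<partial>halfline)
       \<le> (\<integral>\<^sup>+t. ennreal 2 * (ennreal (\<kappa> 0 (2 * t)) * ennreal (heat (2 * t) x y)) \<partial>halfline)"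
      using mult_right_mono[of 1 "ennreal 2"] by (intro nn_integral_halfline_mono) auto
    also have "\<dots> = riesz_kernel \<alpha> x y"
      unfolding riesz_kernel_eq_mix mix_def by (rule nn_integral_halfline_scale[symmetric]) auto
    finally show "ennreal (D * 2 powr (1 - \<beta>)) * (\<integral>\<^sup>+t. ennreal (\<kappa> 0 (2 * t)) * ennreal (heat (2 * t) x y) \<partial>halfline)
        \<le> ennreal C1 * riesz_kernel \<alpha> x y"
      unfolding C1_def by (rule mult_left_mono) simp
  next
    have int: "(\<integral>\<^sup>+t. ennreal (\<kappa> 0 t) * indicator {0<..s} t \<partial>halfline) = ennreal (c\<^sub>0 * s powr \<beta> / \<beta>)"
    proof -
      have "((\<lambda>t. c\<^sub>0 * t powr (\<beta> - 1)) has_integral c\<^sub>0 * (s powr (\<beta> - 1 + 1) / (\<beta> - 1 + 1))) {0..s}"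
        using s \<beta> by (intro has_integral_mult_right has_integral_powr_from_0) auto
      then have "(\<integral>\<^sup>+t. ennreal (indicator {0..s} t * (c\<^sub>0 * t powr (\<beta> - 1))) \<partial>lborel) = ennreal (c\<^sub>0 * (s powr (\<beta> - 1 + 1) / (\<beta> - 1 + 1)))"
        using c by (intro nn_integral_has_integral_lebesgue) auto
      moreover have "(\<integral>\<^sup>+t. ennreal (\<kappa> 0 t) * indicator {0<..s} t \<partial>halfline)
         = (\<integral>\<^sup>+t. ennreal (indicator {0..s} t * (c\<^sub>0 * t powr (\<beta> - 1))) \<partial>lborel)"
        by (subst nn_integral_halfline) (auto intro!: nn_integral_cong simp: indicator_def \<kappa>_def)
      ultimately show ?thesis by simp
    qed
    have "ennreal (D * heat (2 * s) x y) * ennreal (c\<^sub>0 * s powr \<beta> / \<beta>)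
       = ennreal C2 * ennreal (heat (2 * s) x y / D * (c\<^sub>0 * (4 * s) powr (\<beta> - 1) * (2 * s)))"
    proof -
      have "D * heat (2 * s) x y * (c\<^sub>0 * s powr \<beta> / \<beta>) = C2 * (heat (2 * s) x y / D * (c\<^sub>0 * (4 * s) powr (\<beta> - 1) * (2 * s)))"
        unfolding C2_def using s D \<beta> by (simp add: powr_mult powr_diff divide_simps)
      then show ?thesis using D c \<beta> s by (simp add: C2_def flip: ennreal_mult)
    qed
    also have "ennreal (heat (2 * s) x y / D * (c\<^sub>0 * (4 * s) powr (\<beta> - 1) * (2 * s)))
       = (\<integral>\<^sup>+t. ennreal (heat (2 * s) x y / D * (c\<^sub>0 * (4 * s) powr (\<beta> - 1))) * indicator {2 * s..4 * s} t \<partial>lborel)"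
      using s c D by (simp add: nn_integral_cmult_indicator mult.assoc flip: ennreal_mult)
    also have "\<dots> = (\<integral>\<^sup>+t. ennreal (heat (2 * s) x y / D * (c\<^sub>0 * (4 * s) powr (\<beta> - 1))) * indicator {2 * s..4 * s} t \<partial>halfline)"
      using s by (subst nn_integral_halfline) (auto intro!: nn_integral_cong simp: indicator_def)
    also have "\<dots> \<le> riesz_kernel \<alpha> x y"
      unfolding riesz_kernel_eq_mix mix_def
    proof (rule nn_integral_halfline_mono)
      fix t :: real assume t: "0 < t"
      show "ennreal (heat (2 * s) x y / D * (c\<^sub>0 * (4 * s) powr (\<beta> - 1))) * indicator {2 * s..4 * s} t \<le> ennreal (\<kappa> 0 t) * ennreal (heat t x y)"
      proof (cases "t \<in> {2 * s..4 * s}")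
        case True
        have "heat (2 * s) x y / D \<le> heat t x y" using True s D dh[of "2 * s" t] by (simp add: field_simps)
        \<comment> \<open>The weight decreases in \<open>t\<close> because
          \<open>\<beta> \<le> 1\<close>, so its value at the right end is a lower bound.\<close>
        moreover have "c\<^sub>0 * (4 * s) powr (\<beta> - 1) \<le> \<kappa> 0 t"
          unfolding \<kappa>_def using True s t \<beta> c by (auto intro!: mult_left_mono powr_mono2')
        ultimately have "heat (2 * s) x y / D * (c\<^sub>0 * (4 * s) powr (\<beta> - 1)) \<le> heat t x y * \<kappa> 0 t"
          using c s by (intro mult_mono) auto
        then show ?thesis using True by (simp add: ennreal_leI mult.commute flip: ennreal_mult)
      qed simp
    qed
    finally show "ennreal (D * heat (2 * s) x y) * (\<integral>\<^sup>+t. ennreal (\<kappa> 0 t) * indicator {0<..s} t \<partial>halfline) \<le> ennreal C2 * riesz_kernel \<alpha> x y"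
      unfolding int by (simp add: mult_left_mono)
  qed
  have s4: "ennreal C1 * riesz_kernel \<alpha> x y + ennreal C2 * riesz_kernel \<alpha> x y = ennreal (C1 + C2) * riesz_kernel \<alpha> x y"
    using D \<beta> by (subst ennreal_plus) (auto simp: C1_def C2_def distrib_right)
  show "(\<integral>\<^sup>+t. ennreal (\<kappa> 0 t) * ennreal (heat (s + t) x y) \<partial>halfline) \<le> ennreal (C1 + C2) * riesz_kernel \<alpha> x y"
    by (rule order_trans[OF s1 ord_eq_le_trans[OF s2 ord_le_eq_trans[OF s3 s4]]])
qed

text \<open>
  As \<open>\<rho>\<close> tends to 0, the weights \<open>hw \<rho> \<eta> / H \<eta> \<rho>\<close> concentrate at \<open>t = 0\<close>. That \<open>\<rho>\<close> is
  negligible against \<open>H \<eta> \<rho>\<close> rests on \<open>\<beta> \<le> 1\<close>; at \<open>\<beta> = 1\<close> only the factor \<open>ln (1 / \<rho>)\<close> is left.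
\<close>

definition H :: "real \<Rightarrow> real \<Rightarrow> ennreal" where
  "H \<eta> \<rho> = (\<integral>\<^sup>+t. ennreal (hw \<rho> \<eta> t) * indicator {..<1} t \<partial>halfline)"

lemma nn_integral_\<kappa>_unit: "(\<integral>\<^sup>+t. ennreal (\<kappa> 0 t) * indicator {..<1} t \<partial>halfline) < \<infinity>"
proof -
  have "((\<lambda>t. t powr (\<beta> - 1)) has_integral (1 powr (\<beta> - 1 + 1) / (\<beta> - 1 + 1))) {0..1}"
    using \<beta> by (intro has_integral_powr_from_0) auto
  then have "((\<lambda>t. c\<^sub>0 * t powr (\<beta> - 1)) has_integral c\<^sub>0 * (1 powr (\<beta> - 1 + 1) / (\<beta> - 1 + 1))) {0..1}"
    by (rule has_integral_mult_right)
  then have "(\<integral>\<^sup>+t. ennreal (indicator {0..1} t * (c\<^sub>0 * t powr (\<beta> - 1))) \<partial>lborel) = ennreal (c\<^sub>0 * (1 powr (\<beta> - 1 + 1) / (\<beta> - 1 + 1)))"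
    using c\<^sub>0_pos by (intro nn_integral_has_integral_lebesgue) auto
  moreover have "(\<integral>\<^sup>+t. ennreal (\<kappa> 0 t) * indicator {..<1} t \<partial>halfline)
      \<le> (\<integral>\<^sup>+t. ennreal (indicator {0..1} t * (c\<^sub>0 * t powr (\<beta> - 1))) \<partial>lborel)"
    by (subst nn_integral_halfline) (auto intro!: nn_integral_mono simp: indicator_def \<kappa>_def)
  ultimately show ?thesis by (simp add: order_le_less_trans)
qed

lemma \<kappa>_antimono: "0 \<le> \<eta> \<Longrightarrow> 0 \<le> t \<Longrightarrow> \<kappa> \<eta> t \<le> \<kappa> 0 t"
  using c\<^sub>0_pos unfolding \<kappa>_def by (intro mult_left_mono) auto

lemma H_finite: "0 \<le> \<eta> \<Longrightarrow> H \<eta> \<rho> < \<infinity>"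
proof -
  assume "0 \<le> \<eta>"
  then have "H \<eta> \<rho> \<le> (\<integral>\<^sup>+t. ennreal (\<kappa> 0 t) * indicator {..<1} t \<partial>halfline)"
    unfolding H_def by (intro nn_integral_halfline_mono mult_right_mono ennreal_leI)
      (auto intro: order_trans[OF hw_le \<kappa>_antimono])
  then show ?thesis using nn_integral_\<kappa>_unit by (rule order_le_less_trans)
qed

text \<open>Between \<rho> and 1 the weight \<kappa> is bounded below, as
  \<open>\<beta> \<le> 1\<close>, and \<open>1 - exp (- \<rho> / t)\<close> is at least
  \<open>\<rho> / (2 * t)\<close>; the integral of \<open>1 / t\<close> over this range is the
  logarithm.\<close>

lemma H_lower:
  assumes \<eta>: "0 \<le> \<eta>" and \<rho>: "0 < \<rho>" "\<rho> < 1"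
  shows "ennreal (c\<^sub>0 * exp (- \<eta>) / 2 * \<rho> * ln (1 / \<rho>)) \<le> H \<eta> \<rho>"
proof -
  have "(\<integral>\<^sup>+t. ennreal (1 / t) * indicator {\<rho>..1} t \<partial>lborel) = ennreal (ln 1 - ln \<rho>)"
    using \<rho> by (intro nn_integral_FTC_Icc) (auto intro!: derivative_eq_intros simp: field_simps)
  then have "ennreal (c\<^sub>0 * exp (- \<eta>) / 2 * \<rho> * ln (1 / \<rho>)) = ennreal (c\<^sub>0 * exp (- \<eta>) / 2 * \<rho>) * (\<integral>\<^sup>+t. ennreal (1 / t) * indicator {\<rho>..1} t \<partial>lborel)"
    using \<rho> c\<^sub>0_pos by (simp add: ln_div flip: ennreal_mult)
  also have "\<dots> = (\<integral>\<^sup>+t. ennreal (c\<^sub>0 * exp (- \<eta>) / 2 * \<rho>) * (ennreal (1 / t) * indicator {\<rho>..1} t) \<partial>lborel)"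
    by (rule nn_integral_cmult[symmetric]) simp
  also have "\<dots> \<le> (\<integral>\<^sup>+t. ennreal (hw \<rho> \<eta> t) * indicator {..<1} t * indicator {0<..} t \<partial>lborel)"
  \<comment> \<open>The end point 1 lies in \<open>{\<rho>..1}\<close> but not in
    \<open>{..<1}\<close>; it is discarded as a null set.\<close>
  proof (rule nn_integral_mono_AE, rule AE_mp[OF AE_lborel_singleton[of 1]], intro AE_I2 impI)
    fix t :: real assume "t \<noteq> 1"
    show "ennreal (c\<^sub>0 * exp (- \<eta>) / 2 * \<rho>) * (ennreal (1 / t) * indicator {\<rho>..1} t) \<le> ennreal (hw \<rho> \<eta> t) * indicator {..<1} t * indicator {0<..} t"
    proof (cases "t \<in> {\<rho>..1}")
      case True
      then have t: "0 < t" "t < 1" "\<rho> \<le> t" using \<rho> \<open>t \<noteq> 1\<close> by auto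
      have "1 \<le> t powr (\<beta> - 1)" using t \<beta> powr_mono2'[of "\<beta> - 1" t 1] by simp
      moreover have "\<eta> * t \<le> \<eta>" using t \<eta> by (simp add: mult_left_le)
      ultimately have "c\<^sub>0 * 1 * exp (- \<eta>) \<le> \<kappa> \<eta> t"
        unfolding \<kappa>_def using c\<^sub>0_pos by (intro mult_mono) auto
      moreover have "\<rho> / t / 2 \<le> 1 - exp (- (\<rho> / t))"
        using t \<rho> by (intro one_minus_exp_bounds) auto
      ultimately have "c\<^sub>0 * 1 * exp (- \<eta>) * (\<rho> / t / 2) \<le> hw \<rho> \<eta> t"
        unfolding hw_def using t \<rho> by (intro mult_mono) auto
      then have "ennreal (c\<^sub>0 * exp (- \<eta>) / 2 * \<rho> * (1 / t)) \<le> ennreal (hw \<rho> \<eta> t)"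
        by (intro ennreal_leI) (simp add: field_simps)
      then show ?thesis using True t \<rho> c\<^sub>0_pos by (simp flip: ennreal_mult)
    qed simp
  qed
  also have "\<dots> = H \<eta> \<rho>"
    unfolding H_def by (subst nn_integral_halfline) auto
  finally show ?thesis .
qed

lemma H_pos: "0 \<le> \<eta> \<Longrightarrow> 0 < \<rho> \<Longrightarrow> \<rho> < 1 \<Longrightarrow> 0 < H \<eta> \<rho>"
proof -
  assume *: "0 \<le> \<eta>" "0 < \<rho>" "\<rho> < 1"
  then have "0 < c\<^sub>0 * exp (- \<eta>) / 2 * \<rho> * ln (1 / \<rho>)"
    using c\<^sub>0_pos by (intro mult_pos_pos divide_pos_pos) (auto simp: ln_div)
  then show ?thesis by (intro less_le_trans[OF _ H_lower[OF *]]) (simp only: ennreal_less_zero_iff)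
qed

lemma tendsto_div_H:
  assumes \<eta>: "0 \<le> \<eta>"
  shows "((\<lambda>\<rho>. ennreal \<rho> / H \<eta> \<rho>) \<longlongrightarrow> 0) (at_right 0)"
proof (rule tendsto_sandwich[where f="\<lambda>_. 0"])
  define c where "c = c\<^sub>0 * exp (- \<eta>) / 2"
  have c: "0 < c" using c\<^sub>0_pos by (simp add: c_def)
  have ev: "\<forall>\<^sub>F \<rho> in at_right 0. \<rho> \<in> {0<..<1::real}"
    by (rule eventually_at_right_real) simp
  show "\<forall>\<^sub>F \<rho> in at_right 0. ennreal \<rho> / H \<eta> \<rho> \<le> ennreal (1 / (c * ln (1 / \<rho>)))"
    using ev
  proof eventually_elim
    case (elim \<rho>)
    then have \<rho>: "0 < \<rho>" "\<rho> < 1" by auto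
    then have l: "0 < ln (1 / \<rho>)" by (simp add: ln_div)
    have "ennreal \<rho> / H \<eta> \<rho> \<le> ennreal \<rho> / ennreal (c * \<rho> * ln (1 / \<rho>))"
      using H_lower[OF \<eta> \<rho>] by (intro ennreal_divide_left_mono) (auto simp: c_def)
    also have "\<dots> = ennreal (\<rho> / (c * \<rho> * ln (1 / \<rho>)))"
      using \<rho> l c by (subst divide_ennreal) auto
    also have "\<rho> / (c * \<rho> * ln (1 / \<rho>)) = 1 / (c * ln (1 / \<rho>))" using \<rho> by simp
    finally show ?case .
  qed
  have "((\<lambda>\<rho>. 1 / (c * ln (1 / \<rho>))) \<longlongrightarrow> 0) (at_right 0)" using c by real_asymp
  then show "((\<lambda>\<rho>. ennreal (1 / (c * ln (1 / \<rho>)))) \<longlongrightarrow> 0) (at_right 0)"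
    using tendsto_ennrealI by fastforce
  show "((\<lambda>\<rho>::real. 0::ennreal) \<longlongrightarrow> 0) (at_right 0)" by simp
qed simp

lemma hw_indicator_le:
  assumes "0 < t" "0 < \<rho>" "0 < \<delta>" "\<delta> \<le> t"
  shows "ennreal (hw \<rho> \<eta> t) \<le> ennreal \<rho> * (ennreal (1 / \<delta>) * ennreal (\<kappa> \<eta> t))"
proof -
  have "hw \<rho> \<eta> t \<le> \<rho> / t * \<kappa> \<eta> t" using assms by (intro hw_le') auto
  also have "\<dots> \<le> \<rho> / \<delta> * \<kappa> \<eta> t" using assms by (intro mult_right_mono divide_left_mono) auto
  finally show ?thesis using assms by (simp add: ennreal_leI flip: ennreal_mult)
qed

text \<open>Times beyond a fixed \<delta> contribute a term of order \<rho>, negligible against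
  \<open>H\<close>, and below \<delta> the function \<open>J\<close> is close to its limit. The two
  order bounds are proved separately, so an infinite limit needs no case of its own.\<close>

lemma approx_identity:
  fixes J :: "real \<Rightarrow> ennreal"
  assumes [measurable]: "J \<in> borel_measurable borel" and \<eta>: "0 \<le> \<eta>"
    and fin: "(\<integral>\<^sup>+t. ennreal (\<kappa> \<eta> t) * J t \<partial>halfline) < \<infinity>"
    and lim: "(J \<longlongrightarrow> J\<^sub>0) (at_right 0)"
  shows "((\<lambda>\<rho>. (\<integral>\<^sup>+t. ennreal (hw \<rho> \<eta> t) * J t \<partial>halfline) / H \<eta> \<rho>) \<longlongrightarrow> J\<^sub>0) (at_right 0)"
proof (rule order_tendstoI)
  have ev: "\<forall>\<^sub>F \<rho> in at_right 0. \<rho> \<in> {0<..<1::real}"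
    by (rule eventually_at_right_real) simp
  have cont: "((\<lambda>\<rho>. D * (ennreal \<rho> / H \<eta> \<rho>)) \<longlongrightarrow> 0) (at_right 0)" if "D < \<infinity>" for D
    using ennreal_tendsto_cmult[OF that[unfolded infinity_ennreal_def] tendsto_div_H[OF \<eta>]] by simp
  { fix a assume a: "a > J\<^sub>0"
    obtain b where b: "J\<^sub>0 < b" "b < a" using dense[OF a] by auto
    have "\<forall>\<^sub>F t in at_right 0. J t < b" using order_tendstoD(2)[OF lim b(1)] .
    then obtain \<delta>' where "0 < \<delta>'" and \<delta>': "\<And>t. 0 < t \<Longrightarrow> t < \<delta>' \<Longrightarrow> J t < b"
      by (auto simp: eventually_at_right_field)
    define \<delta> where "\<delta> = min \<delta>' 1"
    have \<delta>: "0 < \<delta>" "\<delta> \<le> 1" "\<And>t. 0 < t \<Longrightarrow> t < \<delta> \<Longrightarrow> J t < b"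
      using \<open>0 < \<delta>'\<close> \<delta>' by (auto simp: \<delta>_def)
    \<comment> \<open>Up to the factor \<rho>, a bound for the contribution of the times from
      \<delta> on.\<close>
    define D where "D = ennreal (1 / \<delta>) * (\<integral>\<^sup>+t. ennreal (\<kappa> \<eta> t) * J t \<partial>halfline)"
    have D: "D < \<infinity>" using fin by (simp add: D_def ennreal_mult_less_top)
    have "((\<lambda>\<rho>. b + D * (ennreal \<rho> / H \<eta> \<rho>)) \<longlongrightarrow> b + 0) (at_right 0)"
      by (intro tendsto_add tendsto_const cont D)
    then have "\<forall>\<^sub>F \<rho> in at_right 0. b + D * (ennreal \<rho> / H \<eta> \<rho>) < a"
      using b by (intro order_tendstoD(2)[of _ "b + 0"]) auto
    with ev show "\<forall>\<^sub>F \<rho> in at_right 0. (\<integral>\<^sup>+t. ennreal (hw \<rho> \<eta> t) * J t \<partial>halfline) / H \<eta> \<rho> < a"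
    proof eventually_elim
      case (elim \<rho>)
      then have \<rho>: "0 < \<rho>" "\<rho> < 1" by auto
      have Hp: "0 < H \<eta> \<rho>" "H \<eta> \<rho> < \<infinity>" using H_pos H_finite \<eta> \<rho> by auto
      have "(\<integral>\<^sup>+t. ennreal (hw \<rho> \<eta> t) * J t \<partial>halfline)
        \<le> (\<integral>\<^sup>+t. b * (ennreal (hw \<rho> \<eta> t) * indicator {..<1} t) + ennreal \<rho> * (ennreal (1 / \<delta>) * (ennreal (\<kappa> \<eta> t) * J t)) \<partial>halfline)"
      proof (rule nn_integral_halfline_mono)
        fix t :: real assume t: "0 < t"
        show "ennreal (hw \<rho> \<eta> t) * J t \<le> b * (ennreal (hw \<rho> \<eta> t) * indicator {..<1} t) + ennreal \<rho> * (ennreal (1 / \<delta>) * (ennreal (\<kappa> \<eta> t) * J t))"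
        proof (cases "t < \<delta>")
          case True
          then have "ennreal (hw \<rho> \<eta> t) * J t \<le> b * (ennreal (hw \<rho> \<eta> t) * indicator {..<1} t)"
            using \<delta>(2) less_imp_le[OF \<delta>(3)[OF t True]] by (simp add: mult.commute mult_right_mono)
          then show ?thesis by (simp add: add_increasing2)
        next
          case False
          then have "ennreal (hw \<rho> \<eta> t) * J t \<le> (ennreal \<rho> * (ennreal (1 / \<delta>) * ennreal (\<kappa> \<eta> t))) * J t"
            using t \<rho> \<delta> by (intro mult_right_mono hw_indicator_le) auto
          also have "\<dots> = ennreal \<rho> * (ennreal (1 / \<delta>) * (ennreal (\<kappa> \<eta> t) * J t))" by (simp only: mult.assoc)
          finally show ?thesis by (simp add: add_increasing)
        qed
      qed
      also have "\<dots> = b * H \<eta> \<rho> + ennreal \<rho> * D"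
        unfolding H_def D_def by (subst nn_integral_add, measurable) (simp add: nn_integral_cmult)
      finally have "(\<integral>\<^sup>+t. ennreal (hw \<rho> \<eta> t) * J t \<partial>halfline) / H \<eta> \<rho> \<le> (b * H \<eta> \<rho> + ennreal \<rho> * D) / H \<eta> \<rho>"
        by (rule divide_right_mono_ennreal)
      also have "\<dots> = b + D * (ennreal \<rho> / H \<eta> \<rho>)"
        using Hp by (simp add: add_divide_distrib_ennreal ennreal_mult_divide_eq ennreal_times_divide mult.commute)
      finally show ?case using elim by simp
    qed }
  { fix a assume a: "a < J\<^sub>0"
    obtain b where b: "a < b" "b < J\<^sub>0" using dense[OF a] by auto
    have "\<forall>\<^sub>F t in at_right 0. b < J t" using order_tendstoD(1)[OF lim b(2)] .
    then obtain \<delta>' where "0 < \<delta>'" and \<delta>': "\<And>t. 0 < t \<Longrightarrow> t < \<delta>' \<Longrightarrow> b < J t"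
      by (auto simp: eventually_at_right_field)
    define \<delta> where "\<delta> = min \<delta>' 1"
    have \<delta>: "0 < \<delta>" "\<delta> \<le> 1" "\<And>t. 0 < t \<Longrightarrow> t < \<delta> \<Longrightarrow> b < J t"
      using \<open>0 < \<delta>'\<close> \<delta>' by (auto simp: \<delta>_def)
    have bf: "b < \<infinity>" using b less_le_trans[of b J\<^sub>0 \<infinity>] by (auto simp: less_top)
    \<comment> \<open>Here the loss is the mass of the weight between \<delta> and 1, where
      \<open>J\<close> may lie below \<open>b\<close>; again it is of order \<rho>.\<close>
    define D where "D = b * (ennreal (1 / \<delta>) * (\<integral>\<^sup>+t. ennreal (\<kappa> 0 t) * indicator {..<1} t \<partial>halfline))"
    have D: "D < \<infinity>" using nn_integral_\<kappa>_unit bf by (simp add: D_def ennreal_mult_less_top)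
    have "((\<lambda>\<rho>. b - D * (ennreal \<rho> / H \<eta> \<rho>)) \<longlongrightarrow> b - 0) (at_right 0)"
      using bf by (intro tendsto_diff_ennreal tendsto_const cont D) auto
    then have "\<forall>\<^sub>F \<rho> in at_right 0. a < b - D * (ennreal \<rho> / H \<eta> \<rho>)"
      using b by (intro order_tendstoD(1)[of _ "b - 0"]) auto
    with ev show "\<forall>\<^sub>F \<rho> in at_right 0. a < (\<integral>\<^sup>+t. ennreal (hw \<rho> \<eta> t) * J t \<partial>halfline) / H \<eta> \<rho>"
    proof eventually_elim
      case (elim \<rho>)
      then have \<rho>: "0 < \<rho>" "\<rho> < 1" by auto
      have Hp: "0 < H \<eta> \<rho>" "H \<eta> \<rho> < \<infinity>" using H_pos H_finite \<eta> \<rho> by auto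
      have "b * H \<eta> \<rho> = (\<integral>\<^sup>+t. b * (ennreal (hw \<rho> \<eta> t) * indicator {..<1} t) \<partial>halfline)"
        unfolding H_def by (rule nn_integral_cmult[symmetric]) simp
      also have "\<dots> \<le> (\<integral>\<^sup>+t. ennreal (hw \<rho> \<eta> t) * J t + ennreal \<rho> * (b * (ennreal (1 / \<delta>) * (ennreal (\<kappa> 0 t) * indicator {..<1} t))) \<partial>halfline)"
      proof (rule nn_integral_halfline_mono)
        fix t :: real assume t: "0 < t"
        show "b * (ennreal (hw \<rho> \<eta> t) * indicator {..<1} t) \<le> ennreal (hw \<rho> \<eta> t) * J t + ennreal \<rho> * (b * (ennreal (1 / \<delta>) * (ennreal (\<kappa> 0 t) * indicator {..<1} t)))"
        proof (cases "t < \<delta>")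
          case True
          then have "b * (ennreal (hw \<rho> \<eta> t) * indicator {..<1} t) \<le> ennreal (hw \<rho> \<eta> t) * J t"
            using \<delta>(2) less_imp_le[OF \<delta>(3)[OF t True]] by (simp add: mult.commute mult_right_mono)
          then show ?thesis by (simp add: add_increasing2)
        next
          case False
          have "ennreal (hw \<rho> \<eta> t) \<le> ennreal \<rho> * (ennreal (1 / \<delta>) * ennreal (\<kappa> \<eta> t))"
            using t \<rho> \<delta> False by (intro hw_indicator_le) auto
          also have "\<dots> \<le> ennreal \<rho> * (ennreal (1 / \<delta>) * ennreal (\<kappa> 0 t))"
            using \<eta> t by (intro mult_left_mono ennreal_leI \<kappa>_antimono) auto
          finally have "b * (ennreal (hw \<rho> \<eta> t) * indicator {..<1} t) \<le> b * ((ennreal \<rho> * (ennreal (1 / \<delta>) * ennreal (\<kappa> 0 t))) * indicator {..<1} t)"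
            by (intro mult_left_mono mult_right_mono) auto
          also have "\<dots> = ennreal \<rho> * (b * (ennreal (1 / \<delta>) * (ennreal (\<kappa> 0 t) * indicator {..<1} t)))"
            by (simp only: ac_simps)
          finally show ?thesis by (simp add: add_increasing)
        qed
      qed
      also have "\<dots> = (\<integral>\<^sup>+t. ennreal (hw \<rho> \<eta> t) * J t \<partial>halfline) + ennreal \<rho> * D"
        unfolding D_def by (subst nn_integral_add, measurable) (simp add: nn_integral_cmult)
      finally have "b * H \<eta> \<rho> / H \<eta> \<rho> \<le> ((\<integral>\<^sup>+t. ennreal (hw \<rho> \<eta> t) * J t \<partial>halfline) + ennreal \<rho> * D) / H \<eta> \<rho>"
        by (rule divide_right_mono_ennreal)
      then have "b \<le> (\<integral>\<^sup>+t. ennreal (hw \<rho> \<eta> t) * J t \<partial>halfline) / H \<eta> \<rho> + D * (ennreal \<rho> / H \<eta> \<rho>)"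
        using Hp by (simp add: add_divide_distrib_ennreal ennreal_mult_divide_eq ennreal_times_divide mult.commute)
      then have "b - D * (ennreal \<rho> / H \<eta> \<rho>) \<le> (\<integral>\<^sup>+t. ennreal (hw \<rho> \<eta> t) * J t \<partial>halfline) / H \<eta> \<rho>"
        using bf by (auto simp: ennreal_minus_le_iff add.commute)
      with elim show ?case by (auto intro: less_le_trans)
    qed }
qed

end

section \<open>Energy as an inner product\<close>

text \<open>The heat transform: the density at \<open>z\<close>, after time \<open>s\<close>, of the
  heat flow started from \<mu>.\<close>

definition hm :: "'a::euclidean_space measure \<Rightarrow> real \<Rightarrow> 'a \<Rightarrow> ennreal" where
  "hm \<mu> s z = (\<integral>\<^sup>+y. ennreal (heat s z y) \<partial>\<mu>)"

lemma radon_sigma_finite: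
  assumes "radon (\<mu> :: 'a::euclidean_space measure)" shows "sigma_finite_measure \<mu>"
proof
  have s: "sets \<mu> = sets borel" and K: "\<And>K. compact K \<Longrightarrow> emeasure \<mu> K < \<infinity>"
    using assms by (auto simp: radon_def)
  have sp: "space \<mu> = UNIV" using sets_eq_imp_space_eq[OF s] by simp
  show "\<exists>A. countable A \<and> A \<subseteq> sets \<mu> \<and> \<Union> A = space \<mu> \<and> (\<forall>a\<in>A. emeasure \<mu> a \<noteq> \<infinity>)"
  proof (intro exI conjI ballI)
    show "\<Union> (range (\<lambda>i::nat. cball (0::'a) (real i))) = space \<mu>"
      using real_arch_simple by (auto simp: sp)
    show "emeasure \<mu> a \<noteq> \<infinity>" if "a \<in> range (\<lambda>i::nat. cball (0::'a) (real i))" for a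
      using that K by (auto simp: less_top)
  qed (auto simp: s)
qed

lemma radon_sets: "radon \<mu> \<Longrightarrow> sets \<mu> = sets borel"
  by (simp add: radon_def)

lemma borel_measurable_nn_integral_radon:
  assumes "radon \<mu>" and f: "case_prod f \<in> borel_measurable (N \<Otimes>\<^sub>M borel)"
  shows "(\<lambda>x. \<integral>\<^sup>+y. f x y \<partial>\<mu>) \<in> borel_measurable N"
proof -
  interpret sigma_finite_measure \<mu> by (rule radon_sigma_finite[OF assms(1)])
  have "case_prod f \<in> borel_measurable (N \<Otimes>\<^sub>M \<mu>)"
    using f measurable_cong_sets[OF sets_pair_measure_cong[OF refl radon_sets[OF assms(1)]] refl] by blast
  then show ?thesis by (rule borel_measurable_nn_integral)
qed

lemma borel_measurable_hm:
  assumes "radon \<mu>" shows "(\<lambda>p. hm \<mu> (fst p) (snd p)) \<in> borel_measurable (borel \<Otimes>\<^sub>M borel)"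
  unfolding hm_def by (intro borel_measurable_nn_integral_radon assms) measurable

lemma borel_measurable_hm':
  assumes "radon \<mu>" and [measurable]: "f \<in> borel_measurable N" "g \<in> borel_measurable N"
  shows "(\<lambda>x. hm \<mu> (f x) (g x)) \<in> borel_measurable N"
  using measurable_compose[OF _ borel_measurable_hm[OF assms(1)], of "\<lambda>x. (f x, g x)" N] by simp

lemma measurable_radon: "radon \<mu> \<Longrightarrow> f \<in> borel_measurable borel \<Longrightarrow> f \<in> borel_measurable \<mu>"
  using measurable_cong_sets[OF radon_sets refl] by blast

lemma nn_integral_mult_split:
  fixes c :: ennreal
  assumes "f \<in> borel_measurable M" "g \<in> borel_measurable N"
  shows "c * ((\<integral>\<^sup>+x. f x \<partial>M) * (\<integral>\<^sup>+y. g y \<partial>N)) = (\<integral>\<^sup>+x. \<integral>\<^sup>+y. c * (f x * g y) \<partial>N \<partial>M)"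
  using assms by (simp add: nn_integral_cmult nn_integral_multc)

text \<open>This is \<open>(1 + x / k) ^ k \<le> exp x\<close> at \<open>x = u / s\<close>; the
  constant \<open>M\<close> absorbs the factor 2 and the rescaling.\<close>

lemma one_plus_power_le_exp:
  fixes s :: real assumes s: "0 < s"
  obtains C where "0 < C" "\<And>u. 0 \<le> u \<Longrightarrow> (1 + 2 * u) ^ k \<le> C * exp (u / s)"
proof (cases "k = 0")
  case True
  show ?thesis by (rule that[of 1]) (use True s in auto)
next
  case False
  define M where "M = max 1 (2 * s * real k)"
  show ?thesis
  proof (rule that)
    show "0 < M ^ k" by (simp add: M_def)
    fix u :: real assume u: "0 \<le> u"
    have "1 + 2 * u \<le> M * (1 + u / s / real k)"
    proof -
      have "2 * u = (2 * s * real k) * (u / s / real k)" using s False by simp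
      also have "\<dots> \<le> M * (u / s / real k)" using s u by (intro mult_right_mono) (auto simp: M_def)
      finally have "2 * u \<le> M * (u / s / real k)" .
      moreover have "1 \<le> M" by (simp add: M_def)
      ultimately show ?thesis by (simp add: distrib_left)
    qed
    then have "(1 + 2 * u) ^ k \<le> (M * (1 + u / s / real k)) ^ k" using u by (intro power_mono) auto
    also have "\<dots> = M ^ k * (1 + u / s / real k) ^ k" by (simp add: power_mult_distrib)
    also have "\<dots> \<le> M ^ k * exp (u / s)"
    proof (rule mult_left_mono)
      have "0 \<le> u / s" using u s by simp
      then show "(1 + u / s / real k) ^ k \<le> exp (u / s)"
        using exp_ge_one_plus_x_over_n_power_n[of k "u / s"] False by simp
    qed (simp add: M_def)
    finally show "(1 + 2 * u) ^ k \<le> M ^ k * exp (u / s)" .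
  qed
qed

text \<open>Moving the centre from \<open>z\<close> to the origin costs a constant, by \<open>1 +
  (norm y)\<^sup>2 \<le> (1 + 2 * (norm z)\<^sup>2) * (1 + 2 * r)\<close>; then the exponential
  beats every power of \<open>r\<close>.\<close>

lemma heat_le_power:
  fixes z :: "'a::euclidean_space"
  assumes s: "0 < s"
  obtains C where "0 < C" "\<And>y. heat s z y \<le> C / (1 + (norm y)\<^sup>2) ^ k"
proof -
  obtain C where C: "0 < C" "\<And>u. 0 \<le> u \<Longrightarrow> (1 + 2 * u) ^ k \<le> C * exp (u / s)"
    using one_plus_power_le_exp[OF s] by blast
  define A where "A = (pi * s) powr (- (real DIM('a) / 2))"
  show ?thesis
  proof (rule that)
    show "0 < A * C * (1 + 2 * (norm z)\<^sup>2) ^ k"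
      using C s by (intro mult_pos_pos zero_less_power) (auto simp: A_def intro: add_pos_nonneg)
    fix y
    define r where "r = (norm (z - y))\<^sup>2"
    have "norm y \<le> norm z + norm (z - y)" by (metis norm_minus_commute norm_triangle_sub)
    then have "(norm y)\<^sup>2 \<le> (norm z + norm (z - y))\<^sup>2" by (rule power_mono) simp
    also have "\<dots> \<le> 2 * (norm z)\<^sup>2 + 2 * r"
      unfolding r_def using sum_squares_bound[of "norm z" "norm (z - y)"] by (simp add: power2_sum)
    finally have "(norm y)\<^sup>2 \<le> 2 * (norm z)\<^sup>2 + 2 * r" .
    moreover have "0 \<le> 4 * ((norm z)\<^sup>2 * r)" by (simp add: r_def)
    ultimately have "1 + (norm y)\<^sup>2 \<le> (1 + 2 * (norm z)\<^sup>2) * (1 + 2 * r)"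
      by (simp add: algebra_simps)
    then have "(1 + (norm y)\<^sup>2) ^ k \<le> ((1 + 2 * (norm z)\<^sup>2) * (1 + 2 * r)) ^ k"
      by (intro power_mono) auto
    also have "\<dots> \<le> (1 + 2 * (norm z)\<^sup>2) ^ k * (C * exp (r / s))"
      unfolding power_mult_distrib by (intro mult_left_mono C) (auto simp: r_def)
    finally have "(1 + (norm y)\<^sup>2) ^ k * (A * exp (- r / s)) \<le> (1 + 2 * (norm z)\<^sup>2) ^ k * (C * exp (r / s)) * (A * exp (- r / s))"
      by (rule mult_right_mono) (simp add: A_def)
    also have "\<dots> = A * C * (1 + 2 * (norm z)\<^sup>2) ^ k" by (simp add: exp_minus field_simps)
    finally show "heat s z y \<le> A * C * (1 + 2 * (norm z)\<^sup>2) ^ k / (1 + (norm y)\<^sup>2) ^ k"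
      by (simp add: heat_def A_def r_def pos_le_divide_eq add_pos_nonneg zero_less_power mult.commute)
  qed
qed

context riesz begin

lemma potential_eq: "potential \<alpha> \<mu> (x::'a) = (\<integral>\<^sup>+y. mix (\<kappa> 0) x y \<partial>\<mu>)"
  by (simp add: potential_def riesz_kernel_eq_mix)

lemma mutual_energy_eq:
  assumes "radon (\<mu> :: 'a measure)" "radon \<nu>"
  shows "mutual_energy \<alpha> \<mu> \<nu> = (\<integral>\<^sup>+x. \<integral>\<^sup>+y. mix (\<kappa> 0) x y \<partial>\<nu> \<partial>\<mu>)"
proof -
  interpret N: sigma_finite_measure \<nu> by (rule radon_sigma_finite[OF assms(2)])
  have [measurable_cong]: "sets \<mu> = sets borel" "sets \<nu> = sets borel" using assms by (simp_all add: radon_sets)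
  show ?thesis
    unfolding mutual_energy_def riesz_kernel_eq_mix
    by (subst N.nn_integral_fst[symmetric]) auto
qed

lemma mutual_energy_potential:
  assumes "radon (\<mu> :: 'a measure)" "radon \<nu>"
  shows "mutual_energy \<alpha> \<mu> \<nu> = (\<integral>\<^sup>+x. potential \<alpha> \<nu> x \<partial>\<mu>)"
  by (simp add: mutual_energy_eq assms potential_eq)

lemma mutual_energy_commute:
  assumes "radon (\<mu> :: 'a measure)" "radon \<nu>"
  shows "mutual_energy \<alpha> \<mu> \<nu> = mutual_energy \<alpha> \<nu> \<mu>"
proof -
  have [measurable_cong]: "sets \<mu> = sets borel" "sets \<nu> = sets borel" using assms by (simp_all add: radon_sets)
  have "(\<integral>\<^sup>+x. \<integral>\<^sup>+y. mix (\<kappa> 0) x y \<partial>\<nu> \<partial>\<mu>) = (\<integral>\<^sup>+y. \<integral>\<^sup>+x. mix (\<kappa> 0) x y \<partial>\<mu> \<partial>\<nu>)"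
    by (intro nn_integral_swap radon_sigma_finite assms) measurable
  then show ?thesis by (simp add: mutual_energy_eq assms mix_commute)
qed

text \<open>
  By the semigroup law \<open>heat (2 * s) x y\<close> is the inner product of \<open>heat s x\<close> and \<open>heat s y\<close>, and the
  substitution \<open>t = 2 * s\<close> in \<open>mix (\<kappa> 0)\<close> produces the two factors 2.
\<close>

definition SM :: "(real \<times> 'a) measure" where
  "SM = density (halfline \<Otimes>\<^sub>M lborel) (\<lambda>p. ennreal (2 * \<kappa> 0 (2 * fst p)))"

lemma sets_SM [simp, measurable_cong]: "sets SM = sets (borel \<Otimes>\<^sub>M borel)"
  by (simp add: SM_def)

lemma AE_SM_pos: "AE p in SM. 0 < fst p"
proof -
  interpret P: pair_sigma_finite halfline "lborel :: 'a measure" ..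
  have "AE p in halfline \<Otimes>\<^sub>M (lborel :: 'a measure). 0 < fst p"
  proof (rule P.AE_pair_measure)
    show "{p \<in> space (halfline \<Otimes>\<^sub>M (lborel :: 'a measure)). 0 < fst p} \<in> sets (halfline \<Otimes>\<^sub>M lborel)"
      by measurable
    show "AE t in halfline. AE x in (lborel :: 'a measure). 0 < fst (t, x)"
      using AE_halfline by eventually_elim simp
  qed
  then show ?thesis unfolding SM_def by (subst AE_density) auto
qed

lemma nn_integral_SM:
  assumes [measurable]: "f \<in> borel_measurable (borel \<Otimes>\<^sub>M borel)"
  shows "(\<integral>\<^sup>+p. f p \<partial>SM) = (\<integral>\<^sup>+s. \<integral>\<^sup>+z. ennreal (2 * \<kappa> 0 (2 * s)) * f (s, z) \<partial>lborel \<partial>halfline)"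
  unfolding SM_def by (subst nn_integral_density, measurable) (subst lborel.nn_integral_fst[symmetric], auto)

lemma mutual_energy_SM:
  assumes \<mu>: "radon (\<mu> :: 'a measure)" and \<nu>: "radon \<nu>"
  shows "mutual_energy \<alpha> \<mu> \<nu> = (\<integral>\<^sup>+p. hm \<mu> (fst p) (snd p) * hm \<nu> (fst p) (snd p) \<partial>SM)"
proof -
  note [measurable (raw)] = borel_measurable_hm'[OF \<mu>] borel_measurable_hm'[OF \<nu>]
  have [measurable_cong]: "sets \<mu> = sets borel" "sets \<nu> = sets borel" using assms by (simp_all add: radon_sets)
  interpret M: sigma_finite_measure \<mu> by (rule radon_sigma_finite[OF \<mu>])
  interpret N: sigma_finite_measure \<nu> by (rule radon_sigma_finite[OF \<nu>])
  note sf = halfline.sigma_finite_measure_axioms lborel.sigma_finite_measure_axioms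
    M.sigma_finite_measure_axioms N.sigma_finite_measure_axioms
  have kern: "mix (\<kappa> 0) x y = (\<integral>\<^sup>+s. \<integral>\<^sup>+z. ennreal (2 * \<kappa> 0 (2 * s)) * (ennreal (heat s z x) * ennreal (heat s z y)) \<partial>lborel \<partial>halfline)" for x y :: 'a
  proof -
    have "mix (\<kappa> 0) x y = (\<integral>\<^sup>+t. ennreal 2 * (ennreal (\<kappa> 0 (2 * t)) * ennreal (heat (2 * t) x y)) \<partial>halfline)"
      unfolding mix_def by (rule nn_integral_halfline_scale) auto
    also have "\<dots> = (\<integral>\<^sup>+s. \<integral>\<^sup>+z. ennreal (2 * \<kappa> 0 (2 * s)) * (ennreal (heat s z x) * ennreal (heat s z y)) \<partial>lborel \<partial>halfline)"
    proof (rule nn_integral_halfline_cong)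
      fix s :: real assume s: "0 < s"
      have ss: "s + s = 2 * s" by simp
      have "(\<integral>\<^sup>+z. ennreal (2 * \<kappa> 0 (2 * s)) * (ennreal (heat s z x) * ennreal (heat s z y)) \<partial>lborel)
         = ennreal (2 * \<kappa> 0 (2 * s)) * (\<integral>\<^sup>+z. ennreal (heat s x z) * ennreal (heat s z y) \<partial>lborel)"
        by (subst nn_integral_cmult) (auto simp: heat_commute)
      also have "\<dots> = ennreal (2 * \<kappa> 0 (2 * s)) * ennreal (heat (s + s) x y)"
        by (simp add: heat_semigroup[OF s s])
      finally show "ennreal 2 * (ennreal (\<kappa> 0 (2 * s)) * ennreal (heat (2 * s) x y))
         = (\<integral>\<^sup>+z. ennreal (2 * \<kappa> 0 (2 * s)) * (ennreal (heat s z x) * ennreal (heat s z y)) \<partial>lborel)"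
        unfolding ss by (simp add: ennreal_mult mult.assoc)
    qed
    finally show ?thesis .
  qed
  have "(\<integral>\<^sup>+p. hm \<mu> (fst p) (snd p) * hm \<nu> (fst p) (snd p) \<partial>SM)
    = (\<integral>\<^sup>+s. \<integral>\<^sup>+z. ennreal (2 * \<kappa> 0 (2 * s)) * (hm \<mu> s z * hm \<nu> s z) \<partial>lborel \<partial>halfline)"
    by (subst nn_integral_SM, measurable)
  also have "\<dots> = (\<integral>\<^sup>+s. \<integral>\<^sup>+z. \<integral>\<^sup>+x. \<integral>\<^sup>+y. ennreal (2 * \<kappa> 0 (2 * s)) * (ennreal (heat s z x) * ennreal (heat s z y)) \<partial>\<nu> \<partial>\<mu> \<partial>lborel \<partial>halfline)"
    unfolding hm_def by (intro nn_integral_cong nn_integral_mult_split) measurable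
  \<comment> \<open>The swaps move the integrals over \<open>x\<close> and \<open>y\<close> outward
    one place at a time, until the inner pair is the one in \<open>kern\<close>.\<close>
  also have "\<dots> = (\<integral>\<^sup>+s. \<integral>\<^sup>+x. \<integral>\<^sup>+z. \<integral>\<^sup>+y. ennreal (2 * \<kappa> 0 (2 * s)) * (ennreal (heat s z x) * ennreal (heat s z y)) \<partial>\<nu> \<partial>lborel \<partial>\<mu> \<partial>halfline)"
    by (intro nn_integral_cong nn_integral_swap sf) measurable
  also have "\<dots> = (\<integral>\<^sup>+x. \<integral>\<^sup>+s. \<integral>\<^sup>+z. \<integral>\<^sup>+y. ennreal (2 * \<kappa> 0 (2 * s)) * (ennreal (heat s z x) * ennreal (heat s z y)) \<partial>\<nu> \<partial>lborel \<partial>halfline \<partial>\<mu>)"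
    by (intro nn_integral_cong nn_integral_swap sf) measurable
  also have "\<dots> = (\<integral>\<^sup>+x. \<integral>\<^sup>+s. \<integral>\<^sup>+y. \<integral>\<^sup>+z. ennreal (2 * \<kappa> 0 (2 * s)) * (ennreal (heat s z x) * ennreal (heat s z y)) \<partial>lborel \<partial>\<nu> \<partial>halfline \<partial>\<mu>)"
    by (intro nn_integral_cong nn_integral_swap sf) measurable
  also have "\<dots> = (\<integral>\<^sup>+x. \<integral>\<^sup>+y. \<integral>\<^sup>+s. \<integral>\<^sup>+z. ennreal (2 * \<kappa> 0 (2 * s)) * (ennreal (heat s z x) * ennreal (heat s z y)) \<partial>lborel \<partial>halfline \<partial>\<nu> \<partial>\<mu>)"
    by (intro nn_integral_cong nn_integral_swap sf) measurable
  also have "\<dots> = mutual_energy \<alpha> \<mu> \<nu>"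
    by (simp add: mutual_energy_eq[OF \<mu> \<nu>] kern)
  finally show ?thesis ..
qed

lemma E_plus_radon: "\<mu> \<in> E_plus \<alpha> \<Longrightarrow> radon \<mu>"
  by (simp add: E_plus_def)

lemma mutual_energy_CS:
  assumes \<mu>: "radon (\<mu> :: 'a measure)" and \<nu>: "radon \<nu>"
  shows "(mutual_energy \<alpha> \<mu> \<nu>)\<^sup>2 \<le> energy \<alpha> \<mu> * energy \<alpha> \<nu>"
proof -
  note [measurable (raw)] = borel_measurable_hm'[OF \<mu>] borel_measurable_hm'[OF \<nu>]
  show ?thesis
    unfolding energy_def mutual_energy_SM[OF \<mu> \<nu>] mutual_energy_SM[OF \<mu> \<mu>] mutual_energy_SM[OF \<nu> \<nu>]
    using Cauchy_Schwarz_nn_integral[of "\<lambda>p. hm \<mu> (fst p) (snd p)" SM "\<lambda>p. hm \<nu> (fst p) (snd p)"]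
    by (simp add: power2_eq_square)
qed

lemma mutual_energy_finite:
  assumes "\<mu> \<in> E_plus \<alpha>" "\<nu> \<in> E_plus \<alpha>"
  shows "mutual_energy \<alpha> (\<mu> :: 'a measure) \<nu> < \<infinity>"
proof -
  have "(mutual_energy \<alpha> \<mu> \<nu>)\<^sup>2 < \<infinity>"
    using mutual_energy_CS[OF E_plus_radon[OF assms(1)] E_plus_radon[OF assms(2)]] assms
    by (auto simp: E_plus_def ennreal_mult_less_top intro: order_le_less_trans)
  then show ?thesis by (simp add: power_less_top_ennreal)
qed

text \<open>Real values are needed to form differences. Infinite transforms become 0, which for a
  measure of finite energy happens on an \<open>SM\<close>-null set only.\<close>

definition \<Phi> :: "'a measure \<Rightarrow> real \<times> 'a \<Rightarrow> real" where
  "\<Phi> \<mu> p = enn2real (hm \<mu> (fst p) (snd p))"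

lemma \<Phi>_nonneg [simp]: "0 \<le> \<Phi> \<mu> p"
  by (simp add: \<Phi>_def)

lemma borel_measurable_\<Phi>: "radon \<mu> \<Longrightarrow> \<Phi> \<mu> \<in> borel_measurable SM"
  unfolding \<Phi>_def[abs_def] using borel_measurable_hm[of \<mu>] by measurable

lemma AE_hm_finite:
  assumes "\<mu> \<in> E_plus \<alpha>" shows "AE p in SM. hm \<mu> (fst p) (snd p) = ennreal (\<Phi> \<mu> p)"
proof -
  have \<mu>: "radon \<mu>" using assms by (rule E_plus_radon)
  note [measurable (raw)] = borel_measurable_hm'[OF \<mu>]
  have "(\<integral>\<^sup>+p. hm \<mu> (fst p) (snd p) * hm \<mu> (fst p) (snd p) \<partial>SM) < \<infinity>"
    using assms mutual_energy_SM[OF \<mu> \<mu>] by (simp add: E_plus_def energy_def)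
  then have "AE p in SM. hm \<mu> (fst p) (snd p) * hm \<mu> (fst p) (snd p) \<noteq> \<infinity>"
    by (intro nn_integral_PInf_AE) auto
  then show ?thesis
    by eventually_elim (auto simp: \<Phi>_def ennreal_mult_eq_top_iff less_top)
qed

lemma mutual_energy_\<Phi>:
  assumes "\<mu> \<in> E_plus \<alpha>" "\<nu> \<in> E_plus \<alpha>"
  shows "integrable SM (\<lambda>p. \<Phi> \<mu> p * \<Phi> \<nu> p)"
    and "mutual_energy \<alpha> \<mu> \<nu> = ennreal (\<integral>p. \<Phi> \<mu> p * \<Phi> \<nu> p \<partial>SM)"
proof -
  have \<mu>: "radon \<mu>" and \<nu>: "radon \<nu>" using assms by (auto intro: E_plus_radon)
  note [measurable] = borel_measurable_\<Phi>[OF \<mu>] borel_measurable_\<Phi>[OF \<nu>]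
  have eq: "mutual_energy \<alpha> \<mu> \<nu> = (\<integral>\<^sup>+p. ennreal (\<Phi> \<mu> p * \<Phi> \<nu> p) \<partial>SM)"
    unfolding mutual_energy_SM[OF \<mu> \<nu>]
  proof (rule nn_integral_cong_AE)
    show "AE p in SM. hm \<mu> (fst p) (snd p) * hm \<nu> (fst p) (snd p) = ennreal (\<Phi> \<mu> p * \<Phi> \<nu> p)"
      using AE_hm_finite[OF assms(1)] AE_hm_finite[OF assms(2)]
      by eventually_elim (simp add: ennreal_mult)
  qed
  then have "(\<integral>\<^sup>+p. ennreal (\<Phi> \<mu> p * \<Phi> \<nu> p) \<partial>SM) < \<infinity>" using mutual_energy_finite[OF assms] by simp
  then show i: "integrable SM (\<lambda>p. \<Phi> \<mu> p * \<Phi> \<nu> p)"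
    by (intro integrableI_nonneg) auto
  show "mutual_energy \<alpha> \<mu> \<nu> = ennreal (\<integral>p. \<Phi> \<mu> p * \<Phi> \<nu> p \<partial>SM)"
    unfolding eq by (rule nn_integral_eq_integral[OF i]) auto
qed

text \<open>
  \<open>W\<close> is the potential of the Gaussian measure \<open>\<sigma>\<close>.
\<close>

definition W :: "'a \<Rightarrow> ennreal" where
  "W y = (\<integral>\<^sup>+t. ennreal (\<kappa> 0 t) * ennreal (heat (1 + t) 0 y) \<partial>halfline)"

definition \<sigma> :: "'a measure" where "\<sigma> = density lborel (\<lambda>x. ennreal (heat 1 0 x))"

lemma borel_measurable_W [measurable]: "W \<in> borel_measurable borel"
  unfolding W_def[abs_def] by measurable

lemma radon_density_finite:
  assumes [measurable]: "f \<in> borel_measurable borel" and "(\<integral>\<^sup>+x. f x \<partial>lborel) < \<infinity>"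
  shows "radon (density lborel f :: 'a measure)"
proof -
  have "emeasure (density lborel f) K < \<infinity>" if "compact K" for K :: "'a set"
  proof -
    have "emeasure (density lborel f) K = (\<integral>\<^sup>+x. f x * indicator K x \<partial>lborel)"
      using that by (subst emeasure_density) (auto simp: borel_compact)
    also have "\<dots> \<le> (\<integral>\<^sup>+x. f x \<partial>lborel)" by (intro nn_integral_mono) (auto simp: indicator_def)
    finally show ?thesis using assms by simp
  qed
  then show ?thesis by (simp add: radon_def)
qed

lemma radon_\<sigma>: "radon \<sigma>"
  unfolding \<sigma>_def by (rule radon_density_finite) (auto simp: nn_integral_heat)

lemma potential_\<sigma>: "potential \<alpha> \<sigma> y = W y"
proof -
  have "potential \<alpha> \<sigma> y = (\<integral>\<^sup>+x. ennreal (heat 1 0 x) * mix (\<kappa> 0) x y \<partial>lborel)"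
    unfolding potential_eq \<sigma>_def by (subst nn_integral_density) (auto simp: mix_commute)
  also have "\<dots> = W y" unfolding W_def by (rule heat_mix) auto
  finally show ?thesis .
qed

lemma mutual_energy_\<sigma>: "radon \<nu> \<Longrightarrow> mutual_energy \<alpha> \<nu> \<sigma> = (\<integral>\<^sup>+y. W y \<partial>\<nu>)"
  by (simp add: mutual_energy_potential radon_\<sigma> potential_\<sigma>)

text \<open>Bounds the peak of the Gaussian by a value at distance 1, so that the estimate for
  smoothed kernels can be used off the diagonal, where the Riesz kernel is finite.\<close>

lemma heat_origin_le:
  fixes z :: 'a assumes "norm z = 1" "0 < t"
  shows "heat (1 + t) z z \<le> exp 1 * heat (1 + t) 0 z"
proof -
  have "1 \<le> exp 1 * exp (- 1 / (1 + t))" using assms by (simp add: exp_add[symmetric])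
  then show ?thesis using assms mult_right_mono[of 1 "exp 1 * exp (- 1 / (1 + t))" "(pi * (1 + t)) powr (- (real DIM('a) / 2))"]
    by (simp add: heat_def ac_simps)
qed

text \<open>The potential \<open>W\<close> of a measure of mass 1 is integrated against that
  measure, so a bound for \<open>W\<close> suffices. Each Gaussian is largest at its centre, and
  this peak is controlled by the Riesz kernel at distance 1.\<close>

lemma \<sigma>_E_plus: "\<sigma> \<in> E_plus \<alpha>"
proof -
  obtain z :: 'a where z: "norm z = 1" using vector_choose_size[of 1] by auto
  obtain C where C: "0 < C" "\<And>s (x::'a) y. 0 < s \<Longrightarrow>
    (\<integral>\<^sup>+t. ennreal (\<kappa> 0 t) * ennreal (heat (s + t) x y) \<partial>halfline) \<le> ennreal C * riesz_kernel \<alpha> x y"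
    using heat_\<kappa>_le by blast
  have fin: "ennreal C * riesz_kernel \<alpha> 0 z < \<infinity>"
    using z by (auto simp: riesz_kernel_def ennreal_mult_less_top)
  have le: "W y \<le> ennreal (exp 1) * (ennreal C * riesz_kernel \<alpha> 0 z)" for y
  proof -
    have "W y \<le> (\<integral>\<^sup>+t. ennreal (exp 1) * (ennreal (\<kappa> 0 t) * ennreal (heat (1 + t) 0 z)) \<partial>halfline)"
      unfolding W_def
    proof (rule nn_integral_halfline_mono)
      fix t :: real assume t: "0 < t"
      have "heat (1 + t) 0 y \<le> heat (1 + t) z z" using t by (simp add: heat_def)
      also have "\<dots> \<le> exp 1 * heat (1 + t) 0 z" using heat_origin_le[OF z t] .
      finally have "\<kappa> 0 t * heat (1 + t) 0 y \<le> \<kappa> 0 t * (exp 1 * heat (1 + t) 0 z)"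
        by (rule mult_left_mono) simp
      then have "\<kappa> 0 t * heat (1 + t) 0 y \<le> exp 1 * (\<kappa> 0 t * heat (1 + t) 0 z)"
        by (simp add: mult.left_commute)
      then show "ennreal (\<kappa> 0 t) * ennreal (heat (1 + t) 0 y) \<le> ennreal (exp 1) * (ennreal (\<kappa> 0 t) * ennreal (heat (1 + t) 0 z))"
        by (simp add: ennreal_leI flip: ennreal_mult)
    qed
    also have "\<dots> = ennreal (exp 1) * (\<integral>\<^sup>+t. ennreal (\<kappa> 0 t) * ennreal (heat (1 + t) 0 z) \<partial>halfline)"
      by (rule nn_integral_cmult) measurable
    also have "\<dots> \<le> ennreal (exp 1) * (ennreal C * riesz_kernel \<alpha> 0 z)"
      by (intro mult_left_mono C) auto
    finally show ?thesis .
  qed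
  have "energy \<alpha> \<sigma> = (\<integral>\<^sup>+y. W y \<partial>\<sigma>)" unfolding energy_def by (rule mutual_energy_\<sigma>[OF radon_\<sigma>])
  also have "\<dots> \<le> (\<integral>\<^sup>+y. ennreal (exp 1) * (ennreal C * riesz_kernel \<alpha> 0 z) \<partial>\<sigma>)"
    by (intro nn_integral_mono le)
  also have "\<dots> = ennreal (exp 1) * (ennreal C * riesz_kernel \<alpha> 0 z) * emeasure \<sigma> UNIV"
    by (simp add: nn_integral_const \<sigma>_def)
  also have "emeasure \<sigma> UNIV = 1" by (simp add: \<sigma>_def emeasure_density nn_integral_heat)
  finally have "energy \<alpha> \<sigma> < \<infinity>" using fin by (auto simp: ennreal_mult_less_top intro: order_le_less_trans)
  then show ?thesis using radon_\<sigma> by (simp add: E_plus_def)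
qed

text \<open>Turns a bound on energies into a bound on the integrals of one fixed positive function,
  as vague compactness requires.\<close>

lemma nn_integral_W_le:
  assumes "\<nu> \<in> E_plus \<alpha>"
  shows "(\<integral>\<^sup>+y. W y \<partial>\<nu>)\<^sup>2 \<le> energy \<alpha> \<sigma> * energy \<alpha> \<nu>"
  using mutual_energy_CS[OF radon_\<sigma> E_plus_radon[OF assms]]
  by (simp add: mutual_energy_commute[OF radon_\<sigma> E_plus_radon[OF assms]] mutual_energy_\<sigma>[OF E_plus_radon[OF assms]])

lemma nn_integral_W_finite: "\<nu> \<in> E_plus \<alpha> \<Longrightarrow> (\<integral>\<^sup>+y. W y \<partial>\<nu>) < \<infinity>"
  using mutual_energy_finite[OF _ \<sigma>_E_plus] by (simp add: mutual_energy_\<sigma> E_plus_radon)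

text \<open>Times between \<open>R\<close> and \<open>2 * R\<close>, for
  \<open>R = 1 + (norm y)\<^sup>2\<close>, are long enough for the Gaussian factor to be bounded
  below. They give decay like \<open>R powr (\<beta> - m)\<close>, which is then weakened to a
  natural exponent.\<close>

lemma W_lower:
  obtains c where "0 < c" "\<And>y. ennreal (c / (1 + (norm y)\<^sup>2) ^ DIM('a)) \<le> W y"
proof
  define c where "c = c\<^sub>0 * 2 powr (\<beta> - 1) * ((3 * pi) powr (- m) * exp (- 1))"
  show "0 < c" using c\<^sub>0_pos by (simp add: c_def)
  fix y :: 'a
  define R where "R = 1 + (norm y)\<^sup>2"
  have R: "1 \<le> R" by (simp add: R_def)
  have "c / R ^ DIM('a) \<le> c * R powr (\<beta> - 1) * R powr (- m) * R"
  proof -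
    have "1 / R ^ DIM('a) = R powr (- real DIM('a))" using R by (simp add: powr_minus_divide powr_realpow)
    also have "\<dots> \<le> R powr (\<beta> - 1 + - m + 1)" using R \<beta> by (intro powr_mono) (auto simp: m_def)
    also have "\<dots> = R powr (\<beta> - 1) * R powr (- m) * R" using R by (simp only: powr_add) simp
    finally show ?thesis using \<open>0 < c\<close> mult_left_mono[of "1 / R ^ DIM('a)" "R powr (\<beta> - 1) * R powr (- m) * R" c]
      by (simp add: mult.assoc)
  qed
  then have "ennreal (c / R ^ DIM('a)) \<le> ennreal (c * R powr (\<beta> - 1) * R powr (- m) * R)" by (rule ennreal_leI)
  also have "\<dots> = (\<integral>\<^sup>+t. ennreal (c * R powr (\<beta> - 1) * R powr (- m)) * indicator {R..2 * R} t \<partial>lborel)"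
    using \<open>0 < c\<close> R by (simp add: nn_integral_cmult_indicator flip: ennreal_mult)
  also have "\<dots> = (\<integral>\<^sup>+t. ennreal (c * R powr (\<beta> - 1) * R powr (- m)) * indicator {R..2 * R} t \<partial>halfline)"
    using R by (subst nn_integral_halfline) (auto intro!: nn_integral_cong simp: indicator_def)
  also have "\<dots> \<le> W y"
    unfolding W_def
  proof (rule nn_integral_halfline_mono)
    fix t :: real assume t: "0 < t"
    show "ennreal (c * R powr (\<beta> - 1) * R powr (- m)) * indicator {R..2 * R} t \<le> ennreal (\<kappa> 0 t) * ennreal (heat (1 + t) 0 y)"
    proof (cases "t \<in> {R..2 * R}")
      case True
      have 1: "c\<^sub>0 * (2 powr (\<beta> - 1) * R powr (\<beta> - 1)) \<le> \<kappa> 0 t"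
        unfolding \<kappa>_def powr_mult[symmetric] using True t \<beta> c\<^sub>0_pos R by (auto intro!: mult_left_mono powr_mono2')
      have "(norm y)\<^sup>2 / (1 + t) \<le> 1" using True t by (simp add: R_def)
      then have e: "exp (- 1) \<le> exp (- (norm (0 - y))\<^sup>2 / (1 + t))" by simp
      have "((3 * pi) * R) powr (- m) \<le> (pi * (1 + t)) powr (- m)"
        using True R m t by (intro powr_mono2') (auto simp: mult.commute)
      then have 2: "((3 * pi) powr (- m) * R powr (- m)) * exp (- 1) \<le> heat (1 + t) 0 y"
        unfolding heat_def m_def[symmetric] powr_mult[symmetric]
        using e by (intro mult_mono) auto
      have "c\<^sub>0 * (2 powr (\<beta> - 1) * R powr (\<beta> - 1)) * (((3 * pi) powr (- m) * R powr (- m)) * exp (- 1)) \<le> \<kappa> 0 t * heat (1 + t) 0 y"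
        using 1 2 c\<^sub>0_pos by (intro mult_mono) auto
      then have "c * R powr (\<beta> - 1) * R powr (- m) \<le> \<kappa> 0 t * heat (1 + t) 0 y"
        by (simp add: c_def ac_simps)
      then show ?thesis using True by (simp add: ennreal_leI flip: ennreal_mult)
    qed simp
  qed
  finally show "ennreal (c / (1 + (norm y)\<^sup>2) ^ DIM('a)) \<le> W y" by (simp add: R_def)
qed

text \<open>Gaussian decay beats the polynomial lower bound of \<open>W\<close>; hence a finite
  integral of \<open>W\<close> makes all heat transforms at positive times finite.\<close>

lemma heat_le_W:
  fixes z :: 'a assumes s: "0 < s"
  obtains C where "0 < C" "\<And>y. ennreal (heat s z y) \<le> ennreal C * W y"
proof -
  obtain c where c: "0 < c" "\<And>y. ennreal (c / (1 + (norm y)\<^sup>2) ^ DIM('a)) \<le> W y" using W_lower by blast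
  obtain C where C: "0 < C" "\<And>y. heat s z y \<le> C / (1 + (norm y)\<^sup>2) ^ DIM('a)" using heat_le_power[OF s] by blast
  show ?thesis
  proof (rule that)
    show "0 < C / c" using c C by simp
    fix y
    have "ennreal (heat s z y) \<le> ennreal (C / c * (c / (1 + (norm y)\<^sup>2) ^ DIM('a)))"
      using C(2)[of y] c by (intro ennreal_leI) simp
    also have "\<dots> = ennreal (C / c) * ennreal (c / (1 + (norm y)\<^sup>2) ^ DIM('a))"
      using c C by (intro ennreal_mult) auto
    also have "\<dots> \<le> ennreal (C / c) * W y" by (intro mult_left_mono c) auto
    finally show "ennreal (heat s z y) \<le> ennreal (C / c) * W y" .
  qed
qed

end

section \<open>Measures are determined by their mutual energies\<close>

lemma heat_lower:
  fixes x :: "'a::euclidean_space"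
  assumes "norm x \<le> r" shows "pi powr (- (real DIM('a) / 2)) * exp (- r\<^sup>2) \<le> heat 1 0 x"
proof -
  have "(norm x)\<^sup>2 \<le> r\<^sup>2" using assms by (intro power_mono) auto
  then show ?thesis by (simp add: heat_def)
qed

lemma nn_integral_heat_tendsto:
  fixes f :: "'a::euclidean_space \<Rightarrow> real"
  assumes f: "continuous_on UNIV f" and b: "\<And>x. 0 \<le> f x" "\<And>x. f x \<le> B"
    and s: "\<And>n. 0 < s n" "s \<longlonglongrightarrow> 0"
  shows "(\<lambda>n. \<integral>\<^sup>+z. ennreal (heat (s n) y z) * ennreal (f z) \<partial>lborel) \<longlonglongrightarrow> ennreal (f y)"
proof -
  have [measurable]: "f \<in> borel_measurable borel" using f by (rule borel_measurable_continuous_onI)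
  have eq: "(\<integral>\<^sup>+z. ennreal (heat (s n) y z) * ennreal (f z) \<partial>lborel)
      = (\<integral>\<^sup>+z. ennreal (heat 1 0 z) * ennreal (f (y + sqrt (s n) *\<^sub>R z)) \<partial>lborel)" for n
    by (rule nn_integral_heat_affine[OF _ s(1)]) simp
  have "(\<lambda>n. \<integral>\<^sup>+z. ennreal (heat 1 0 z) * ennreal (f (y + sqrt (s n) *\<^sub>R z)) \<partial>lborel)
      \<longlonglongrightarrow> (\<integral>\<^sup>+z. ennreal (heat 1 0 (z::'a)) * ennreal (f y) \<partial>lborel)"
  proof (rule nn_integral_dominated_convergence[where w="\<lambda>z. ennreal B * ennreal (heat 1 0 (z::'a))"])
    show "AE z in lborel. ennreal (heat 1 0 z) * ennreal (f (y + sqrt (s j) *\<^sub>R z)) \<le> ennreal B * ennreal (heat 1 0 z)" for j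
    proof (intro AE_I2)
      fix z :: 'a
      have "ennreal (heat 1 0 z) * ennreal (f (y + sqrt (s j) *\<^sub>R z)) \<le> ennreal (heat 1 0 z) * ennreal B"
        by (intro mult_left_mono ennreal_leI b) simp
      then show "ennreal (heat 1 0 z) * ennreal (f (y + sqrt (s j) *\<^sub>R z)) \<le> ennreal B * ennreal (heat 1 0 z)"
        by (simp only: mult.commute)
    qed
    show "(\<integral>\<^sup>+z. ennreal B * ennreal (heat 1 0 (z::'a)) \<partial>lborel) < \<infinity>"
      by (subst nn_integral_cmult) (auto simp: nn_integral_heat)
    show "AE z in lborel. (\<lambda>i. ennreal (heat 1 0 z) * ennreal (f (y + sqrt (s i) *\<^sub>R z))) \<longlonglongrightarrow> ennreal (heat 1 0 z) * ennreal (f y)"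
    proof (intro AE_I2 ennreal_tendsto_cmult tendsto_ennrealI)
      fix z :: 'a
      have "(\<lambda>i. y + sqrt (s i) *\<^sub>R z) \<longlonglongrightarrow> y + sqrt 0 *\<^sub>R z"
        by (intro tendsto_intros s)
      then have "(\<lambda>i. y + sqrt (s i) *\<^sub>R z) \<longlonglongrightarrow> y" by simp
      moreover have "isCont f y" using f by (simp add: continuous_on_eq_continuous_at)
      ultimately show "(\<lambda>i. f (y + sqrt (s i) *\<^sub>R z)) \<longlonglongrightarrow> f y" by (rule isCont_tendsto_compose[rotated])
    qed simp
  qed measurable
  also have "(\<integral>\<^sup>+z. ennreal (heat 1 0 (z::'a)) * ennreal (f y) \<partial>lborel) = ennreal (f y)"
    by (subst nn_integral_multc) (auto simp: nn_integral_heat)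
  finally show ?thesis unfolding eq .
qed

section \<open>Recovery of a measure from its energies\<close>

context riesz begin

lemma potential_density:
  assumes [measurable]: "g \<in> borel_measurable borel"
  shows "potential \<alpha> (density lborel g) (x::'a) = (\<integral>\<^sup>+y. mix (\<kappa> 0) x y * g y \<partial>lborel)"
  unfolding potential_eq by (subst nn_integral_density) (auto simp: mult.commute)

lemma mutual_energy_density:
  assumes "g \<in> borel_measurable borel" "radon (density lborel g :: 'a measure)"
    and \<nu>: "radon \<nu>"
  shows "mutual_energy \<alpha> (density lborel g) \<nu> = (\<integral>\<^sup>+x. g x * potential \<alpha> \<nu> x \<partial>lborel)"
proof -
  have "potential \<alpha> \<nu> \<in> borel_measurable (borel :: 'a measure)"
    unfolding potential_eq[abs_def] by (rule borel_measurable_nn_integral_radon[OF \<nu>]) measurable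
  then show ?thesis using assms by (simp add: mutual_energy_potential nn_integral_density)
qed

text \<open>
  The potential of the signed measure with density \<open>f - qf \<rho> f\<close> is the smoothing of \<open>f\<close> by
  \<open>mix (hw \<rho> 0)\<close>, which after division by \<open>H 0 \<rho>\<close> approximates \<open>f\<close> itself.
\<close>

definition qf :: "real \<Rightarrow> ('a \<Rightarrow> real) \<Rightarrow> 'a \<Rightarrow> ennreal" where
  "qf \<rho> f x = (\<integral>\<^sup>+z. mix (\<theta> \<rho> 0) x z * ennreal (f z) \<partial>lborel)"

lemma potential_qf:
  assumes [measurable]: "f \<in> borel_measurable borel" and \<rho>: "0 < \<rho>"
  shows "potential \<alpha> (density lborel f) (x::'a)
    = (\<integral>\<^sup>+z. mix (hw \<rho> 0) x z * ennreal (f z) \<partial>lborel) + potential \<alpha> (density lborel (qf \<rho> f)) x"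
proof -
  have "potential \<alpha> (density lborel (qf \<rho> f)) x = (\<integral>\<^sup>+y. mix (\<kappa> 0) x y * (\<integral>\<^sup>+z. mix (\<theta> \<rho> 0) y z * ennreal (f z) \<partial>lborel) \<partial>lborel)"
    unfolding qf_def[abs_def] by (rule potential_density) measurable
  also have "\<dots> = (\<integral>\<^sup>+y. \<integral>\<^sup>+z. mix (\<theta> \<rho> 0) z y * mix (\<kappa> 0) y x * ennreal (f z) \<partial>lborel \<partial>lborel)"
    by (intro nn_integral_cong, subst nn_integral_cmult[symmetric], measurable)
      (simp add: mix_commute[of _ x] mix_commute[of "\<theta> \<rho> 0"] ac_simps)
  also have "\<dots> = (\<integral>\<^sup>+z. \<integral>\<^sup>+y. mix (\<theta> \<rho> 0) z y * mix (\<kappa> 0) y x * ennreal (f z) \<partial>lborel \<partial>lborel)"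
    by (intro nn_integral_swap lborel.sigma_finite_measure_axioms) measurable
  also have "\<dots> = (\<integral>\<^sup>+z. (\<integral>\<^sup>+y. mix (\<theta> \<rho> 0) z y * mix (\<kappa> 0) y x \<partial>lborel) * ennreal (f z) \<partial>lborel)"
    by (intro nn_integral_cong nn_integral_multc) measurable
  finally have q: "potential \<alpha> (density lborel (qf \<rho> f)) x = (\<integral>\<^sup>+z. (\<integral>\<^sup>+y. mix (\<theta> \<rho> 0) z y * mix (\<kappa> 0) y x \<partial>lborel) * ennreal (f z) \<partial>lborel)" .
  have "potential \<alpha> (density lborel f) x = (\<integral>\<^sup>+z. mix (\<kappa> 0) z x * ennreal (f z) \<partial>lborel)"
    by (subst potential_density) (auto simp: mix_commute)
  also have "\<dots> = (\<integral>\<^sup>+z. mix (hw \<rho> 0) z x * ennreal (f z) + (\<integral>\<^sup>+y. mix (\<theta> \<rho> 0) z y * mix (\<kappa> 0) y x \<partial>lborel) * ennreal (f z) \<partial>lborel)"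
    by (intro nn_integral_cong) (subst mix_\<kappa>_eq[OF \<rho>], simp only: distrib_right)
  also have "\<dots> = (\<integral>\<^sup>+z. mix (hw \<rho> 0) z x * ennreal (f z) \<partial>lborel) + potential \<alpha> (density lborel (qf \<rho> f)) x"
    unfolding q by (intro nn_integral_add) measurable
  finally show ?thesis by (simp add: mix_commute)
qed

text \<open>Written as an integral over time, the smoothing has the form to which
  \<open>approx_identity\<close> applies, the inner double integral being the function of
  time.\<close>

lemma nn_integral_hw_halfline:
  fixes f :: "'a \<Rightarrow> real"
  assumes [measurable]: "f \<in> borel_measurable borel" "w \<in> borel_measurable borel" and \<nu>: "radon \<nu>"
  shows "(\<integral>\<^sup>+y. \<integral>\<^sup>+z. mix w y z * ennreal (f z) \<partial>lborel \<partial>\<nu>)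
    = (\<integral>\<^sup>+t. ennreal (w t) * (\<integral>\<^sup>+y. \<integral>\<^sup>+z. ennreal (heat t y z) * ennreal (f z) \<partial>lborel \<partial>\<nu>) \<partial>halfline)"
proof -
  have [measurable_cong]: "sets \<nu> = sets borel" using \<nu> by (simp add: radon_sets)
  interpret N: sigma_finite_measure \<nu> by (rule radon_sigma_finite[OF \<nu>])
  have "(\<integral>\<^sup>+y. \<integral>\<^sup>+z. mix w y z * ennreal (f z) \<partial>lborel \<partial>\<nu>)
    = (\<integral>\<^sup>+y. \<integral>\<^sup>+z. \<integral>\<^sup>+t. ennreal (w t) * (ennreal (heat t y z) * ennreal (f z)) \<partial>halfline \<partial>lborel \<partial>\<nu>)"
    unfolding mix_def by (intro nn_integral_cong, subst nn_integral_multc[symmetric], measurable) (simp add: mult.assoc)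
  also have "\<dots> = (\<integral>\<^sup>+y. \<integral>\<^sup>+t. \<integral>\<^sup>+z. ennreal (w t) * (ennreal (heat t y z) * ennreal (f z)) \<partial>lborel \<partial>halfline \<partial>\<nu>)"
    by (intro nn_integral_cong nn_integral_swap lborel.sigma_finite_measure_axioms halfline.sigma_finite_measure_axioms) measurable
  also have "\<dots> = (\<integral>\<^sup>+t. \<integral>\<^sup>+y. \<integral>\<^sup>+z. ennreal (w t) * (ennreal (heat t y z) * ennreal (f z)) \<partial>lborel \<partial>\<nu> \<partial>halfline)"
    by (intro nn_integral_swap N.sigma_finite_measure_axioms halfline.sigma_finite_measure_axioms) measurable
  also have "\<dots> = (\<integral>\<^sup>+t. ennreal (w t) * (\<integral>\<^sup>+y. \<integral>\<^sup>+z. ennreal (heat t y z) * ennreal (f z) \<partial>lborel \<partial>\<nu>) \<partial>halfline)"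
  proof (intro nn_integral_cong)
    fix t
    have "(\<integral>\<^sup>+y. \<integral>\<^sup>+z. ennreal (w t) * (ennreal (heat t y z) * ennreal (f z)) \<partial>lborel \<partial>\<nu>)
       = (\<integral>\<^sup>+y. ennreal (w t) * (\<integral>\<^sup>+z. ennreal (heat t y z) * ennreal (f z) \<partial>lborel) \<partial>\<nu>)"
      by (intro nn_integral_cong nn_integral_cmult) measurable
    also have "\<dots> = ennreal (w t) * (\<integral>\<^sup>+y. \<integral>\<^sup>+z. ennreal (heat t y z) * ennreal (f z) \<partial>lborel \<partial>\<nu>)"
      by (intro nn_integral_cmult) measurable
    finally show "(\<integral>\<^sup>+y. \<integral>\<^sup>+z. ennreal (w t) * (ennreal (heat t y z) * ennreal (f z)) \<partial>lborel \<partial>\<nu>)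
       = ennreal (w t) * (\<integral>\<^sup>+y. \<integral>\<^sup>+z. ennreal (heat t y z) * ennreal (f z) \<partial>lborel \<partial>\<nu>)" .
  qed
  finally show ?thesis .
qed

text \<open>The Gaussian bound on \<open>f\<close> keeps its heat averages over times below 1 under
  a multiple of \<open>W\<close>, which is integrable by assumption even if \<nu> has infinite
  energy.\<close>

lemma heat_smoothing_tendsto:
  fixes f :: "'a \<Rightarrow> real"
  assumes f: "continuous_on UNIV f" and b: "\<And>x. 0 \<le> f x" "\<And>x. f x \<le> M * heat 1 0 x" and M: "0 \<le> M"
    and \<nu>: "radon \<nu>" "(\<integral>\<^sup>+y. W y \<partial>\<nu>) < \<infinity>"
  shows "((\<lambda>t. \<integral>\<^sup>+y. \<integral>\<^sup>+z. ennreal (heat t y z) * ennreal (f z) \<partial>lborel \<partial>\<nu>) \<longlongrightarrow> (\<integral>\<^sup>+y. ennreal (f y) \<partial>\<nu>)) (at_right 0)"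
proof (rule tendsto_at_right_sequentially[where b=1])
  fix s :: "nat \<Rightarrow> real" assume s: "\<And>n. 0 < s n" "\<And>n. s n < 1" "s \<longlonglongrightarrow> 0"
  have [measurable]: "f \<in> borel_measurable borel" using f by (rule borel_measurable_continuous_onI)
  have [measurable_cong]: "sets \<nu> = sets borel" using \<nu> by (simp add: radon_sets)
  obtain C where C: "0 < C" "\<And>y. ennreal (heat 2 0 y) \<le> ennreal C * W y" using heat_le_W[of 2 0] by auto
  \<comment> \<open>\<open>M\<close> comes from the bound on \<open>f\<close>, and
    \<open>2 powr m\<close> is the price of replacing the times \<open>t + 1\<close>, with
    \<open>t < 1\<close>, by the single time 2.\<close>
  define D where "D = M * 2 powr m"
  have D: "0 \<le> D" using M by (simp add: D_def)
  have B: "f x \<le> M * pi powr (- m)" for x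
  proof -
    have "heat 1 0 x \<le> pi powr (- m)" by (simp add: heat_def m_def)
    then show ?thesis using b(2)[of x] M mult_left_mono[of "heat 1 0 x" "pi powr (- m)" M] by simp
  qed
  have dom: "(\<integral>\<^sup>+z. ennreal (heat t y z) * ennreal (f z) \<partial>lborel) \<le> ennreal D * (ennreal C * W y)" if t: "0 < t" "t < 1" for t y
  proof -
    have "(\<integral>\<^sup>+z. ennreal (heat t y z) * ennreal (f z) \<partial>lborel) \<le> (\<integral>\<^sup>+z. ennreal M * (ennreal (heat t y z) * ennreal (heat 1 z 0)) \<partial>lborel)"
    proof (intro nn_integral_mono)
      fix z
      have "heat t y z * f z \<le> heat t y z * (M * heat 1 z 0)" using b(2)[of z] by (intro mult_left_mono) (auto simp: heat_commute)
      then have "heat t y z * f z \<le> M * (heat t y z * heat 1 z 0)" by (simp add: mult.left_commute)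
      then show "ennreal (heat t y z) * ennreal (f z) \<le> ennreal M * (ennreal (heat t y z) * ennreal (heat 1 z 0))"
        using M b by (simp add: ennreal_leI flip: ennreal_mult)
    qed
    also have "\<dots> = ennreal M * ennreal (heat (t + 1) y 0)"
      using t by (subst nn_integral_cmult) (auto simp: heat_semigroup)
    also have "\<dots> \<le> ennreal D * ennreal (heat 2 0 y)"
    proof -
      have "heat (t + 1) y 0 \<le> 2 powr m * heat 2 y 0" unfolding m_def using t by (intro heat_le_heat) auto
      then have "M * heat (t + 1) y 0 \<le> M * (2 powr m * heat 2 0 y)" using M by (simp add: mult_left_mono heat_commute)
      then show ?thesis using M D by (simp add: D_def ennreal_leI mult.assoc flip: ennreal_mult)
    qed
    also have "\<dots> \<le> ennreal D * (ennreal C * W y)" by (intro mult_left_mono C) auto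
    finally show ?thesis .
  qed
  show "(\<lambda>n. \<integral>\<^sup>+y. \<integral>\<^sup>+z. ennreal (heat (s n) y z) * ennreal (f z) \<partial>lborel \<partial>\<nu>) \<longlonglongrightarrow> (\<integral>\<^sup>+y. ennreal (f y) \<partial>\<nu>)"
  proof (rule nn_integral_dominated_convergence[where w="\<lambda>y. ennreal D * (ennreal C * W y)"])
    show "AE y in \<nu>. (\<integral>\<^sup>+z. ennreal (heat (s j) y z) * ennreal (f z) \<partial>lborel) \<le> ennreal D * (ennreal C * W y)" for j
      using dom s by auto
    show "(\<integral>\<^sup>+y. ennreal D * (ennreal C * W y) \<partial>\<nu>) < \<infinity>"
      using \<nu> by (subst nn_integral_cmult, measurable, subst nn_integral_cmult, measurable) (auto simp: ennreal_mult_less_top)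
    show "AE y in \<nu>. (\<lambda>i. \<integral>\<^sup>+z. ennreal (heat (s i) y z) * ennreal (f z) \<partial>lborel) \<longlonglongrightarrow> ennreal (f y)"
      by (intro AE_I2 nn_integral_heat_tendsto[OF f b(1) B s(1) s(3)])
  qed measurable
qed simp

lemma density_E_plus:
  assumes [measurable]: "f \<in> borel_measurable borel" and b: "\<And>x::'a. 0 \<le> f x" "\<And>x. f x \<le> M * heat 1 0 x" and M: "0 \<le> M"
  shows "density lborel f \<in> E_plus \<alpha>" "potential \<alpha> (density lborel f) x \<le> ennreal M * W x"
    "(\<integral>\<^sup>+x. ennreal (f x) \<partial>lborel) < \<infinity>"
proof -
  have le: "ennreal (f x) \<le> ennreal M * ennreal (heat 1 0 x)" for x
    using b(2)[of x] M by (simp add: ennreal_leI flip: ennreal_mult)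
  have "(\<integral>\<^sup>+x. ennreal (f x) \<partial>lborel) \<le> (\<integral>\<^sup>+x. ennreal M * ennreal (heat 1 0 (x::'a)) \<partial>lborel)"
    by (intro nn_integral_mono le)
  also have "\<dots> < \<infinity>" by (subst nn_integral_cmult) (auto simp: nn_integral_heat)
  finally show fin: "(\<integral>\<^sup>+x. ennreal (f x) \<partial>lborel) < \<infinity>" .
  have rad: "radon (density lborel f :: 'a measure)" by (rule radon_density_finite[OF _ fin]) simp
  have pot: "potential \<alpha> (density lborel f) x \<le> ennreal M * W x" for x
  proof -
    have "potential \<alpha> (density lborel f) x \<le> (\<integral>\<^sup>+y. ennreal M * (ennreal (heat 1 0 y) * mix (\<kappa> 0) y x) \<partial>lborel)"
    proof (subst potential_density, simp, rule nn_integral_mono)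
      fix y
      have "mix (\<kappa> 0) y x * ennreal (f y) \<le> mix (\<kappa> 0) y x * (ennreal M * ennreal (heat 1 0 y))"
        by (intro mult_left_mono le) simp
      then show "mix (\<kappa> 0) x y * ennreal (f y) \<le> ennreal M * (ennreal (heat 1 0 y) * mix (\<kappa> 0) y x)"
        by (simp only: mix_commute[of _ x y] ac_simps)
    qed
    also have "\<dots> = ennreal M * W x" by (subst nn_integral_cmult) (auto simp: heat_mix W_def)
    finally show ?thesis .
  qed
  show "potential \<alpha> (density lborel f) x \<le> ennreal M * W x" by (rule pot)
  have "energy \<alpha> (density lborel f) = (\<integral>\<^sup>+x. ennreal (f x) * potential \<alpha> (density lborel f) x \<partial>lborel)"
    unfolding energy_def using rad by (intro mutual_energy_density) auto
  also have "\<dots> \<le> (\<integral>\<^sup>+x. (ennreal M * ennreal (heat 1 0 x)) * (ennreal M * W x) \<partial>lborel)"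
    by (intro nn_integral_mono mult_mono le pot) auto
  also have "\<dots> = ennreal M * ennreal M * (\<integral>\<^sup>+x. W x \<partial>\<sigma>)"
    unfolding \<sigma>_def by (subst nn_integral_density, measurable, subst nn_integral_cmult[symmetric], measurable) (simp add: ac_simps)
  also have "\<dots> < \<infinity>" using nn_integral_W_finite[OF \<sigma>_E_plus] by (auto simp: ennreal_mult_less_top)
  finally show "density lborel f \<in> E_plus \<alpha>" using rad by (simp add: E_plus_def)
qed

text \<open>No Gaussian bound is available for \<open>qf \<rho> f\<close>. Its potential is at most
  that of \<open>f\<close>, and this is used in each of the two variables, with the symmetry of the
  mutual energy in between.\<close>

lemma qf_E_plus:
  assumes [measurable]: "f \<in> borel_measurable borel" and b: "\<And>x::'a. 0 \<le> f x" "\<And>x. f x \<le> M * heat 1 0 x" and M: "0 \<le> M"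
    and \<rho>: "0 < \<rho>"
  shows "density lborel (qf \<rho> f) \<in> E_plus \<alpha>"
proof -
  note D = density_E_plus[of f, OF _ b M]
  have [measurable]: "qf \<rho> f \<in> borel_measurable borel" unfolding qf_def[abs_def] by measurable
  have "(\<integral>\<^sup>+x. qf \<rho> f x \<partial>lborel) = (\<integral>\<^sup>+z. \<integral>\<^sup>+x. mix (\<theta> \<rho> 0) x z * ennreal (f z) \<partial>lborel \<partial>lborel)"
    unfolding qf_def by (intro nn_integral_swap lborel.sigma_finite_measure_axioms) measurable
  also have "\<dots> = (\<integral>\<^sup>+z. \<integral>\<^sup>+x. mix (\<theta> \<rho> 0) z x * ennreal (f z) \<partial>lborel \<partial>lborel)"
    by (intro nn_integral_cong) (simp add: mix_commute)
  also have "\<dots> = (\<integral>\<^sup>+z. (\<integral>\<^sup>+x. mix (\<theta> \<rho> 0) z x \<partial>lborel) * ennreal (f z) \<partial>lborel)"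
    by (intro nn_integral_cong nn_integral_multc) measurable
  also have "\<dots> \<le> (\<integral>\<^sup>+z. 1 * ennreal (f z) \<partial>lborel)"
    using \<rho> by (intro nn_integral_mono mult_right_mono nn_integral_mix_\<theta>_le) auto
  finally have "(\<integral>\<^sup>+x. qf \<rho> f x \<partial>lborel) < \<infinity>" using D(3) by (simp add: order_le_less_trans)
  then have rad: "radon (density lborel (qf \<rho> f))" by (intro radon_density_finite) auto
  have radf: "radon (density lborel f)" using D(1) by (simp add: E_plus_radon)
  have le: "potential \<alpha> (density lborel (qf \<rho> f)) x \<le> potential \<alpha> (density lborel f) x" for x
    using potential_qf[of f \<rho> x] \<rho> by (simp add: add_increasing)
  have "energy \<alpha> (density lborel (qf \<rho> f)) = (\<integral>\<^sup>+x. qf \<rho> f x * potential \<alpha> (density lborel (qf \<rho> f)) x \<partial>lborel)"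
    unfolding energy_def using rad by (intro mutual_energy_density) auto
  also have "\<dots> \<le> (\<integral>\<^sup>+x. qf \<rho> f x * potential \<alpha> (density lborel f) x \<partial>lborel)"
    by (intro nn_integral_mono mult_left_mono le) auto
  also have "\<dots> = mutual_energy \<alpha> (density lborel (qf \<rho> f)) (density lborel f)"
    using rad radf by (intro mutual_energy_density[symmetric]) auto
  also have "\<dots> = mutual_energy \<alpha> (density lborel f) (density lborel (qf \<rho> f))"
    by (rule mutual_energy_commute[OF rad radf])
  also have "\<dots> = (\<integral>\<^sup>+x. ennreal (f x) * potential \<alpha> (density lborel (qf \<rho> f)) x \<partial>lborel)"
    using rad radf by (intro mutual_energy_density) auto
  also have "\<dots> \<le> (\<integral>\<^sup>+x. ennreal (f x) * potential \<alpha> (density lborel f) x \<partial>lborel)"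
    by (intro nn_integral_mono mult_left_mono le) auto
  also have "\<dots> = energy \<alpha> (density lborel f)"
    unfolding energy_def using radf by (intro mutual_energy_density[symmetric]) auto
  also have "\<dots> < \<infinity>" using D(1) by (simp add: E_plus_def)
  finally show ?thesis using rad by (simp add: E_plus_def)
qed

text \<open>The energies with the densities \<open>f\<close> and \<open>qf \<rho> f\<close> are
  prescribed, and their difference divided by \<open>H 0 \<rho>\<close> tends to the integral of
  \<open>f\<close>. Finite integrals of \<open>W\<close> make the difference legitimate; no finite
  energy of the two measures is assumed.\<close>

lemma nn_integral_determined:
  fixes f :: "'a \<Rightarrow> real"
  assumes f: "continuous_on UNIV f" and b: "\<And>x. 0 \<le> f x" "\<And>x. f x \<le> M * heat 1 0 x" and M: "0 \<le> M"
    and \<nu>\<^sub>1: "radon \<nu>\<^sub>1" "(\<integral>\<^sup>+y. W y \<partial>\<nu>\<^sub>1) < \<infinity>" and \<nu>\<^sub>2: "radon \<nu>\<^sub>2"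
    and eq: "\<And>l. l \<in> E_plus \<alpha> \<Longrightarrow> mutual_energy \<alpha> \<nu>\<^sub>1 l = mutual_energy \<alpha> \<nu>\<^sub>2 l"
  shows "(\<integral>\<^sup>+y. ennreal (f y) \<partial>\<nu>\<^sub>1) = (\<integral>\<^sup>+y. ennreal (f y) \<partial>\<nu>\<^sub>2)"
proof -
  have f_m [measurable]: "f \<in> borel_measurable borel" using f by (rule borel_measurable_continuous_onI)
  \<comment> \<open>Testing the hypothesis with \<sigma> transfers finiteness from
    \<open>\<nu>\<^sub>1\<close> to \<open>\<nu>\<^sub>2\<close>.\<close>
  have W2: "(\<integral>\<^sup>+y. W y \<partial>\<nu>\<^sub>2) < \<infinity>" using eq[OF \<sigma>_E_plus] \<nu>\<^sub>1 \<nu>\<^sub>2 by (simp add: mutual_energy_\<sigma>)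
  define J where "J = (\<lambda>\<nu> t. \<integral>\<^sup>+y. \<integral>\<^sup>+z. ennreal (heat t y z) * ennreal (f z) \<partial>lborel \<partial>(\<nu> :: 'a measure))"
  note D = density_E_plus[of f, OF f_m b M]
  have gen: "((\<lambda>\<rho>. (mutual_energy \<alpha> \<nu> (density lborel f) - mutual_energy \<alpha> \<nu> (density lborel (qf \<rho> f))) / H 0 \<rho>) \<longlongrightarrow> (\<integral>\<^sup>+y. ennreal (f y) \<partial>\<nu>)) (at_right 0)"
    if \<nu>: "radon \<nu>" "(\<integral>\<^sup>+y. W y \<partial>\<nu>) < \<infinity>" for \<nu>
  proof -
    have [measurable_cong]: "sets \<nu> = sets borel" using \<nu> by (simp add: radon_sets)
    interpret N: sigma_finite_measure \<nu> by (rule radon_sigma_finite[OF \<nu>(1)])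
    have pot: "mutual_energy \<alpha> \<nu> (density lborel f) = (\<integral>\<^sup>+t. ennreal (\<kappa> 0 t) * J \<nu> t \<partial>halfline)"
      using \<nu> D(1) unfolding J_def
      by (subst nn_integral_hw_halfline[symmetric]) (auto simp: mutual_energy_potential E_plus_radon potential_density)
    have "mutual_energy \<alpha> \<nu> (density lborel f) \<le> (\<integral>\<^sup>+y. ennreal M * W y \<partial>\<nu>)"
      using \<nu> D(1) by (simp add: mutual_energy_potential E_plus_radon nn_integral_mono D(2))
    also have "\<dots> < \<infinity>" using \<nu> by (subst nn_integral_cmult) (auto simp: ennreal_mult_less_top)
    finally have fin: "mutual_energy \<alpha> \<nu> (density lborel f) < \<infinity>" .
    have Jm: "J \<nu> \<in> borel_measurable borel" unfolding J_def by measurable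
    have lim: "(J \<nu> \<longlongrightarrow> (\<integral>\<^sup>+y. ennreal (f y) \<partial>\<nu>)) (at_right 0)"
      unfolding J_def by (rule heat_smoothing_tendsto[OF f b M \<nu>])
    have "mutual_energy \<alpha> \<nu> (density lborel f) - mutual_energy \<alpha> \<nu> (density lborel (qf \<rho> f)) = (\<integral>\<^sup>+t. ennreal (hw \<rho> 0 t) * J \<nu> t \<partial>halfline)"
      if \<rho>: "0 < \<rho>" for \<rho>
    proof -
      have E: "density lborel (qf \<rho> f) \<in> E_plus \<alpha>" by (rule qf_E_plus[OF f_m b M \<rho>])
      have [measurable]: "qf \<rho> f \<in> borel_measurable borel" unfolding qf_def[abs_def] by measurable
      have sum: "mutual_energy \<alpha> \<nu> (density lborel f) = (\<integral>\<^sup>+t. ennreal (hw \<rho> 0 t) * J \<nu> t \<partial>halfline) + mutual_energy \<alpha> \<nu> (density lborel (qf \<rho> f))"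
        unfolding J_def using \<nu> D(1) E
        by (subst nn_integral_hw_halfline[symmetric], measurable)
          (auto simp: mutual_energy_potential E_plus_radon potential_qf[OF f_m \<rho>] potential_density[of "qf \<rho> f"] intro!: nn_integral_add)
      then have "mutual_energy \<alpha> \<nu> (density lborel (qf \<rho> f)) \<noteq> \<top>" using fin by (auto simp: top_unique)
      then show ?thesis unfolding sum by (rule ennreal_add_diff_cancel_right)
    qed
    then have "\<forall>\<^sub>F \<rho> in at_right 0. (\<integral>\<^sup>+t. ennreal (hw \<rho> 0 t) * J \<nu> t \<partial>halfline) / H 0 \<rho>
       = (mutual_energy \<alpha> \<nu> (density lborel f) - mutual_energy \<alpha> \<nu> (density lborel (qf \<rho> f))) / H 0 \<rho>"
      by (intro eventually_at_rightI[of 0 1]) auto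
    with approx_identity[OF Jm _ _ lim, of 0] fin[unfolded pot] show ?thesis
      by (auto elim: Lim_transform_eventually)
  qed
  have "\<forall>\<^sub>F \<rho> in at_right 0. (mutual_energy \<alpha> \<nu>\<^sub>1 (density lborel f) - mutual_energy \<alpha> \<nu>\<^sub>1 (density lborel (qf \<rho> f))) / H 0 \<rho>
     = (mutual_energy \<alpha> \<nu>\<^sub>2 (density lborel f) - mutual_energy \<alpha> \<nu>\<^sub>2 (density lborel (qf \<rho> f))) / H 0 \<rho>"
    using eq D(1) qf_E_plus[OF f_m b M] by (intro eventually_at_rightI[of 0 1]) auto
  from Lim_transform_eventually[OF gen[OF \<nu>\<^sub>1] this] gen[OF \<nu>\<^sub>2 W2] show ?thesis
    by (intro tendsto_unique[of "at_right (0::real)"]) auto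
qed

text \<open>Boxes generate the Borel sets, and their indicators are limits of continuous functions
  vanishing off a bounded set, which satisfy the required Gaussian bound.\<close>

lemma measure_determined:
  assumes \<nu>\<^sub>1: "radon (\<nu>\<^sub>1 :: 'a measure)" "(\<integral>\<^sup>+y. W y \<partial>\<nu>\<^sub>1) < \<infinity>" and \<nu>\<^sub>2: "radon \<nu>\<^sub>2"
    and eq: "\<And>l. l \<in> E_plus \<alpha> \<Longrightarrow> mutual_energy \<alpha> \<nu>\<^sub>1 l = mutual_energy \<alpha> \<nu>\<^sub>2 l"
  shows "\<nu>\<^sub>1 = \<nu>\<^sub>2"
proof -
  have s: "sets \<nu>\<^sub>1 = sets borel" "sets \<nu>\<^sub>2 = sets borel" using \<nu>\<^sub>1 \<nu>\<^sub>2 by (auto simp: radon_sets)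
  note [measurable_cong] = s
  have fin: "emeasure \<nu> (box a b) < \<infinity>" if "radon \<nu>" for \<nu> :: "'a measure" and a b
  proof -
    have "emeasure \<nu> (box a b) \<le> emeasure \<nu> (cbox a b)"
      using that by (intro emeasure_mono box_subset_cbox) (auto simp: radon_sets)
    also have "\<dots> < \<infinity>" using that by (auto simp: radon_def compact_cbox)
    finally show ?thesis .
  qed
  have box_eq: "emeasure \<nu>\<^sub>1 (box a b) = emeasure \<nu>\<^sub>2 (box a b)" for a b :: 'a
  proof -
    define X where "X = box a b"
    have X: "open X" "bounded X" by (auto simp: X_def open_box)
    have ne: "- X \<noteq> {}" using X(2) not_bounded_UNIV by (metis Compl_empty_eq double_compl)
    define f where "f = (\<lambda>(n::nat) x. min 1 (real n * infdist x (- X)))"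
    have cont: "continuous_on UNIV (f n)" for n
      unfolding f_def by (intro continuous_intros)
    have f0: "0 \<le> f n x" for n x by (simp add: f_def infdist_nonneg)
    have fX: "f n x = 0" if "x \<notin> X" for n x using that by (simp add: f_def)
    have fle: "f n x \<le> 1" for n x by (simp add: f_def)
    have f1: "f n x \<le> indicator X x" for n x using fX[of x n] by (auto simp: indicator_def f_def)
    obtain r where r: "\<And>x. x \<in> X \<Longrightarrow> norm x \<le> r" using X(2) by (auto simp: bounded_iff)
    define M where "M = 1 / (pi powr (- (real DIM('a) / 2)) * exp (- r\<^sup>2))"
    have M: "0 < M" by (simp add: M_def)
    have fM: "f n x \<le> M * heat 1 0 x" for n x
    proof (cases "x \<in> X")
      case True
      have "1 \<le> M * heat 1 0 x" using heat_lower[OF r[OF True]] M by (simp add: M_def field_simps)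
      then show ?thesis using f1[of n x] True by simp
    next
      case False then show ?thesis using M by (simp add: fX)
    qed
    have lim: "(\<lambda>n. \<integral>\<^sup>+x. ennreal (f n x) \<partial>\<nu>) \<longlonglongrightarrow> emeasure \<nu> X" if \<nu>: "radon \<nu>" for \<nu>
    proof -
      have [measurable_cong]: "sets \<nu> = sets borel" using \<nu> by (simp add: radon_sets)
      have [measurable]: "X \<in> sets borel" using X by simp
      have [measurable]: "f n \<in> borel_measurable borel" for n using cont by (rule borel_measurable_continuous_onI)
      have "(\<lambda>n. \<integral>\<^sup>+x. ennreal (f n x) \<partial>\<nu>) \<longlonglongrightarrow> (\<integral>\<^sup>+x. indicator X x \<partial>\<nu>)"
      proof (rule nn_integral_dominated_convergence[where w="indicator X"])
        show "AE x in \<nu>. ennreal (f j x) \<le> indicator X x" for j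
          using fle fX by (intro AE_I2) (auto simp: indicator_def)
        show "(\<integral>\<^sup>+x. indicator X x \<partial>\<nu>) < \<infinity>" using fin[OF \<nu>] by (simp add: X_def)
        show "AE x in \<nu>. (\<lambda>i. ennreal (f i x)) \<longlonglongrightarrow> indicator X x"
        proof (intro AE_I2)
          fix x
          show "(\<lambda>i. ennreal (f i x)) \<longlonglongrightarrow> indicator X x"
          proof (cases "x \<in> X")
            case True
            have pos: "0 < infdist x (- X)" using infdist_pos_not_in_closed[of "- X" x] X ne True by (auto simp: closed_Compl)
            obtain N where N: "1 < real N * infdist x (- X)" using reals_Archimedean3[OF pos] by auto
            have "f i x = 1" if "N \<le> i" for i
            proof -
              have "real N * infdist x (- X) \<le> real i * infdist x (- X)" using that pos by (intro mult_right_mono) auto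
              then show ?thesis using N by (simp add: f_def)
            qed
            then have "\<forall>\<^sub>F i in sequentially. ennreal (f i x) = indicator X x"
              using True by (auto simp: eventually_sequentially intro!: exI[of _ N])
            then show ?thesis by (rule tendsto_eventually)
          qed (simp add: fX)
        qed
      qed measurable
      then show ?thesis by simp
    qed
    have "(\<integral>\<^sup>+x. ennreal (f n x) \<partial>\<nu>\<^sub>1) = (\<integral>\<^sup>+x. ennreal (f n x) \<partial>\<nu>\<^sub>2)" for n
      using nn_integral_determined[OF cont f0 fM _ \<nu>\<^sub>1 \<nu>\<^sub>2 eq] M by simp
    then show ?thesis using lim[OF \<nu>\<^sub>1(1)] lim[OF \<nu>\<^sub>2] LIMSEQ_unique unfolding X_def by auto
  qed
  show ?thesis
  proof (rule measure_eqI_generator_eq[where E="range (\<lambda>(a, b). box a b)" and \<Omega>=UNIV and A="\<lambda>i::nat. box (- (real i *\<^sub>R One)) (real i *\<^sub>R One)"])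
    show "Int_stable (range (\<lambda>(a, b). box a b :: 'a set))"
      by (auto simp: Int_stable_def box_Int_box)
    show "sets \<nu>\<^sub>1 = sigma_sets UNIV (range (\<lambda>(a, b). box a b))" "sets \<nu>\<^sub>2 = sigma_sets UNIV (range (\<lambda>(a, b). box a b))"
      unfolding s by (simp_all add: borel_eq_box)
    show "(\<Union>i::nat. box (- (real i *\<^sub>R One)) (real i *\<^sub>R One)) = (UNIV :: 'a set)" by (rule UN_box_eq_UNIV)
    show "emeasure \<nu>\<^sub>1 (box (- (real i *\<^sub>R One)) (real i *\<^sub>R One)) \<noteq> \<infinity>" for i using fin[OF \<nu>\<^sub>1(1)] by (simp add: less_top)
  qed (use box_eq in auto)
qed

end

section \<open>The domination inequality\<close>

definition L2 :: "'b measure \<Rightarrow> ('b \<Rightarrow> real) set" where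
  "L2 M = {f. f \<in> borel_measurable M \<and> integrable M (\<lambda>x. (f x)\<^sup>2)}"

lemma L2_measurable: "f \<in> L2 M \<Longrightarrow> f \<in> borel_measurable M"
  and L2_square: "f \<in> L2 M \<Longrightarrow> integrable M (\<lambda>x. (f x)\<^sup>2)"
  by (auto simp: L2_def)

lemma L2_lborel_measurable: "f \<in> L2 lborel \<Longrightarrow> f \<in> borel_measurable borel"
  by (auto simp: L2_def)

lemma abs_mult_le_squares: "\<bar>a * b\<bar> \<le> a\<^sup>2 + (b::real)\<^sup>2"
proof -
  have "2 * (\<bar>a\<bar> * \<bar>b\<bar>) \<le> a\<^sup>2 + b\<^sup>2" using sum_squares_bound[of "\<bar>a\<bar>" "\<bar>b\<bar>"] by simp
  moreover have "0 \<le> \<bar>a\<bar> * \<bar>b\<bar>" by simp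
  ultimately show ?thesis unfolding abs_mult by linarith
qed

lemma L2_mult:
  assumes "f \<in> L2 M" "g \<in> L2 M" shows "integrable M (\<lambda>x. f x * g x)"
proof (rule Bochner_Integration.integrable_bound)
  show "integrable M (\<lambda>x. (f x)\<^sup>2 + (g x)\<^sup>2)" using assms by (intro Bochner_Integration.integrable_add L2_square)
  show "(\<lambda>x. f x * g x) \<in> borel_measurable M"
    using L2_measurable[OF assms(1)] L2_measurable[OF assms(2)] by measurable
  show "AE x in M. norm (f x * g x) \<le> norm ((f x)\<^sup>2 + (g x)\<^sup>2)"
    using abs_mult_le_squares[of "f _" "g _"] by (intro AE_I2) (simp add: add_nonneg_nonneg)
qed

lemma L2_le:
  assumes "g \<in> L2 M" "f \<in> borel_measurable M" "\<And>x. \<bar>f x\<bar> \<le> \<bar>g x\<bar>" shows "f \<in> L2 M"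
proof -
  have "integrable M (\<lambda>x. (f x)\<^sup>2)"
    by (rule Bochner_Integration.integrable_bound[OF L2_square[OF assms(1)]])
      (use assms in \<open>auto simp: abs_le_square_iff\<close>)
  then show ?thesis using assms by (simp add: L2_def)
qed

lemma L2_add:
  assumes "f \<in> L2 M" "g \<in> L2 M" shows "(\<lambda>x. f x + c * g x) \<in> L2 M"
proof -
  have [measurable]: "f \<in> borel_measurable M" "g \<in> borel_measurable M" using assms by (auto simp: L2_def)
  have "integrable M (\<lambda>x. (f x)\<^sup>2 + 2 * c * (f x * g x) + c\<^sup>2 * (g x)\<^sup>2)"
    using assms by (intro Bochner_Integration.integrable_add integrable_mult_right L2_square L2_mult)
  also have "(\<lambda>x. (f x)\<^sup>2 + 2 * c * (f x * g x) + c\<^sup>2 * (g x)\<^sup>2) = (\<lambda>x. (f x + c * g x)\<^sup>2)"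
    by (auto simp: power2_eq_square algebra_simps)
  finally show ?thesis by (simp add: L2_def)
qed

lemma quadratic_nonneg_imp_CS:
  fixes a b d :: real
  assumes quad: "\<And>c. 0 \<le> a + 2 * c * b + c\<^sup>2 * d" and d: "0 \<le> d" shows "b\<^sup>2 \<le> a * d"
proof (cases "d = 0")
  case True
  have "b = 0"
  proof (rule ccontr)
    assume ne: "b \<noteq> 0"
    \<comment> \<open>For \<open>d = 0\<close> the expression is affine in \<open>c\<close>, and
      this \<open>c\<close> gives it the value \<open>-1\<close>.\<close>
    show False using quad[of "- (a + 1) / (2 * b)"] ne True by (simp add: field_simps)
  qed
  then show ?thesis using True by simp
next
  case False
  then have pos: "0 < d" using d by simp
  have "0 \<le> a + 2 * (- b / d) * b + (- b / d)\<^sup>2 * d" by (rule quad)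
  also have "\<dots> = a - b\<^sup>2 / d" using pos by (simp add: power2_eq_square field_simps)
  finally show ?thesis using pos by (simp add: field_simps)
qed

lemma L2_CS:
  assumes f: "f \<in> L2 M" and g: "g \<in> L2 M"
  shows "(\<integral>x. f x * g x \<partial>M)\<^sup>2 \<le> (\<integral>x. (f x)\<^sup>2 \<partial>M) * (\<integral>x. (g x)\<^sup>2 \<partial>M)"
proof (rule quadratic_nonneg_imp_CS)
  fix c :: real
  have "0 \<le> (\<integral>x. (f x + c * g x)\<^sup>2 \<partial>M)" by (intro integral_nonneg_AE) auto
  also have "\<dots> = (\<integral>x. (f x)\<^sup>2 + 2 * c * (f x * g x) + c\<^sup>2 * (g x)\<^sup>2 \<partial>M)"
    by (intro Bochner_Integration.integral_cong) (auto simp: power2_eq_square algebra_simps)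
  also have "\<dots> = (\<integral>x. (f x)\<^sup>2 \<partial>M) + 2 * c * (\<integral>x. f x * g x \<partial>M) + c\<^sup>2 * (\<integral>x. (g x)\<^sup>2 \<partial>M)"
    using L2_square[OF f] L2_square[OF g] L2_mult[OF f g] by simp
  finally show "0 \<le> (\<integral>x. (f x)\<^sup>2 \<partial>M) + 2 * c * (\<integral>x. f x * g x \<partial>M) + c\<^sup>2 * (\<integral>x. (g x)\<^sup>2 \<partial>M)" .
qed (auto intro!: integral_nonneg_AE)

section \<open>The quadratic form of the sub-Markovian operator\<close>

locale riesz_killed = riesz \<alpha> n for \<alpha> :: real and n :: "'a::euclidean_space itself" +
  fixes \<rho> \<eta> :: real
  assumes \<rho>: "0 < \<rho>" and \<eta>: "0 < \<eta>"
begin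

text \<open>
  \<open>B\<close> below is the quadratic form of \<open>1 - \<Theta>\<close>, where \<open>\<Theta>\<close> has the symmetric sub-Markovian kernel
  \<open>mix (\<theta> \<rho> \<eta>)\<close>. On nonnegative functions with disjoint supports it is nonpositive, which is what makes the
  positive part of a difference of potentials a good test function.
\<close>

definition QM :: "('a \<times> 'a) measure" where
  "QM = density (lborel \<Otimes>\<^sub>M lborel) (\<lambda>p. mix (\<theta> \<rho> \<eta>) (fst p) (snd p))"

lemma sets_QM [simp, measurable_cong]: "sets QM = sets (borel \<Otimes>\<^sub>M borel)"
  by (simp add: QM_def)

lemma nn_integral_QM:
  assumes [measurable]: "f \<in> borel_measurable (borel \<Otimes>\<^sub>M borel)"
  shows "(\<integral>\<^sup>+p. f p \<partial>QM) = (\<integral>\<^sup>+x. \<integral>\<^sup>+y. mix (\<theta> \<rho> \<eta>) x y * f (x, y) \<partial>lborel \<partial>lborel)"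
  unfolding QM_def by (subst nn_integral_density, measurable) (subst lborel.nn_integral_fst[symmetric], auto)

text \<open>Row masses of the kernel are at most 1, so the first marginal of \<open>QM\<close> is
  dominated by Lebesgue measure; by symmetry so is the second, which is all that boundedness on
  \<open>L2 lborel\<close> needs.\<close>

lemma nn_integral_QM_fst:
  assumes [measurable]: "f \<in> borel_measurable borel"
  shows "(\<integral>\<^sup>+p. f (fst p) \<partial>QM) \<le> (\<integral>\<^sup>+x. f x \<partial>lborel)"
proof -
  have "(\<integral>\<^sup>+p. f (fst p) \<partial>QM) = (\<integral>\<^sup>+x. (\<integral>\<^sup>+y. mix (\<theta> \<rho> \<eta>) x y \<partial>lborel) * f x \<partial>lborel)"
    by (subst nn_integral_QM, measurable) (auto intro!: nn_integral_cong nn_integral_multc)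
  also have "\<dots> \<le> (\<integral>\<^sup>+x. 1 * f x \<partial>lborel)"
    using \<rho> \<eta> by (intro nn_integral_mono mult_right_mono nn_integral_mix_\<theta>_le) auto
  finally show ?thesis by simp
qed

lemma QM_swap: "distr QM (borel \<Otimes>\<^sub>M borel) (\<lambda>p. (snd p, fst p)) = QM"
proof (rule measure_eqI)
  show "sets (distr QM (borel \<Otimes>\<^sub>M borel) (\<lambda>p. (snd p, fst p))) = sets QM" by simp
  fix X assume "X \<in> sets (distr QM (borel \<Otimes>\<^sub>M borel) (\<lambda>p. (snd p, fst p)))"
  then have [measurable]: "X \<in> sets (borel \<Otimes>\<^sub>M borel)" by simp
  have "emeasure (distr QM (borel \<Otimes>\<^sub>M borel) (\<lambda>p. (snd p, fst p))) X = (\<integral>\<^sup>+p. indicator X p \<partial>distr QM (borel \<Otimes>\<^sub>M borel) (\<lambda>p. (snd p, fst p)))"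
    by (subst nn_integral_indicator) auto
  also have "\<dots> = (\<integral>\<^sup>+p. indicator X (snd p, fst p) \<partial>QM)"
    by (subst nn_integral_distr) auto
  also have "\<dots> = (\<integral>\<^sup>+x. \<integral>\<^sup>+y. mix (\<theta> \<rho> \<eta>) x y * indicator X (y, x) \<partial>lborel \<partial>lborel)"
    by (subst nn_integral_QM) auto
  also have "\<dots> = (\<integral>\<^sup>+y. \<integral>\<^sup>+x. mix (\<theta> \<rho> \<eta>) x y * indicator X (y, x) \<partial>lborel \<partial>lborel)"
    by (intro nn_integral_swap lborel.sigma_finite_measure_axioms) measurable
  also have "\<dots> = (\<integral>\<^sup>+y. \<integral>\<^sup>+x. mix (\<theta> \<rho> \<eta>) y x * indicator X (y, x) \<partial>lborel \<partial>lborel)"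
    by (intro nn_integral_cong) (simp add: mix_commute)
  also have "\<dots> = (\<integral>\<^sup>+p. indicator X p \<partial>QM)"
    by (subst nn_integral_QM) auto
  also have "\<dots> = emeasure QM X" by (subst nn_integral_indicator) auto
  finally show "emeasure (distr QM (borel \<Otimes>\<^sub>M borel) (\<lambda>p. (snd p, fst p))) X = emeasure QM X" .
qed

lemma integral_QM_swap:
  fixes f :: "'a \<times> 'a \<Rightarrow> real"
  assumes [measurable]: "f \<in> borel_measurable (borel \<Otimes>\<^sub>M borel)"
  shows "(\<integral>p. f (snd p, fst p) \<partial>QM) = (\<integral>p. f p \<partial>QM)"
proof -
  have "(\<integral>p. f p \<partial>distr QM (borel \<Otimes>\<^sub>M borel) (\<lambda>p. (snd p, fst p))) = (\<integral>p. f (snd p, fst p) \<partial>QM)"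
    by (rule integral_distr) measurable
  then show ?thesis unfolding QM_swap by simp
qed

lemma L2_QM_fst:
  assumes "f \<in> L2 lborel"
  shows "integrable QM (\<lambda>p. (f (fst p))\<^sup>2)" "(\<integral>p. (f (fst p))\<^sup>2 \<partial>QM) \<le> (\<integral>x. (f x)\<^sup>2 \<partial>lborel)"
proof -
  have [measurable]: "f \<in> borel_measurable borel" using assms by (rule L2_lborel_measurable)
  have le: "(\<integral>\<^sup>+p. ennreal ((f (fst p))\<^sup>2) \<partial>QM) \<le> (\<integral>\<^sup>+x. ennreal ((f x)\<^sup>2) \<partial>lborel)"
    by (rule nn_integral_QM_fst) simp
  also have eq: "\<dots> = ennreal (\<integral>x. (f x)\<^sup>2 \<partial>lborel)"
    by (rule nn_integral_eq_integral[OF L2_square[OF assms]]) simp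
  finally have le': "(\<integral>\<^sup>+p. ennreal ((f (fst p))\<^sup>2) \<partial>QM) \<le> ennreal (\<integral>x. (f x)\<^sup>2 \<partial>lborel)" .
  then show i: "integrable QM (\<lambda>p. (f (fst p))\<^sup>2)"
    by (intro integrableI_nonneg) (auto intro: order_le_less_trans)
  show "(\<integral>p. (f (fst p))\<^sup>2 \<partial>QM) \<le> (\<integral>x. (f x)\<^sup>2 \<partial>lborel)"
    using le' by (subst (asm) nn_integral_eq_integral[OF i]) auto
qed

lemma L2_QM_snd:
  assumes "f \<in> L2 lborel"
  shows "integrable QM (\<lambda>p. (f (snd p))\<^sup>2)" "(\<integral>p. (f (snd p))\<^sup>2 \<partial>QM) \<le> (\<integral>x. (f x)\<^sup>2 \<partial>lborel)"
proof -
  have [measurable]: "f \<in> borel_measurable borel" using assms by (rule L2_lborel_measurable)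
  have "integrable (distr QM (borel \<Otimes>\<^sub>M borel) (\<lambda>p. (snd p, fst p))) (\<lambda>p. (f (fst p))\<^sup>2)"
    unfolding QM_swap by (rule L2_QM_fst[OF assms])
  then show "integrable QM (\<lambda>p. (f (snd p))\<^sup>2)" by (subst (asm) integrable_distr_eq) auto
  show "(\<integral>p. (f (snd p))\<^sup>2 \<partial>QM) \<le> (\<integral>x. (f x)\<^sup>2 \<partial>lborel)"
    using integral_QM_swap[of "\<lambda>p. (f (fst p))\<^sup>2"] L2_QM_fst[OF assms] by simp
qed

lemma L2_QM_mult:
  assumes "f \<in> L2 lborel" "g \<in> L2 lborel" shows "integrable QM (\<lambda>p. f (fst p) * g (snd p))"
proof (rule Bochner_Integration.integrable_bound)
  have [measurable]: "f \<in> borel_measurable borel" "g \<in> borel_measurable borel" using assms by (auto intro: L2_lborel_measurable)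
  show "integrable QM (\<lambda>p. (f (fst p))\<^sup>2 + (g (snd p))\<^sup>2)"
    using assms by (intro Bochner_Integration.integrable_add L2_QM_fst L2_QM_snd)
  show "(\<lambda>p. f (fst p) * g (snd p)) \<in> borel_measurable QM" by measurable
  show "AE p in QM. norm (f (fst p) * g (snd p)) \<le> norm ((f (fst p))\<^sup>2 + (g (snd p))\<^sup>2)"
    using abs_mult_le_squares[of "f _" "g _"] by (intro AE_I2) (simp add: add_nonneg_nonneg)
qed

definition B :: "('a \<Rightarrow> real) \<Rightarrow> ('a \<Rightarrow> real) \<Rightarrow> real" where
  "B f g = (\<integral>x. f x * g x \<partial>lborel) - (\<integral>p. f (fst p) * g (snd p) \<partial>QM)"

lemma B_commute:
  assumes "f \<in> L2 lborel" "g \<in> L2 lborel" shows "B f g = B g f"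
proof -
  have [measurable]: "f \<in> borel_measurable borel" "g \<in> borel_measurable borel" using assms by (auto intro: L2_lborel_measurable)
  show ?thesis
    using integral_QM_swap[of "\<lambda>p. f (fst p) * g (snd p)"] by (simp add: B_def mult.commute)
qed

lemma B_add_left:
  assumes "f \<in> L2 lborel" "g \<in> L2 lborel" "h \<in> L2 lborel"
  shows "B (\<lambda>x. f x + c * g x) h = B f h + c * B g h"
proof -
  have "(\<integral>x. (f x + c * g x) * h x \<partial>lborel) = (\<integral>x. f x * h x + c * (g x * h x) \<partial>lborel)"
    by (simp only: distrib_right mult.assoc)
  also have "\<dots> = (\<integral>x. f x * h x \<partial>lborel) + c * (\<integral>x. g x * h x \<partial>lborel)"
    using L2_mult[OF assms(1,3)] L2_mult[OF assms(2,3)] by simp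
  finally have 1: "(\<integral>x. (f x + c * g x) * h x \<partial>lborel) = (\<integral>x. f x * h x \<partial>lborel) + c * (\<integral>x. g x * h x \<partial>lborel)" .
  have "(\<integral>p. (f (fst p) + c * g (fst p)) * h (snd p) \<partial>QM) = (\<integral>p. f (fst p) * h (snd p) + c * (g (fst p) * h (snd p)) \<partial>QM)"
    by (simp only: distrib_right mult.assoc)
  also have "\<dots> = (\<integral>p. f (fst p) * h (snd p) \<partial>QM) + c * (\<integral>p. g (fst p) * h (snd p) \<partial>QM)"
    using L2_QM_mult[OF assms(1,3)] L2_QM_mult[OF assms(2,3)] by simp
  finally show ?thesis unfolding B_def 1 by (simp add: right_diff_distrib)
qed

text \<open>The product of the values at two points is at most the mean of their squares, and the
  marginal bounds reduce each square to its Lebesgue integral.\<close>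

lemma B_nonneg:
  assumes "f \<in> L2 lborel" shows "0 \<le> B f f"
proof -
  have "(\<integral>p. f (fst p) * f (snd p) \<partial>QM) \<le> (\<integral>p. (1/2) * (f (fst p))\<^sup>2 + (1/2) * (f (snd p))\<^sup>2 \<partial>QM)"
  proof (rule integral_mono)
    show "integrable QM (\<lambda>p. (1/2) * (f (fst p))\<^sup>2 + (1/2) * (f (snd p))\<^sup>2)"
      using assms by (intro Bochner_Integration.integrable_add integrable_mult_right L2_QM_fst L2_QM_snd)
    show "f (fst p) * f (snd p) \<le> (1/2) * (f (fst p))\<^sup>2 + (1/2) * (f (snd p))\<^sup>2" for p
      using sum_squares_bound[of "f (fst p)" "f (snd p)"] by simp
  qed (rule L2_QM_mult[OF assms assms])
  also have "\<dots> = (1/2) * (\<integral>p. (f (fst p))\<^sup>2 \<partial>QM) + (1/2) * (\<integral>p. (f (snd p))\<^sup>2 \<partial>QM)"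
    using L2_QM_fst[OF assms] L2_QM_snd[OF assms] by (subst Bochner_Integration.integral_add) auto
  also have "\<dots> \<le> (\<integral>x. (f x)\<^sup>2 \<partial>lborel)"
    using L2_QM_fst(2)[OF assms] L2_QM_snd(2)[OF assms] by simp
  finally show ?thesis by (simp add: B_def power2_eq_square)
qed

lemma B_CS:
  assumes f: "f \<in> L2 lborel" and g: "g \<in> L2 lborel" shows "(B f g)\<^sup>2 \<le> B f f * B g g"
proof -
  have quad: "0 \<le> B f f + 2 * c * B f g + c\<^sup>2 * B g g" for c
  proof -
    let ?h = "\<lambda>x. f x + c * g x"
    have h: "?h \<in> L2 lborel" using f g by (rule L2_add)
    have "0 \<le> B ?h ?h" by (rule B_nonneg[OF h])
    also have "B ?h ?h = B f ?h + c * B g ?h" by (rule B_add_left[OF f g h])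
    also have "B f ?h = B f f + c * B f g"
      using B_commute[OF f h] B_add_left[OF f g f] B_commute[OF g f] by simp
    also have "B g ?h = B f g + c * B g g"
      using B_commute[OF g h] B_add_left[OF f g g] by simp
    finally show ?thesis by (simp add: power2_eq_square algebra_simps)
  qed
  show ?thesis by (rule quadratic_nonneg_imp_CS[OF quad B_nonneg[OF g]])
qed

end

section \<open>Potentials with killing and their square integrability\<close>

context riesz begin

text \<open>
  The killing rate \<open>\<eta> > 0\<close> puts the potentials \<open>up \<eta> \<mu>\<close> into \<open>L2 lborel\<close>; the limit \<open>\<eta> = 0\<close> is
  taken at the end.
\<close>

definition pw :: "real \<Rightarrow> 'a measure \<Rightarrow> 'a \<Rightarrow> ennreal" where
  "pw \<eta> \<mu> x = (\<integral>\<^sup>+y. mix (\<kappa> \<eta>) x y \<partial>\<mu>)"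

text \<open>Infinite values become 0. For finite-energy measures this concerns null sets only:
  Lebesgue-null ones when \<open>\<eta> > 0\<close>, and null sets of every other finite-energy
  measure when \<open>\<eta> \<ge> 0\<close>.\<close>

definition up :: "real \<Rightarrow> 'a measure \<Rightarrow> 'a \<Rightarrow> real" where
  "up \<eta> \<mu> x = enn2real (pw \<eta> \<mu> x)"

definition excess :: "real \<Rightarrow> 'a measure \<Rightarrow> 'a measure \<Rightarrow> 'a \<Rightarrow> real" where
  "excess \<eta> P L x = max 0 (up \<eta> P x - up \<eta> L x)"

text \<open>For nonnegative \<open>g\<close> this will be the form \<open>B\<close> of the potential
  of \<mu> and \<open>g\<close>, written without a subtraction; in this shape the limit \<rho> to 0
  is accessible.\<close>

definition T :: "real \<Rightarrow> real \<Rightarrow> 'a measure \<Rightarrow> ('a \<Rightarrow> real) \<Rightarrow> ennreal" where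
  "T \<rho> \<eta> \<mu> g = (\<integral>\<^sup>+y. \<integral>\<^sup>+x. mix (hw \<rho> \<eta>) y x * ennreal (g x) \<partial>lborel \<partial>\<mu>)"

lemma pw_0: "pw 0 \<mu> = potential \<alpha> \<mu>"
  by (simp add: fun_eq_iff pw_def potential_eq)

lemma pw_measurable: "radon \<mu> \<Longrightarrow> pw \<eta> \<mu> \<in> borel_measurable borel"
  unfolding pw_def[abs_def] by (rule borel_measurable_nn_integral_radon) measurable

lemma up_measurable: "radon \<mu> \<Longrightarrow> up \<eta> \<mu> \<in> borel_measurable borel"
  unfolding up_def[abs_def] using pw_measurable[of \<mu> \<eta>] by measurable

lemma excess_measurable: "radon P \<Longrightarrow> radon L \<Longrightarrow> excess \<eta> P L \<in> borel_measurable borel"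
  unfolding excess_def[abs_def] using up_measurable[of P \<eta>] up_measurable[of L \<eta>] by measurable

lemma up_nonneg [simp]: "0 \<le> up \<eta> \<mu> x" and excess_nonneg [simp]: "0 \<le> excess \<eta> P L x"
  and excess_le: "excess \<eta> P L x \<le> up \<eta> P x"
  by (auto simp: up_def excess_def)

lemma mix_\<kappa>_mono: "0 \<le> \<eta> \<Longrightarrow> mix (\<kappa> \<eta>) x y \<le> mix (\<kappa> 0) x y"
  by (intro mix_mono \<kappa>_antimono) auto

lemma pw_le: "0 \<le> \<eta> \<Longrightarrow> pw \<eta> \<mu> x \<le> pw 0 \<mu> x"
  unfolding pw_def by (intro nn_integral_mono mix_\<kappa>_mono)

lemma ennreal_up_le: "ennreal (up \<eta> \<mu> x) \<le> pw \<eta> \<mu> x"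
  unfolding up_def using ennreal_enn2real_if[of "pw \<eta> \<mu> x"] by auto

lemma mutual_energy_pw: "radon \<mu> \<Longrightarrow> radon \<nu> \<Longrightarrow> mutual_energy \<alpha> \<mu> \<nu> = (\<integral>\<^sup>+x. pw 0 \<nu> x \<partial>\<mu>)"
  by (simp add: mutual_energy_potential pw_0)

lemma AE_pw_finite:
  assumes "\<mu> \<in> E_plus \<alpha>" "\<nu> \<in> E_plus \<alpha>" shows "AE x in \<mu>. pw 0 \<nu> x < \<infinity>"
proof -
  have r: "radon \<mu>" "radon \<nu>" using assms by (auto intro: E_plus_radon)
  have "(\<integral>\<^sup>+x. pw 0 \<nu> x \<partial>\<mu>) < \<infinity>" using mutual_energy_finite[OF assms] r by (simp add: mutual_energy_pw)
  then show ?thesis using nn_integral_PInf_AE[OF measurable_radon[OF r(1) pw_measurable[OF r(2)]]] by (auto simp: less_top)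
qed

lemma nn_integral_\<kappa>_finite: "0 < \<eta> \<Longrightarrow> (\<integral>\<^sup>+t. ennreal (\<kappa> \<eta> t) \<partial>halfline) < \<infinity>"
proof -
  assume \<eta>: "0 < \<eta>"
  have "(\<integral>\<^sup>+t. ennreal (\<kappa> \<eta> t) \<partial>halfline) = (\<integral>\<^sup>+t. ennreal c\<^sub>0 * ennreal (t powr (\<beta> - 1) * exp (- \<eta> * t)) \<partial>halfline)"
    using c\<^sub>0_pos by (intro nn_integral_cong) (simp add: \<kappa>_def mult.assoc flip: ennreal_mult)
  also have "\<dots> = ennreal c\<^sub>0 * ennreal (Gamma \<beta> / \<eta> powr \<beta>)"
    by (subst nn_integral_cmult, simp, subst nn_integral_Gamma[OF \<beta>(1) \<eta>]) simp
  finally show ?thesis by (simp add: ennreal_mult_less_top)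
qed

text \<open>Killing makes the total mass of the weight finite, so the times of one factor can be
  integrated out while the other factor is a smoothed kernel. Consequently the square of a killed
  potential has an integral bounded by a constant times the energy.\<close>

lemma mix_\<kappa>_mix_\<kappa>_le:
  assumes \<eta>: "0 < \<eta>"
  obtains D where "D < (\<infinity>::ennreal)" "\<And>x y. (\<integral>\<^sup>+z. mix (\<kappa> \<eta>) x z * mix (\<kappa> \<eta>) z y \<partial>lborel) \<le> D * mix (\<kappa> 0) x (y::'a)"
proof -
  obtain C where C: "0 < C" "\<And>s (x::'a) y. 0 < s \<Longrightarrow>
    (\<integral>\<^sup>+t. ennreal (\<kappa> 0 t) * ennreal (heat (s + t) x y) \<partial>halfline) \<le> ennreal C * riesz_kernel \<alpha> x y"
    using heat_\<kappa>_le by blast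
  show ?thesis
  proof (rule that)
    show "(\<integral>\<^sup>+s. ennreal (\<kappa> \<eta> s) \<partial>halfline) * ennreal C < \<infinity>"
      using nn_integral_\<kappa>_finite[OF \<eta>] by (simp add: ennreal_mult_less_top)
    fix x y :: 'a
    have "(\<integral>\<^sup>+z. mix (\<kappa> \<eta>) x z * mix (\<kappa> \<eta>) z y \<partial>lborel)
      = (\<integral>\<^sup>+s. \<integral>\<^sup>+t. ennreal (\<kappa> \<eta> s) * ennreal (\<kappa> \<eta> t) * ennreal (heat (s + t) x y) \<partial>halfline \<partial>halfline)"
      by (rule mix_convolve) auto
    also have "\<dots> \<le> (\<integral>\<^sup>+s. ennreal (\<kappa> \<eta> s) * (ennreal C * mix (\<kappa> 0) x y) \<partial>halfline)"
    proof (rule nn_integral_halfline_mono)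
      fix s :: real assume s: "0 < s"
      have "(\<integral>\<^sup>+t. ennreal (\<kappa> \<eta> s) * ennreal (\<kappa> \<eta> t) * ennreal (heat (s + t) x y) \<partial>halfline)
        = ennreal (\<kappa> \<eta> s) * (\<integral>\<^sup>+t. ennreal (\<kappa> \<eta> t) * ennreal (heat (s + t) x y) \<partial>halfline)"
        unfolding mult.assoc by (rule nn_integral_cmult) measurable
      also have "\<dots> \<le> ennreal (\<kappa> \<eta> s) * (\<integral>\<^sup>+t. ennreal (\<kappa> 0 t) * ennreal (heat (s + t) x y) \<partial>halfline)"
        using \<eta> by (intro mult_left_mono nn_integral_halfline_mono mult_right_mono ennreal_leI \<kappa>_antimono) auto
      also have "\<dots> \<le> ennreal (\<kappa> \<eta> s) * (ennreal C * mix (\<kappa> 0) x y)"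
        using C(2)[OF s] by (intro mult_left_mono) (simp_all add: riesz_kernel_eq_mix)
      finally show "(\<integral>\<^sup>+t. ennreal (\<kappa> \<eta> s) * ennreal (\<kappa> \<eta> t) * ennreal (heat (s + t) x y) \<partial>halfline)
        \<le> ennreal (\<kappa> \<eta> s) * (ennreal C * mix (\<kappa> 0) x y)" .
    qed
    also have "\<dots> = (\<integral>\<^sup>+s. ennreal (\<kappa> \<eta> s) \<partial>halfline) * ennreal C * mix (\<kappa> 0) x y"
      by (subst nn_integral_multc) (auto simp: mult.assoc)
    finally show "(\<integral>\<^sup>+z. mix (\<kappa> \<eta>) x z * mix (\<kappa> \<eta>) z y \<partial>lborel)
      \<le> (\<integral>\<^sup>+s. ennreal (\<kappa> \<eta> s) \<partial>halfline) * ennreal C * mix (\<kappa> 0) x y" .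
  qed
qed

lemma nn_integral_mix_pw:
  assumes \<mu>: "radon \<mu>" and [measurable]: "w \<in> borel_measurable borel"
  shows "(\<integral>\<^sup>+z. mix w x z * pw \<eta> \<mu> z \<partial>lborel) = (\<integral>\<^sup>+y. \<integral>\<^sup>+z. mix w x z * mix (\<kappa> \<eta>) z y \<partial>lborel \<partial>\<mu>)"
proof -
  have [measurable_cong]: "sets \<mu> = sets borel" using \<mu> by (simp add: radon_sets)
  interpret M: sigma_finite_measure \<mu> by (rule radon_sigma_finite[OF \<mu>])
  have "(\<integral>\<^sup>+z. mix w x z * pw \<eta> \<mu> z \<partial>lborel) = (\<integral>\<^sup>+z. \<integral>\<^sup>+y. mix w x z * mix (\<kappa> \<eta>) z y \<partial>\<mu> \<partial>lborel)"
    unfolding pw_def by (intro nn_integral_cong nn_integral_cmult[symmetric]) measurable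
  also have "\<dots> = (\<integral>\<^sup>+y. \<integral>\<^sup>+z. mix w x z * mix (\<kappa> \<eta>) z y \<partial>lborel \<partial>\<mu>)"
    by (intro nn_integral_swap M.sigma_finite_measure_axioms lborel.sigma_finite_measure_axioms) measurable
  finally show ?thesis .
qed

lemma nn_integral_mix_pw_finite:
  assumes \<mu>: "\<mu> \<in> E_plus \<alpha>" and \<nu>: "\<nu> \<in> E_plus \<alpha>" and \<eta>: "0 < \<eta>"
  shows "(\<integral>\<^sup>+x. \<integral>\<^sup>+z. mix (\<kappa> \<eta>) x z * pw \<eta> \<mu> z \<partial>lborel \<partial>\<nu>) < \<infinity>"
proof -
  have r: "radon \<mu>" "radon \<nu>" using assms by (auto intro: E_plus_radon)
  have [measurable_cong]: "sets \<mu> = sets borel" using r by (simp add: radon_sets)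
  obtain D where D: "D < (\<infinity>::ennreal)" "\<And>x y. (\<integral>\<^sup>+z. mix (\<kappa> \<eta>) x z * mix (\<kappa> \<eta>) z y \<partial>lborel) \<le> D * mix (\<kappa> 0) x (y::'a)"
    using mix_\<kappa>_mix_\<kappa>_le[OF \<eta>] by blast
  have "(\<integral>\<^sup>+x. \<integral>\<^sup>+z. mix (\<kappa> \<eta>) x z * pw \<eta> \<mu> z \<partial>lborel \<partial>\<nu>) \<le> (\<integral>\<^sup>+x. \<integral>\<^sup>+y. D * mix (\<kappa> 0) x y \<partial>\<mu> \<partial>\<nu>)"
    by (subst nn_integral_mix_pw[OF r(1)]) (auto intro!: nn_integral_mono D)
  also have "\<dots> = (\<integral>\<^sup>+x. D * pw 0 \<mu> x \<partial>\<nu>)"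
    unfolding pw_def by (intro nn_integral_cong nn_integral_cmult) measurable
  also have "\<dots> = D * mutual_energy \<alpha> \<nu> \<mu>"
    unfolding mutual_energy_pw[OF r(2,1)] using measurable_radon[OF r(2) pw_measurable[OF r(1)]] by (rule nn_integral_cmult)
  also have "\<dots> < \<infinity>" using D mutual_energy_finite[OF \<nu> \<mu>] by (simp add: ennreal_mult_less_top)
  finally show ?thesis .
qed

lemma nn_integral_pw_mult:
  assumes \<mu>: "radon \<mu>" and [measurable]: "g \<in> borel_measurable borel"
  shows "(\<integral>\<^sup>+x. pw \<eta> \<mu> x * g x \<partial>lborel) = (\<integral>\<^sup>+y. \<integral>\<^sup>+x. mix (\<kappa> \<eta>) y x * g x \<partial>lborel \<partial>\<mu>)"
proof -
  have [measurable_cong]: "sets \<mu> = sets borel" using \<mu> by (simp add: radon_sets)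
  interpret M: sigma_finite_measure \<mu> by (rule radon_sigma_finite[OF \<mu>])
  have "(\<integral>\<^sup>+x. pw \<eta> \<mu> x * g x \<partial>lborel) = (\<integral>\<^sup>+x. \<integral>\<^sup>+y. mix (\<kappa> \<eta>) y x * g x \<partial>\<mu> \<partial>lborel)"
    unfolding pw_def by (intro nn_integral_cong) (subst nn_integral_multc, auto simp: mix_commute)
  also have "\<dots> = (\<integral>\<^sup>+y. \<integral>\<^sup>+x. mix (\<kappa> \<eta>) y x * g x \<partial>lborel \<partial>\<mu>)"
    by (intro nn_integral_swap M.sigma_finite_measure_axioms lborel.sigma_finite_measure_axioms) measurable
  finally show ?thesis .
qed

lemma nn_integral_pw_square_finite:
  assumes "\<mu> \<in> E_plus \<alpha>" "0 < \<eta>"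
  shows "(\<integral>\<^sup>+x. pw \<eta> \<mu> x * pw \<eta> \<mu> x \<partial>lborel) < \<infinity>"
  unfolding nn_integral_pw_mult[OF E_plus_radon[OF assms(1)] pw_measurable[OF E_plus_radon[OF assms(1)]]]
  by (rule nn_integral_mix_pw_finite[OF assms(1,1,2)])

lemma AE_lborel_pw_finite:
  assumes "\<mu> \<in> E_plus \<alpha>" "0 < \<eta>"
  shows "AE x in lborel. pw \<eta> \<mu> x = ennreal (up \<eta> \<mu> x)"
proof -
  have [measurable]: "pw \<eta> \<mu> \<in> borel_measurable borel" using assms by (intro pw_measurable E_plus_radon)
  have "AE x in lborel. pw \<eta> \<mu> x * pw \<eta> \<mu> x \<noteq> \<infinity>"
    using nn_integral_pw_square_finite[OF assms] by (intro nn_integral_PInf_AE) auto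
  then show ?thesis by eventually_elim (auto simp: up_def ennreal_mult_eq_top_iff less_top)
qed

lemma up_L2:
  assumes "\<mu> \<in> E_plus \<alpha>" "0 < \<eta>" shows "up \<eta> \<mu> \<in> L2 lborel"
proof -
  have [measurable]: "up \<eta> \<mu> \<in> borel_measurable borel" using assms by (intro up_measurable E_plus_radon)
  have "(\<integral>\<^sup>+x. ennreal ((up \<eta> \<mu> x)\<^sup>2) \<partial>lborel) \<le> (\<integral>\<^sup>+x. pw \<eta> \<mu> x * pw \<eta> \<mu> x \<partial>lborel)"
    by (intro nn_integral_mono) (simp add: power2_eq_square ennreal_mult mult_mono ennreal_up_le)
  also have "\<dots> < \<infinity>" by (rule nn_integral_pw_square_finite[OF assms])
  finally show ?thesis by (auto simp: L2_def intro!: integrableI_nonneg)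
qed

lemma excess_L2:
  assumes "P \<in> E_plus \<alpha>" "L \<in> E_plus \<alpha>" "0 < \<eta>" shows "excess \<eta> P L \<in> L2 lborel"
proof (rule L2_le[OF up_L2[OF assms(1,3)]])
  show "excess \<eta> P L \<in> borel_measurable lborel" using assms by (simp add: excess_measurable E_plus_radon)
  show "\<bar>excess \<eta> P L x\<bar> \<le> \<bar>up \<eta> P x\<bar>" for x using excess_le[of \<eta> P L x] by simp
qed

end

section \<open>The domination inequality before the limits\<close>

context riesz_killed begin

text \<open>Pairing the kernel decomposition with \<mu> and \<open>g\<close> gives an equation
  between three nonnegative integrals. The two that contain the full potential are finite by square
  integrability, so the equation can be solved for \<open>T\<close>.\<close>

lemma B_up:
  assumes \<mu>: "\<mu> \<in> E_plus \<alpha>" and g: "g \<in> L2 lborel" "\<And>x. 0 \<le> g x"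
  shows "T \<rho> \<eta> \<mu> g = ennreal (B (up \<eta> \<mu>) g)" and "0 \<le> B (up \<eta> \<mu>) g"
proof -
  have r: "radon \<mu>" using \<mu> by (rule E_plus_radon)
  have [measurable_cong]: "sets \<mu> = sets borel" using r by (simp add: radon_sets)
  interpret M: sigma_finite_measure \<mu> by (rule radon_sigma_finite[OF r])
  have [measurable]: "g \<in> borel_measurable borel" using g(1) by (rule L2_lborel_measurable)
  have [measurable]: "up \<eta> \<mu> \<in> borel_measurable borel" "pw \<eta> \<mu> \<in> borel_measurable borel" using r by (auto intro: up_measurable pw_measurable)
  have u: "up \<eta> \<mu> \<in> L2 lborel" using \<mu> \<eta> by (rule up_L2)
  have 1: "(\<integral>\<^sup>+x. pw \<eta> \<mu> x * ennreal (g x) \<partial>lborel) = ennreal (\<integral>x. up \<eta> \<mu> x * g x \<partial>lborel)"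
  proof -
    have "(\<integral>\<^sup>+x. pw \<eta> \<mu> x * ennreal (g x) \<partial>lborel) = (\<integral>\<^sup>+x. ennreal (up \<eta> \<mu> x * g x) \<partial>lborel)"
      using AE_lborel_pw_finite[OF \<mu> \<eta>] by (intro nn_integral_cong_AE) (auto simp: ennreal_mult g(2))
    also have "\<dots> = ennreal (\<integral>x. up \<eta> \<mu> x * g x \<partial>lborel)"
      using g by (intro nn_integral_eq_integral L2_mult u) auto
    finally show ?thesis .
  qed
  have 2: "(\<integral>\<^sup>+p. pw \<eta> \<mu> (fst p) * ennreal (g (snd p)) \<partial>QM) = ennreal (\<integral>p. up \<eta> \<mu> (fst p) * g (snd p) \<partial>QM)"
  proof -
    have "AE p in QM. pw \<eta> \<mu> (fst p) = ennreal (up \<eta> \<mu> (fst p))"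
    proof -
      have "AE p in lborel \<Otimes>\<^sub>M (lborel :: 'a measure). pw \<eta> \<mu> (fst p) = ennreal (up \<eta> \<mu> (fst p))"
      proof (rule lborel_pair.AE_pair_measure)
        show "{p \<in> space (lborel \<Otimes>\<^sub>M (lborel :: 'a measure)). pw \<eta> \<mu> (fst p) = ennreal (up \<eta> \<mu> (fst p))} \<in> sets (lborel \<Otimes>\<^sub>M lborel)"
          by measurable
        show "AE x in lborel. AE y in (lborel :: 'a measure). pw \<eta> \<mu> (fst (x, y)) = ennreal (up \<eta> \<mu> (fst (x, y)))"
          using AE_lborel_pw_finite[OF \<mu> \<eta>] by eventually_elim simp
      qed
      then show ?thesis unfolding QM_def by (subst AE_density) auto
    qed
    then have "(\<integral>\<^sup>+p. pw \<eta> \<mu> (fst p) * ennreal (g (snd p)) \<partial>QM) = (\<integral>\<^sup>+p. ennreal (up \<eta> \<mu> (fst p) * g (snd p)) \<partial>QM)"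
      by (intro nn_integral_cong_AE) (auto simp: ennreal_mult g(2))
    also have "\<dots> = ennreal (\<integral>p. up \<eta> \<mu> (fst p) * g (snd p) \<partial>QM)"
      using g by (intro nn_integral_eq_integral L2_QM_mult u) auto
    finally show ?thesis .
  qed
  have 3: "(\<integral>\<^sup>+p. pw \<eta> \<mu> (fst p) * ennreal (g (snd p)) \<partial>QM)
     = (\<integral>\<^sup>+y. \<integral>\<^sup>+z. (\<integral>\<^sup>+x. mix (\<theta> \<rho> \<eta>) z x * mix (\<kappa> \<eta>) x y \<partial>lborel) * ennreal (g z) \<partial>lborel \<partial>\<mu>)"
  proof -
    have "(\<integral>\<^sup>+p. pw \<eta> \<mu> (fst p) * ennreal (g (snd p)) \<partial>QM)
      = (\<integral>\<^sup>+x. \<integral>\<^sup>+z. mix (\<theta> \<rho> \<eta>) x z * (pw \<eta> \<mu> x * ennreal (g z)) \<partial>lborel \<partial>lborel)"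
      by (subst nn_integral_QM) auto
    also have "\<dots> = (\<integral>\<^sup>+z. \<integral>\<^sup>+x. mix (\<theta> \<rho> \<eta>) x z * (pw \<eta> \<mu> x * ennreal (g z)) \<partial>lborel \<partial>lborel)"
      by (intro nn_integral_swap lborel.sigma_finite_measure_axioms) measurable
    also have "\<dots> = (\<integral>\<^sup>+z. (\<integral>\<^sup>+x. mix (\<theta> \<rho> \<eta>) z x * pw \<eta> \<mu> x \<partial>lborel) * ennreal (g z) \<partial>lborel)"
      by (intro nn_integral_cong, subst nn_integral_multc[symmetric], measurable) (simp add: mix_commute mult.assoc)
    also have "\<dots> = (\<integral>\<^sup>+z. \<integral>\<^sup>+y. (\<integral>\<^sup>+x. mix (\<theta> \<rho> \<eta>) z x * mix (\<kappa> \<eta>) x y \<partial>lborel) * ennreal (g z) \<partial>\<mu> \<partial>lborel)"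
      by (intro nn_integral_cong, subst nn_integral_mix_pw[OF r], measurable) (subst nn_integral_multc, auto)
    also have "\<dots> = (\<integral>\<^sup>+y. \<integral>\<^sup>+z. (\<integral>\<^sup>+x. mix (\<theta> \<rho> \<eta>) z x * mix (\<kappa> \<eta>) x y \<partial>lborel) * ennreal (g z) \<partial>lborel \<partial>\<mu>)"
      by (intro nn_integral_swap M.sigma_finite_measure_axioms lborel.sigma_finite_measure_axioms) measurable
    finally show ?thesis .
  qed
  have 4: "(\<integral>\<^sup>+x. pw \<eta> \<mu> x * ennreal (g x) \<partial>lborel) = T \<rho> \<eta> \<mu> g + (\<integral>\<^sup>+p. pw \<eta> \<mu> (fst p) * ennreal (g (snd p)) \<partial>QM)"
  proof -
    have "(\<integral>\<^sup>+x. pw \<eta> \<mu> x * ennreal (g x) \<partial>lborel) = (\<integral>\<^sup>+y. \<integral>\<^sup>+z. mix (\<kappa> \<eta>) y z * ennreal (g z) \<partial>lborel \<partial>\<mu>)"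
      by (rule nn_integral_pw_mult[OF r]) measurable
    also have "\<dots> = (\<integral>\<^sup>+y. \<integral>\<^sup>+z. mix (hw \<rho> \<eta>) y z * ennreal (g z) + (\<integral>\<^sup>+x. mix (\<theta> \<rho> \<eta>) z x * mix (\<kappa> \<eta>) x y \<partial>lborel) * ennreal (g z) \<partial>lborel \<partial>\<mu>)"
    proof (intro nn_integral_cong)
      fix y z :: 'a
      have "mix (\<kappa> \<eta>) y z = mix (\<kappa> \<eta>) z y" by (rule mix_commute)
      also have "\<dots> = mix (hw \<rho> \<eta>) z y + (\<integral>\<^sup>+x. mix (\<theta> \<rho> \<eta>) z x * mix (\<kappa> \<eta>) x y \<partial>lborel)" by (rule mix_\<kappa>_eq[OF \<rho>])
      finally show "mix (\<kappa> \<eta>) y z * ennreal (g z) = mix (hw \<rho> \<eta>) y z * ennreal (g z) + (\<integral>\<^sup>+x. mix (\<theta> \<rho> \<eta>) z x * mix (\<kappa> \<eta>) x y \<partial>lborel) * ennreal (g z)"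
        by (simp add: mix_commute[of "hw \<rho> \<eta>"] distrib_right)
    qed
    also have "\<dots> = (\<integral>\<^sup>+y. (\<integral>\<^sup>+z. mix (hw \<rho> \<eta>) y z * ennreal (g z) \<partial>lborel) + (\<integral>\<^sup>+z. (\<integral>\<^sup>+x. mix (\<theta> \<rho> \<eta>) z x * mix (\<kappa> \<eta>) x y \<partial>lborel) * ennreal (g z) \<partial>lborel) \<partial>\<mu>)"
      by (intro nn_integral_cong nn_integral_add) measurable
    also have "\<dots> = T \<rho> \<eta> \<mu> g + (\<integral>\<^sup>+y. \<integral>\<^sup>+z. (\<integral>\<^sup>+x. mix (\<theta> \<rho> \<eta>) z x * mix (\<kappa> \<eta>) x y \<partial>lborel) * ennreal (g z) \<partial>lborel \<partial>\<mu>)"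
      unfolding T_def by (intro nn_integral_add) measurable
    finally show ?thesis unfolding 3 .
  qed
  define p q where "p = (\<integral>x. up \<eta> \<mu> x * g x \<partial>lborel)" and "q = (\<integral>p. up \<eta> \<mu> (fst p) * g (snd p) \<partial>QM)"
  have pq: "0 \<le> p" "0 \<le> q" unfolding p_def q_def using g by (auto intro!: integral_nonneg_AE)
  have eq: "ennreal p = T \<rho> \<eta> \<mu> g + ennreal q" using 4 unfolding 1 2 p_def q_def .
  then have "T \<rho> \<eta> \<mu> g \<noteq> \<top>" by (auto simp: ennreal_add_eq_top[symmetric] simp del: ennreal_add_eq_top)
  then obtain t where t: "T \<rho> \<eta> \<mu> g = ennreal t" "0 \<le> t" by (cases "T \<rho> \<eta> \<mu> g") auto
  have "p = t + q" using eq t pq by (simp flip: ennreal_plus)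
  then have "B (up \<eta> \<mu>) g = t" by (simp add: B_def p_def q_def)
  then show "T \<rho> \<eta> \<mu> g = ennreal (B (up \<eta> \<mu>) g)" "0 \<le> B (up \<eta> \<mu>) g" using t by auto
qed

text \<open>The difference of the potentials of \<open>P\<close> and \<open>L\<close> is
  \<open>F - F'\<close> with disjoint supports, and pairing it with \<open>F\<close> gives
  \<open>B F F - B F' F\<close>, which is at least \<open>B F F\<close>. Cauchy-Schwarz against the
  difference \<open>d\<close> of the other two potentials does the rest; \<open>B d d\<close> is the
  forerunner of the squared strong distance.\<close>

lemma domination_killed:
  assumes P: "P \<in> E_plus \<alpha>" and L: "L \<in> E_plus \<alpha>" and \<mu>\<^sub>1: "\<mu>\<^sub>1 \<in> E_plus \<alpha>" and \<mu>\<^sub>2: "\<mu>\<^sub>2 \<in> E_plus \<alpha>"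
  defines "F \<equiv> excess \<eta> P L" and "t \<equiv> \<lambda>\<mu> g. enn2real (T \<rho> \<eta> \<mu> g)"
  shows "(t \<mu>\<^sub>1 F - t \<mu>\<^sub>2 F)\<^sup>2 \<le> (t P F - t L F) *
    (t \<mu>\<^sub>1 (up \<eta> \<mu>\<^sub>1) - t \<mu>\<^sub>1 (up \<eta> \<mu>\<^sub>2) - t \<mu>\<^sub>2 (up \<eta> \<mu>\<^sub>1) + t \<mu>\<^sub>2 (up \<eta> \<mu>\<^sub>2))"
proof -
  have tB: "t \<mu> g = B (up \<eta> \<mu>) g" if "\<mu> \<in> E_plus \<alpha>" "g \<in> L2 lborel" "\<And>x. 0 \<le> g x" for \<mu> g
    using B_up[OF that] by (simp add: t_def)
  have u: "up \<eta> \<mu> \<in> L2 lborel" if "\<mu> \<in> E_plus \<alpha>" for \<mu> using up_L2[OF that \<eta>] .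
  have F: "F \<in> L2 lborel" "\<And>x. 0 \<le> F x" unfolding F_def using excess_L2[OF P L \<eta>] by auto
  define F' where "F' = excess \<eta> L P"
  have F': "F' \<in> L2 lborel" "\<And>x. 0 \<le> F' x" unfolding F'_def using excess_L2[OF L P \<eta>] by auto
  define d where "d = (\<lambda>x. up \<eta> \<mu>\<^sub>1 x + (-1) * up \<eta> \<mu>\<^sub>2 x)"
  have d: "d \<in> L2 lborel" unfolding d_def using u[OF \<mu>\<^sub>1] u[OF \<mu>\<^sub>2] by (rule L2_add)
  have "t P F - t L F = B (\<lambda>x. up \<eta> P x + (-1) * up \<eta> L x) F"
    using B_add_left[OF u[OF P] u[OF L] F(1), of "-1"] by (simp add: tB[OF P F] tB[OF L F])
  also have "(\<lambda>x. up \<eta> P x + (-1) * up \<eta> L x) = (\<lambda>x. F x + (-1) * F' x)"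
    by (auto simp: F_def F'_def excess_def)
  also have "B (\<lambda>x. F x + (-1) * F' x) F = B F F - B F' F"
    using B_add_left[OF F(1) F'(1) F(1), of "-1"] by simp
  finally have 1: "t P F - t L F = B F F - B F' F" .
  \<comment> \<open>Disjoint supports kill the Lebesgue term of \<open>B F' F\<close>; what remains
    is minus a nonnegative double integral.\<close>
  have "(\<lambda>x. F' x * F x) = (\<lambda>x. 0)" by (auto simp: F_def F'_def excess_def max_def)
  then have "B F' F = - (\<integral>p. F' (fst p) * F (snd p) \<partial>QM)" by (simp add: B_def)
  moreover have "0 \<le> (\<integral>p. F' (fst p) * F (snd p) \<partial>QM)" using F F' by (intro integral_nonneg_AE) auto
  ultimately have 2: "B F F \<le> t P F - t L F" using 1 by simp
  have 3: "t \<mu>\<^sub>1 F - t \<mu>\<^sub>2 F = B F d"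
    using B_add_left[OF u[OF \<mu>\<^sub>1] u[OF \<mu>\<^sub>2] F(1), of "-1"] B_commute[OF F(1) d]
    by (simp add: tB[OF \<mu>\<^sub>1 F] tB[OF \<mu>\<^sub>2 F] d_def)
  have dd: "B d (up \<eta> \<mu>) = t \<mu>\<^sub>1 (up \<eta> \<mu>) - t \<mu>\<^sub>2 (up \<eta> \<mu>)" if "\<mu> \<in> E_plus \<alpha>" for \<mu>
    using B_add_left[OF u[OF \<mu>\<^sub>1] u[OF \<mu>\<^sub>2] u[OF that], of "-1"]
    by (simp add: d_def tB[OF \<mu>\<^sub>1 u[OF that]] tB[OF \<mu>\<^sub>2 u[OF that]])
  have "B d d = B (up \<eta> \<mu>\<^sub>1) d + (-1) * B (up \<eta> \<mu>\<^sub>2) d"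
    using B_add_left[OF u[OF \<mu>\<^sub>1] u[OF \<mu>\<^sub>2] d, of "-1"] unfolding d_def[symmetric] .
  also have "\<dots> = t \<mu>\<^sub>1 (up \<eta> \<mu>\<^sub>1) - t \<mu>\<^sub>1 (up \<eta> \<mu>\<^sub>2) - t \<mu>\<^sub>2 (up \<eta> \<mu>\<^sub>1) + t \<mu>\<^sub>2 (up \<eta> \<mu>\<^sub>2)"
    using B_commute[OF u[OF \<mu>\<^sub>1] d] B_commute[OF u[OF \<mu>\<^sub>2] d] dd[OF \<mu>\<^sub>1] dd[OF \<mu>\<^sub>2]
      B_commute[OF u[OF \<mu>\<^sub>1] u[OF \<mu>\<^sub>2]] tB[OF \<mu>\<^sub>1 u[OF \<mu>\<^sub>2]] tB[OF \<mu>\<^sub>2 u[OF \<mu>\<^sub>1]] by simp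
  finally have 4: "B d d = t \<mu>\<^sub>1 (up \<eta> \<mu>\<^sub>1) - t \<mu>\<^sub>1 (up \<eta> \<mu>\<^sub>2) - t \<mu>\<^sub>2 (up \<eta> \<mu>\<^sub>1) + t \<mu>\<^sub>2 (up \<eta> \<mu>\<^sub>2)" .
  have "(B F d)\<^sup>2 \<le> B F F * B d d" by (rule B_CS[OF F(1) d])
  also have "\<dots> \<le> (t P F - t L F) * B d d" by (intro mult_right_mono 2 B_nonneg[OF d])
  finally show ?thesis unfolding 3 4 .
qed

end

section \<open>Heat averages of potentials and of their differences\<close>

lemma heat_tendsto_time:
  assumes "0 < t" "(s \<longlongrightarrow> t) F" shows "((\<lambda>n. heat (s n) x y) \<longlongrightarrow> heat t x y) F"
  unfolding heat_def using assms by (intro tendsto_intros) auto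

lemma heat_tendsto_space:
  assumes "(x \<longlongrightarrow> z) F" shows "((\<lambda>n. heat t (x n) y) \<longlongrightarrow> heat t z y) F"
  unfolding heat_def using assms
  by (cases "t = 0") (auto intro!: tendsto_intros)

text \<open>In terms of \<open>v = r / u\<close> the kernel is a constant times
  \<open>v powr k * exp (- v)\<close>, which is bounded over all positive \<open>v\<close>; the
  constant is finite because \<open>r > 0\<close>.\<close>

lemma heat_bounded_off_diagonal:
  fixes x y :: "'a::euclidean_space"
  assumes "x \<noteq> y" obtains M where "\<And>u. 0 < u \<Longrightarrow> heat u x y \<le> M"
proof -
  obtain C where C: "0 < C" "\<And>u::real. 0 \<le> u \<Longrightarrow> (1 + 2 * u) ^ DIM('a) \<le> C * exp (u / 1)"
    using one_plus_power_le_exp[of 1 "DIM('a)"] by auto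
  define k where "k = real DIM('a) / 2"
  define r where "r = (norm (x - y))\<^sup>2"
  have r: "0 < r" using assms by (simp add: r_def)
  have "heat u x y \<le> C * (pi * r) powr (- k)" if u: "0 < u" for u
  proof -
    define v where "v = r / u"
    have v: "0 < v" using r u by (simp add: v_def)
    have "v powr k \<le> (1 + 2 * v) powr k" using v by (intro powr_mono2) (auto simp: k_def)
    also have "\<dots> \<le> (1 + 2 * v) powr (real DIM('a))" using v by (intro powr_mono) (auto simp: k_def)
    also have "\<dots> = (1 + 2 * v) ^ DIM('a)" using v by (intro powr_realpow) auto
    also have "\<dots> \<le> C * exp v" using C(2)[of v] v by simp
    finally have "exp (- v) \<le> C * v powr (- k)" using v by (simp add: powr_minus exp_minus field_simps)
    then have "(pi * u) powr (- k) * exp (- v) \<le> (pi * u) powr (- k) * (C * v powr (- k))" by (intro mult_left_mono) auto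
    also have "\<dots> = C * ((pi * u) powr (- k) * v powr (- k))" by simp
    also have "(pi * u) powr (- k) * v powr (- k) = (pi * r) powr (- k)"
      unfolding powr_mult[symmetric] using u by (simp add: v_def)
    finally show ?thesis by (simp add: heat_def k_def v_def r_def)
  qed
  then show ?thesis by (rule that)
qed

context riesz begin

lemma mix_diagonal: "mix (\<kappa> 0) x (x::'a) = \<infinity>"
  using riesz_kernel_eq_mix[of x x] by (simp add: riesz_kernel_def)

text \<open>Off the diagonal the heat kernel is bounded in time, and killing makes the weight
  integrable, so dominated convergence applies.\<close>

lemma mix_smoothing_tendsto:
  fixes x y :: 'a
  assumes "x \<noteq> y" "0 < \<eta>" "\<And>n. 0 < s n" "s \<longlonglongrightarrow> 0"
  shows "(\<lambda>n. \<integral>\<^sup>+t. ennreal (\<kappa> \<eta> t) * ennreal (heat (s n + t) x y) \<partial>halfline) \<longlonglongrightarrow> mix (\<kappa> \<eta>) x y"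
proof -
  obtain M where M: "\<And>u. 0 < u \<Longrightarrow> heat u x y \<le> M" using heat_bounded_off_diagonal[OF assms(1)] by blast
  show ?thesis
    unfolding mix_def
  proof (rule nn_integral_dominated_convergence[where w="\<lambda>t. ennreal (\<kappa> \<eta> t) * ennreal M"])
    show "AE t in halfline. ennreal (\<kappa> \<eta> t) * ennreal (heat (s j + t) x y) \<le> ennreal (\<kappa> \<eta> t) * ennreal M" for j
      using AE_halfline
    proof eventually_elim
      case (elim t)
      then show ?case using assms(3)[of j] by (intro mult_left_mono ennreal_leI M) auto
    qed
    show "(\<integral>\<^sup>+t. ennreal (\<kappa> \<eta> t) * ennreal M \<partial>halfline) < \<infinity>"
      using nn_integral_\<kappa>_finite[OF assms(2)] by (subst nn_integral_multc) (auto simp: ennreal_mult_less_top)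
    show "AE t in halfline. (\<lambda>i. ennreal (\<kappa> \<eta> t) * ennreal (heat (s i + t) x y)) \<longlonglongrightarrow> ennreal (\<kappa> \<eta> t) * ennreal (heat t x y)"
      using AE_halfline
    proof eventually_elim
      case (elim t)
      have "(\<lambda>i. s i + t) \<longlonglongrightarrow> 0 + t" by (intro tendsto_intros assms)
      then show ?case using elim by (intro ennreal_tendsto_cmult tendsto_ennrealI heat_tendsto_time) auto
    qed
  qed measurable
qed

lemma smoothing_pw:
  assumes \<mu>: "radon \<mu>" and s: "0 < s"
  shows "(\<integral>\<^sup>+z. ennreal (heat s y z) * pw \<eta> \<mu> z \<partial>lborel)
    = (\<integral>\<^sup>+x. \<integral>\<^sup>+t. ennreal (\<kappa> \<eta> t) * ennreal (heat (s + t) y x) \<partial>halfline \<partial>\<mu>)"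
proof -
  have [measurable_cong]: "sets \<mu> = sets borel" using \<mu> by (simp add: radon_sets)
  interpret M: sigma_finite_measure \<mu> by (rule radon_sigma_finite[OF \<mu>])
  have "(\<integral>\<^sup>+z. ennreal (heat s y z) * pw \<eta> \<mu> z \<partial>lborel) = (\<integral>\<^sup>+z. \<integral>\<^sup>+x. ennreal (heat s y z) * mix (\<kappa> \<eta>) z x \<partial>\<mu> \<partial>lborel)"
    unfolding pw_def by (intro nn_integral_cong nn_integral_cmult[symmetric]) measurable
  also have "\<dots> = (\<integral>\<^sup>+x. \<integral>\<^sup>+z. ennreal (heat s y z) * mix (\<kappa> \<eta>) z x \<partial>lborel \<partial>\<mu>)"
    by (intro nn_integral_swap M.sigma_finite_measure_axioms lborel.sigma_finite_measure_axioms) measurable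
  also have "\<dots> = (\<integral>\<^sup>+x. \<integral>\<^sup>+t. ennreal (\<kappa> \<eta> t) * ennreal (heat (s + t) y x) \<partial>halfline \<partial>\<mu>)"
    using s by (intro nn_integral_cong heat_mix) auto
  finally show ?thesis .
qed

lemma smoothing_kernel_le:
  obtains C where "0 < C" "\<And>\<eta> s (x::'a) y. 0 \<le> \<eta> \<Longrightarrow> 0 < s \<Longrightarrow>
    (\<integral>\<^sup>+t. ennreal (\<kappa> \<eta> t) * ennreal (heat (s + t) x y) \<partial>halfline) \<le> ennreal C * mix (\<kappa> 0) x y"
proof -
  obtain C where C: "0 < C" "\<And>s (x::'a) y. 0 < s \<Longrightarrow>
    (\<integral>\<^sup>+t. ennreal (\<kappa> 0 t) * ennreal (heat (s + t) x y) \<partial>halfline) \<le> ennreal C * riesz_kernel \<alpha> x y"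
    using heat_\<kappa>_le by blast
  show ?thesis
  proof (rule that[OF C(1)])
    fix \<eta> s :: real and x y :: 'a assume *: "0 \<le> \<eta>" "0 < s"
    have "(\<integral>\<^sup>+t. ennreal (\<kappa> \<eta> t) * ennreal (heat (s + t) x y) \<partial>halfline)
      \<le> (\<integral>\<^sup>+t. ennreal (\<kappa> 0 t) * ennreal (heat (s + t) x y) \<partial>halfline)"
      using * by (intro nn_integral_halfline_mono mult_right_mono ennreal_leI \<kappa>_antimono) auto
    then show "(\<integral>\<^sup>+t. ennreal (\<kappa> \<eta> t) * ennreal (heat (s + t) x y) \<partial>halfline) \<le> ennreal C * mix (\<kappa> 0) x y"
      using C(2)[OF *(2), of x y] by (simp add: riesz_kernel_eq_mix)
  qed
qed

lemma smoothing_pw_le: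
  obtains C where "0 < C" "\<And>\<eta> s \<mu> y. 0 \<le> \<eta> \<Longrightarrow> 0 < s \<Longrightarrow> radon \<mu> \<Longrightarrow>
    (\<integral>\<^sup>+z. ennreal (heat s y z) * pw \<eta> \<mu> z \<partial>lborel) \<le> ennreal C * pw 0 \<mu> y"
proof -
  obtain C where C: "0 < C" "\<And>\<eta> s (x::'a) y. 0 \<le> \<eta> \<Longrightarrow> 0 < s \<Longrightarrow>
    (\<integral>\<^sup>+t. ennreal (\<kappa> \<eta> t) * ennreal (heat (s + t) x y) \<partial>halfline) \<le> ennreal C * mix (\<kappa> 0) x y"
    using smoothing_kernel_le by blast
  show ?thesis
  proof (rule that[OF C(1)])
    fix \<eta> s :: real and \<mu> :: "'a measure" and y assume *: "0 \<le> \<eta>" "0 < s" "radon \<mu>"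
    have [measurable_cong]: "sets \<mu> = sets borel" using * by (simp add: radon_sets)
    have "(\<integral>\<^sup>+z. ennreal (heat s y z) * pw \<eta> \<mu> z \<partial>lborel) \<le> (\<integral>\<^sup>+x. ennreal C * mix (\<kappa> 0) y x \<partial>\<mu>)"
      using * by (subst smoothing_pw) (auto intro!: nn_integral_mono C)
    also have "\<dots> = ennreal C * pw 0 \<mu> y" unfolding pw_def by (intro nn_integral_cmult) measurable
    finally show "(\<integral>\<^sup>+z. ennreal (heat s y z) * pw \<eta> \<mu> z \<partial>lborel) \<le> ennreal C * pw 0 \<mu> y" .
  qed
qed

lemma AE_mix_finite:
  assumes "radon \<mu>" "pw 0 \<mu> y < \<infinity>" shows "AE x in \<mu>. mix (\<kappa> 0) y x < \<infinity> \<and> x \<noteq> y"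
proof -
  have [measurable_cong]: "sets \<mu> = sets borel" using assms by (simp add: radon_sets)
  have "AE x in \<mu>. mix (\<kappa> 0) y x \<noteq> \<infinity>"
    using assms by (intro nn_integral_PInf_AE) (auto simp: pw_def)
  then show ?thesis by eventually_elim (auto simp: less_top mix_diagonal)
qed

text \<open>Finiteness of the potential without killing at \<open>y\<close> provides the integrable
  majorant and also shows that \<mu> has no atom at \<open>y\<close>, where the kernel is
  infinite.\<close>

lemma smoothing_pw_tendsto:
  assumes \<mu>: "radon \<mu>" and \<eta>: "0 < \<eta>" and s: "\<And>n. 0 < s n" "s \<longlonglongrightarrow> 0" and fin: "pw 0 \<mu> y < \<infinity>"
  shows "(\<lambda>n. \<integral>\<^sup>+z. ennreal (heat (s n) y z) * pw \<eta> \<mu> z \<partial>lborel) \<longlonglongrightarrow> pw \<eta> \<mu> y"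
proof -
  have [measurable_cong]: "sets \<mu> = sets borel" using \<mu> by (simp add: radon_sets)
  obtain C where C: "0 < C" "\<And>\<eta> s (x::'a) y. 0 \<le> \<eta> \<Longrightarrow> 0 < s \<Longrightarrow>
    (\<integral>\<^sup>+t. ennreal (\<kappa> \<eta> t) * ennreal (heat (s + t) x y) \<partial>halfline) \<le> ennreal C * mix (\<kappa> 0) x y"
    using smoothing_kernel_le by blast
  show ?thesis
    unfolding smoothing_pw[OF \<mu> s(1)] unfolding pw_def
  proof (rule nn_integral_dominated_convergence[where w="\<lambda>x. ennreal C * mix (\<kappa> 0) y x"])
    show "AE x in \<mu>. (\<integral>\<^sup>+t. ennreal (\<kappa> \<eta> t) * ennreal (heat (s j + t) y x) \<partial>halfline) \<le> ennreal C * mix (\<kappa> 0) y x" for j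
      using C(2) \<eta> s by auto
    show "(\<integral>\<^sup>+x. ennreal C * mix (\<kappa> 0) y x \<partial>\<mu>) < \<infinity>"
      using fin by (subst nn_integral_cmult) (auto simp: pw_def ennreal_mult_less_top)
    show "AE x in \<mu>. (\<lambda>i. \<integral>\<^sup>+t. ennreal (\<kappa> \<eta> t) * ennreal (heat (s i + t) y x) \<partial>halfline) \<longlonglongrightarrow> mix (\<kappa> \<eta>) y x"
      using AE_mix_finite[OF \<mu> fin] by eventually_elim (rule mix_smoothing_tendsto[OF _ \<eta> s], auto)
  qed measurable
qed

lemma mix_lsc:
  fixes x :: "nat \<Rightarrow> 'a"
  assumes [measurable]: "w \<in> borel_measurable borel" and "x \<longlonglongrightarrow> y"
  shows "mix w y z \<le> liminf (\<lambda>n. mix w (x n) z)"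
proof -
  have "mix w y z = (\<integral>\<^sup>+t. liminf (\<lambda>n. ennreal (w t) * ennreal (heat t (x n) z)) \<partial>halfline)"
    unfolding mix_def
  proof (rule nn_integral_cong)
    fix t
    have "(\<lambda>n. ennreal (w t) * ennreal (heat t (x n) z)) \<longlonglongrightarrow> ennreal (w t) * ennreal (heat t y z)"
      by (intro ennreal_tendsto_cmult tendsto_ennrealI heat_tendsto_space assms) simp
    then show "ennreal (w t) * ennreal (heat t y z) = liminf (\<lambda>n. ennreal (w t) * ennreal (heat t (x n) z))"
      by (intro lim_imp_Liminf[symmetric]) auto
  qed
  also have "\<dots> \<le> liminf (\<lambda>n. mix w (x n) z)"
    unfolding mix_def by (rule nn_integral_liminf) measurable
  finally show ?thesis .
qed

lemma pw_lsc:
  assumes \<mu>: "radon \<mu>" and "x \<longlonglongrightarrow> y"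
  shows "pw \<eta> \<mu> y \<le> liminf (\<lambda>n. pw \<eta> \<mu> (x n))"
proof -
  have [measurable_cong]: "sets \<mu> = sets borel" using \<mu> by (simp add: radon_sets)
  have "pw \<eta> \<mu> y \<le> (\<integral>\<^sup>+z. liminf (\<lambda>n. mix (\<kappa> \<eta>) (x n) z) \<partial>\<mu>)"
    unfolding pw_def by (intro nn_integral_mono mix_lsc assms) measurable
  also have "\<dots> \<le> liminf (\<lambda>n. pw \<eta> \<mu> (x n))"
    unfolding pw_def by (rule nn_integral_liminf) measurable
  finally show ?thesis .
qed

text \<open>The minimum of two lower semicontinuous functions is lower semicontinuous; after
  rescaling, Fatou's lemma against one fixed Gaussian gives the bound.\<close>

lemma smoothing_min_ge:
  assumes \<mu>: "radon \<mu>" and \<nu>: "radon \<nu>" and s: "\<And>n. 0 < s n" "s \<longlonglongrightarrow> 0"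
  shows "min (pw \<eta> \<mu> y) (pw \<eta> \<nu> y) \<le> liminf (\<lambda>n. \<integral>\<^sup>+z. ennreal (heat (s n) y z) * min (pw \<eta> \<mu> z) (pw \<eta> \<nu> z) \<partial>lborel)"
proof -
  define M where "M = (\<lambda>z. min (pw \<eta> \<mu> z) (pw \<eta> \<nu> z))"
  have [measurable]: "M \<in> borel_measurable borel"
    unfolding M_def using pw_measurable[OF \<mu>] pw_measurable[OF \<nu>] by measurable
  have lsc: "M y \<le> liminf (\<lambda>n. M (x n))" if "x \<longlonglongrightarrow> y" for x
  proof -
    have "\<forall>\<^sub>F n in sequentially. c < M (x n)" if "c < M y" for c
    proof -
      have "\<forall>\<^sub>F n in sequentially. c < pw \<eta> \<mu> (x n)" "\<forall>\<^sub>F n in sequentially. c < pw \<eta> \<nu> (x n)"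
        using pw_lsc[OF \<mu> \<open>x \<longlonglongrightarrow> y\<close>, of \<eta>] pw_lsc[OF \<nu> \<open>x \<longlonglongrightarrow> y\<close>, of \<eta>] \<open>c < M y\<close>
        by (auto simp: le_Liminf_iff M_def)
      then show ?thesis by eventually_elim (simp add: M_def)
    qed
    then show ?thesis by (simp add: le_Liminf_iff)
  qed
  have "M y = (\<integral>\<^sup>+z. ennreal (heat 1 0 (z::'a)) * M y \<partial>lborel)"
    by (subst nn_integral_multc) (auto simp: nn_integral_heat)
  also have "\<dots> \<le> (\<integral>\<^sup>+z. liminf (\<lambda>n. ennreal (heat 1 0 z) * M (y + sqrt (s n) *\<^sub>R z)) \<partial>lborel)"
  proof (rule nn_integral_mono)
    fix z :: 'a
    have "(\<lambda>i. y + sqrt (s i) *\<^sub>R z) \<longlonglongrightarrow> y + sqrt 0 *\<^sub>R z" by (intro tendsto_intros s)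
    then have "M y \<le> liminf (\<lambda>n. M (y + sqrt (s n) *\<^sub>R z))" by (intro lsc) simp
    then have "ennreal (heat 1 0 z) * M y \<le> ennreal (heat 1 0 z) * liminf (\<lambda>n. M (y + sqrt (s n) *\<^sub>R z))"
      by (rule mult_left_mono) simp
    also have "\<dots> \<le> liminf (\<lambda>n. ennreal (heat 1 0 z) * M (y + sqrt (s n) *\<^sub>R z))"
      by (subst Liminf_compose_continuous_mono[where f="\<lambda>v. ennreal (heat 1 0 z) * v", symmetric])
        (auto intro!: ennreal_continuous_on_cmult continuous_on_id monoI mult_left_mono)
    finally show "ennreal (heat 1 0 z) * M y \<le> liminf (\<lambda>n. ennreal (heat 1 0 z) * M (y + sqrt (s n) *\<^sub>R z))" .
  qed
  also have "\<dots> \<le> liminf (\<lambda>n. \<integral>\<^sup>+z. ennreal (heat 1 0 z) * M (y + sqrt (s n) *\<^sub>R z) \<partial>lborel)"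
    by (rule nn_integral_liminf) measurable
  also have "\<dots> = liminf (\<lambda>n. \<integral>\<^sup>+z. ennreal (heat (s n) y z) * M z \<partial>lborel)"
    by (subst nn_integral_heat_affine) (auto simp: s)
  finally show ?thesis by (simp add: M_def)
qed

text \<open>The upper bound comes from each potential separately, the lower one from
  semicontinuity.\<close>

lemma smoothing_min_tendsto:
  assumes \<mu>: "radon \<mu>" and \<nu>: "radon \<nu>" and \<eta>: "0 < \<eta>" and s: "\<And>n. 0 < s n" "s \<longlonglongrightarrow> 0"
    and fin: "pw 0 \<mu> y < \<infinity>" "pw 0 \<nu> y < \<infinity>"
  shows "(\<lambda>n. \<integral>\<^sup>+z. ennreal (heat (s n) y z) * min (pw \<eta> \<mu> z) (pw \<eta> \<nu> z) \<partial>lborel) \<longlonglongrightarrow> min (pw \<eta> \<mu> y) (pw \<eta> \<nu> y)"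
proof -
  let ?c = "\<lambda>n. \<integral>\<^sup>+z. ennreal (heat (s n) y z) * min (pw \<eta> \<mu> z) (pw \<eta> \<nu> z) \<partial>lborel"
  have "limsup ?c \<le> limsup (\<lambda>n. \<integral>\<^sup>+z. ennreal (heat (s n) y z) * pw \<eta> \<mu> z \<partial>lborel)"
    by (intro Limsup_mono always_eventually allI nn_integral_mono mult_left_mono) auto
  also have "\<dots> = pw \<eta> \<mu> y" using smoothing_pw_tendsto[OF \<mu> \<eta> s fin(1)] by (intro lim_imp_Limsup) auto
  finally have 1: "limsup ?c \<le> pw \<eta> \<mu> y" .
  have "limsup ?c \<le> limsup (\<lambda>n. \<integral>\<^sup>+z. ennreal (heat (s n) y z) * pw \<eta> \<nu> z \<partial>lborel)"
    by (intro Limsup_mono always_eventually allI nn_integral_mono mult_left_mono) auto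
  also have "\<dots> = pw \<eta> \<nu> y" using smoothing_pw_tendsto[OF \<nu> \<eta> s fin(2)] by (intro lim_imp_Limsup) auto
  finally have "limsup ?c \<le> min (pw \<eta> \<mu> y) (pw \<eta> \<nu> y)" using 1 by simp
  note le = this
  have ge: "min (pw \<eta> \<mu> y) (pw \<eta> \<nu> y) \<le> liminf ?c" by (rule smoothing_min_ge[OF \<mu> \<nu> s])
  have "liminf ?c \<le> limsup ?c" by (rule Liminf_le_Limsup) simp
  then have "liminf ?c = min (pw \<eta> \<mu> y) (pw \<eta> \<nu> y)" "limsup ?c = min (pw \<eta> \<mu> y) (pw \<eta> \<nu> y)"
    by (rule antisym[OF order_trans[OF _ le] ge], rule antisym[OF le order_trans[OF ge]])
  then show ?thesis by (subst tendsto_iff_Liminf_eq_Limsup) auto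
qed

text \<open>A positive part of a difference of potentials is in general not semicontinuous. It
  equals the potential of \<open>P\<close> minus the minimum of both potentials, and the averages of
  these two converge.\<close>

lemma smoothing_excess_tendsto:
  assumes P: "P \<in> E_plus \<alpha>" and L: "L \<in> E_plus \<alpha>" and \<eta>: "0 < \<eta>" and s: "\<And>n. 0 < s n" "s \<longlonglongrightarrow> 0"
    and fin: "pw 0 P y < \<infinity>" "pw 0 L y < \<infinity>"
  shows "(\<lambda>n. \<integral>\<^sup>+z. ennreal (heat (s n) y z) * ennreal (excess \<eta> P L z) \<partial>lborel) \<longlonglongrightarrow> ennreal (excess \<eta> P L y)"
proof -
  have rP: "radon P" and rL: "radon L" using P L by (auto intro: E_plus_radon)
  have [measurable]: "pw \<eta> P \<in> borel_measurable borel" "pw \<eta> L \<in> borel_measurable borel" "excess \<eta> P L \<in> borel_measurable borel"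
    using rP rL by (auto intro: pw_measurable excess_measurable)
  let ?a = "\<lambda>n. \<integral>\<^sup>+z. ennreal (heat (s n) y z) * pw \<eta> P z \<partial>lborel"
  let ?c = "\<lambda>n. \<integral>\<^sup>+z. ennreal (heat (s n) y z) * min (pw \<eta> P z) (pw \<eta> L z) \<partial>lborel"
  let ?g = "\<lambda>n. \<integral>\<^sup>+z. ennreal (heat (s n) y z) * ennreal (excess \<eta> P L z) \<partial>lborel"
  have split: "pw \<eta> P z = ennreal (excess \<eta> P L z) + min (pw \<eta> P z) (pw \<eta> L z)"
    if "pw \<eta> P z = ennreal (up \<eta> P z)" "pw \<eta> L z = ennreal (up \<eta> L z)" for z
    unfolding that excess_def by (auto simp: min_def max_def simp flip: ennreal_plus)
  have up: "pw \<eta> \<mu> y = ennreal (up \<eta> \<mu> y)" if "pw 0 \<mu> y < \<infinity>" for \<mu>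
    using that pw_le[of \<eta> \<mu> y] \<eta> by (auto simp: up_def less_top intro!: ennreal_enn2real[symmetric] intro: order_le_less_trans)
  have fa: "pw \<eta> P y < \<top>" "min (pw \<eta> P y) (pw \<eta> L y) < \<top>" unfolding up[OF fin(1)] by (auto simp: min_less_iff_disj)
  have ag: "?a n = ?g n + ?c n" for n
  proof -
    have "?a n = (\<integral>\<^sup>+z. ennreal (heat (s n) y z) * ennreal (excess \<eta> P L z) + ennreal (heat (s n) y z) * min (pw \<eta> P z) (pw \<eta> L z) \<partial>lborel)"
    proof (rule nn_integral_cong_AE)
      show "AE z in lborel. ennreal (heat (s n) y z) * pw \<eta> P z = ennreal (heat (s n) y z) * ennreal (excess \<eta> P L z) + ennreal (heat (s n) y z) * min (pw \<eta> P z) (pw \<eta> L z)"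
        using AE_lborel_pw_finite[OF P \<eta>] AE_lborel_pw_finite[OF L \<eta>]
      proof eventually_elim
        case (elim z)
        show ?case by (subst split[OF elim]) (rule distrib_left)
      qed
    qed
    also have "\<dots> = ?g n + ?c n" by (rule nn_integral_add) measurable
    finally show ?thesis .
  qed
  have c: "?c \<longlonglongrightarrow> min (pw \<eta> P y) (pw \<eta> L y)" by (rule smoothing_min_tendsto[OF rP rL \<eta> s fin])
  have a: "?a \<longlonglongrightarrow> pw \<eta> P y" by (rule smoothing_pw_tendsto[OF rP \<eta> s fin(1)])
  have "(\<lambda>n. ?a n - ?c n) \<longlonglongrightarrow> pw \<eta> P y - min (pw \<eta> P y) (pw \<eta> L y)"
    using fa by (intro tendsto_diff_ennreal a c) auto
  moreover have "\<forall>\<^sub>F n in sequentially. ?a n - ?c n = ?g n"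
    using order_tendstoD(2)[OF c fa(2)]
    by eventually_elim (simp only: ag, rule ennreal_add_diff_cancel_right, auto)
  ultimately have "?g \<longlonglongrightarrow> pw \<eta> P y - min (pw \<eta> P y) (pw \<eta> L y)" by (rule Lim_transform_eventually)
  also have "pw \<eta> P y - min (pw \<eta> P y) (pw \<eta> L y) = ennreal (excess \<eta> P L y)"
    using fa(2) fin by (subst split[OF up up]) (auto intro: ennreal_add_diff_cancel_right)
  finally show ?thesis .
qed

lemma smoothing_excess_le:
  "(\<integral>\<^sup>+z. ennreal (heat s y z) * ennreal (excess \<eta> P L z) \<partial>lborel) \<le> (\<integral>\<^sup>+z. ennreal (heat s y z) * pw \<eta> P z \<partial>lborel)"
  by (intro nn_integral_mono mult_left_mono order_trans[OF ennreal_leI[OF excess_le] ennreal_up_le]) auto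

text \<open>The majorant is a multiple of the potential of \<open>P\<close>, whose integral against
  \<mu> is a finite mutual energy.\<close>

lemma smoothing_integral_tendsto:
  assumes P: "P \<in> E_plus \<alpha>" and L: "L \<in> E_plus \<alpha>" and \<mu>: "\<mu> \<in> E_plus \<alpha>" and \<eta>: "0 < \<eta>"
  shows "((\<lambda>t. \<integral>\<^sup>+y. \<integral>\<^sup>+z. ennreal (heat t y z) * ennreal (excess \<eta> P L z) \<partial>lborel \<partial>\<mu>) \<longlongrightarrow> (\<integral>\<^sup>+y. ennreal (excess \<eta> P L y) \<partial>\<mu>)) (at_right 0)"
proof (rule tendsto_at_right_sequentially[where b=1])
  fix s :: "nat \<Rightarrow> real" assume s: "\<And>n. 0 < s n" "s \<longlonglongrightarrow> 0"
  have rP: "radon P" and rL: "radon L" and r: "radon \<mu>" using P L \<mu> by (auto intro: E_plus_radon)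
  have [measurable_cong]: "sets \<mu> = sets borel" using r by (simp add: radon_sets)
  have [measurable]: "pw 0 P \<in> borel_measurable borel" "excess \<eta> P L \<in> borel_measurable borel"
    using rP rL by (auto intro: pw_measurable excess_measurable)
  obtain C where C: "0 < C" "\<And>\<eta> s \<mu> y. 0 \<le> \<eta> \<Longrightarrow> 0 < s \<Longrightarrow> radon \<mu> \<Longrightarrow>
    (\<integral>\<^sup>+z. ennreal (heat s y z) * pw \<eta> \<mu> z \<partial>lborel) \<le> ennreal C * pw 0 \<mu> y"
    using smoothing_pw_le by blast
  show "(\<lambda>n. \<integral>\<^sup>+y. \<integral>\<^sup>+z. ennreal (heat (s n) y z) * ennreal (excess \<eta> P L z) \<partial>lborel \<partial>\<mu>) \<longlonglongrightarrow> (\<integral>\<^sup>+y. ennreal (excess \<eta> P L y) \<partial>\<mu>)"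
  proof (rule nn_integral_dominated_convergence[where w="\<lambda>y. ennreal C * pw 0 P y"])
    show "AE y in \<mu>. (\<integral>\<^sup>+z. ennreal (heat (s j) y z) * ennreal (excess \<eta> P L z) \<partial>lborel) \<le> ennreal C * pw 0 P y" for j
      using \<eta> s(1)[of j] by (intro AE_I2 order_trans[OF smoothing_excess_le] C rP) auto
    show "(\<integral>\<^sup>+y. ennreal C * pw 0 P y \<partial>\<mu>) < \<infinity>"
      using mutual_energy_finite[OF \<mu> P] mutual_energy_pw[OF r rP]
      by (subst nn_integral_cmult) (auto simp: ennreal_mult_less_top)
    show "AE y in \<mu>. (\<lambda>i. \<integral>\<^sup>+z. ennreal (heat (s i) y z) * ennreal (excess \<eta> P L z) \<partial>lborel) \<longlonglongrightarrow> ennreal (excess \<eta> P L y)"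
      using AE_pw_finite[OF \<mu> P] AE_pw_finite[OF \<mu> L]
      by eventually_elim (rule smoothing_excess_tendsto[OF P L \<eta> s])
  qed measurable
qed simp

lemma nn_integral_excess_finite:
  assumes P: "P \<in> E_plus \<alpha>" and \<mu>: "\<mu> \<in> E_plus \<alpha>" and \<eta>: "0 \<le> \<eta>"
  shows "(\<integral>\<^sup>+y. ennreal (excess \<eta> P L y) \<partial>\<mu>) < \<infinity>"
proof -
  have "(\<integral>\<^sup>+y. ennreal (excess \<eta> P L y) \<partial>\<mu>) \<le> (\<integral>\<^sup>+y. pw 0 P y \<partial>\<mu>)"
    using \<eta> by (intro nn_integral_mono order_trans[OF ennreal_leI[OF excess_le] order_trans[OF ennreal_up_le pw_le]])
  also have "\<dots> < \<infinity>" using mutual_energy_finite[OF \<mu> P] mutual_energy_pw[of \<mu> P] P \<mu> by (simp add: E_plus_radon)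
  finally show ?thesis .
qed

lemma T_tendsto:
  assumes P: "P \<in> E_plus \<alpha>" and L: "L \<in> E_plus \<alpha>" and \<mu>: "\<mu> \<in> E_plus \<alpha>" and \<eta>: "0 < \<eta>"
  shows "((\<lambda>\<rho>. enn2real (T \<rho> \<eta> \<mu> (excess \<eta> P L)) / enn2real (H \<eta> \<rho>)) \<longlongrightarrow> enn2real (\<integral>\<^sup>+y. ennreal (excess \<eta> P L y) \<partial>\<mu>)) (at_right 0)"
proof -
  have rP: "radon P" and rL: "radon L" and r: "radon \<mu>" using P L \<mu> by (auto intro: E_plus_radon)
  have [measurable_cong]: "sets \<mu> = sets borel" using r by (simp add: radon_sets)
  interpret M: sigma_finite_measure \<mu> by (rule radon_sigma_finite[OF r])
  have [measurable]: "excess \<eta> P L \<in> borel_measurable borel" using rP rL by (rule excess_measurable)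
  define J where "J = (\<lambda>t. \<integral>\<^sup>+y. \<integral>\<^sup>+z. ennreal (heat t y z) * ennreal (excess \<eta> P L z) \<partial>lborel \<partial>\<mu>)"
  have Jm: "J \<in> borel_measurable borel" unfolding J_def by measurable
  have T: "T \<rho> \<eta> \<mu> (excess \<eta> P L) = (\<integral>\<^sup>+t. ennreal (hw \<rho> \<eta> t) * J t \<partial>halfline)" for \<rho>
    unfolding T_def J_def by (rule nn_integral_hw_halfline[OF _ _ r]) measurable
  have "(\<integral>\<^sup>+t. ennreal (\<kappa> \<eta> t) * J t \<partial>halfline) = (\<integral>\<^sup>+y. \<integral>\<^sup>+z. mix (\<kappa> \<eta>) y z * ennreal (excess \<eta> P L z) \<partial>lborel \<partial>\<mu>)"
    unfolding J_def by (rule nn_integral_hw_halfline[OF _ _ r, symmetric]) measurable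
  also have "\<dots> \<le> (\<integral>\<^sup>+y. \<integral>\<^sup>+z. mix (\<kappa> \<eta>) y z * pw \<eta> P z \<partial>lborel \<partial>\<mu>)"
    by (intro nn_integral_mono mult_left_mono order_trans[OF ennreal_leI[OF excess_le] ennreal_up_le]) auto
  also have "\<dots> < \<infinity>" by (rule nn_integral_mix_pw_finite[OF P \<mu> \<eta>])
  finally have fin: "(\<integral>\<^sup>+t. ennreal (\<kappa> \<eta> t) * J t \<partial>halfline) < \<infinity>" .
  have lim: "(J \<longlongrightarrow> (\<integral>\<^sup>+y. ennreal (excess \<eta> P L y) \<partial>\<mu>)) (at_right 0)"
    unfolding J_def by (rule smoothing_integral_tendsto[OF P L \<mu> \<eta>])
  have "((\<lambda>\<rho>. T \<rho> \<eta> \<mu> (excess \<eta> P L) / H \<eta> \<rho>) \<longlongrightarrow> (\<integral>\<^sup>+y. ennreal (excess \<eta> P L y) \<partial>\<mu>)) (at_right 0)"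
    unfolding T using \<eta> by (intro approx_identity[OF Jm _ fin lim]) simp
  then have "((\<lambda>\<rho>. enn2real (T \<rho> \<eta> \<mu> (excess \<eta> P L) / H \<eta> \<rho>)) \<longlongrightarrow> enn2real (\<integral>\<^sup>+y. ennreal (excess \<eta> P L y) \<partial>\<mu>)) (at_right 0)"
    using nn_integral_excess_finite[OF P \<mu>, of \<eta> L] \<eta> ennreal_enn2real[of "\<integral>\<^sup>+y. ennreal (excess \<eta> P L y) \<partial>\<mu>"]
    by (intro tendsto_enn2real) auto
  \<comment> \<open>\<open>B_up\<close> provides the finiteness of \<open>T\<close>, so that
    \<open>enn2real\<close> commutes with the division.\<close>
  moreover have "\<forall>\<^sub>F \<rho> in at_right 0. enn2real (T \<rho> \<eta> \<mu> (excess \<eta> P L) / H \<eta> \<rho>) = enn2real (T \<rho> \<eta> \<mu> (excess \<eta> P L)) / enn2real (H \<eta> \<rho>)"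
  proof (rule eventually_at_rightI[of 0 1])
    fix \<rho> :: real assume "\<rho> \<in> {0<..<1}"
    then have \<rho>: "0 < \<rho>" "\<rho> < 1" by auto
    interpret K: riesz_killed \<alpha> n \<rho> \<eta> using \<rho> \<eta> by unfold_locales
    have "T \<rho> \<eta> \<mu> (excess \<eta> P L) = ennreal (K.B (up \<eta> \<mu>) (excess \<eta> P L))" "0 \<le> K.B (up \<eta> \<mu>) (excess \<eta> P L)"
      by (intro K.B_up \<mu> excess_L2 P L \<eta> excess_nonneg)+
    moreover obtain h where "H \<eta> \<rho> = ennreal h" "0 < h"
      using H_pos[of \<eta> \<rho>] H_finite[of \<eta> \<rho>] \<rho> \<eta> by (cases "H \<eta> \<rho>") auto
    ultimately show "enn2real (T \<rho> \<eta> \<mu> (excess \<eta> P L) / H \<eta> \<rho>) = enn2real (T \<rho> \<eta> \<mu> (excess \<eta> P L)) / enn2real (H \<eta> \<rho>)"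
      by (simp add: divide_ennreal)
  qed simp
  ultimately show ?thesis by (rule Lim_transform_eventually)
qed

lemma null_E_plus: "(null_measure borel :: 'a measure) \<in> E_plus \<alpha>"
proof -
  have "radon (null_measure borel :: 'a measure)" by (simp add: radon_def)
  then show ?thesis by (simp add: E_plus_def energy_def mutual_energy_potential)
qed

text \<open>Potentials are the case of a zero second measure, so every limit statement for excesses
  contains the one for potentials.\<close>

lemma excess_null: "excess \<eta> P (null_measure borel) = up \<eta> P"
  by (auto simp: excess_def up_def pw_def)

definition I :: "'a measure \<Rightarrow> ('a \<Rightarrow> real) \<Rightarrow> real" where
  "I \<mu> g = enn2real (\<integral>\<^sup>+y. ennreal (g y) \<partial>\<mu>)"

lemma domination_pos:
  assumes P: "P \<in> E_plus \<alpha>" and L: "L \<in> E_plus \<alpha>" and \<mu>\<^sub>1: "\<mu>\<^sub>1 \<in> E_plus \<alpha>" and \<mu>\<^sub>2: "\<mu>\<^sub>2 \<in> E_plus \<alpha>" and \<eta>: "0 < \<eta>"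
  defines "F \<equiv> excess \<eta> P L"
  shows "(I \<mu>\<^sub>1 F - I \<mu>\<^sub>2 F)\<^sup>2 \<le> (I P F - I L F) *
    (I \<mu>\<^sub>1 (up \<eta> \<mu>\<^sub>1) - I \<mu>\<^sub>1 (up \<eta> \<mu>\<^sub>2) - I \<mu>\<^sub>2 (up \<eta> \<mu>\<^sub>1) + I \<mu>\<^sub>2 (up \<eta> \<mu>\<^sub>2))"
proof -
  define t where "t = (\<lambda>\<rho> \<mu> g. enn2real (T \<rho> \<eta> \<mu> g) / enn2real (H \<eta> \<rho>))"
  have tF: "((\<lambda>\<rho>. t \<rho> \<mu> F) \<longlongrightarrow> I \<mu> F) (at_right 0)" if "\<mu> \<in> E_plus \<alpha>" for \<mu>
    unfolding t_def F_def I_def by (rule T_tendsto[OF P L that \<eta>])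
  have tu: "((\<lambda>\<rho>. t \<rho> \<mu> (up \<eta> \<nu>)) \<longlongrightarrow> I \<mu> (up \<eta> \<nu>)) (at_right 0)" if "\<mu> \<in> E_plus \<alpha>" "\<nu> \<in> E_plus \<alpha>" for \<mu> \<nu>
    using T_tendsto[OF that(2) null_E_plus that(1) \<eta>] unfolding t_def I_def excess_null .
  show ?thesis
  proof (rule tendsto_le[of "at_right (0::real)"])
    show "((\<lambda>\<rho>. (t \<rho> \<mu>\<^sub>1 F - t \<rho> \<mu>\<^sub>2 F)\<^sup>2) \<longlongrightarrow> (I \<mu>\<^sub>1 F - I \<mu>\<^sub>2 F)\<^sup>2) (at_right 0)"
      by (intro tendsto_intros tF \<mu>\<^sub>1 \<mu>\<^sub>2)
    show "((\<lambda>\<rho>. (t \<rho> P F - t \<rho> L F) * (t \<rho> \<mu>\<^sub>1 (up \<eta> \<mu>\<^sub>1) - t \<rho> \<mu>\<^sub>1 (up \<eta> \<mu>\<^sub>2) - t \<rho> \<mu>\<^sub>2 (up \<eta> \<mu>\<^sub>1) + t \<rho> \<mu>\<^sub>2 (up \<eta> \<mu>\<^sub>2)))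
      \<longlongrightarrow> (I P F - I L F) * (I \<mu>\<^sub>1 (up \<eta> \<mu>\<^sub>1) - I \<mu>\<^sub>1 (up \<eta> \<mu>\<^sub>2) - I \<mu>\<^sub>2 (up \<eta> \<mu>\<^sub>1) + I \<mu>\<^sub>2 (up \<eta> \<mu>\<^sub>2))) (at_right 0)"
      by (intro tendsto_intros tF tu P L \<mu>\<^sub>1 \<mu>\<^sub>2)
    show "\<forall>\<^sub>F \<rho> in at_right 0. (t \<rho> \<mu>\<^sub>1 F - t \<rho> \<mu>\<^sub>2 F)\<^sup>2 \<le> (t \<rho> P F - t \<rho> L F) * (t \<rho> \<mu>\<^sub>1 (up \<eta> \<mu>\<^sub>1) - t \<rho> \<mu>\<^sub>1 (up \<eta> \<mu>\<^sub>2) - t \<rho> \<mu>\<^sub>2 (up \<eta> \<mu>\<^sub>1) + t \<rho> \<mu>\<^sub>2 (up \<eta> \<mu>\<^sub>2))"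
    proof (rule eventually_at_rightI[of 0 1])
      fix \<rho> :: real assume "\<rho> \<in> {0<..<1}"
      then interpret K: riesz_killed \<alpha> n \<rho> \<eta> using \<eta> by unfold_locales auto
      define h where "h = enn2real (H \<eta> \<rho>)"
      \<comment> \<open>Both sides are homogeneous of degree 2 in the values of \<open>T\<close>, so
        division by \<open>h\<^sup>2\<close> normalizes all of them at once.\<close>
      note dom = K.domination_killed[OF P L \<mu>\<^sub>1 \<mu>\<^sub>2, folded F_def]
      show "(t \<rho> \<mu>\<^sub>1 F - t \<rho> \<mu>\<^sub>2 F)\<^sup>2 \<le> (t \<rho> P F - t \<rho> L F) * (t \<rho> \<mu>\<^sub>1 (up \<eta> \<mu>\<^sub>1) - t \<rho> \<mu>\<^sub>1 (up \<eta> \<mu>\<^sub>2) - t \<rho> \<mu>\<^sub>2 (up \<eta> \<mu>\<^sub>1) + t \<rho> \<mu>\<^sub>2 (up \<eta> \<mu>\<^sub>2))"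
        using divide_right_mono[OF dom, of "h\<^sup>2"]
        unfolding t_def h_def[symmetric] diff_divide_distrib[symmetric] add_divide_distrib[symmetric] power_divide
        by (simp add: power2_eq_square)
    qed simp
  qed simp
qed

lemma mix_\<kappa>_tendsto:
  assumes "mix (\<kappa> 0) x (y::'a) < \<infinity>" "\<And>n. 0 \<le> e n" "e \<longlonglongrightarrow> 0"
  shows "(\<lambda>n. mix (\<kappa> (e n)) x y) \<longlonglongrightarrow> mix (\<kappa> 0) x y"
  unfolding mix_def
proof (rule nn_integral_dominated_convergence[where w="\<lambda>t. ennreal (\<kappa> 0 t) * ennreal (heat t x y)"])
  show "AE t in halfline. ennreal (\<kappa> (e j) t) * ennreal (heat t x y) \<le> ennreal (\<kappa> 0 t) * ennreal (heat t x y)" for j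
    using AE_halfline by eventually_elim (intro mult_right_mono ennreal_leI \<kappa>_antimono assms, auto)
  show "(\<integral>\<^sup>+t. ennreal (\<kappa> 0 t) * ennreal (heat t x y) \<partial>halfline) < \<infinity>"
    using assms(1) by (simp add: mix_def)
  show "AE t in halfline. (\<lambda>i. ennreal (\<kappa> (e i) t) * ennreal (heat t x y)) \<longlonglongrightarrow> ennreal (\<kappa> 0 t) * ennreal (heat t x y)"
  proof (intro AE_I2)
    fix t
    have "(\<lambda>i. \<kappa> (e i) t * heat t x y) \<longlonglongrightarrow> \<kappa> 0 t * heat t x y"
      unfolding \<kappa>_def by (intro tendsto_intros assms)
    then have "(\<lambda>i. ennreal (\<kappa> (e i) t * heat t x y)) \<longlonglongrightarrow> ennreal (\<kappa> 0 t * heat t x y)" by (rule tendsto_ennrealI)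
    then show "(\<lambda>i. ennreal (\<kappa> (e i) t) * ennreal (heat t x y)) \<longlonglongrightarrow> ennreal (\<kappa> 0 t) * ennreal (heat t x y)"
      by (simp add: ennreal_mult)
  qed
qed measurable

lemma up_tendsto:
  assumes \<mu>: "radon \<mu>" and fin: "pw 0 \<mu> y < \<infinity>" and e: "\<And>n. 0 \<le> e n" "e \<longlonglongrightarrow> 0"
  shows "(\<lambda>n. up (e n) \<mu> y) \<longlonglongrightarrow> up 0 \<mu> y"
proof -
  have [measurable_cong]: "sets \<mu> = sets borel" using \<mu> by (simp add: radon_sets)
  have "(\<lambda>n. pw (e n) \<mu> y) \<longlonglongrightarrow> pw 0 \<mu> y"
    unfolding pw_def
  proof (rule nn_integral_dominated_convergence[where w="\<lambda>x. mix (\<kappa> 0) y x"])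
    show "AE x in \<mu>. mix (\<kappa> (e j)) y x \<le> mix (\<kappa> 0) y x" for j by (intro AE_I2 mix_\<kappa>_mono e)
    show "(\<integral>\<^sup>+x. mix (\<kappa> 0) y x \<partial>\<mu>) < \<infinity>" using fin by (simp add: pw_def)
    show "AE x in \<mu>. (\<lambda>i. mix (\<kappa> (e i)) y x) \<longlonglongrightarrow> mix (\<kappa> 0) y x"
      using AE_mix_finite[OF \<mu> fin] by eventually_elim (rule mix_\<kappa>_tendsto[OF _ e], simp)
  qed measurable
  then show ?thesis
    unfolding up_def using fin by (intro tendsto_enn2real) auto
qed

lemma I_excess_tendsto:
  assumes P: "P \<in> E_plus \<alpha>" and L: "L \<in> E_plus \<alpha>" and \<mu>: "\<mu> \<in> E_plus \<alpha>" and e: "\<And>n. 0 \<le> e n" "e \<longlonglongrightarrow> 0"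
  shows "(\<lambda>n. I \<mu> (excess (e n) P L)) \<longlonglongrightarrow> I \<mu> (excess 0 P L)"
proof -
  have rP: "radon P" and rL: "radon L" and r: "radon \<mu>" using P L \<mu> by (auto intro: E_plus_radon)
  have [measurable_cong]: "sets \<mu> = sets borel" using r by (simp add: radon_sets)
  have [measurable]: "pw 0 P \<in> borel_measurable borel" "\<And>\<eta>. excess \<eta> P L \<in> borel_measurable borel"
    using rP rL by (auto intro: pw_measurable excess_measurable)
  have "(\<lambda>n. \<integral>\<^sup>+y. ennreal (excess (e n) P L y) \<partial>\<mu>) \<longlonglongrightarrow> (\<integral>\<^sup>+y. ennreal (excess 0 P L y) \<partial>\<mu>)"
  proof (rule nn_integral_dominated_convergence[where w="pw 0 P"])
    show "AE y in \<mu>. ennreal (excess (e j) P L y) \<le> pw 0 P y" for j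
      using e by (intro AE_I2 order_trans[OF ennreal_leI[OF excess_le] order_trans[OF ennreal_up_le pw_le]])
    show "(\<integral>\<^sup>+y. pw 0 P y \<partial>\<mu>) < \<infinity>" using mutual_energy_finite[OF \<mu> P] by (simp add: mutual_energy_pw r rP)
    show "AE y in \<mu>. (\<lambda>i. ennreal (excess (e i) P L y)) \<longlonglongrightarrow> ennreal (excess 0 P L y)"
      using AE_pw_finite[OF \<mu> P] AE_pw_finite[OF \<mu> L]
      by eventually_elim (unfold excess_def, intro tendsto_ennrealI tendsto_intros up_tendsto rP rL e)
  qed measurable
  then show ?thesis
    unfolding I_def using nn_integral_excess_finite[OF P \<mu>, of 0 L] by (intro tendsto_enn2real) auto
qed

lemma I_up: "\<mu> \<in> E_plus \<alpha> \<Longrightarrow> \<nu> \<in> E_plus \<alpha> \<Longrightarrow> I \<mu> (up 0 \<nu>) = enn2real (mutual_energy \<alpha> \<mu> \<nu>)"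
proof -
  assume *: "\<mu> \<in> E_plus \<alpha>" "\<nu> \<in> E_plus \<alpha>"
  have "(\<integral>\<^sup>+y. ennreal (up 0 \<nu> y) \<partial>\<mu>) = (\<integral>\<^sup>+y. pw 0 \<nu> y \<partial>\<mu>)"
  proof (rule nn_integral_cong_AE)
    show "AE y in \<mu>. ennreal (up 0 \<nu> y) = pw 0 \<nu> y"
      using AE_pw_finite[OF *] by eventually_elim (simp add: up_def less_top)
  qed
  then show ?thesis using * by (simp add: I_def mutual_energy_pw E_plus_radon)
qed

lemma domination:
  assumes P: "P \<in> E_plus \<alpha>" and L: "L \<in> E_plus \<alpha>" and \<mu>\<^sub>1: "\<mu>\<^sub>1 \<in> E_plus \<alpha>" and \<mu>\<^sub>2: "\<mu>\<^sub>2 \<in> E_plus \<alpha>"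
  shows "(I \<mu>\<^sub>1 (excess 0 P L) - I \<mu>\<^sub>2 (excess 0 P L))\<^sup>2 \<le> I P (excess 0 P L) * (\<integral>p. (\<Phi> \<mu>\<^sub>1 p - \<Phi> \<mu>\<^sub>2 p)\<^sup>2 \<partial>SM)"
proof -
  define e where "e = (\<lambda>n. 1 / real (Suc n))"
  have e: "\<And>n. 0 \<le> e n" "\<And>n. 0 < e n" "e \<longlonglongrightarrow> 0"
    using LIMSEQ_inverse_real_of_nat by (auto simp: e_def inverse_eq_divide)
  note IF = I_excess_tendsto[OF P L _ e(1,3)]
  have Iu: "(\<lambda>n. I \<mu> (up (e n) \<nu>)) \<longlonglongrightarrow> enn2real (mutual_energy \<alpha> \<mu> \<nu>)" if "\<mu> \<in> E_plus \<alpha>" "\<nu> \<in> E_plus \<alpha>" for \<mu> \<nu>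
    using I_excess_tendsto[OF that(2) null_E_plus that(1) e(1,3)] unfolding excess_null I_up[OF that] .
  let ?m = "\<lambda>\<mu> \<nu>. enn2real (mutual_energy \<alpha> \<mu> \<nu>)"
  let ?F = "excess 0 P L"
  have "(I \<mu>\<^sub>1 ?F - I \<mu>\<^sub>2 ?F)\<^sup>2 \<le> (I P ?F - I L ?F) * (?m \<mu>\<^sub>1 \<mu>\<^sub>1 - ?m \<mu>\<^sub>1 \<mu>\<^sub>2 - ?m \<mu>\<^sub>2 \<mu>\<^sub>1 + ?m \<mu>\<^sub>2 \<mu>\<^sub>2)"
  proof (rule LIMSEQ_le)
    show "(\<lambda>n. (I \<mu>\<^sub>1 (excess (e n) P L) - I \<mu>\<^sub>2 (excess (e n) P L))\<^sup>2) \<longlonglongrightarrow> (I \<mu>\<^sub>1 ?F - I \<mu>\<^sub>2 ?F)\<^sup>2"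
      by (intro tendsto_intros IF \<mu>\<^sub>1 \<mu>\<^sub>2)
    show "(\<lambda>n. (I P (excess (e n) P L) - I L (excess (e n) P L)) *
        (I \<mu>\<^sub>1 (up (e n) \<mu>\<^sub>1) - I \<mu>\<^sub>1 (up (e n) \<mu>\<^sub>2) - I \<mu>\<^sub>2 (up (e n) \<mu>\<^sub>1) + I \<mu>\<^sub>2 (up (e n) \<mu>\<^sub>2)))
      \<longlonglongrightarrow> (I P ?F - I L ?F) * (?m \<mu>\<^sub>1 \<mu>\<^sub>1 - ?m \<mu>\<^sub>1 \<mu>\<^sub>2 - ?m \<mu>\<^sub>2 \<mu>\<^sub>1 + ?m \<mu>\<^sub>2 \<mu>\<^sub>2)"
      by (intro tendsto_intros IF Iu P L \<mu>\<^sub>1 \<mu>\<^sub>2)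
  qed (use domination_pos[OF P L \<mu>\<^sub>1 \<mu>\<^sub>2 e(2)] in auto)
  also have "?m \<mu>\<^sub>1 \<mu>\<^sub>1 - ?m \<mu>\<^sub>1 \<mu>\<^sub>2 - ?m \<mu>\<^sub>2 \<mu>\<^sub>1 + ?m \<mu>\<^sub>2 \<mu>\<^sub>2 = (\<integral>p. (\<Phi> \<mu>\<^sub>1 p - \<Phi> \<mu>\<^sub>2 p)\<^sup>2 \<partial>SM)"
  proof -
    note i = mutual_energy_\<Phi>(1)[OF \<mu>\<^sub>1 \<mu>\<^sub>1] mutual_energy_\<Phi>(1)[OF \<mu>\<^sub>1 \<mu>\<^sub>2] mutual_energy_\<Phi>(1)[OF \<mu>\<^sub>2 \<mu>\<^sub>1] mutual_energy_\<Phi>(1)[OF \<mu>\<^sub>2 \<mu>\<^sub>2]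
    have m: "?m \<mu> \<nu> = (\<integral>p. \<Phi> \<mu> p * \<Phi> \<nu> p \<partial>SM)" if "\<mu> \<in> E_plus \<alpha>" "\<nu> \<in> E_plus \<alpha>" for \<mu> \<nu>
      using mutual_energy_\<Phi>(2)[OF that] by (simp add: integral_nonneg_AE)
    have "(\<integral>p. (\<Phi> \<mu>\<^sub>1 p - \<Phi> \<mu>\<^sub>2 p)\<^sup>2 \<partial>SM) = (\<integral>p. \<Phi> \<mu>\<^sub>1 p * \<Phi> \<mu>\<^sub>1 p - \<Phi> \<mu>\<^sub>1 p * \<Phi> \<mu>\<^sub>2 p - \<Phi> \<mu>\<^sub>2 p * \<Phi> \<mu>\<^sub>1 p + \<Phi> \<mu>\<^sub>2 p * \<Phi> \<mu>\<^sub>2 p \<partial>SM)"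
      by (intro Bochner_Integration.integral_cong) (auto simp: power2_eq_square algebra_simps)
    also have "\<dots> = ?m \<mu>\<^sub>1 \<mu>\<^sub>1 - ?m \<mu>\<^sub>1 \<mu>\<^sub>2 - ?m \<mu>\<^sub>2 \<mu>\<^sub>1 + ?m \<mu>\<^sub>2 \<mu>\<^sub>2"
      using i by (simp add: m \<mu>\<^sub>1 \<mu>\<^sub>2 mult.commute)
    finally show ?thesis ..
  qed
  \<comment> \<open>Only \<open>I P ?F\<close> is kept: a zero integral against \<open>P\<close>
    alone then forces \<open>?F\<close> to have equal integrals against any two measures of finite
    energy.\<close>
  also have "(I P ?F - I L ?F) * (\<integral>p. (\<Phi> \<mu>\<^sub>1 p - \<Phi> \<mu>\<^sub>2 p)\<^sup>2 \<partial>SM) \<le> I P ?F * (\<integral>p. (\<Phi> \<mu>\<^sub>1 p - \<Phi> \<mu>\<^sub>2 p)\<^sup>2 \<partial>SM)"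
    by (intro mult_right_mono integral_nonneg_AE) (auto simp: I_def)
  finally show ?thesis .
qed

end

section \<open>Tightness and weak convergence\<close>

text \<open>Coordinatewise rounding down to the dyadic lattice of mesh \<open>1 / 2 ^ k\<close>;
  rounding down, unlike rounding to the nearest point, makes the levels nest.\<close>

definition grid :: "nat \<Rightarrow> 'a::euclidean_space \<Rightarrow> 'a" where
  "grid k x = (\<Sum>b\<in>Basis. (of_int \<lfloor>2 ^ k * (x \<bullet> b)\<rfloor> / 2 ^ k) *\<^sub>R b)"

lemma grid_inner: "b \<in> Basis \<Longrightarrow> grid k x \<bullet> b = of_int \<lfloor>2 ^ k * (x \<bullet> b)\<rfloor> / 2 ^ k"
  by (simp add: grid_def)

lemma borel_measurable_grid [measurable]: "grid k \<in> borel_measurable borel"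
  unfolding grid_def[abs_def] by measurable

lemma grid_vimage: "A \<in> sets borel \<Longrightarrow> grid k -` A \<in> sets borel"
  using measurable_sets[OF borel_measurable_grid, of A k] by simp

text \<open>The coarse floor is the integer quotient of the fine floor by
  \<open>2 ^ (k - i)\<close>. This is what makes the limit laws at different levels
  consistent.\<close>

lemma grid_grid:
  assumes "i \<le> k" shows "grid i (grid k x) = grid i x"
proof (rule euclidean_eqI)
  fix b :: 'a assume b: "b \<in> Basis"
  define y where "y = 2 ^ k * (x \<bullet> b)"
  have k: "(2::real) ^ k = 2 ^ i * 2 ^ (k - i)" using assms by (simp flip: power_add)
  have N: "of_int (2 ^ (k - i)) = (2::real) ^ (k - i)" by simp
  have "2 ^ i * (of_int \<lfloor>y\<rfloor> / 2 ^ k :: real) = of_int \<lfloor>y\<rfloor> / of_int (2 ^ (k - i))"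
    unfolding k N by simp
  then have "\<lfloor>2 ^ i * (of_int \<lfloor>y\<rfloor> / 2 ^ k :: real)\<rfloor> = \<lfloor>y\<rfloor> div 2 ^ (k - i)"
    by (simp only: floor_divide_of_int_eq)
  moreover have "\<lfloor>2 ^ i * (x \<bullet> b)\<rfloor> = \<lfloor>y\<rfloor> div 2 ^ (k - i)"
  proof -
    have "2 ^ i * (x \<bullet> b) = y / of_int (2 ^ (k - i))" unfolding y_def k N by simp
    then show ?thesis by (simp only: floor_divide_real_eq_div zero_le_power zero_le_numeral)
  qed
  ultimately show "grid i (grid k x) \<bullet> b = grid i x \<bullet> b"
    using b by (simp add: grid_inner y_def)
qed

lemma norm_grid_diff: "norm (grid k x - x) \<le> real DIM('a) / 2 ^ k" for x :: "'a::euclidean_space"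
proof -
  have "norm (grid k x - x) \<le> (\<Sum>b\<in>Basis. \<bar>(grid k x - x) \<bullet> b\<bar>)" by (rule norm_le_l1)
  also have "\<dots> \<le> (\<Sum>b\<in>(Basis::'a set). 1 / 2 ^ k)"
  proof (rule sum_mono)
    fix b :: 'a assume b: "b \<in> Basis"
    define y where "y = 2 ^ k * (x \<bullet> b)"
    have "x \<bullet> b = y / 2 ^ k" by (simp add: y_def)
    then have "(grid k x - x) \<bullet> b = (of_int \<lfloor>y\<rfloor> - y) / 2 ^ k"
      using b by (simp add: inner_diff_left grid_inner y_def diff_divide_distrib)
    moreover have "\<bar>of_int \<lfloor>y\<rfloor> - y\<bar> \<le> 1" by linarith
    ultimately show "\<bar>(grid k x - x) \<bullet> b\<bar> \<le> 1 / 2 ^ k" by (simp add: divide_right_mono)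
  qed
  finally show ?thesis by simp
qed

lemma grid_image: "grid k ` S \<subseteq> (\<lambda>f. \<Sum>b\<in>Basis. (of_int (f b) / 2 ^ k) *\<^sub>R b) ` (PiE Basis (\<lambda>b. (\<lambda>x. \<lfloor>2 ^ k * (x \<bullet> b)\<rfloor>) ` S))"
proof
  fix y :: 'a assume "y \<in> grid k ` S"
  then obtain x where x: "x \<in> S" "y = grid k x" by auto
  define f where "f = (\<lambda>b\<in>Basis. \<lfloor>2 ^ k * (x \<bullet> b)\<rfloor>)"
  have "y = (\<Sum>b\<in>Basis. (of_int (f b) / 2 ^ k) *\<^sub>R b)"
    unfolding x grid_def by (intro sum.cong) (auto simp: f_def)
  moreover have "f \<in> PiE Basis (\<lambda>b. (\<lambda>x. \<lfloor>2 ^ k * (x \<bullet> b)\<rfloor>) ` S)" using x by (auto simp: f_def)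
  ultimately show "y \<in> (\<lambda>f. \<Sum>b\<in>Basis. (of_int (f b) / 2 ^ k) *\<^sub>R b) ` (PiE Basis (\<lambda>b. (\<lambda>x. \<lfloor>2 ^ k * (x \<bullet> b)\<rfloor>) ` S))"
    by blast
qed

lemma countable_range_grid: "countable (range (grid k))"
  by (rule countable_subset[OF grid_image]) (auto intro!: countable_PiE)

lemma finite_grid_cball: "finite (grid k ` cball (0::'a::euclidean_space) r)"
proof (rule finite_subset[OF grid_image], rule finite_imageI, rule finite_PiE)
  fix b :: 'a assume b: "b \<in> Basis"
  have "(\<lambda>x. \<lfloor>2 ^ k * (x \<bullet> b)\<rfloor>) ` cball 0 r \<subseteq> {\<lfloor>- (2 ^ k * r)\<rfloor>..\<lfloor>2 ^ k * r\<rfloor>}"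
  proof safe
    fix x :: 'a assume "x \<in> cball 0 r"
    then have "\<bar>x \<bullet> b\<bar> \<le> r" using Basis_le_norm[OF b, of x] by simp
    then have "- r \<le> x \<bullet> b" "x \<bullet> b \<le> r" by auto
    then have "2 ^ k * (- r) \<le> 2 ^ k * (x \<bullet> b)" "2 ^ k * (x \<bullet> b) \<le> 2 ^ k * r"
      by (intro mult_left_mono; simp)+
    then show "\<lfloor>2 ^ k * (x \<bullet> b)\<rfloor> \<in> {\<lfloor>- (2 ^ k * r)\<rfloor>..\<lfloor>2 ^ k * r\<rfloor>}" by (auto intro: floor_mono)
  qed
  then show "finite ((\<lambda>x. \<lfloor>2 ^ k * (x \<bullet> b)\<rfloor>) ` cball 0 r)" by (rule finite_subset) simp
qed simp

text \<open>
  A weak limit of a tight sequence whose masses on all dyadic cubes converge is the law of a limit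
  of dyadic approximations; their joint law exists by Kolmogorov's extension theorem.
\<close>

locale tight_sequence =
  fixes M :: "nat \<Rightarrow> 'a::euclidean_space measure" and p :: "nat \<Rightarrow> 'a \<Rightarrow> real"
  assumes prob: "\<And>j. prob_space (M j)" and sets_M: "\<And>j. sets (M j) = sets borel"
    and tight: "\<And>\<epsilon>. 0 < \<epsilon> \<Longrightarrow> \<exists>r. \<forall>j. measure (M j) (- cball 0 r) \<le> \<epsilon>"
    and lim: "\<And>k y. y \<in> range (grid k) \<Longrightarrow> (\<lambda>j. measure (M j) (grid k -` {y})) \<longlonglongrightarrow> p k y"
begin

lemma sets_M' [measurable_cong]: "sets (M j) = sets borel" by (rule sets_M)

lemma space_M [simp]: "space (M j) = UNIV"
  using sets_eq_imp_space_eq[OF sets_M] by simp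

abbreviation G :: "nat \<Rightarrow> 'a set" where "G k \<equiv> range (grid k)"

text \<open>The discrete law with the limiting cell masses, moved to the Borel sets so that all
  levels live on one measurable space.\<close>

definition N :: "nat \<Rightarrow> 'a measure" where
  "N k = distr (density (count_space (G k)) (\<lambda>y. ennreal (p k y))) borel (\<lambda>y. y)"

lemma sets_N [simp, measurable_cong]: "sets (N k) = sets borel"
  by (simp add: N_def)

lemma space_N [simp]: "space (N k) = UNIV"
  by (simp add: N_def)

lemma nn_integral_N:
  assumes [measurable]: "f \<in> borel_measurable borel"
  shows "(\<integral>\<^sup>+y. f y \<partial>N k) = (\<integral>\<^sup>+y. ennreal (p k y) * f y \<partial>count_space (G k))"
  unfolding N_def by (subst nn_integral_distr) (auto simp: nn_integral_density)

lemma nn_integral_M_grid: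
  assumes [measurable]: "f \<in> borel_measurable borel"
  shows "(\<integral>\<^sup>+x. f (grid k x) \<partial>M j) = (\<integral>\<^sup>+y. ennreal (measure (M j) (grid k -` {y})) * f y \<partial>count_space (G k))"
proof -
  interpret prob_space "M j" by (rule prob)
  have [measurable]: "grid k \<in> M j \<rightarrow>\<^sub>M count_space (G k)"
    by (subst measurable_count_space_eq_countable[OF countable_range_grid])
      (auto intro!: grid_vimage simp: sets_M)
  let ?D = "distr (M j) (count_space (G k)) (grid k)"
  have "?D = density (count_space (G k)) (\<lambda>y. ennreal (measure (M j) (grid k -` {y})))"
  proof (rule measure_eqI_countable[of _ "G k"])
    fix y assume "y \<in> G k"
    then show "emeasure ?D {y} = emeasure (density (count_space (G k)) (\<lambda>y. ennreal (measure (M j) (grid k -` {y})))) {y}"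
      by (simp add: emeasure_distr emeasure_density emeasure_eq_measure)
  qed (auto simp: countable_range_grid)
  then have "(\<integral>\<^sup>+y. f y \<partial>?D) = (\<integral>\<^sup>+y. ennreal (measure (M j) (grid k -` {y})) * f y \<partial>count_space (G k))"
    by (simp add: nn_integral_density)
  then show ?thesis by (subst (asm) nn_integral_distr) auto
qed

text \<open>Fatou's lemma for the counting measure on the lattice, applied to the cell
  masses.\<close>

lemma nn_integral_N_le_liminf:
  fixes f :: "'a \<Rightarrow> real"
  assumes [measurable]: "f \<in> borel_measurable borel"
  shows "(\<integral>\<^sup>+y. ennreal (f y) \<partial>N k) \<le> liminf (\<lambda>j. \<integral>\<^sup>+x. ennreal (f (grid k x)) \<partial>M j)"
proof -
  have borel_measurable_ennreal_f: "(\<lambda>y. ennreal (f y)) \<in> borel_measurable borel" by measurable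
  have "(\<integral>\<^sup>+y. ennreal (f y) \<partial>N k) = (\<integral>\<^sup>+y. liminf (\<lambda>j. ennreal (measure (M j) (grid k -` {y})) * ennreal (f y)) \<partial>count_space (G k))"
    unfolding nn_integral_N[OF borel_measurable_ennreal_f]
  proof (rule nn_integral_cong)
    fix y assume "y \<in> space (count_space (G k))"
    then have l: "(\<lambda>j. ennreal (measure (M j) (grid k -` {y}))) \<longlonglongrightarrow> ennreal (p k y)" using lim by auto
    show "ennreal (p k y) * ennreal (f y) = liminf (\<lambda>j. ennreal (measure (M j) (grid k -` {y})) * ennreal (f y))"
      by (intro lim_imp_Liminf[symmetric]) (auto intro!: ennreal_tendsto_cmult l simp: mult.commute[of _ "ennreal (f y)"])
  qed
  also have "\<dots> \<le> liminf (\<lambda>j. \<integral>\<^sup>+x. ennreal (f (grid k x)) \<partial>M j)"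
    unfolding nn_integral_M_grid[OF borel_measurable_ennreal_f] by (rule nn_integral_liminf) simp
  finally show ?thesis .
qed

text \<open>Fatou bounds the total mass by 1. Conversely, tightness confines all but \<epsilon> of
  the mass to a ball, which meets finitely many cells only, and finite sums pass to the
  limit.\<close>

lemma prob_N: "prob_space (N k)"
proof
  have "emeasure (N k) UNIV = (\<integral>\<^sup>+y. ennreal 1 \<partial>N k)" by simp
  also have "\<dots> \<le> liminf (\<lambda>j. \<integral>\<^sup>+x. ennreal 1 \<partial>M j)" by (rule nn_integral_N_le_liminf) simp
  also have "\<dots> = 1" using prob_space.emeasure_space_1[OF prob] by (simp add: Liminf_const)
  finally have le: "emeasure (N k) UNIV \<le> 1" .
  have eps: "ennreal (1 - \<epsilon>) \<le> emeasure (N k) UNIV" if \<epsilon>: "0 < \<epsilon>" for \<epsilon> :: real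
  proof -
    obtain r where r: "\<And>j. measure (M j) (- cball 0 r) \<le> \<epsilon>" using tight[OF \<epsilon>] by blast
    define S where "S = grid k ` cball (0::'a) r"
    have S: "finite S" "S \<subseteq> G k" by (auto simp: S_def finite_grid_cball)
    have "1 - \<epsilon> \<le> (\<Sum>y\<in>S. measure (M j) (grid k -` {y}))" for j
    proof -
      interpret prob_space "M j" by (rule prob)
      have m: "grid k -` {y} \<in> sets (M j)" for y
        using measurable_sets[OF borel_measurable_grid, of "{y}" k] by (simp add: sets_M)
      have "measure (M j) (cball 0 r) = 1 - measure (M j) (- cball 0 r)"
        using prob_compl[of "cball 0 r"] by (simp add: sets_M Compl_eq_Diff_UNIV)
      then have "1 - \<epsilon> \<le> measure (M j) (cball 0 r)" using r[of j] by simp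
      also have "\<dots> \<le> measure (M j) (\<Union>y\<in>S. grid k -` {y})"
        using S m by (intro finite_measure_mono sets.finite_UN) (auto simp: S_def)
      also have "\<dots> = (\<Sum>y\<in>S. measure (M j) (grid k -` {y}))"
        using S m by (intro finite_measure_finite_Union) (auto simp: disjoint_family_on_def)
      finally show ?thesis .
    qed
    moreover have "(\<lambda>j. \<Sum>y\<in>S. measure (M j) (grid k -` {y})) \<longlonglongrightarrow> (\<Sum>y\<in>S. p k y)"
      using S by (intro tendsto_sum lim) auto
    ultimately have "1 - \<epsilon> \<le> (\<Sum>y\<in>S. p k y)" by (intro LIMSEQ_le_const) auto
    moreover have p0: "0 \<le> p k y" if "y \<in> G k" for y
      using lim[OF that] by (rule LIMSEQ_le_const) auto
    ultimately have "ennreal (1 - \<epsilon>) \<le> (\<Sum>y\<in>S. ennreal (p k y))"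
      using S by (subst sum_ennreal) (auto simp: ennreal_leI)
    also have "\<dots> = (\<integral>\<^sup>+y. ennreal (p k y) * indicator S y \<partial>count_space (G k))"
      using S by (subst nn_integral_indicator_finite)
        (auto intro!: sum.cong simp: emeasure_count_space_finite[of "{_}"])
    also have "\<dots> \<le> (\<integral>\<^sup>+y. ennreal (p k y) * 1 \<partial>count_space (G k))"
      by (intro nn_integral_mono mult_left_mono) (auto simp: indicator_def)
    also have "\<dots> = emeasure (N k) UNIV" using nn_integral_N[of "\<lambda>_. 1" k] by simp
    finally show ?thesis .
  qed
  have "1 \<le> emeasure (N k) UNIV"
  proof (rule ennreal_le_epsilon)
    fix e :: real assume e: "0 < e"
    have "1 \<le> ennreal (1 - e) + ennreal e"
    proof (cases "e \<le> 1")
      case True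
      then have "ennreal (1 - e) + ennreal e = ennreal (1 - e + e)" using e by (intro ennreal_plus[symmetric]) auto
      then show ?thesis by simp
    next
      case False
      then have "ennreal 1 \<le> ennreal e" by (intro ennreal_leI) simp
      then show ?thesis by (simp add: add_increasing)
    qed
    also have "\<dots> \<le> emeasure (N k) UNIV + ennreal e" by (intro add_right_mono eps e)
    finally show "1 \<le> emeasure (N k) UNIV + ennreal e" .
  qed
  with le show "emeasure (N k) (space (N k)) = 1" by simp
qed

lemma integral_grid_tendsto:
  fixes f :: "'a \<Rightarrow> real"
  assumes [measurable]: "f \<in> borel_measurable borel" and B: "\<And>x. \<bar>f x\<bar> \<le> B"
  shows "(\<lambda>j. \<integral>x. f (grid k x) \<partial>M j) \<longlonglongrightarrow> (\<integral>y. f y \<partial>N k)"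
proof -
  interpret N: prob_space "N k" by (rule prob_N)
  \<comment> \<open>Adding \<open>B\<close> makes \<open>h\<close> nonnegative, so Fatou's lemma
    yields a lower bound; applied to \<open>f\<close> and to \<open>- f\<close> it gives both halves
    of the limit.\<close>
  have half: "\<forall>\<^sub>F j in sequentially. c < (\<integral>x. h (grid k x) \<partial>M j)"
    if [measurable]: "h \<in> borel_measurable borel" and h: "\<And>x. \<bar>h x\<bar> \<le> B" and c: "c < (\<integral>y. h y \<partial>N k)" for h :: "'a \<Rightarrow> real" and c
  proof -
    have h0: "0 \<le> h x + B" "\<bar>h x + B\<bar> \<le> 2 * B" for x using h[of x] by auto
    have iN: "integrable (N k) (\<lambda>y. h y + B)"
      by (rule N.integrable_const_bound[where B="2 * B"]) (use h0 in auto)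
    have iM: "integrable (M j) (\<lambda>x. h (grid k x) + B)" for j
    proof -
      interpret prob_space "M j" by (rule prob)
      show ?thesis by (rule integrable_const_bound[where B="2 * B"]) (use h0 in auto)
    qed
    have N: "(\<integral>\<^sup>+y. ennreal (h y + B) \<partial>N k) = ennreal ((\<integral>y. h y \<partial>N k) + B)"
    proof -
      have "(\<integral>\<^sup>+y. ennreal (h y + B) \<partial>N k) = ennreal (\<integral>y. h y + B \<partial>N k)"
        by (rule nn_integral_eq_integral[OF iN]) (use h0 in auto)
      also have "(\<integral>y. h y + B \<partial>N k) = (\<integral>y. h y \<partial>N k) + B"
        using N.integrable_const_bound[of h B] h N.prob_space by (subst Bochner_Integration.integral_add) auto
      finally show ?thesis .
    qed
    have M: "(\<integral>\<^sup>+x. ennreal (h (grid k x) + B) \<partial>M j) = ennreal ((\<integral>x. h (grid k x) \<partial>M j) + B)" for j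
    proof -
      interpret prob_space "M j" by (rule prob)
      have "(\<integral>\<^sup>+x. ennreal (h (grid k x) + B) \<partial>M j) = ennreal (\<integral>x. h (grid k x) + B \<partial>M j)"
        by (rule nn_integral_eq_integral[OF iM]) (use h0 in auto)
      also have "(\<integral>x. h (grid k x) + B \<partial>M j) = (\<integral>x. h (grid k x) \<partial>M j) + B"
        using integrable_const_bound[of "\<lambda>x. h (grid k x)" B] h prob_space by (subst Bochner_Integration.integral_add) auto
      finally show ?thesis .
    qed
    have "ennreal ((\<integral>y. h y \<partial>N k) + B) \<le> liminf (\<lambda>j. ennreal ((\<integral>x. h (grid k x) \<partial>M j) + B))"
      unfolding N[symmetric] M[symmetric] by (rule nn_integral_N_le_liminf) measurable
    moreover have "ennreal (c + B) < ennreal ((\<integral>y. h y \<partial>N k) + B) \<or> c + B < 0"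
      using c by (auto simp: ennreal_less_iff)
    moreover have nonneg: "0 \<le> (\<integral>x. h (grid k x) \<partial>M j) + B" for j
    proof -
      interpret prob_space "M j" by (rule prob)
      have "0 \<le> (\<integral>x. h (grid k x) + B \<partial>M j)" using h0 by (intro integral_nonneg_AE) auto
      also have "(\<integral>x. h (grid k x) + B \<partial>M j) = (\<integral>x. h (grid k x) \<partial>M j) + B"
        using integrable_const_bound[of "\<lambda>x. h (grid k x)" B] h prob_space by (subst Bochner_Integration.integral_add) auto
      finally show ?thesis .
    qed
    ultimately show ?thesis
    proof (cases "c + B < 0")
      \<comment> \<open>\<open>ennreal\<close> truncates a negative \<open>c + B\<close> to 0, so
        this case rests on nonnegativity instead.\<close>
      case True
      have "c < (\<integral>x. h (grid k x) \<partial>M j)" for j using nonneg[of j] True by simp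
      then show ?thesis by simp
    next
      case False
      assume le: "ennreal ((\<integral>y. h y \<partial>N k) + B) \<le> liminf (\<lambda>j. ennreal ((\<integral>x. h (grid k x) \<partial>M j) + B))"
        and "ennreal (c + B) < ennreal ((\<integral>y. h y \<partial>N k) + B) \<or> c + B < 0"
      then have "ennreal (c + B) < ennreal ((\<integral>y. h y \<partial>N k) + B)" using False by simp
      then have "\<forall>\<^sub>F j in sequentially. ennreal (c + B) < ennreal ((\<integral>x. h (grid k x) \<partial>M j) + B)"
        using le unfolding le_Liminf_iff by blast
      then show ?thesis by eventually_elim (use False in \<open>simp add: ennreal_less_iff\<close>)
    qed
  qed
  show ?thesis
  proof (rule order_tendstoI)
    fix a assume "a < (\<integral>y. f y \<partial>N k)"
    then show "\<forall>\<^sub>F j in sequentially. a < (\<integral>x. f (grid k x) \<partial>M j)" by (intro half B) measurable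
  next
    fix a assume "(\<integral>y. f y \<partial>N k) < a"
    then have "- a < (\<integral>y. - f y \<partial>N k)" by simp
    then have "\<forall>\<^sub>F j in sequentially. - a < (\<integral>x. - f (grid k x) \<partial>M j)"
      using B by (intro half) auto
    then show "\<forall>\<^sub>F j in sequentially. (\<integral>x. f (grid k x) \<partial>M j) < a" by simp
  qed
qed

lemma measure_grid_tendsto:
  assumes [measurable]: "A \<in> sets borel"
  shows "(\<lambda>j. measure (M j) (grid k -` A)) \<longlonglongrightarrow> measure (N k) A"
proof -
  have "(\<integral>x. indicator A (grid k x) \<partial>M j) = measure (M j) (grid k -` A)" for j
    by (simp add: indicator_vimage[symmetric])
  then show ?thesis using integral_grid_tendsto[of "indicator A" 1 k] by simp
qed

text \<open>Preimages under a coarser rounding are unions of finer cells, so both sides are limits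
  of the same masses.\<close>

lemma distr_N_grid:
  assumes "i \<le> k" shows "distr (N k) borel (grid i) = N i"
proof (rule measure_eqI)
  interpret N: prob_space "N k" by (rule prob_N)
  interpret N': prob_space "N i" by (rule prob_N)
  fix A assume "A \<in> sets (distr (N k) borel (grid i))"
  then have [measurable]: "A \<in> sets borel" by simp
  have v: "grid i -` A \<in> sets borel" using measurable_sets[OF borel_measurable_grid, of A i] by simp
  have "grid k -` (grid i -` A) = grid i -` A" using grid_grid[OF assms] by auto
  then have "(\<lambda>j. measure (M j) (grid i -` A)) \<longlonglongrightarrow> measure (N k) (grid i -` A)"
    using measure_grid_tendsto[OF v, of k] by simp
  then have "measure (N k) (grid i -` A) = measure (N i) A"
    using measure_grid_tendsto[of A i] by (intro LIMSEQ_unique) auto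
  then show "emeasure (distr (N k) borel (grid i)) A = emeasure (N i) A"
    by (simp add: emeasure_distr N.emeasure_eq_measure N'.emeasure_eq_measure)
qed simp

text \<open>The finest level occurring in \<open>J\<close>; inserting 0 covers the empty index
  set.\<close>

definition K :: "nat set \<Rightarrow> nat" where "K J = Max (insert 0 J)"

lemma K_ge: "finite J \<Longrightarrow> i \<in> J \<Longrightarrow> i \<le> K J"
  unfolding K_def by (intro Max_ge) auto

definition P :: "nat set \<Rightarrow> (nat \<Rightarrow> 'a) measure" where
  "P J = distr (N (K J)) (PiM J (\<lambda>_. borel)) (\<lambda>y. \<lambda>i\<in>J. grid i y)"

lemma P_eq:
  assumes "finite J" "K J \<le> k" shows "P J = distr (N k) (PiM J (\<lambda>_. borel)) (\<lambda>y. \<lambda>i\<in>J. grid i y)"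
proof -
  have "P J = distr (distr (N k) borel (grid (K J))) (PiM J (\<lambda>_. borel)) (\<lambda>y. \<lambda>i\<in>J. grid i y)"
    unfolding P_def distr_N_grid[OF assms(2)] ..
  also have "\<dots> = distr (N k) (PiM J (\<lambda>_. borel)) ((\<lambda>y. \<lambda>i\<in>J. grid i y) \<circ> grid (K J))"
    by (rule distr_distr) measurable
  also have "(\<lambda>y. \<lambda>i\<in>J. grid i y) \<circ> grid (K J) = (\<lambda>y::'a. \<lambda>i\<in>J. grid i y)"
    using K_ge[OF assms(1)] by (auto simp: fun_eq_iff grid_grid)
  finally show ?thesis .
qed

sublocale polish_projective "UNIV :: nat set" P
proof (intro polish_projective.intro projective_family.intro)
  fix J H :: "nat set" assume JH: "J \<subseteq> H" "finite H" "H \<subseteq> UNIV"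
  then have J: "finite J" by (auto intro: finite_subset)
  have le: "K J \<le> K H" unfolding K_def using JH by (intro Max_mono) auto
  have "distr (P H) (PiM J (\<lambda>_. borel)) (\<lambda>f. restrict f J) = distr (N (K H)) (PiM J (\<lambda>_. borel)) ((\<lambda>f. restrict f J) \<circ> (\<lambda>y. \<lambda>i\<in>H. grid i y))"
    unfolding P_def using JH by (intro distr_distr measurable_restrict_subset) measurable
  also have "(\<lambda>f. restrict f J) \<circ> (\<lambda>y. \<lambda>i\<in>H. grid i y) = (\<lambda>y::'a. \<lambda>i\<in>J. grid i y)"
    using JH by (auto simp: fun_eq_iff)
  finally have eq: "distr (P H) (PiM J (\<lambda>_. borel)) (\<lambda>f. restrict f J) = distr (N (K H)) (PiM J (\<lambda>_. borel)) (\<lambda>y. \<lambda>i\<in>J. grid i y)" .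
  show "P J = distr (P H) (PiM J (\<lambda>_. borel)) (\<lambda>f. restrict f J)"
    by (rule trans[OF P_eq[OF J le] sym[OF eq]])
next
  fix J :: "nat set"
  show "prob_space (P J)" unfolding P_def by (rule prob_space.prob_space_distr[OF prob_N]) measurable
qed

lemma emeasure_lim_coord:
  assumes J: "finite J" "K J \<le> k" and A: "A \<in> sets (PiM J (\<lambda>_. borel :: 'a measure))"
  shows "emeasure lim (prod_emb UNIV (\<lambda>_. borel) J A) = emeasure (N k) ((\<lambda>y. \<lambda>i\<in>J. grid i y) -` A)"
proof -
  have "emeasure lim (prod_emb UNIV (\<lambda>_. borel) J A) = emeasure (P J) A"
    using J A by (intro emeasure_lim_emb) auto
  also have "\<dots> = emeasure (N k) ((\<lambda>y. \<lambda>i\<in>J. grid i y) -` A)"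
    unfolding P_eq[OF J] using A by (subst emeasure_distr) auto
  finally show ?thesis .
qed

lemma measurable_coord [measurable]: "(\<lambda>\<omega>. \<omega> k) \<in> borel_measurable lim"
  by (subst measurable_cong_sets[OF sets_lim refl]) (rule measurable_component_singleton, simp)

lemma distr_lim_coord: "distr lim borel (\<lambda>\<omega>. \<omega> k) = N k"
proof (rule measure_eqI)
  fix A assume "A \<in> sets (distr lim borel (\<lambda>\<omega>. \<omega> k))"
  then have A [measurable]: "A \<in> sets borel" by simp
  have S: "{f \<in> space (PiM {k} (\<lambda>_. borel)). f k \<in> A} \<in> sets (PiM {k} (\<lambda>_. borel :: 'a measure))"
    by measurable
  have "emeasure (distr lim borel (\<lambda>\<omega>. \<omega> k)) A = emeasure lim {\<omega>. \<omega> k \<in> A}"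
    by (subst emeasure_distr) (auto simp: space_PiM vimage_def)
  also have "{\<omega>. \<omega> k \<in> A} = prod_emb UNIV (\<lambda>_. borel) {k} {f \<in> space (PiM {k} (\<lambda>_. borel)). f k \<in> A}"
    by (auto simp: prod_emb_def space_PiM)
  also have "emeasure lim \<dots> = emeasure (N k) ((\<lambda>y. \<lambda>i\<in>{k}. grid i y) -` {f \<in> space (PiM {k} (\<lambda>_. borel)). f k \<in> A})"
    by (rule emeasure_lim_coord[OF _ _ S]) (auto simp: K_def)
  also have "(\<lambda>y. \<lambda>i\<in>{k}. grid i y) -` {f \<in> space (PiM {k} (\<lambda>_. borel)). f k \<in> A} = grid k -` A"
    by (auto simp: space_PiM PiE_def extensional_def)
  also have "emeasure (N k) (grid k -` A) = emeasure (distr (N k) borel (grid k)) A"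
  proof (subst emeasure_distr)
    show "grid k \<in> borel_measurable (N k)"
      by (subst measurable_cong_sets[OF sets_N refl]) (rule borel_measurable_grid)
  qed (use A in simp_all)
  finally show "emeasure (distr lim borel (\<lambda>\<omega>. \<omega> k)) A = emeasure (N k) A" by (simp add: distr_N_grid)
qed simp

text \<open>Under the law of the two levels both coordinates are roundings of one point, so the
  relation has probability 1; depending on finitely many coordinates, it passes to the projective
  limit.\<close>

lemma AE_coord_grid:
  assumes "i \<le> k" shows "AE \<omega> in lim. \<omega> i = grid i (\<omega> k)"
proof -
  have m: "{f \<in> space (PiM {i, k} (\<lambda>_. borel)). f i = grid i (f k)} \<in> sets (PiM {i, k} (\<lambda>_. borel :: 'a measure))"
    by measurable
  have Kle: "K {i, k} \<le> k" unfolding K_def using assms by (subst Max_le_iff) auto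
  interpret N: prob_space "N k" by (rule prob_N)
  have eq: "{\<omega>. \<omega> i = grid i (\<omega> k)} = prod_emb UNIV (\<lambda>_. borel) {i, k} {f \<in> space (PiM {i, k} (\<lambda>_. borel)). f i = grid i (f k)}"
    by (auto simp: prod_emb_def space_PiM)
  have "emeasure lim {\<omega>. \<omega> i = grid i (\<omega> k)}
      = emeasure (N k) ((\<lambda>y. \<lambda>j\<in>{i, k}. grid j y) -` {f \<in> space (PiM {i, k} (\<lambda>_. borel)). f i = grid i (f k)})"
    unfolding eq by (rule emeasure_lim_coord[OF _ Kle m]) simp
  also have "(\<lambda>y. \<lambda>j\<in>{i, k}. grid j y) -` {f \<in> space (PiM {i, k} (\<lambda>_. borel)). f i = grid i (f k)} = UNIV"
    by (auto simp: space_PiM PiE_def extensional_def grid_grid[OF assms])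
  finally have "emeasure lim {\<omega>. \<omega> i = grid i (\<omega> k)} = 1" using N.emeasure_space_1 by simp
  moreover have "{\<omega>. \<omega> i = grid i (\<omega> k)} = {\<omega> \<in> space lim. \<omega> i = grid i (\<omega> k)}" by (simp add: space_PiM)
  ultimately show ?thesis
  proof (subst P.AE_iff_emeasure_eq_1)
    have "{\<omega> \<in> space (PiM UNIV (\<lambda>_. borel)). \<omega> i = grid i (\<omega> k)} \<in> sets (PiM UNIV (\<lambda>_::nat. borel :: 'a measure))"
      by measurable
    then show "Measurable.pred lim (\<lambda>\<omega>. \<omega> i = grid i (\<omega> k))"
      by (simp only: pred_def space_lim sets_lim)
  qed simp
qed

text \<open>The qualified name is the topological limit; plain \<open>lim\<close> is here the
  projective limit measure.\<close>

definition Y :: "(nat \<Rightarrow> 'a) \<Rightarrow> 'a" where "Y \<omega> = Topological_Spaces.lim (\<lambda>i. \<omega> i)"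

lemma measurable_Y [measurable]: "Y \<in> borel_measurable lim"
  unfolding Y_def[abs_def] by (rule borel_measurable_lim_metric) measurable

text \<open>Almost surely each coordinate is the rounding of all later ones, so the coordinates form
  a Cauchy sequence with an explicit rate.\<close>

lemma AE_tendsto_Y: "AE \<omega> in lim. (\<lambda>i. \<omega> i) \<longlonglongrightarrow> Y \<omega>"
proof -
  have "AE \<omega> in lim. \<forall>i k. i \<le> k \<longrightarrow> \<omega> i = grid i (\<omega> k)"
    using AE_coord_grid by (auto simp: AE_all_countable)
  then show ?thesis
  proof eventually_elim
    case (elim \<omega>)
    have le: "norm (\<omega> i - \<omega> k) \<le> real DIM('a) / 2 ^ i" if "i \<le> k" for i k
      using elim that norm_grid_diff[of i "\<omega> k"] by simp
    have "Cauchy \<omega>"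
    proof (rule metric_CauchyI)
      fix e :: real assume e: "0 < e"
      have "(\<lambda>i. real DIM('a) / 2 ^ i) \<longlonglongrightarrow> 0" by real_asymp
      then obtain i where i: "real DIM('a) / 2 ^ i < e / 2"
        using e order_tendstoD(2)[of "\<lambda>i. real DIM('a) / 2 ^ i" 0 sequentially "e / 2"] by (auto simp: eventually_sequentially)
      show "\<exists>M. \<forall>m\<ge>M. \<forall>n\<ge>M. dist (\<omega> m) (\<omega> n) < e"
      proof (intro exI allI impI)
        fix m n assume "m \<ge> i" "n \<ge> i"
        then have "dist (\<omega> i) (\<omega> m) < e / 2" "dist (\<omega> i) (\<omega> n) < e / 2"
          using le[of i m] le[of i n] i unfolding dist_norm by linarith+
        then show "dist (\<omega> m) (\<omega> n) < e" by (rule dist_triangle_half_r)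
      qed
    qed
    then show ?case unfolding Y_def by (simp add: Cauchy_convergent_iff convergent_LIMSEQ_iff)
  qed
qed

text \<open>The limits in \<open>j\<close> and in the level have to be exchanged. This needs a
  rounding error that is uniform in \<open>j\<close>, which tightness and uniform continuity on a
  ball provide.\<close>

lemma weak_limit:
  fixes f :: "'a \<Rightarrow> real"
  assumes f: "continuous_on UNIV f" and B: "\<And>x. \<bar>f x\<bar> \<le> B"
  shows "(\<lambda>j. \<integral>x. f x \<partial>M j) \<longlonglongrightarrow> (\<integral>x. f x \<partial>distr lim borel Y)"
proof -
  have [measurable]: "f \<in> borel_measurable borel" using f by (rule borel_measurable_continuous_onI)
  have B0: "0 \<le> B" using B[of 0] by simp
  have "(\<lambda>k. \<integral>\<omega>. f (\<omega> k) \<partial>lim) \<longlonglongrightarrow> (\<integral>\<omega>. f (Y \<omega>) \<partial>lim)"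
  proof (rule integral_dominated_convergence[where w="\<lambda>_. B"])
    show "AE \<omega> in lim. (\<lambda>i. f (\<omega> i)) \<longlonglongrightarrow> f (Y \<omega>)"
      using AE_tendsto_Y
      by eventually_elim (use f in \<open>auto simp: continuous_on_eq_continuous_at intro: isCont_tendsto_compose\<close>)
  qed (use B in auto)
  moreover have "(\<integral>\<omega>. f (\<omega> k) \<partial>lim) = (\<integral>y. f y \<partial>N k)" for k
    by (subst distr_lim_coord[symmetric], subst integral_distr) auto
  ultimately have bk: "(\<lambda>k. \<integral>y. f y \<partial>N k) \<longlonglongrightarrow> (\<integral>x. f x \<partial>distr lim borel Y)"
    by (subst integral_distr) auto
  have unif: "\<exists>K. \<forall>k\<ge>K. \<forall>j. \<bar>(\<integral>x. f (grid k x) \<partial>M j) - (\<integral>x. f x \<partial>M j)\<bar> \<le> \<epsilon>" if \<epsilon>: "0 < \<epsilon>" for \<epsilon>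
  proof -
    \<comment> \<open>An error \<open>d\<close> inside the ball and \<open>2 * B * d\<close> for the
      mass outside add up to \<epsilon>.\<close>
    define d where "d = \<epsilon> / (1 + 2 * B)"
    have d: "0 < d" using \<epsilon> B0 by (simp add: d_def)
    obtain r where r: "\<And>j. measure (M j) (- cball 0 r) \<le> d" using tight[OF d] by blast
    \<comment> \<open>The larger radius leaves room for the rounding, which moves a point by at most
      \<open>DIM('a)\<close>.\<close>
    have "uniformly_continuous_on (cball 0 (r + DIM('a))) f"
      using f by (intro compact_uniformly_continuous continuous_on_subset[OF f]) auto
    then obtain \<delta> where \<delta>: "0 < \<delta>" "\<And>x y. x \<in> cball 0 (r + DIM('a)) \<Longrightarrow> y \<in> cball 0 (r + DIM('a)) \<Longrightarrow> dist y x < \<delta> \<Longrightarrow> dist (f y) (f x) < d"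
      unfolding uniformly_continuous_on_def using d by metis
    have "(\<lambda>k. real DIM('a) / 2 ^ k) \<longlonglongrightarrow> 0" by real_asymp
    then obtain K where K: "\<And>k. K \<le> k \<Longrightarrow> real DIM('a) / 2 ^ k < \<delta>"
      using \<delta>(1) order_tendstoD(2)[of "\<lambda>i. real DIM('a) / 2 ^ i" 0 sequentially \<delta>] by (auto simp: eventually_sequentially)
    have "\<bar>(\<integral>x. f (grid k x) \<partial>M j) - (\<integral>x. f x \<partial>M j)\<bar> \<le> \<epsilon>" if k: "K \<le> k" for k j
    proof -
      interpret prob_space "M j" by (rule prob)
      have pt: "\<bar>f (grid k x) - f x\<bar> \<le> d + 2 * B * indicator (- cball 0 r) x" for x
      proof (cases "x \<in> cball 0 r")
        case True
        have le: "norm (grid k x - x) \<le> real DIM('a) / 2 ^ k" by (rule norm_grid_diff)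
        also have "\<dots> \<le> real DIM('a)" by (simp add: divide_le_eq_1 field_simps)
        finally have "norm (grid k x) \<le> r + DIM('a)" using True norm_triangle_sub[of "grid k x" x] by simp
        moreover have "dist (grid k x) x < \<delta>" using le K[OF k] by (simp add: dist_norm)
        ultimately have "dist (f (grid k x)) (f x) < d" using True by (intro \<delta>(2)) auto
        then show ?thesis using True by (simp add: dist_real_def)
      next
        case False
        have "\<bar>f (grid k x) - f x\<bar> \<le> 2 * B" using B[of "grid k x"] B[of x] by linarith
        then show ?thesis using False d by simp
      qed
      have fm: "(\<lambda>x. f (grid k x)) \<in> borel_measurable (M j)" "f \<in> borel_measurable (M j)"
        unfolding measurable_cong_sets[OF sets_M refl] by measurable
      have i1: "integrable (M j) (\<lambda>x. f (grid k x))" "integrable (M j) f"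
        by (rule integrable_const_bound[where B=B], use B in simp, rule fm)+
      have "\<bar>(\<integral>x. f (grid k x) \<partial>M j) - (\<integral>x. f x \<partial>M j)\<bar> = \<bar>\<integral>x. f (grid k x) - f x \<partial>M j\<bar>"
        using i1 by simp
      also have "\<dots> \<le> (\<integral>x. \<bar>f (grid k x) - f x\<bar> \<partial>M j)" by (rule integral_abs_bound)
      also have "\<dots> \<le> (\<integral>x. d + 2 * B * indicator (- cball 0 r) x \<partial>M j)"
        using i1 by (intro integral_mono pt) (auto intro!: integrable_real_indicator simp: sets_M emeasure_eq_measure)
      also have "\<dots> = d + 2 * B * measure (M j) (- cball 0 r)"
        using prob_space by (subst Bochner_Integration.integral_add) (auto intro!: integrable_real_indicator simp: sets_M emeasure_eq_measure)
      also have "\<dots> \<le> d + 2 * B * d" using r[of j] B0 by (intro add_left_mono mult_left_mono) auto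
      also have "\<dots> = d * (1 + 2 * B)" by (simp add: algebra_simps)
      also have "\<dots> = \<epsilon>" using B0 by (simp add: d_def)
      finally show ?thesis .
    qed
    then show ?thesis by blast
  qed
  show ?thesis
  proof (rule LIMSEQ_I)
    fix e :: real assume e: "0 < e"
    obtain K1 where K1: "\<And>k j. K1 \<le> k \<Longrightarrow> \<bar>(\<integral>x. f (grid k x) \<partial>M j) - (\<integral>x. f x \<partial>M j)\<bar> \<le> e / 4"
      using unif[of "e / 4"] e by auto
    obtain K2 where K2: "\<And>k. K2 \<le> k \<Longrightarrow> \<bar>(\<integral>y. f y \<partial>N k) - (\<integral>x. f x \<partial>distr lim borel Y)\<bar> < e / 4"
      using LIMSEQ_D[OF bk, of "e / 4"] e by auto
    define k where "k = max K1 K2"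
    obtain J where J: "\<And>j. J \<le> j \<Longrightarrow> \<bar>(\<integral>x. f (grid k x) \<partial>M j) - (\<integral>y. f y \<partial>N k)\<bar> < e / 4"
      using LIMSEQ_D[OF integral_grid_tendsto[of f B k], of "e / 4"] e B by auto
    show "\<exists>no. \<forall>j\<ge>no. norm ((\<integral>x. f x \<partial>M j) - (\<integral>x. f x \<partial>distr lim borel Y)) < e"
    proof (intro exI allI impI)
      fix j assume "j \<ge> J"
      moreover have "K1 \<le> k" "K2 \<le> k" by (auto simp: k_def)
      ultimately show "norm ((\<integral>x. f x \<partial>M j) - (\<integral>x. f x \<partial>distr lim borel Y)) < e"
        using K1[of k j] K2[of k] J[of j] e unfolding real_norm_def abs_le_iff abs_less_iff by linarith
    qed
  qed
qed

end

text \<open>The cell masses of all levels form a countable family of bounded sequences, so one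
  diagonal subsequence makes all of them converge.\<close>

theorem tight_imp_weakly_convergent_subsequence:
  fixes M :: "nat \<Rightarrow> 'a::euclidean_space measure"
  assumes prob: "\<And>j. prob_space (M j)" and sets_M: "\<And>j. sets (M j) = sets borel"
    and tight: "\<And>\<epsilon>. 0 < \<epsilon> \<Longrightarrow> \<exists>r. \<forall>j. measure (M j) (- cball 0 r) \<le> \<epsilon>"
  obtains s m where "strict_mono (s :: nat \<Rightarrow> nat)" "prob_space m" "sets m = sets borel"
    "\<And>f :: 'a \<Rightarrow> real. continuous_on UNIV f \<Longrightarrow> bounded (range f) \<Longrightarrow> (\<lambda>j. \<integral>x. f x \<partial>M (s j)) \<longlonglongrightarrow> (\<integral>x. f x \<partial>m)"
proof -
  define q where "q = (\<lambda>j (k, y). measure (M j) (grid k -` {y}))"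
  have "countable (SIGMA k:UNIV. range (grid k :: 'a \<Rightarrow> 'a))"
    by (intro countable_SIGMA countable_range_grid) auto
  moreover have "norm (q j z) \<le> 1" for j z
    unfolding q_def using prob_space.prob_le_1[OF prob] by (auto split: prod.split)
  ultimately obtain s where s: "strict_mono (s :: nat \<Rightarrow> nat)"
    and conv: "\<And>z. z \<in> (SIGMA k:UNIV. range (grid k :: 'a \<Rightarrow> 'a)) \<Longrightarrow> \<exists>l. (\<lambda>j. q (s j) z) \<longlonglongrightarrow> l"
    using function_convergent_subsequence[of "SIGMA k:UNIV. range (grid k :: 'a \<Rightarrow> 'a)" q 1] by blast
  define p where "p = (\<lambda>k y. lim (\<lambda>j. q (s j) (k, y)))"
  interpret tight_sequence "\<lambda>j. M (s j)" p
  proof (rule tight_sequence.intro)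
    show "prob_space (M (s j))" for j by (rule prob)
    show "sets (M (s j)) = sets borel" for j by (rule sets_M)
    show "\<exists>r. \<forall>j. measure (M (s j)) (- cball 0 r) \<le> \<epsilon>" if "0 < \<epsilon>" for \<epsilon> using tight[OF that] by blast
    show "(\<lambda>j. measure (M (s j)) (grid k -` {y})) \<longlonglongrightarrow> p k y" if "y \<in> range (grid k)" for k y
    proof -
      have "convergent (\<lambda>j. q (s j) (k, y))" using conv[of "(k, y)"] that by (auto simp: convergent_def)
      then show ?thesis unfolding p_def by (simp add: convergent_LIMSEQ_iff q_def)
    qed
  qed
  show ?thesis
  proof (rule that[OF s, of "distr lim borel Y"])
    show "prob_space (distr lim borel Y)" by (rule P.prob_space_distr) measurable
    fix f :: "'a \<Rightarrow> real" assume f: "continuous_on UNIV f" "bounded (range f)"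
    then obtain B where "\<And>x. \<bar>f x\<bar> \<le> B" by (auto simp: bounded_iff)
    then show "(\<lambda>j. \<integral>x. f x \<partial>M (s j)) \<longlonglongrightarrow> (\<integral>x. f x \<partial>distr lim borel Y)" by (rule weak_limit[OF f(1)])
  qed simp
qed

section \<open>Strong completeness\<close>

text \<open>The exponent is one more than in the lower bound of \<open>W\<close>; the extra factor
  \<open>1 / (1 + (norm y)\<^sup>2)\<close> makes the measures with density \<open>weight\<close>
  tight.\<close>

definition weight :: "'a::euclidean_space \<Rightarrow> real" where
  "weight y = 1 / (1 + (norm y)\<^sup>2) ^ Suc DIM('a)"

lemma weight_pos: "0 < weight y"
  by (simp add: weight_def add_pos_nonneg zero_less_power)

lemma one_plus_norm_pos: "0 < 1 + (norm y)\<^sup>2"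
  by (simp add: add_pos_nonneg)

lemma continuous_weight: "continuous_on S weight"
  unfolding weight_def[abs_def] using less_imp_neq[OF one_plus_norm_pos, symmetric]
  by (intro continuous_intros) auto

lemma borel_measurable_weight [measurable]: "weight \<in> borel_measurable borel"
  by (intro borel_measurable_continuous_onI continuous_weight)

text \<open>Division by the weight turns the heat kernel into a bounded continuous test function for
  the weighted, finite measures.\<close>

definition heat_ratio :: "real \<Rightarrow> 'a::euclidean_space \<Rightarrow> 'a \<Rightarrow> real" where
  "heat_ratio t z y = heat t z y / weight y"

lemma continuous_heat_ratio: "continuous_on UNIV (heat_ratio t z)"
proof -
  have "continuous_on UNIV (heat t z)"
    unfolding heat_def by (cases "t = 0") (auto intro!: continuous_intros)
  then show ?thesis
    unfolding heat_ratio_def[abs_def] using less_imp_neq[OF weight_pos, symmetric]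
    by (intro continuous_on_divide continuous_weight) auto
qed

lemma heat_ratio_nonneg [simp]: "0 \<le> heat_ratio t z y"
  using weight_pos[of y] by (simp add: heat_ratio_def)

lemma heat_ratio_bounded:
  assumes "0 < t" obtains C where "0 < C" "\<And>y. heat_ratio t z y \<le> C"
proof -
  obtain C where C: "0 < C" "\<And>y. heat t z y \<le> C / (1 + (norm y)\<^sup>2) ^ Suc DIM('a)"
    using heat_le_power[OF assms] by blast
  have "heat_ratio t z y \<le> C" for y
    using C(2)[of y] weight_pos[of y] by (simp add: heat_ratio_def weight_def divide_simps split: if_splits)
  then show ?thesis using that C(1) by blast
qed

lemma heat_eq_ratio: "heat t z y = heat_ratio t z y * weight y"
  using weight_pos[of y] by (simp add: heat_ratio_def)

definition madd :: "'a::euclidean_space measure \<Rightarrow> 'a measure \<Rightarrow> 'a measure" where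
  "madd \<mu> \<nu> = measure_of UNIV (sets borel) (\<lambda>A. emeasure \<mu> A + emeasure \<nu> A)"

lemma sets_madd [simp, measurable_cong]: "sets (madd \<mu> \<nu>) = sets borel"
  unfolding madd_def using sets.sets_measure_of_eq[of borel] by simp

lemma emeasure_madd:
  assumes "sets \<mu> = sets borel" "sets \<nu> = sets borel" "A \<in> sets borel"
  shows "emeasure (madd \<mu> \<nu>) A = emeasure \<mu> A + emeasure \<nu> A"
proof (rule emeasure_measure_of[OF madd_def])
  show "positive (sets (madd \<mu> \<nu>)) (\<lambda>A. emeasure \<mu> A + emeasure \<nu> A)" by (simp add: positive_def)
  show "countably_additive (sets (madd \<mu> \<nu>)) (\<lambda>A. emeasure \<mu> A + emeasure \<nu> A)"
  proof (rule countably_additiveI)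
    fix F :: "nat \<Rightarrow> 'a set" assume F: "range F \<subseteq> sets (madd \<mu> \<nu>)" "disjoint_family F"
    then have "(\<Sum>i. emeasure \<mu> (F i)) = emeasure \<mu> (\<Union>i. F i)" "(\<Sum>i. emeasure \<nu> (F i)) = emeasure \<nu> (\<Union>i. F i)"
      using assms by (auto intro!: suminf_emeasure)
    then show "(\<Sum>i. emeasure \<mu> (F i) + emeasure \<nu> (F i)) = emeasure \<mu> (\<Union>i. F i) + emeasure \<nu> (\<Union>i. F i)"
      by (simp add: suminf_add[symmetric])
  qed
qed (use assms sets.sets_into_space[of _ borel] in auto)

lemma nn_integral_madd:
  assumes s: "sets \<mu> = sets borel" "sets \<nu> = sets borel" and f: "f \<in> borel_measurable borel"
  shows "(\<integral>\<^sup>+x. f x \<partial>madd \<mu> \<nu>) = (\<integral>\<^sup>+x. f x \<partial>\<mu>) + (\<integral>\<^sup>+x. f x \<partial>\<nu>)"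
proof -
  note [measurable_cong] = s
  show ?thesis
    using f
  proof (induction rule: borel_measurable_induct)
    case (cong f g)
    then have "f = g" by auto
    then show ?case using cong by simp
  next
    case (set A)
    then show ?case using s by (simp add: emeasure_madd)
  next
    case (mult u c)
    then have "u \<in> borel_measurable (madd \<mu> \<nu>)" "u \<in> borel_measurable \<mu>" "u \<in> borel_measurable \<nu>"
      using s measurable_cong_sets by (metis sets_madd)+
    then show ?case using mult by (simp add: nn_integral_cmult distrib_left)
  next
    case (add u v)
    then have "u \<in> borel_measurable (madd \<mu> \<nu>)" "u \<in> borel_measurable \<mu>" "u \<in> borel_measurable \<nu>"
      "v \<in> borel_measurable (madd \<mu> \<nu>)" "v \<in> borel_measurable \<mu>" "v \<in> borel_measurable \<nu>"
      using s measurable_cong_sets by (metis sets_madd)+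
    then show ?case using add by (simp add: nn_integral_add ac_simps)
  next
    case (seq U)
    have m: "U i \<in> borel_measurable (madd \<mu> \<nu>)" "U i \<in> borel_measurable \<mu>" "U i \<in> borel_measurable \<nu>" for i
      using seq(1)[of i] s measurable_cong_sets by (metis sets_madd)+
    have lim: "(\<lambda>i. \<integral>\<^sup>+x. U i x \<partial>M) \<longlonglongrightarrow> (\<integral>\<^sup>+x. (SUP i. U i x) \<partial>M)" if "\<And>i. U i \<in> borel_measurable M" for M
    proof -
      have "(\<integral>\<^sup>+x. (SUP i. U i x) \<partial>M) = (SUP i. \<integral>\<^sup>+x. U i x \<partial>M)"
        using seq that by (intro nn_integral_monotone_convergence_SUP) auto
      moreover have "incseq (\<lambda>i. \<integral>\<^sup>+x. U i x \<partial>M)"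
        using seq(3) by (auto simp: incseq_def le_fun_def intro!: nn_integral_mono)
      ultimately show ?thesis by (simp add: LIMSEQ_SUP)
    qed
    have e: "(\<lambda>i. \<integral>\<^sup>+x. U i x \<partial>madd \<mu> \<nu>) = (\<lambda>i. (\<integral>\<^sup>+x. U i x \<partial>\<mu>) + (\<integral>\<^sup>+x. U i x \<partial>\<nu>))"
      using seq by (intro ext) blast
    have "(\<lambda>i. \<integral>\<^sup>+x. U i x \<partial>madd \<mu> \<nu>) \<longlonglongrightarrow> (\<integral>\<^sup>+x. (SUP i. U i x) \<partial>\<mu>) + (\<integral>\<^sup>+x. (SUP i. U i x) \<partial>\<nu>)"
      unfolding e by (intro tendsto_add lim m)
    with lim[OF m(1)] have "(\<integral>\<^sup>+x. (SUP i. U i x) \<partial>madd \<mu> \<nu>) = (\<integral>\<^sup>+x. (SUP i. U i x) \<partial>\<mu>) + (\<integral>\<^sup>+x. (SUP i. U i x) \<partial>\<nu>)"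
      by (rule LIMSEQ_unique)
    then show ?case by (simp only: SUP_apply)
  qed
qed

lemma L2_inner_tendsto:
  assumes \<psi>: "\<psi> \<in> L2 M" and f: "\<And>j. f j \<in> L2 M" "g \<in> L2 M"
    and lim: "(\<lambda>j. \<integral>x. (f j x - g x)\<^sup>2 \<partial>M) \<longlonglongrightarrow> 0"
  shows "(\<lambda>j. \<integral>x. \<psi> x * f j x \<partial>M) \<longlonglongrightarrow> (\<integral>x. \<psi> x * g x \<partial>M)"
proof -
  have d: "(\<lambda>x. f j x - g x) \<in> L2 M" for j using L2_add[OF f(1)[of j] f(2), of "-1"] by simp
  have "(\<lambda>j. sqrt ((\<integral>x. (\<psi> x)\<^sup>2 \<partial>M) * (\<integral>x. (f j x - g x)\<^sup>2 \<partial>M))) \<longlonglongrightarrow> sqrt ((\<integral>x. (\<psi> x)\<^sup>2 \<partial>M) * 0)"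
    by (intro tendsto_intros lim)
  then have lim0: "(\<lambda>j. sqrt ((\<integral>x. (\<psi> x)\<^sup>2 \<partial>M) * (\<integral>x. (f j x - g x)\<^sup>2 \<partial>M))) \<longlonglongrightarrow> 0" by simp
  have "(\<lambda>j. (\<integral>x. \<psi> x * f j x \<partial>M) - (\<integral>x. \<psi> x * g x \<partial>M)) \<longlonglongrightarrow> 0"
  proof (rule Lim_null_comparison[OF _ lim0])
    show "\<forall>\<^sub>F j in sequentially. norm ((\<integral>x. \<psi> x * f j x \<partial>M) - (\<integral>x. \<psi> x * g x \<partial>M)) \<le> sqrt ((\<integral>x. (\<psi> x)\<^sup>2 \<partial>M) * (\<integral>x. (f j x - g x)\<^sup>2 \<partial>M))"
    proof (intro always_eventually allI)
      fix j
      have "(\<integral>x. \<psi> x * f j x \<partial>M) - (\<integral>x. \<psi> x * g x \<partial>M) = (\<integral>x. \<psi> x * (f j x - g x) \<partial>M)"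
        using L2_mult[OF \<psi> f(1)[of j]] L2_mult[OF \<psi> f(2)] by (simp add: right_diff_distrib)
      then show "norm ((\<integral>x. \<psi> x * f j x \<partial>M) - (\<integral>x. \<psi> x * g x \<partial>M)) \<le> sqrt ((\<integral>x. (\<psi> x)\<^sup>2 \<partial>M) * (\<integral>x. (f j x - g x)\<^sup>2 \<partial>M))"
        using L2_CS[OF \<psi> d[of j]] by (simp add: real_le_rsqrt abs_le_square_iff real_sqrt_ge_abs1 power2_abs flip: real_sqrt_abs)
    qed
  qed
  then show ?thesis by (rule LIM_zero_cancel)
qed

lemma L2_diff_square:
  assumes "f \<in> L2 M" "g \<in> L2 M"
  shows "(\<integral>x. (f x - g x)\<^sup>2 \<partial>M) = (\<integral>x. (f x)\<^sup>2 \<partial>M) - 2 * (\<integral>x. f x * g x \<partial>M) + (\<integral>x. (g x)\<^sup>2 \<partial>M)"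
proof -
  have "(\<integral>x. (f x - g x)\<^sup>2 \<partial>M) = (\<integral>x. (f x)\<^sup>2 - 2 * (f x * g x) + (g x)\<^sup>2 \<partial>M)"
    by (intro Bochner_Integration.integral_cong) (auto simp: power2_eq_square algebra_simps)
  then show ?thesis using L2_square[OF assms(1)] L2_square[OF assms(2)] L2_mult[OF assms] by simp
qed

section \<open>Vague compactness and completeness of the cone\<close>

context riesz begin

lemma \<Phi>_L2: "\<mu> \<in> E_plus \<alpha> \<Longrightarrow> \<Phi> \<mu> \<in> L2 SM"
  using mutual_energy_\<Phi>(1)[of \<mu> \<mu>] by (simp add: L2_def borel_measurable_\<Phi> E_plus_radon power2_eq_square)

lemma weight_le_W:
  obtains C where "0 < C" "\<And>y. ennreal (weight y) \<le> ennreal (C / (1 + (norm y)\<^sup>2)) * W y"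
proof -
  obtain c where c: "0 < c" "\<And>y. ennreal (c / (1 + (norm y)\<^sup>2) ^ DIM('a)) \<le> W y" using W_lower by blast
  show ?thesis
  proof (rule that)
    show "0 < 1 / c" using c by simp
    fix y :: 'a
    have "weight y = 1 / c / (1 + (norm y)\<^sup>2) * (c / (1 + (norm y)\<^sup>2) ^ DIM('a))"
      using c by (simp add: weight_def)
    then have "ennreal (weight y) = ennreal (1 / c / (1 + (norm y)\<^sup>2)) * ennreal (c / (1 + (norm y)\<^sup>2) ^ DIM('a))"
      using c one_plus_norm_pos[of y] by (simp only:) (intro ennreal_mult; simp)
    also have "\<dots> \<le> ennreal (1 / c / (1 + (norm y)\<^sup>2)) * W y" by (intro mult_left_mono c) simp
    finally show "ennreal (weight y) \<le> ennreal (1 / c / (1 + (norm y)\<^sup>2)) * W y" .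
  qed
qed

lemma hm_eq_ratio:
  assumes "sets \<nu> = sets borel"
  shows "hm \<nu> t z = (\<integral>\<^sup>+y. ennreal (heat_ratio t z y) \<partial>density \<nu> weight)"
proof -
  note [measurable_cong] = assms
  have [measurable]: "heat_ratio t z \<in> borel_measurable borel"
    using continuous_heat_ratio by (rule borel_measurable_continuous_onI)
  show ?thesis
    unfolding hm_def heat_eq_ratio
    by (subst nn_integral_density) (auto simp: ennreal_mult less_imp_le[OF weight_pos] mult.commute)
qed

text \<open>The bound on the integrals of \<open>W\<close> makes the measures with density
  \<open>weight\<close> tight and of bounded mass, so after normalization weak compactness of
  probability measures applies. Convergence is recorded for heat transforms only, the form in which
  energies see it.\<close>

lemma vague_subsequence:
  assumes r: "\<And>j. radon (\<nu> j :: 'a measure)" and b: "\<And>j. (\<integral>\<^sup>+y. W y \<partial>\<nu> j) \<le> ennreal B"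
  obtains s \<mu> where "strict_mono (s :: nat \<Rightarrow> nat)" "radon \<mu>" "\<And>t z. 0 < t \<Longrightarrow> hm \<mu> t z < \<infinity>"
    "\<And>t z. 0 < t \<Longrightarrow> (\<lambda>j. hm (\<nu> (s j)) t z) \<longlonglongrightarrow> hm \<mu> t z"
proof -
  have sn: "sets (\<nu> j) = sets borel" for j using r by (rule radon_sets)
  note [measurable_cong] = sn
  obtain C where C: "0 < C" "\<And>y. ennreal (weight y) \<le> ennreal (C / (1 + (norm y)\<^sup>2)) * W y" using weight_le_W by blast
  define m where "m = (\<lambda>j. emeasure (density (\<nu> j) weight) UNIV)"
  have tail: "emeasure (density (\<nu> j) weight) A \<le> ennreal (C * \<bar>B\<bar> / (1 + R\<^sup>2))"
    if A: "A \<in> sets borel" "\<And>y. y \<in> A \<Longrightarrow> R \<le> norm y" and R: "0 \<le> R" for A R j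
  proof -
    have "emeasure (density (\<nu> j) weight) A = (\<integral>\<^sup>+y. ennreal (weight y) * indicator A y \<partial>\<nu> j)"
      using A by (subst emeasure_density) auto
    also have "\<dots> \<le> (\<integral>\<^sup>+y. ennreal (C / (1 + R\<^sup>2)) * W y \<partial>\<nu> j)"
    proof (rule nn_integral_mono)
      fix y
      show "ennreal (weight y) * indicator A y \<le> ennreal (C / (1 + R\<^sup>2)) * W y"
      proof (cases "y \<in> A")
        case True
        have "R\<^sup>2 \<le> (norm y)\<^sup>2" using A(2)[OF True] R by (intro power_mono)
        then have "C / (1 + (norm y)\<^sup>2) \<le> C / (1 + R\<^sup>2)" using C(1) by (intro divide_left_mono) (auto intro!: mult_pos_pos add_pos_nonneg)
        then have "ennreal (C / (1 + (norm y)\<^sup>2)) * W y \<le> ennreal (C / (1 + R\<^sup>2)) * W y" by (intro mult_right_mono ennreal_leI) auto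
        then show ?thesis using True order_trans[OF C(2)[of y]] by simp
      qed simp
    qed
    also have "\<dots> = ennreal (C / (1 + R\<^sup>2)) * (\<integral>\<^sup>+y. W y \<partial>\<nu> j)" by (rule nn_integral_cmult) measurable
    also have "\<dots> \<le> ennreal (C / (1 + R\<^sup>2)) * ennreal \<bar>B\<bar>"
      by (intro mult_left_mono order_trans[OF b]) (auto intro: ennreal_leI)
    also have "\<dots> = ennreal (C * \<bar>B\<bar> / (1 + R\<^sup>2))" using C(1) by (subst ennreal_mult[symmetric]) auto
    finally show ?thesis .
  qed
  have m_le: "m j \<le> ennreal (C * \<bar>B\<bar>)" for j
    using tail[of UNIV 0 j] by (simp add: m_def)
  define mr where "mr = (\<lambda>j. enn2real (m j))"
  have m: "m j = ennreal (mr j)" "0 \<le> mr j" "mr j \<le> C * \<bar>B\<bar>" for j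
    using m_le[of j] C(1) by (auto simp: mr_def less_top order_le_less_trans[OF m_le] intro!: enn2real_leI)
  have "bounded (range mr)" using m by (auto simp: bounded_iff intro!: exI[of _ "C * \<bar>B\<bar>"])
  then obtain l s0 where s0: "strict_mono (s0 :: nat \<Rightarrow> nat)" "(mr \<circ> s0) \<longlonglongrightarrow> l"
    using bounded_imp_convergent_subsequence by blast
  have l0: "0 \<le> l" using s0(2) m(2) by (intro LIMSEQ_le_const[of "mr \<circ> s0" l 0]) auto
  show ?thesis
  proof (cases "l = 0")
    \<comment> \<open>Masses tending to 0 cannot be normalized; the limit is then the zero
      measure.\<close>
    case True
    show ?thesis
    proof (rule that[OF s0(1), of "null_measure borel"])
      show "radon (null_measure borel :: 'a measure)" by (simp add: radon_def)
      fix t :: real and z :: 'a assume t: "0 < t"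
      show "hm (null_measure borel) t z < \<infinity>" by (simp add: hm_def)
      obtain D where D: "0 < D" "\<And>y. heat_ratio t z y \<le> D" using heat_ratio_bounded[OF t] by blast
      have up: "hm (\<nu> j) t z \<le> ennreal (D * mr j)" for j
      proof -
        have "hm (\<nu> j) t z \<le> (\<integral>\<^sup>+y. ennreal D \<partial>density (\<nu> j) weight)"
          unfolding hm_eq_ratio[OF sn] by (intro nn_integral_mono ennreal_leI D)
        also have "\<dots> = ennreal D * m j" using sets_eq_imp_space_eq[OF sn] by (simp add: m_def)
        finally show ?thesis using m D by (simp add: ennreal_mult)
      qed
      have "(\<lambda>j. ennreal (D * mr (s0 j))) \<longlonglongrightarrow> ennreal (D * 0)"
        using s0(2) unfolding True o_def by (rule tendsto_ennrealI[OF tendsto_mult[OF tendsto_const]])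
      then have l0: "(\<lambda>j. ennreal (D * mr (s0 j))) \<longlonglongrightarrow> 0" by simp
      have "(\<lambda>j. hm (\<nu> (s0 j)) t z) \<longlonglongrightarrow> 0"
        by (rule tendsto_sandwich[OF _ _ tendsto_const l0]) (simp_all add: up)
      then show "(\<lambda>j. hm (\<nu> (s0 j)) t z) \<longlonglongrightarrow> hm (null_measure borel) t z" by (simp add: hm_def)
    qed
  next
    case False
    then have l: "0 < l" using l0 by simp
    \<comment> \<open>Dropping finitely many terms keeps the masses above \<open>l / 2\<close>, so
      the normalizing factors stay below \<open>2 / l\<close>.\<close>
    obtain J where J: "\<And>j. J \<le> j \<Longrightarrow> l / 2 < mr (s0 j)"
      using order_tendstoD(1)[OF s0(2), of "l / 2"] l by (auto simp: eventually_sequentially)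
    define s1 where "s1 = (\<lambda>j. s0 (j + J))"
    have s1: "strict_mono s1" using s0(1) by (auto simp: s1_def strict_mono_def)
    have ml: "l / 2 < mr (s1 j)" for j using J by (simp add: s1_def)
    then have mp: "0 < mr (s1 j)" for j using l by (meson half_gt_zero less_trans)
    define M where "M = (\<lambda>j. scale_measure (ennreal (1 / mr (s1 j))) (density (\<nu> (s1 j)) weight))"
    have eM: "emeasure (M j) A = ennreal (1 / mr (s1 j)) * emeasure (density (\<nu> (s1 j)) weight) A" for j A
      by (simp add: M_def)
    have spM: "space (M j) = UNIV" for j using sets_eq_imp_space_eq[OF sn] by (simp add: M_def space_scale_measure)
    have sM: "sets (M j) = sets borel" for j by (simp add: M_def sn)
    have pM: "prob_space (M j)" for j
    proof
      have "emeasure (M j) UNIV = ennreal (1 / mr (s1 j)) * ennreal (mr (s1 j))"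
        by (simp only: eM m(1)[symmetric]) (simp add: m_def)
      then show "emeasure (M j) (space (M j)) = 1" using mp[of j] by (simp add: spM flip: ennreal_mult)
    qed
    have tightM: "\<exists>r. \<forall>j. measure (M j) (- cball 0 r) \<le> \<epsilon>" if \<epsilon>: "0 < \<epsilon>" for \<epsilon>
    proof -
      \<comment> \<open>The normalizing factor times the bound on the total mass. The radius
        \<open>R = E / \<epsilon>\<close> works because
        \<open>R \<le> 1 + R\<^sup>2\<close>.\<close>
      define E where "E = 2 / l * (C * \<bar>B\<bar>)"
      have E: "0 \<le> E" using l C by (simp add: E_def)
      define R where "R = E / \<epsilon>"
      have R: "0 \<le> R" using E \<epsilon> by (simp add: R_def)
      have "measure (M j) (- cball 0 R) \<le> \<epsilon>" for j
      proof -
        have "emeasure (M j) (- cball 0 R) \<le> ennreal (2 / l) * ennreal (C * \<bar>B\<bar> / (1 + R\<^sup>2))"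
          unfolding eM using ml[of j] mp[of j] l R by (intro mult_mono tail ennreal_leI) (auto simp: field_simps)
        also have "\<dots> = ennreal (E / (1 + R\<^sup>2))"
          using l C by (subst ennreal_mult[symmetric]) (auto simp: E_def)
        also have "E / (1 + R\<^sup>2) \<le> \<epsilon>"
        proof -
          have "R \<le> 1 + R\<^sup>2" using sum_squares_bound[of 1 R] R by (simp add: power2_eq_square)
          then have "\<epsilon> * R \<le> \<epsilon> * (1 + R\<^sup>2)" using \<epsilon> by (intro mult_left_mono) auto
          then have "E \<le> \<epsilon> * (1 + R\<^sup>2)" using \<epsilon> by (simp add: R_def)
          then show ?thesis by (simp add: pos_divide_le_eq add_pos_nonneg)
        qed
        finally show ?thesis
          using \<epsilon> by (simp add: finite_measure.emeasure_eq_measure[OF prob_space.finite_measure[OF pM]] ennreal_leI)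
      qed
      then show ?thesis by blast
    qed
    obtain s2 p where s2: "strict_mono (s2 :: nat \<Rightarrow> nat)" and p: "prob_space p" "sets p = sets borel"
      and conv: "\<And>f :: 'a \<Rightarrow> real. continuous_on UNIV f \<Longrightarrow> bounded (range f) \<Longrightarrow> (\<lambda>j. \<integral>x. f x \<partial>M (s2 j)) \<longlonglongrightarrow> (\<integral>x. f x \<partial>p)"
      using tight_imp_weakly_convergent_subsequence[OF pM sM tightM] by blast
    interpret p: prob_space p by (rule p)
    note [measurable_cong] = p(2)
    \<comment> \<open>Undoes the normalization, through the limit \<open>l\<close> of the masses,
      and the weight.\<close>
    define \<mu> where "\<mu> = density p (\<lambda>y. ennreal (l / weight y))"
    have s\<mu>: "sets \<mu> = sets borel" using p by (simp add: \<mu>_def)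
    have hr [measurable]: "heat_ratio t z \<in> borel_measurable borel" for t and z :: 'a
      using continuous_heat_ratio by (rule borel_measurable_continuous_onI)
    have hm\<mu>: "hm \<mu> t z = ennreal (l * (\<integral>y. heat_ratio t z y \<partial>p))" if t: "0 < t" for t z
    proof -
      obtain D where D: "0 < D" "\<And>y. heat_ratio t z y \<le> D" using heat_ratio_bounded[OF t] by blast
      have i: "integrable p (heat_ratio t z)"
        by (rule p.integrable_const_bound[where B=D]) (use D in auto)
      have "hm \<mu> t z = (\<integral>\<^sup>+y. ennreal (l * heat_ratio t z y) \<partial>p)"
        unfolding hm_def \<mu>_def using l weight_pos
        by (subst nn_integral_density) (auto simp: heat_eq_ratio less_imp_le[OF weight_pos] less_imp_neq[OF weight_pos, symmetric] field_simps simp flip: ennreal_mult intro!: nn_integral_cong)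
      also have "\<dots> = ennreal (\<integral>y. l * heat_ratio t z y \<partial>p)"
        using i l by (intro nn_integral_eq_integral) auto
      finally show ?thesis using i by simp
    qed
    show ?thesis
    proof (rule that[of "s1 \<circ> s2" \<mu>])
      show "strict_mono (s1 \<circ> s2)" using s1 s2 by (rule strict_mono_o)
      show "radon \<mu>"
        unfolding radon_def
      proof (intro conjI allI impI)
        show "sets \<mu> = sets borel" by (rule s\<mu>)
        fix K :: "'a set" assume K: "compact K"
        have cont: "continuous_on K (\<lambda>y. l / weight y)"
          using less_imp_neq[OF weight_pos, symmetric] by (intro continuous_intros continuous_weight) auto
        obtain D where D: "\<And>y. y \<in> K \<Longrightarrow> l / weight y \<le> D"
          using compact_imp_bounded[OF compact_continuous_image[OF cont K]] by (auto simp: bounded_iff abs_le_iff)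
        have "emeasure \<mu> K = (\<integral>\<^sup>+y. ennreal (l / weight y) * indicator K y \<partial>p)"
          unfolding \<mu>_def using K by (subst emeasure_density) (auto simp: p borel_compact)
        also have "\<dots> \<le> (\<integral>\<^sup>+y. ennreal D \<partial>p)"
          using D by (intro nn_integral_mono) (auto simp: indicator_def intro: ennreal_leI)
        also have "\<dots> < \<infinity>" using p.emeasure_space_1 by simp
        finally show "emeasure \<mu> K < \<infinity>" .
      qed
      fix t :: real and z :: 'a assume t: "0 < t"
      show "hm \<mu> t z < \<infinity>" unfolding hm\<mu>[OF t] by simp
      obtain D where D: "0 < D" "\<And>y. heat_ratio t z y \<le> D" using heat_ratio_bounded[OF t] by blast
      have hmj: "hm (\<nu> (s1 j)) t z = ennreal (mr (s1 j) * (\<integral>y. heat_ratio t z y \<partial>M j))" for j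
      proof -
        interpret Mj: prob_space "M j" by (rule pM)
        have hrM: "heat_ratio t z \<in> borel_measurable (M j)" using hr by (simp add: measurable_cong_sets[OF sM refl])
        have i: "integrable (M j) (heat_ratio t z)"
          by (rule Mj.integrable_const_bound[where B=D]) (use D hrM in auto)
        have "(\<integral>\<^sup>+y. ennreal (heat_ratio t z y) \<partial>M j) = ennreal (1 / mr (s1 j)) * hm (\<nu> (s1 j)) t z"
          unfolding M_def hm_eq_ratio[OF sn] by (rule nn_integral_scale_measure) (simp add: measurable_cong_sets[OF sn refl])
        then have "ennreal (mr (s1 j)) * ennreal (\<integral>y. heat_ratio t z y \<partial>M j) = (ennreal (mr (s1 j)) * ennreal (1 / mr (s1 j))) * hm (\<nu> (s1 j)) t z"
          using nn_integral_eq_integral[OF i] by (simp add: mult.assoc)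
        also have "ennreal (mr (s1 j)) * ennreal (1 / mr (s1 j)) = 1" using mp[of j] by (simp flip: ennreal_mult)
        finally show ?thesis using mp[of j] by (simp add: ennreal_mult integral_nonneg_AE)
      qed
      have "bounded (range (heat_ratio t z))" using D by (auto simp: bounded_iff)
      then have c1: "(\<lambda>j. \<integral>y. heat_ratio t z y \<partial>M (s2 j)) \<longlonglongrightarrow> (\<integral>y. heat_ratio t z y \<partial>p)"
        by (intro conv continuous_heat_ratio)
      have c2: "(\<lambda>j. mr (s1 (s2 j))) \<longlonglongrightarrow> l"
      proof -
        have "(\<lambda>j. mr (s1 j)) \<longlonglongrightarrow> l" using LIMSEQ_ignore_initial_segment[OF s0(2), of J] by (simp add: s1_def o_def)
        then show ?thesis using LIMSEQ_subseq_LIMSEQ[OF _ s2] by (simp add: o_def)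
      qed
      show "(\<lambda>j. hm (\<nu> ((s1 \<circ> s2) j)) t z) \<longlonglongrightarrow> hm \<mu> t z"
        unfolding hm\<mu>[OF t] o_def hmj by (intro tendsto_ennrealI tendsto_mult c1 c2)
    qed
  qed
qed

lemma energy_\<Phi>: "\<mu> \<in> E_plus \<alpha> \<Longrightarrow> energy \<alpha> \<mu> = ennreal (\<integral>p. (\<Phi> \<mu> p)\<^sup>2 \<partial>SM)"
  unfolding energy_def by (simp add: mutual_energy_\<Phi>(2) power2_eq_square)

text \<open>Heat transforms converge pointwise along a subsequence, and Fatou's lemma in the second
  index of the Cauchy condition bounds the distance of every late term to the limit, not only of
  those in the subsequence.\<close>

theorem strongly_complete:
  assumes E: "\<And>j. \<nu> j \<in> E_plus \<alpha>" and b: "\<And>j. (\<integral>p. (\<Phi> (\<nu> j) p)\<^sup>2 \<partial>SM) \<le> B"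
    and cauchy: "\<And>\<epsilon>. 0 < \<epsilon> \<Longrightarrow> \<exists>N. \<forall>i\<ge>N. \<forall>j\<ge>N. (\<integral>p. (\<Phi> (\<nu> i) p - \<Phi> (\<nu> j) p)\<^sup>2 \<partial>SM) \<le> \<epsilon>"
  obtains \<mu> where "\<mu> \<in> E_plus \<alpha>" "(\<lambda>j. \<integral>p. (\<Phi> (\<nu> j) p - \<Phi> \<mu> p)\<^sup>2 \<partial>SM) \<longlonglongrightarrow> 0"
proof -
  have r: "radon (\<nu> j)" for j using E by (rule E_plus_radon)
  have LE: "\<Phi> (\<nu> j) \<in> L2 SM" for j by (rule \<Phi>_L2[OF E])
  have "0 \<le> (\<integral>p. (\<Phi> (\<nu> 0) p)\<^sup>2 \<partial>SM)" by (intro integral_nonneg_AE) auto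
  then have B0: "0 \<le> B" using b[of 0] by (rule order_trans)
  obtain S where S: "energy \<alpha> \<sigma> = ennreal S" "0 \<le> S" using \<sigma>_E_plus by (cases "energy \<alpha> \<sigma>") (auto simp: E_plus_def)
  have W: "(\<integral>\<^sup>+y. W y \<partial>\<nu> j) \<le> ennreal (sqrt (S * B))" for j
  proof -
    obtain w where w: "(\<integral>\<^sup>+y. W y \<partial>\<nu> j) = ennreal w" "0 \<le> w"
      using nn_integral_W_finite[OF E, of j] by (cases "\<integral>\<^sup>+y. W y \<partial>\<nu> j") auto
    have "ennreal (w\<^sup>2) \<le> ennreal S * energy \<alpha> (\<nu> j)"
      using nn_integral_W_le[OF E, of j] w S by (simp add: ennreal_power)
    also have "\<dots> \<le> ennreal S * ennreal B" unfolding energy_\<Phi>[OF E] by (intro mult_left_mono ennreal_leI b) simp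
    finally have "w\<^sup>2 \<le> S * B" using S B0 by (simp flip: ennreal_mult)
    then show ?thesis unfolding w by (intro ennreal_leI real_le_rsqrt)
  qed
  obtain s \<mu> where s: "strict_mono (s :: nat \<Rightarrow> nat)" and \<mu>: "radon \<mu>" "\<And>t z. 0 < t \<Longrightarrow> hm \<mu> t z < \<infinity>"
    and conv: "\<And>t z. 0 < t \<Longrightarrow> (\<lambda>j. hm (\<nu> (s j)) t z) \<longlonglongrightarrow> hm \<mu> t z"
    by (rule vague_subsequence[of \<nu>, OF r W]) (rule that)
  have m [measurable]: "\<Phi> \<mu> \<in> borel_measurable SM" "\<Phi> (\<nu> j) \<in> borel_measurable SM" for j
    using borel_measurable_\<Phi>[OF \<mu>(1)] borel_measurable_\<Phi>[OF r] by auto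
  have pt: "AE p in SM. (\<lambda>j. \<Phi> (\<nu> (s j)) p) \<longlonglongrightarrow> \<Phi> \<mu> p"
    using AE_SM_pos
  proof eventually_elim
    case (elim p)
    have "hm \<mu> (fst p) (snd p) = ennreal (\<Phi> \<mu> p)" using \<mu>(2)[OF elim] by (simp add: \<Phi>_def less_top)
    with conv[OF elim, of "snd p"] have "(\<lambda>j. hm (\<nu> (s j)) (fst p) (snd p)) \<longlonglongrightarrow> ennreal (\<Phi> \<mu> p)" by simp
    from tendsto_enn2real[OF this \<Phi>_nonneg] show ?case by (simp add: \<Phi>_def)
  qed
  have fatou: "(\<integral>\<^sup>+p. ennreal ((\<Phi> (\<nu> i) p - \<Phi> \<mu> p)\<^sup>2) \<partial>SM) \<le> ennreal \<epsilon>"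
    if N: "\<And>i j. N \<le> i \<Longrightarrow> N \<le> j \<Longrightarrow> (\<integral>p. (\<Phi> (\<nu> i) p - \<Phi> (\<nu> j) p)\<^sup>2 \<partial>SM) \<le> \<epsilon>" and i: "N \<le> i" for i N \<epsilon>
  proof -
    have "(\<integral>\<^sup>+p. ennreal ((\<Phi> (\<nu> i) p - \<Phi> \<mu> p)\<^sup>2) \<partial>SM) = (\<integral>\<^sup>+p. liminf (\<lambda>j. ennreal ((\<Phi> (\<nu> i) p - \<Phi> (\<nu> (s j)) p)\<^sup>2)) \<partial>SM)"
    proof (rule nn_integral_cong_AE)
      show "AE p in SM. ennreal ((\<Phi> (\<nu> i) p - \<Phi> \<mu> p)\<^sup>2) = liminf (\<lambda>j. ennreal ((\<Phi> (\<nu> i) p - \<Phi> (\<nu> (s j)) p)\<^sup>2))"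
        using pt
      proof eventually_elim
        case (elim p)
        have "(\<lambda>j. ennreal ((\<Phi> (\<nu> i) p - \<Phi> (\<nu> (s j)) p)\<^sup>2)) \<longlonglongrightarrow> ennreal ((\<Phi> (\<nu> i) p - \<Phi> \<mu> p)\<^sup>2)"
          by (intro tendsto_intros elim)
        then show ?case by (intro lim_imp_Liminf[symmetric]) auto
      qed
    qed
    also have "\<dots> \<le> liminf (\<lambda>j. \<integral>\<^sup>+p. ennreal ((\<Phi> (\<nu> i) p - \<Phi> (\<nu> (s j)) p)\<^sup>2) \<partial>SM)"
      by (rule nn_integral_liminf) measurable
    also have "\<dots> \<le> liminf (\<lambda>j. ennreal \<epsilon>)"
    proof (rule Liminf_mono)
      show "\<forall>\<^sub>F j in sequentially. (\<integral>\<^sup>+p. ennreal ((\<Phi> (\<nu> i) p - \<Phi> (\<nu> (s j)) p)\<^sup>2) \<partial>SM) \<le> ennreal \<epsilon>"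
        unfolding eventually_sequentially
      proof (intro exI allI impI)
        fix j assume "N \<le> j"
        then have "N \<le> s j" using seq_suble[OF s, of j] by simp
        have "(\<lambda>p. \<Phi> (\<nu> i) p - \<Phi> (\<nu> (s j)) p) \<in> L2 SM" using L2_add[OF LE[of i] LE[of "s j"], of "-1"] by simp
        from nn_integral_eq_integral[OF L2_square[OF this]] show "(\<integral>\<^sup>+p. ennreal ((\<Phi> (\<nu> i) p - \<Phi> (\<nu> (s j)) p)\<^sup>2) \<partial>SM) \<le> ennreal \<epsilon>"
          using N[OF i \<open>N \<le> s j\<close>] by (simp add: ennreal_leI)
      qed
    qed
    also have "\<dots> = ennreal \<epsilon>" by (simp add: Liminf_const)
    finally show ?thesis .
  qed
  \<comment> \<open>The transform of the limit is at finite distance from one of the approximants,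
    so its square is integrable too.\<close>
  have \<mu>E: "\<mu> \<in> E_plus \<alpha>"
  proof -
    obtain N where N: "\<And>i j. N \<le> i \<Longrightarrow> N \<le> j \<Longrightarrow> (\<integral>p. (\<Phi> (\<nu> i) p - \<Phi> (\<nu> j) p)\<^sup>2 \<partial>SM) \<le> 1"
      using cauchy[of 1] by auto
    have "energy \<alpha> \<mu> = (\<integral>\<^sup>+p. ennreal ((\<Phi> \<mu> p)\<^sup>2) \<partial>SM)"
      unfolding energy_def mutual_energy_SM[OF \<mu>(1) \<mu>(1)]
    proof (rule nn_integral_cong_AE)
      show "AE p in SM. hm \<mu> (fst p) (snd p) * hm \<mu> (fst p) (snd p) = ennreal ((\<Phi> \<mu> p)\<^sup>2)"
        using AE_SM_pos
      proof eventually_elim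
        case (elim p)
        have "hm \<mu> (fst p) (snd p) = ennreal (\<Phi> \<mu> p)" using \<mu>(2)[OF elim] by (simp add: \<Phi>_def less_top)
        then show ?case by (simp add: power2_eq_square ennreal_mult)
      qed
    qed
    also have "\<dots> \<le> (\<integral>\<^sup>+p. ennreal 2 * ennreal ((\<Phi> (\<nu> N) p - \<Phi> \<mu> p)\<^sup>2) + ennreal 2 * ennreal ((\<Phi> (\<nu> N) p)\<^sup>2) \<partial>SM)"
    proof (rule nn_integral_mono)
      fix p
      have "0 \<le> ((\<Phi> (\<nu> N) p - \<Phi> \<mu> p) + \<Phi> (\<nu> N) p)\<^sup>2" by simp
      then have "(\<Phi> \<mu> p)\<^sup>2 \<le> 2 * (\<Phi> (\<nu> N) p - \<Phi> \<mu> p)\<^sup>2 + 2 * (\<Phi> (\<nu> N) p)\<^sup>2"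
        by (simp add: power2_eq_square algebra_simps)
      then have "ennreal ((\<Phi> \<mu> p)\<^sup>2) \<le> ennreal (2 * (\<Phi> (\<nu> N) p - \<Phi> \<mu> p)\<^sup>2 + 2 * (\<Phi> (\<nu> N) p)\<^sup>2)" by (rule ennreal_leI)
      then show "ennreal ((\<Phi> \<mu> p)\<^sup>2) \<le> ennreal 2 * ennreal ((\<Phi> (\<nu> N) p - \<Phi> \<mu> p)\<^sup>2) + ennreal 2 * ennreal ((\<Phi> (\<nu> N) p)\<^sup>2)"
        by (simp add: ennreal_mult)
    qed
    also have "\<dots> = ennreal 2 * (\<integral>\<^sup>+p. ennreal ((\<Phi> (\<nu> N) p - \<Phi> \<mu> p)\<^sup>2) \<partial>SM) + ennreal 2 * (\<integral>\<^sup>+p. ennreal ((\<Phi> (\<nu> N) p)\<^sup>2) \<partial>SM)"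
      by (subst nn_integral_add, measurable, subst nn_integral_cmult, measurable, subst nn_integral_cmult, measurable)
    also have "\<dots> < \<infinity>"
    proof -
      have "(\<integral>\<^sup>+p. ennreal ((\<Phi> (\<nu> N) p - \<Phi> \<mu> p)\<^sup>2) \<partial>SM) < \<infinity>"
        by (rule order_le_less_trans[OF fatou[of N 1 N]]) (use N in auto)
      moreover have "(\<integral>\<^sup>+p. ennreal ((\<Phi> (\<nu> N) p)\<^sup>2) \<partial>SM) < \<infinity>"
        by (subst nn_integral_eq_integral[OF L2_square[OF LE]]) auto
      ultimately show ?thesis by (simp add: ennreal_mult_less_top)
    qed
    finally show ?thesis using \<mu>(1) by (simp add: E_plus_def)
  qed
  show ?thesis
  proof (rule that[OF \<mu>E], rule LIMSEQ_I)
    fix e :: real assume e: "0 < e"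
    obtain N where N: "\<And>i j. N \<le> i \<Longrightarrow> N \<le> j \<Longrightarrow> (\<integral>p. (\<Phi> (\<nu> i) p - \<Phi> (\<nu> j) p)\<^sup>2 \<partial>SM) \<le> e / 2"
      using cauchy[of "e / 2"] e by auto
    show "\<exists>no. \<forall>j\<ge>no. norm ((\<integral>p. (\<Phi> (\<nu> j) p - \<Phi> \<mu> p)\<^sup>2 \<partial>SM) - 0) < e"
    proof (intro exI allI impI)
      fix j assume j: "N \<le> j"
      have "(\<lambda>p. \<Phi> (\<nu> j) p - \<Phi> \<mu> p) \<in> L2 SM" using L2_add[OF LE[of j] \<Phi>_L2[OF \<mu>E], of "-1"] by simp
      from nn_integral_eq_integral[OF L2_square[OF this]] have "ennreal (\<integral>p. (\<Phi> (\<nu> j) p - \<Phi> \<mu> p)\<^sup>2 \<partial>SM) \<le> ennreal (e / 2)"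
        using fatou[of N "e / 2" j] N j by simp
      then have "(\<integral>p. (\<Phi> (\<nu> j) p - \<Phi> \<mu> p)\<^sup>2 \<partial>SM) \<le> e / 2" using e by simp
      moreover have "0 \<le> (\<integral>p. (\<Phi> (\<nu> j) p - \<Phi> \<mu> p)\<^sup>2 \<partial>SM)" by (intro integral_nonneg_AE) auto
      ultimately show "norm ((\<integral>p. (\<Phi> (\<nu> j) p - \<Phi> \<mu> p)\<^sup>2 \<partial>SM) - 0) < e" using e by simp
    qed
  qed
qed

end

section \<open>Projection and balayage\<close>

text \<open>Expresses the condition through Borel null sets, in which sums and restrictions of
  measures are easy to handle.\<close>

lemma carried_by_iff:
  assumes "sets (\<nu> :: 'a::euclidean_space measure) = sets borel"
  shows "carried_by \<nu> Q \<longleftrightarrow> (\<exists>N\<in>null_sets \<nu>. - Q \<subseteq> N)"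
proof -
  have sp: "space (completion \<nu>) = UNIV" using sets_eq_imp_space_eq[OF assms] by simp
  have "Q \<in> sets (completion \<nu>)" if "- Q \<in> null_sets (completion \<nu>)"
    using sets.compl_sets[of "- Q" "completion \<nu>"] that unfolding sp by (auto simp: Compl_eq_Diff_UNIV[symmetric] dest: null_setsD2)
  then show ?thesis by (auto simp: carried_by_def null_sets_completion_iff2)
qed

lemma null_measure_carried_by: "carried_by (null_measure borel :: 'a::euclidean_space measure) Q"
  by (subst carried_by_iff) (auto intro!: bexI[of _ UNIV] null_setsI)

section \<open>Minimization over the cone\<close>

context riesz begin

definition ip :: "'a measure \<Rightarrow> 'a measure \<Rightarrow> real" where
  "ip \<mu> \<nu> = enn2real (mutual_energy \<alpha> \<mu> \<nu>)"

definition dist2 :: "'a measure \<Rightarrow> 'a measure \<Rightarrow> real" where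
  "dist2 \<mu> \<nu> = ip \<mu> \<mu> - 2 * ip \<mu> \<nu> + ip \<nu> \<nu>"

lemma ip_nonneg [simp]: "0 \<le> ip \<mu> \<nu>"
  by (simp add: ip_def)

lemma mutual_energy_ip: "\<mu> \<in> E_plus \<alpha> \<Longrightarrow> \<nu> \<in> E_plus \<alpha> \<Longrightarrow> mutual_energy \<alpha> \<mu> \<nu> = ennreal (ip \<mu> \<nu>)"
  using mutual_energy_finite[of \<mu> \<nu>] by (simp add: ip_def less_top)

lemma ip_commute: "\<mu> \<in> E_plus \<alpha> \<Longrightarrow> \<nu> \<in> E_plus \<alpha> \<Longrightarrow> ip \<mu> \<nu> = ip \<nu> \<mu>"
  unfolding ip_def by (subst mutual_energy_commute) (auto dest: E_plus_radon)

lemma ip_\<Phi>: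
  assumes "\<mu> \<in> E_plus \<alpha>" "\<nu> \<in> E_plus \<alpha>" shows "ip \<mu> \<nu> = (\<integral>p. \<Phi> \<mu> p * \<Phi> \<nu> p \<partial>SM)"
proof -
  have "0 \<le> (\<integral>p. \<Phi> \<mu> p * \<Phi> \<nu> p \<partial>SM)" by (intro integral_nonneg_AE) (simp add: \<Phi>_nonneg)
  then show ?thesis by (simp add: ip_def mutual_energy_\<Phi>(2)[OF assms])
qed

lemma dist2_\<Phi>:
  assumes "\<mu> \<in> E_plus \<alpha>" "\<nu> \<in> E_plus \<alpha>" shows "dist2 \<mu> \<nu> = (\<integral>p. (\<Phi> \<mu> p - \<Phi> \<nu> p)\<^sup>2 \<partial>SM)"
  using L2_diff_square[OF \<Phi>_L2[OF assms(1)] \<Phi>_L2[OF assms(2)]] assms by (simp add: dist2_def ip_\<Phi> power2_eq_square)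

lemma dist2_nonneg: "\<mu> \<in> E_plus \<alpha> \<Longrightarrow> \<nu> \<in> E_plus \<alpha> \<Longrightarrow> 0 \<le> dist2 \<mu> \<nu>"
  unfolding dist2_\<Phi> by (intro integral_nonneg_AE) auto

lemma ip_CS:
  assumes "\<rho> \<in> E_plus \<alpha>" "\<mu> \<in> E_plus \<alpha>" "\<nu> \<in> E_plus \<alpha>"
  shows "(ip \<rho> \<mu> - ip \<rho> \<nu>)\<^sup>2 \<le> ip \<rho> \<rho> * dist2 \<mu> \<nu>"
proof -
  have d: "(\<lambda>p. \<Phi> \<mu> p - \<Phi> \<nu> p) \<in> L2 SM" using L2_add[OF \<Phi>_L2[OF assms(2)] \<Phi>_L2[OF assms(3)], of "-1"] by simp
  have "ip \<rho> \<mu> - ip \<rho> \<nu> = (\<integral>p. \<Phi> \<rho> p * (\<Phi> \<mu> p - \<Phi> \<nu> p) \<partial>SM)"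
    using L2_mult[OF \<Phi>_L2[OF assms(1)] \<Phi>_L2[OF assms(2)]] L2_mult[OF \<Phi>_L2[OF assms(1)] \<Phi>_L2[OF assms(3)]]
    by (simp add: right_diff_distrib ip_\<Phi> assms)
  then show ?thesis
    using L2_CS[OF \<Phi>_L2[OF assms(1)] d] by (simp add: ip_\<Phi> assms dist2_\<Phi> power2_eq_square)
qed

lemma ip_tendsto:
  assumes \<rho>: "\<rho> \<in> E_plus \<alpha>" and \<nu>: "\<And>j. \<nu> j \<in> E_plus \<alpha>" and \<mu>: "\<mu> \<in> E_plus \<alpha>"
    and lim: "(\<lambda>j. dist2 (\<nu> j) \<mu>) \<longlonglongrightarrow> 0"
  shows "(\<lambda>j. ip \<rho> (\<nu> j)) \<longlonglongrightarrow> ip \<rho> \<mu>"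
proof -
  have "(\<lambda>j. \<integral>p. \<Phi> \<rho> p * \<Phi> (\<nu> j) p \<partial>SM) \<longlonglongrightarrow> (\<integral>p. \<Phi> \<rho> p * \<Phi> \<mu> p \<partial>SM)"
    using lim unfolding dist2_\<Phi>[OF \<nu> \<mu>] by (intro L2_inner_tendsto \<Phi>_L2 \<rho> \<nu> \<mu>)
  then show ?thesis by (simp add: ip_\<Phi> \<rho> \<nu> \<mu>)
qed

lemma E_plus_on_E_plus: "\<nu> \<in> E_plus_on \<alpha> A \<Longrightarrow> \<nu> \<in> E_plus \<alpha>" for A :: "'a set"
  by (simp add: E_plus_on_def)

lemma null_E_plus_on: "(null_measure borel :: 'a measure) \<in> E_plus_on \<alpha> A"
  by (simp add: E_plus_on_def null_E_plus null_measure_carried_by)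

text \<open>Of the combination only its membership and its energies are exported; the minimization
  works with these alone.\<close>

lemma E_plus_on_cone:
  assumes \<mu>: "\<mu> \<in> E_plus_on \<alpha> A" and \<nu>: "\<nu> \<in> E_plus_on \<alpha> A" and a: "0 \<le> a" and b: "0 \<le> b"
  obtains \<kappa> where "\<kappa> \<in> E_plus_on \<alpha> (A :: 'a set)" "\<And>\<rho>. \<rho> \<in> E_plus \<alpha> \<Longrightarrow> ip \<rho> \<kappa> = a * ip \<rho> \<mu> + b * ip \<rho> \<nu>"
proof -
  have E: "\<mu> \<in> E_plus \<alpha>" "\<nu> \<in> E_plus \<alpha>" using \<mu> \<nu> by (auto dest: E_plus_on_E_plus)
  then have r: "radon \<mu>" "radon \<nu>" by (auto dest: E_plus_radon)
  then have s: "sets \<mu> = sets borel" "sets \<nu> = sets borel" by (auto dest: radon_sets)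
  define \<kappa> where "\<kappa> = madd (scale_measure (ennreal a) \<mu>) (scale_measure (ennreal b) \<nu>)"
  have sk: "sets \<kappa> = sets borel" by (simp add: \<kappa>_def)
  have em: "emeasure \<kappa> X = ennreal a * emeasure \<mu> X + ennreal b * emeasure \<nu> X" if "X \<in> sets borel" for X
    using that s by (simp add: \<kappa>_def emeasure_madd)
  have rk: "radon \<kappa>"
    unfolding radon_def
  proof (intro conjI allI impI sk)
    fix K :: "'a set" assume "compact K"
    then show "emeasure \<kappa> K < \<infinity>" using r by (simp add: em borel_compact radon_def ennreal_mult_less_top)
  qed
  have me: "mutual_energy \<alpha> \<rho> \<kappa> = ennreal a * mutual_energy \<alpha> \<rho> \<mu> + ennreal b * mutual_energy \<alpha> \<rho> \<nu>" if \<rho>: "radon \<rho>" for \<rho>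
  proof -
    have m: "pw 0 \<rho> \<in> borel_measurable borel" by (rule pw_measurable[OF \<rho>])
    then have m': "pw 0 \<rho> \<in> borel_measurable \<mu>" "pw 0 \<rho> \<in> borel_measurable \<nu>" by (simp_all add: measurable_cong_sets[OF s(1) refl] measurable_cong_sets[OF s(2) refl])
    show ?thesis
      unfolding mutual_energy_commute[OF \<rho> rk] mutual_energy_commute[OF \<rho> r(1)] mutual_energy_commute[OF \<rho> r(2)]
        mutual_energy_pw[OF rk \<rho>] mutual_energy_pw[OF r(1) \<rho>] mutual_energy_pw[OF r(2) \<rho>]
      unfolding \<kappa>_def
      using s m m' by (simp add: nn_integral_madd nn_integral_scale_measure)
  qed
  have fin: "mutual_energy \<alpha> \<rho> \<kappa> < \<infinity>" if "\<rho> \<in> E_plus \<alpha>" for \<rho>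
    unfolding me[OF E_plus_radon[OF that]] using mutual_energy_finite[OF that E(1)] mutual_energy_finite[OF that E(2)]
    by (simp add: ennreal_mult_less_top)
  have kE: "\<kappa> \<in> E_plus \<alpha>"
    using fin[OF E(1)] fin[OF E(2)] rk
    by (simp add: E_plus_def energy_def me mutual_energy_commute[OF rk r(1)] mutual_energy_commute[OF rk r(2)] ennreal_mult_less_top)
  have "carried_by \<kappa> A"
  proof -
    \<comment> \<open>Each null set covers the complement of \<open>A\<close>, so their intersection
      does too, and it is null for both measures.\<close>
    obtain N N' where N: "N \<in> null_sets \<mu>" "- A \<subseteq> N" "N' \<in> null_sets \<nu>" "- A \<subseteq> N'"
      using \<mu> \<nu> by (auto simp: E_plus_on_def carried_by_iff s)
    then have b: "N \<inter> N' \<in> sets borel" "N \<in> sets borel" "N' \<in> sets borel" using s by (auto dest!: null_setsD2)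
    have "emeasure \<mu> (N \<inter> N') \<le> emeasure \<mu> N" "emeasure \<nu> (N \<inter> N') \<le> emeasure \<nu> N'"
      using N by (auto intro!: emeasure_mono)
    then have "emeasure \<mu> (N \<inter> N') = 0" "emeasure \<nu> (N \<inter> N') = 0"
      using null_setsD1[OF N(1)] null_setsD1[OF N(3)] by simp_all
    then have "emeasure \<kappa> (N \<inter> N') = 0" using b by (simp add: em)
    then show ?thesis using N b by (auto simp: carried_by_iff sk intro!: bexI[of _ "N \<inter> N'"] null_setsI)
  qed
  moreover have "ip \<rho> \<kappa> = a * ip \<rho> \<mu> + b * ip \<rho> \<nu>" if "\<rho> \<in> E_plus \<alpha>" for \<rho>
    unfolding ip_def me[OF E_plus_radon[OF that]]
    using a b by (simp add: mutual_energy_ip[OF that] E ennreal_mult[symmetric] ennreal_plus[symmetric] del: ennreal_plus)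
  ultimately show ?thesis using that kE by (simp add: E_plus_on_def)
qed

text \<open>Allows an inequality that holds for all measures on \<open>A\<close> to be localized to
  a Borel set; energies can only decrease under restriction.\<close>

lemma E_plus_on_restrict:
  assumes \<nu>: "\<nu> \<in> E_plus_on \<alpha> A" and B: "B \<in> sets borel"
  shows "density \<nu> (indicator B) \<in> E_plus_on \<alpha> (A :: 'a set)"
proof -
  have E: "\<nu> \<in> E_plus \<alpha>" using \<nu> by (auto dest: E_plus_on_E_plus)
  then have r: "radon \<nu>" by (auto dest: E_plus_radon)
  then have s [measurable_cong]: "sets \<nu> = sets borel" by (auto dest: radon_sets)
  note [measurable] = B
  let ?\<nu> = "density \<nu> (indicator B)"
  have le: "emeasure ?\<nu> X \<le> emeasure \<nu> X" if [measurable]: "X \<in> sets borel" for X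
  proof -
    have "emeasure ?\<nu> X = (\<integral>\<^sup>+x. indicator B x * indicator X x \<partial>\<nu>)" by (subst emeasure_density) auto
    also have "\<dots> \<le> (\<integral>\<^sup>+x. indicator X x \<partial>\<nu>)" by (intro nn_integral_mono) (auto simp: indicator_def)
    finally show ?thesis using s that by simp
  qed
  have r': "radon ?\<nu>"
    using r order_le_less_trans[OF le] by (auto simp: radon_def borel_compact)
  have int_le: "(\<integral>\<^sup>+x. f x \<partial>?\<nu>) \<le> (\<integral>\<^sup>+x. f x \<partial>\<nu>)" if "f \<in> borel_measurable borel" for f
  proof -
    have "(\<integral>\<^sup>+x. f x \<partial>?\<nu>) = (\<integral>\<^sup>+x. indicator B x * f x \<partial>\<nu>)" using that by (subst nn_integral_density) auto
    also have "\<dots> \<le> (\<integral>\<^sup>+x. f x \<partial>\<nu>)" by (intro nn_integral_mono) (auto simp: indicator_def)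
    finally show ?thesis .
  qed
  have "mutual_energy \<alpha> ?\<nu> ?\<nu> \<le> mutual_energy \<alpha> \<nu> ?\<nu>"
    unfolding mutual_energy_pw[OF r' r'] mutual_energy_pw[OF r r'] by (rule int_le[OF pw_measurable[OF r']])
  also have "\<dots> = mutual_energy \<alpha> ?\<nu> \<nu>" by (rule mutual_energy_commute[OF r r'])
  also have "\<dots> \<le> mutual_energy \<alpha> \<nu> \<nu>"
    unfolding mutual_energy_pw[OF r' r] mutual_energy_pw[OF r r] by (rule int_le[OF pw_measurable[OF r]])
  also have "\<dots> < \<infinity>" by (rule mutual_energy_finite[OF E E])
  finally have "?\<nu> \<in> E_plus \<alpha>" using r' by (simp add: E_plus_def energy_def)
  moreover have "carried_by ?\<nu> A"
  proof -
    obtain N where N: "N \<in> null_sets \<nu>" "- A \<subseteq> N" using \<nu> by (auto simp: E_plus_on_def carried_by_iff s)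
    then have "N \<in> sets borel" using s by (auto dest: null_setsD2)
    then have "N \<in> null_sets ?\<nu>" using le[of N] N by (intro null_setsI) (auto simp: s dest: null_setsD1)
    then show ?thesis using N(2) by (auto simp: carried_by_iff s)
  qed
  ultimately show ?thesis by (simp add: E_plus_on_def)
qed

text \<open>The first-order condition at the end point 0. The chosen \<open>s\<close> satisfies
  \<open>s * (\<bar>N\<bar> + 1) \<le> v\<close>, so a positive linear term would beat the quadratic
  one.\<close>

lemma quadratic_nonneg_imp_nonpos:
  fixes v N :: real
  assumes "\<And>s. 0 \<le> s \<Longrightarrow> s \<le> 1 \<Longrightarrow> 0 \<le> s\<^sup>2 * N - 2 * s * v"
  shows "v \<le> 0"
proof (rule ccontr)
  assume "\<not> v \<le> 0"
  then have v: "0 < v" by simp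
  define s where "s = min 1 (v / (\<bar>N\<bar> + 1))"
  have s: "0 < s" "s \<le> 1" "s * (\<bar>N\<bar> + 1) \<le> v"
    using v by (auto simp: s_def pos_le_divide_eq[symmetric])
  have "0 \<le> s * (s * N - 2 * v)"
    using assms[of s] s(1,2) by (simp add: power2_eq_square right_diff_distrib mult.assoc mult.left_commute)
  then have "2 * v \<le> s * N" using s(1) by (simp add: zero_le_mult_iff)
  also have "\<dots> \<le> s * (\<bar>N\<bar> + 1)" using s by (intro mult_left_mono) auto
  finally show False using s v by simp
qed

text \<open>In a cone a direction \<kappa> may be added but not subtracted, so variations along
  \<kappa> yield inequalities only. Multiples of the minimizer can be varied both ways, which yields
  the equality.\<close>

lemma projection_exists:
  assumes L: "L \<in> E_plus \<alpha>"
  obtains P \<nu> where "P \<in> E_plus \<alpha>" "\<And>j. \<nu> (j::nat) \<in> E_plus_on \<alpha> (A :: 'a set)" "(\<lambda>j. dist2 (\<nu> j) P) \<longlonglongrightarrow> 0"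
    "\<And>\<kappa>. \<kappa> \<in> E_plus_on \<alpha> A \<Longrightarrow> ip \<kappa> L \<le> ip \<kappa> P" "ip P P = ip P L"
proof -
  note on = E_plus_on_E_plus
  define d where "d = (INF \<nu>\<in>E_plus_on \<alpha> A. dist2 L \<nu>)"
  have bdd: "bdd_below (dist2 L ` E_plus_on \<alpha> A)"
    by (intro bdd_belowI[of _ 0]) (auto intro!: dist2_nonneg[OF L] dest: on)
  have d_le: "d \<le> dist2 L \<nu>" if "\<nu> \<in> E_plus_on \<alpha> A" for \<nu>
    unfolding d_def by (rule cINF_lower[OF bdd that])
  have "\<exists>\<nu>\<in>E_plus_on \<alpha> A. dist2 L \<nu> < d + 1 / real (Suc j)" for j
  proof -
    have "dist2 L ` E_plus_on \<alpha> A \<noteq> {}" using null_E_plus_on by auto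
    from cInf_lessD[OF this, of "d + 1 / real (Suc j)"] show ?thesis by (auto simp: d_def)
  qed
  then obtain \<nu> where \<nu>: "\<And>j. \<nu> j \<in> E_plus_on \<alpha> A" and \<nu>d: "\<And>j. dist2 L (\<nu> j) < d + 1 / real (Suc j)"
    by metis
  note \<nu>E = on[OF \<nu>]
  \<comment> \<open>All competitors are combinations of two members of the cone; the distance from
    \<open>L\<close> to such a combination is expanded here once.\<close>
  have comb: "d \<le> ip L L - 2 * (a * ip L \<mu> + b * ip L \<mu>') + (a\<^sup>2 * ip \<mu> \<mu> + 2 * a * b * ip \<mu> \<mu>' + b\<^sup>2 * ip \<mu>' \<mu>')"
    if \<mu>: "\<mu> \<in> E_plus_on \<alpha> A" "\<mu>' \<in> E_plus_on \<alpha> A" "0 \<le> a" "0 \<le> b" for \<mu> \<mu>' a b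
  proof -
    obtain \<kappa> where \<kappa>: "\<kappa> \<in> E_plus_on \<alpha> A" "\<And>\<rho>. \<rho> \<in> E_plus \<alpha> \<Longrightarrow> ip \<rho> \<kappa> = a * ip \<rho> \<mu> + b * ip \<rho> \<mu>'"
      using E_plus_on_cone[OF \<mu>] by metis
    have "ip \<kappa> \<kappa> = a * ip \<mu> \<kappa> + b * ip \<mu>' \<kappa>"
      using \<kappa>(2)[OF on[OF \<kappa>(1)]] by (simp add: ip_commute on[OF \<kappa>(1)] on[OF \<mu>(1)] on[OF \<mu>(2)])
    also have "\<dots> = a\<^sup>2 * ip \<mu> \<mu> + 2 * a * b * ip \<mu> \<mu>' + b\<^sup>2 * ip \<mu>' \<mu>'"
      unfolding \<kappa>(2)[OF on[OF \<mu>(1)]] \<kappa>(2)[OF on[OF \<mu>(2)]] ip_commute[OF on[OF \<mu>(2)] on[OF \<mu>(1)]]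
      by (simp add: power2_eq_square algebra_simps)
    finally show ?thesis using d_le[OF \<kappa>(1)] by (simp add: dist2_def \<kappa>(2)[OF L])
  qed
  \<comment> \<open>The midpoint of \<open>\<nu> i\<close> and \<open>\<nu> j\<close> is a
    competitor, and the parallelogram law bounds their distance.\<close>
  have cauchy: "dist2 (\<nu> i) (\<nu> j) \<le> 2 / real (Suc i) + 2 / real (Suc j)" for i j
  proof -
    have "4 * d \<le> 4 * ip L L - 4 * ip L (\<nu> i) - 4 * ip L (\<nu> j) + ip (\<nu> i) (\<nu> i) + 2 * ip (\<nu> i) (\<nu> j) + ip (\<nu> j) (\<nu> j)"
      using comb[OF \<nu>[of i] \<nu>[of j], of "1/2" "1/2"] by (simp add: power2_eq_square)
    moreover have "2 / real (Suc k) = 2 * (1 / real (Suc k))" for k by simp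
    ultimately show ?thesis using \<nu>d[of i] \<nu>d[of j] unfolding dist2_def by linarith
  qed
  obtain P where P: "P \<in> E_plus \<alpha>" and limP: "(\<lambda>j. dist2 (\<nu> j) P) \<longlonglongrightarrow> 0"
  proof (rule strongly_complete[of \<nu> "2 * (d + 1) + 2 * ip L L"])
    show "\<nu> j \<in> E_plus \<alpha>" for j by (rule \<nu>E)
    show "(\<integral>p. (\<Phi> (\<nu> j) p)\<^sup>2 \<partial>SM) \<le> 2 * (d + 1) + 2 * ip L L" for j
    proof -
      \<comment> \<open>The square of \<open>2 * L - \<nu> j\<close> bounds the energy of
        \<open>\<nu> j\<close> in terms of its distance to \<open>L\<close>.\<close>
      have "0 \<le> (\<integral>p. (2 * \<Phi> L p - \<Phi> (\<nu> j) p)\<^sup>2 \<partial>SM)" by (intro integral_nonneg_AE) auto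
      also have "\<dots> = 4 * ip L L - 4 * ip L (\<nu> j) + ip (\<nu> j) (\<nu> j)"
      proof -
        have "(\<lambda>p. 2 * \<Phi> L p) \<in> L2 SM" using L2_add[OF \<Phi>_L2[OF L] \<Phi>_L2[OF L], of 1] by simp
        from L2_diff_square[OF this \<Phi>_L2[OF \<nu>E[of j]]] show ?thesis
          unfolding ip_\<Phi>[OF L L] ip_\<Phi>[OF L \<nu>E] ip_\<Phi>[OF \<nu>E \<nu>E] power_mult_distrib by (simp add: power2_eq_square mult.assoc)
      qed
      finally have "ip (\<nu> j) (\<nu> j) \<le> 2 * dist2 L (\<nu> j) + 2 * ip L L" by (simp add: dist2_def)
      also have "dist2 L (\<nu> j) \<le> d + 1"
        proof -
          have "1 / real (Suc j) \<le> 1" by simp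
          then show ?thesis using \<nu>d[of j] by linarith
        qed
      finally show ?thesis by (simp add: ip_\<Phi> \<nu>E power2_eq_square)
    qed
    fix \<epsilon> :: real assume \<epsilon>: "0 < \<epsilon>"
    obtain N where N: "4 / \<epsilon> < real N" using reals_Archimedean2 by blast
    show "\<exists>N. \<forall>i\<ge>N. \<forall>j\<ge>N. (\<integral>p. (\<Phi> (\<nu> i) p - \<Phi> (\<nu> j) p)\<^sup>2 \<partial>SM) \<le> \<epsilon>"
    proof (intro exI allI impI)
      fix i j assume ij: "N \<le> i" "N \<le> j"
      have *: "2 / real (Suc k) \<le> \<epsilon> / 2" if "N \<le> k" for k
      proof -
        have "4 / \<epsilon> \<le> real (Suc k)" using N that by linarith
        then show ?thesis using \<epsilon> by (simp add: field_simps)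
      qed
      show "(\<integral>p. (\<Phi> (\<nu> i) p - \<Phi> (\<nu> j) p)\<^sup>2 \<partial>SM) \<le> \<epsilon>"
        using cauchy[of i j] *[OF ij(1)] *[OF ij(2)] by (simp add: dist2_\<Phi> \<nu>E)
    qed
  next
    fix P assume "P \<in> E_plus \<alpha>" "(\<lambda>j. \<integral>p. (\<Phi> (\<nu> j) p - \<Phi> P p)\<^sup>2 \<partial>SM) \<longlonglongrightarrow> 0"
    then show thesis by (intro that[of P]) (simp_all add: dist2_\<Phi> \<nu>E)
  qed
  have lim: "(\<lambda>j. ip \<rho> (\<nu> j)) \<longlonglongrightarrow> ip \<rho> P" if "\<rho> \<in> E_plus \<alpha>" for \<rho>
    by (rule ip_tendsto[OF that \<nu>E P limP])
  have lim2: "(\<lambda>j. ip (\<nu> j) (\<nu> j)) \<longlonglongrightarrow> ip P P"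
  proof -
    have "(\<lambda>j. dist2 (\<nu> j) P + 2 * ip P (\<nu> j) - ip P P) \<longlonglongrightarrow> 0 + 2 * ip P P - ip P P"
      by (intro tendsto_intros limP lim P)
    then show ?thesis by (simp add: dist2_def ip_commute[OF \<nu>E P])
  qed
  have limd: "(\<lambda>j. dist2 L (\<nu> j)) \<longlonglongrightarrow> d"
  proof (rule tendsto_sandwich[OF _ _ tendsto_const])
    show "(\<lambda>j. d + 1 / real (Suc j)) \<longlonglongrightarrow> d"
      using tendsto_add[OF tendsto_const LIMSEQ_Suc[OF lim_1_over_n], of d] by simp
  qed (use d_le[OF \<nu>] less_imp_le[OF \<nu>d] in simp_all)
  \<comment> \<open>The competitor is \<open>\<nu> j\<close> plus \<open>s\<close> times \<kappa>,
    followed by the limit in \<open>j\<close>, since \<open>P\<close> itself is not known to be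
    carried by \<open>A\<close>.\<close>
  have var: "0 \<le> s\<^sup>2 * ip \<kappa> \<kappa> - 2 * s * (ip \<kappa> L - ip \<kappa> P)" if \<kappa>: "\<kappa> \<in> E_plus_on \<alpha> A" and s: "0 \<le> s" for s \<kappa>
  proof -
    have "0 \<le> dist2 L (\<nu> j) - d + (s\<^sup>2 * ip \<kappa> \<kappa> - 2 * s * (ip \<kappa> L - ip \<kappa> (\<nu> j)))" for j
      using comb[OF \<nu>[of j] \<kappa>, of 1 s] s ip_commute[OF L on[OF \<kappa>]] ip_commute[OF \<nu>E[of j] on[OF \<kappa>]]
      by (simp add: dist2_def algebra_simps)
    moreover have "(\<lambda>j. dist2 L (\<nu> j) - d + (s\<^sup>2 * ip \<kappa> \<kappa> - 2 * s * (ip \<kappa> L - ip \<kappa> (\<nu> j)))) \<longlonglongrightarrow>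
        d - d + (s\<^sup>2 * ip \<kappa> \<kappa> - 2 * s * (ip \<kappa> L - ip \<kappa> P))"
      by (intro tendsto_intros limd lim on[OF \<kappa>])
    ultimately show ?thesis using LIMSEQ_le_const[of _ _ 0] by (metis (no_types, lifting) add_0 diff_self)
  qed
  \<comment> \<open>The competitor is \<open>1 + s\<close> times \<open>\<nu> j\<close>, admissible
    from \<open>s = -1\<close> on; both signs of \<open>s\<close> make the first-order condition an
    equality.\<close>
  have varP: "0 \<le> s\<^sup>2 * ip P P - 2 * s * (ip L P - ip P P)" if s: "-1 \<le> s" for s
  proof -
    have "0 \<le> dist2 L (\<nu> j) - d + (s\<^sup>2 * ip (\<nu> j) (\<nu> j) - 2 * s * (ip L (\<nu> j) - ip (\<nu> j) (\<nu> j)))" for j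
      using comb[OF \<nu>[of j] \<nu>[of j], of "1 + s" 0] s by (simp add: dist2_def power2_eq_square algebra_simps)
    moreover have "(\<lambda>j. dist2 L (\<nu> j) - d + (s\<^sup>2 * ip (\<nu> j) (\<nu> j) - 2 * s * (ip L (\<nu> j) - ip (\<nu> j) (\<nu> j)))) \<longlonglongrightarrow>
        d - d + (s\<^sup>2 * ip P P - 2 * s * (ip L P - ip P P))"
      by (intro tendsto_intros limd lim lim2 L)
    ultimately show ?thesis using LIMSEQ_le_const[of _ _ 0] by (metis (no_types, lifting) add_0 diff_self)
  qed
  show ?thesis
  proof (rule that[OF P \<nu> limP])
    fix \<kappa> assume "\<kappa> \<in> E_plus_on \<alpha> A"
    then have "ip \<kappa> L - ip \<kappa> P \<le> 0" using var by (intro quadratic_nonneg_imp_nonpos[of "ip \<kappa> \<kappa>"]) blast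
    then show "ip \<kappa> L \<le> ip \<kappa> P" by simp
  next
    have "ip L P - ip P P \<le> 0" by (rule quadratic_nonneg_imp_nonpos[of "ip P P"]) (rule varP, simp)
    moreover have "- (ip L P - ip P P) \<le> 0"
    proof (rule quadratic_nonneg_imp_nonpos[of "ip P P"])
      fix s :: real assume "0 \<le> s" "s \<le> 1"
      then show "0 \<le> s\<^sup>2 * ip P P - 2 * s * - (ip L P - ip P P)" using varP[of "- s"] by (simp add: right_diff_distrib)
    qed
    ultimately show "ip P P = ip P L" using ip_commute[OF L P] by simp
  qed
qed

text \<open>Both sides integrate the maximum of the two potentials.\<close>

lemma I_excess_swap:
  assumes "\<nu> \<in> E_plus \<alpha>" "\<mu>\<^sub>1 \<in> E_plus \<alpha>" "\<mu>\<^sub>2 \<in> E_plus \<alpha>"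
  shows "I \<nu> (excess 0 \<mu>\<^sub>1 \<mu>\<^sub>2) + ip \<nu> \<mu>\<^sub>2 = I \<nu> (excess 0 \<mu>\<^sub>2 \<mu>\<^sub>1) + ip \<nu> \<mu>\<^sub>1"
proof -
  have r: "radon \<nu>" "radon \<mu>\<^sub>1" "radon \<mu>\<^sub>2" using assms by (auto dest: E_plus_radon)
  note [measurable_cong] = radon_sets[OF r(1)]
  have add: "I \<nu> (excess 0 \<mu> \<mu>') + ip \<nu> \<mu>' = I \<nu> (\<lambda>x. excess 0 \<mu> \<mu>' x + up 0 \<mu>' x)"
    if \<mu>: "\<mu> \<in> E_plus \<alpha>" "\<mu>' \<in> E_plus \<alpha>" for \<mu> \<mu>'
  proof -
    have [measurable]: "excess 0 \<mu> \<mu>' \<in> borel_measurable borel" "up 0 \<mu>' \<in> borel_measurable borel"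
      using \<mu> by (auto intro!: excess_measurable up_measurable dest: E_plus_radon)
    have f: "(\<integral>\<^sup>+x. ennreal (up 0 \<mu>' x) \<partial>\<nu>) < \<infinity>"
      using nn_integral_excess_finite[OF \<mu>(2) assms(1), of 0 "null_measure borel"] by (simp add: excess_null)
    have "(\<integral>\<^sup>+x. ennreal (excess 0 \<mu> \<mu>' x + up 0 \<mu>' x) \<partial>\<nu>) = (\<integral>\<^sup>+x. ennreal (excess 0 \<mu> \<mu>' x) \<partial>\<nu>) + (\<integral>\<^sup>+x. ennreal (up 0 \<mu>' x) \<partial>\<nu>)"
      by (subst nn_integral_add[symmetric]) auto
    then show ?thesis
      unfolding I_up[OF assms(1) \<mu>(2), folded ip_def, symmetric] I_def
      using f nn_integral_excess_finite[OF \<mu>(1) assms(1), of 0 \<mu>'] by (simp add: enn2real_plus)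
  qed
  have "(\<lambda>x. excess 0 \<mu>\<^sub>1 \<mu>\<^sub>2 x + up 0 \<mu>\<^sub>2 x) = (\<lambda>x. excess 0 \<mu>\<^sub>2 \<mu>\<^sub>1 x + up 0 \<mu>\<^sub>1 x)"
    by (auto simp: excess_def max_def)
  then show ?thesis unfolding add[OF assms(2,3)] add[OF assms(3,2)] by simp
qed

text \<open>The hypothesis is tested with the restriction of \<nu> to the set where the potential of
  \<open>P\<close> is the smaller one. There the opposite excess vanishes, so the energy inequality
  bounds a nonnegative integral by 0.\<close>

lemma I_excess_eq_0:
  assumes \<nu>: "\<nu> \<in> E_plus_on \<alpha> (A :: 'a set)" and L: "L \<in> E_plus \<alpha>" and P: "P \<in> E_plus \<alpha>"
    and le: "\<And>\<kappa>. \<kappa> \<in> E_plus_on \<alpha> A \<Longrightarrow> ip \<kappa> L \<le> ip \<kappa> P"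
  shows "I \<nu> (excess 0 L P) = 0"
proof -
  have r: "radon \<nu>" "radon L" "radon P" using \<nu> L P by (auto dest: E_plus_radon E_plus_on_E_plus)
  note [measurable_cong] = radon_sets[OF r(1)]
  note [measurable] = up_measurable[OF r(2), of 0] up_measurable[OF r(3), of 0] excess_measurable[OF r(2,3), of 0] excess_measurable[OF r(3,2), of 0]
  define B where "B = {x. up 0 P x < up 0 L x}"
  have B [measurable]: "B \<in> sets borel" unfolding B_def by measurable
  let ?\<nu> = "density \<nu> (indicator B)"
  have on: "?\<nu> \<in> E_plus_on \<alpha> A" by (rule E_plus_on_restrict[OF \<nu> B])
  have dens: "I ?\<nu> (excess 0 L P) = I \<nu> (excess 0 L P)" "I ?\<nu> (excess 0 P L) = 0"
  proof -
    have "(\<integral>\<^sup>+x. ennreal (excess 0 L P x) \<partial>?\<nu>) = (\<integral>\<^sup>+x. ennreal (excess 0 L P x) \<partial>\<nu>)"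
      by (subst nn_integral_density) (auto simp: B_def excess_def indicator_def max_def intro!: nn_integral_cong)
    then show "I ?\<nu> (excess 0 L P) = I \<nu> (excess 0 L P)" by (simp add: I_def)
    have "(\<integral>\<^sup>+x. ennreal (excess 0 P L x) \<partial>?\<nu>) = (\<integral>\<^sup>+x. 0 \<partial>\<nu>)"
    proof (subst nn_integral_density)
      have "indicator B x * ennreal (excess 0 P L x) = 0" for x by (auto simp: B_def excess_def indicator_def max_def)
      then have "(\<lambda>x. indicator B x * ennreal (excess 0 P L x)) = (\<lambda>x. 0)" by (rule ext)
      then show "(\<integral>\<^sup>+x. indicator B x * ennreal (excess 0 P L x) \<partial>\<nu>) = (\<integral>\<^sup>+x. 0 \<partial>\<nu>)" by simp
    qed auto
    then show "I ?\<nu> (excess 0 P L) = 0" by (simp add: I_def)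
  qed
  have "I \<nu> (excess 0 L P) + ip ?\<nu> P = ip ?\<nu> L"
    using I_excess_swap[OF E_plus_on_E_plus[OF on] L P] dens by simp
  moreover have "0 \<le> I \<nu> (excess 0 L P)" by (simp add: I_def)
  ultimately show ?thesis using le[OF on] by simp
qed

theorem projection:
  assumes L: "L \<in> E_plus \<alpha>"
  obtains P \<nu> where "P \<in> E_plus \<alpha>" "\<And>j. \<nu> (j::nat) \<in> E_plus_on \<alpha> (A :: 'a set)" "(\<lambda>j. dist2 (\<nu> j) P) \<longlonglongrightarrow> 0"
    "\<And>\<kappa>. \<kappa> \<in> E_plus_on \<alpha> A \<Longrightarrow> ip \<kappa> P = ip \<kappa> L"
proof -
  obtain P \<nu> where P: "P \<in> E_plus \<alpha>" and \<nu>: "\<And>j. \<nu> (j::nat) \<in> E_plus_on \<alpha> A" and lim: "(\<lambda>j. dist2 (\<nu> j) P) \<longlonglongrightarrow> 0"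
    and le: "\<And>\<kappa>. \<kappa> \<in> E_plus_on \<alpha> A \<Longrightarrow> ip \<kappa> L \<le> ip \<kappa> P" and eq: "ip P P = ip P L"
    using projection_exists[OF L, of A] by metis
  note zero = I_excess_eq_0[OF _ L P le]
  \<comment> \<open>Domination compares \<open>P\<close> with \<open>\<nu> j\<close>: the integral
    is 0 for \<open>\<nu> j\<close>, and the distance tends to 0.\<close>
  have "(I P (excess 0 L P))\<^sup>2 \<le> I L (excess 0 L P) * dist2 (\<nu> j) P" for j
  proof -
    have "dist2 (\<nu> j) P = dist2 P (\<nu> j)" using ip_commute[OF P E_plus_on_E_plus[OF \<nu>[of j]]] by (simp add: dist2_def)
    then show ?thesis
      using domination[OF L P P E_plus_on_E_plus[OF \<nu>[of j]]] zero[OF \<nu>[of j]] by (simp add: dist2_\<Phi>[OF P E_plus_on_E_plus[OF \<nu>]])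
  qed
  moreover have "(\<lambda>j. I L (excess 0 L P) * dist2 (\<nu> j) P) \<longlonglongrightarrow> I L (excess 0 L P) * 0"
    by (intro tendsto_intros lim)
  ultimately have "(I P (excess 0 L P))\<^sup>2 \<le> I L (excess 0 L P) * 0"
    by (intro LIMSEQ_le_const) auto
  then have "I P (excess 0 L P) = 0" by simp
  \<comment> \<open>The energies of \<open>P\<close> with itself and with \<open>L\<close> agree, so
    the two excesses have the same integral against \<open>P\<close>.\<close>
  then have P0: "I P (excess 0 P L) = 0" using I_excess_swap[OF P P L] eq by simp
  have "ip \<kappa> P = ip \<kappa> L" if \<kappa>: "\<kappa> \<in> E_plus_on \<alpha> A" for \<kappa>
  proof -
    \<comment> \<open>Here \<kappa> is compared with the zero measure at an arbitrary finite
      distance; the right-hand side vanishes through its factor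
      \<open>I P (excess 0 P L)\<close>.\<close>
    have "(I \<kappa> (excess 0 P L) - I (null_measure borel) (excess 0 P L))\<^sup>2 \<le> 0"
      using domination[OF P L E_plus_on_E_plus[OF \<kappa>] null_E_plus] by (simp add: P0)
    then have "I \<kappa> (excess 0 P L) = 0" by (simp add: I_def)
    then show ?thesis using I_excess_swap[OF E_plus_on_E_plus[OF \<kappa>] P L] zero[OF \<kappa>] by simp
  qed
  then show ?thesis by (rule that[OF P \<nu> lim])
qed

section \<open>Signed measures and the strong closure\<close>

definition \<Psi> :: "'a signed_measure \<Rightarrow> real \<times> 'a \<Rightarrow> real" where
  "\<Psi> k p = \<Phi> (fst k) p - \<Phi> (snd k) p"

lemma E_space_E_plus: "k \<in> E_space \<alpha> \<Longrightarrow> fst k \<in> E_plus \<alpha> \<and> snd k \<in> E_plus \<alpha>" for k :: "'a signed_measure"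
  by (simp add: E_space_def E_plus_def signed_radon_def)

lemma of_positive_E_space: "\<mu> \<in> E_plus \<alpha> \<Longrightarrow> of_positive \<mu> \<in> E_space \<alpha>" for \<mu> :: "'a measure"
  using null_E_plus mutual_energy_finite[OF _ null_E_plus, of \<mu>] E_plus_radon[OF null_E_plus]
  by (auto simp: E_space_def E_plus_def of_positive_def signed_radon_def intro!: bexI[of _ UNIV])

lemma \<Psi>_L2: "k \<in> E_space \<alpha> \<Longrightarrow> \<Psi> k \<in> L2 SM"
  using L2_add[of "\<Phi> (fst k)" SM "\<Phi> (snd k)" "-1"] E_space_E_plus[of k] by (simp add: \<Psi>_def[abs_def] \<Phi>_L2)

lemma \<Psi>_of_positive [simp]: "\<Psi> (of_positive \<mu>) = \<Phi> \<mu>"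
  by (simp add: fun_eq_iff \<Psi>_def of_positive_def \<Phi>_def hm_def)

lemma E_inner_\<Psi>:
  assumes "k \<in> E_space \<alpha>" "k' \<in> E_space \<alpha>"
  shows "E_inner \<alpha> k k' = (\<integral>p. \<Psi> k p * \<Psi> k' p \<partial>SM)"
proof -
  note E = E_space_E_plus[OF assms(1), THEN conjunct1] E_space_E_plus[OF assms(1), THEN conjunct2]
    E_space_E_plus[OF assms(2), THEN conjunct1] E_space_E_plus[OF assms(2), THEN conjunct2]
  note i = E[THEN \<Phi>_L2]
  have "(\<integral>p. \<Psi> k p * \<Psi> k' p \<partial>SM) = (\<integral>p. (\<Phi> (fst k) p * \<Phi> (fst k') p + \<Phi> (snd k) p * \<Phi> (snd k') p)
      - \<Phi> (fst k) p * \<Phi> (snd k') p - \<Phi> (snd k) p * \<Phi> (fst k') p \<partial>SM)"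
    by (intro Bochner_Integration.integral_cong) (auto simp: \<Psi>_def algebra_simps)
  also have "\<dots> = E_inner \<alpha> k k'"
    unfolding E_inner_def ip_def[symmetric] ip_\<Phi>[OF E(1,3)] ip_\<Phi>[OF E(2,4)] ip_\<Phi>[OF E(1,4)] ip_\<Phi>[OF E(2,3)]
    using L2_mult[OF i(1,3)] L2_mult[OF i(2,4)] L2_mult[OF i(1,4)] L2_mult[OF i(2,3)] by simp
  finally show ?thesis by simp
qed

lemma strong_dist_\<Psi>:
  assumes "k \<in> E_space \<alpha>" "k' \<in> E_space \<alpha>"
  shows "strong_dist \<alpha> k k' = sqrt (\<integral>p. (\<Psi> k p - \<Psi> k' p)\<^sup>2 \<partial>SM)"
  unfolding strong_dist_def L2_diff_square[OF \<Psi>_L2[OF assms(1)] \<Psi>_L2[OF assms(2)]]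
  by (simp add: E_inner_\<Psi> assms power2_eq_square)

lemma strong_dist_dist2:
  "\<mu> \<in> E_plus \<alpha> \<Longrightarrow> \<nu> \<in> E_plus \<alpha> \<Longrightarrow> strong_dist \<alpha> (of_positive \<mu>) (of_positive \<nu>) = sqrt (dist2 \<mu> \<nu>)"
  by (simp add: strong_dist_\<Psi> of_positive_E_space dist2_\<Phi>)

lemma of_positive_E_closure:
  assumes P: "P \<in> E_plus \<alpha>" and \<nu>: "\<And>j. \<nu> (j::nat) \<in> E_plus_on \<alpha> (A :: 'a set)" and lim: "(\<lambda>j. dist2 (\<nu> j) P) \<longlonglongrightarrow> 0"
  shows "of_positive P \<in> E_closure \<alpha> A"
  unfolding E_closure_def
proof (intro CollectI conjI allI impI of_positive_E_space P)
  fix \<epsilon> :: real assume \<epsilon>: "0 < \<epsilon>"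
  then obtain j where j: "dist2 (\<nu> j) P < \<epsilon>\<^sup>2"
    using order_tendstoD(2)[OF lim, of "\<epsilon>\<^sup>2"] by (auto simp: eventually_sequentially)
  have "dist2 P (\<nu> j) = dist2 (\<nu> j) P" using ip_commute[OF P E_plus_on_E_plus[OF \<nu>[of j]]] by (simp add: dist2_def)
  then have "strong_dist \<alpha> (of_positive P) (of_positive (\<nu> j)) < \<epsilon>"
    using j \<epsilon> real_sqrt_less_mono[OF j] by (simp add: strong_dist_dist2 P E_plus_on_E_plus[OF \<nu>])
  then show "\<exists>\<nu>\<in>E_plus_on \<alpha> A. strong_dist \<alpha> (of_positive P) (of_positive \<nu>) < \<epsilon>" using \<nu> by blast
qed

text \<open>Pairing with \<open>f\<close> is strongly continuous by Cauchy-Schwarz, so its vanishing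
  on the cone extends to all signed elements of the closure.\<close>

lemma E_closure_orthogonal:
  assumes f: "f \<in> L2 SM" and k: "k \<in> E_closure \<alpha> (A :: 'a set)"
    and 0: "\<And>\<nu>. \<nu> \<in> E_plus_on \<alpha> A \<Longrightarrow> (\<integral>p. f p * \<Phi> \<nu> p \<partial>SM) = 0"
  shows "(\<integral>p. f p * \<Psi> k p \<partial>SM) = 0"
proof -
  have E: "k \<in> E_space \<alpha>" using k by (simp add: E_closure_def)
  have "(\<integral>p. f p * \<Psi> k p \<partial>SM)\<^sup>2 \<le> (\<integral>p. (f p)\<^sup>2 \<partial>SM) * \<epsilon>\<^sup>2" if \<epsilon>: "0 < \<epsilon>" for \<epsilon>
  proof -
    obtain \<nu> where \<nu>: "\<nu> \<in> E_plus_on \<alpha> A" and d: "strong_dist \<alpha> k (of_positive \<nu>) < \<epsilon>"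
      using k \<epsilon> by (auto simp: E_closure_def)
    have \<nu>E: "\<nu> \<in> E_plus \<alpha>" by (rule E_plus_on_E_plus[OF \<nu>])
    have L: "(\<lambda>p. \<Psi> k p - \<Phi> \<nu> p) \<in> L2 SM" using L2_add[OF \<Psi>_L2[OF E] \<Phi>_L2[OF \<nu>E], of "-1"] by simp
    have "sqrt (\<integral>p. (\<Psi> k p - \<Phi> \<nu> p)\<^sup>2 \<partial>SM) \<le> \<epsilon>"
      using d by (simp add: strong_dist_\<Psi>[OF E of_positive_E_space[OF \<nu>E]])
    then have le: "(\<integral>p. (\<Psi> k p - \<Phi> \<nu> p)\<^sup>2 \<partial>SM) \<le> \<epsilon>\<^sup>2" using sqrt_le_D by blast
    have "(\<integral>p. f p * (\<Psi> k p - \<Phi> \<nu> p) \<partial>SM) = (\<integral>p. f p * \<Psi> k p \<partial>SM)"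
      using L2_mult[OF f \<Psi>_L2[OF E]] L2_mult[OF f \<Phi>_L2[OF \<nu>E]] 0[OF \<nu>] by (simp add: right_diff_distrib)
    then have "(\<integral>p. f p * \<Psi> k p \<partial>SM)\<^sup>2 \<le> (\<integral>p. (f p)\<^sup>2 \<partial>SM) * (\<integral>p. (\<Psi> k p - \<Phi> \<nu> p)\<^sup>2 \<partial>SM)"
      using L2_CS[OF f L] by simp
    also have "\<dots> \<le> (\<integral>p. (f p)\<^sup>2 \<partial>SM) * \<epsilon>\<^sup>2" using le by (intro mult_left_mono integral_nonneg_AE) auto
    finally show ?thesis .
  qed
  from this[of "1 / real (Suc j)" for j] have "(\<integral>p. f p * \<Psi> k p \<partial>SM)\<^sup>2 \<le> (\<integral>p. (f p)\<^sup>2 \<partial>SM) * (1 / real (Suc j))\<^sup>2" for j by simp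
  moreover have "(\<lambda>j. (\<integral>p. (f p)\<^sup>2 \<partial>SM) * (1 / real (Suc j))\<^sup>2) \<longlonglongrightarrow> (\<integral>p. (f p)\<^sup>2 \<partial>SM) * 0\<^sup>2"
    by (intro tendsto_intros LIMSEQ_Suc[OF lim_1_over_n])
  ultimately have "(\<integral>p. f p * \<Psi> k p \<partial>SM)\<^sup>2 \<le> (\<integral>p. (f p)\<^sup>2 \<partial>SM) * 0\<^sup>2" by (intro LIMSEQ_le_const) auto
  then show ?thesis by simp
qed

text \<open>Positive definiteness of the energy: by Cauchy-Schwarz, distance 0 forces equal energies
  with every measure in \<open>E_plus \<alpha>\<close>.\<close>

lemma eq_if_dist2_eq_0:
  assumes "\<mu> \<in> E_plus \<alpha>" "\<nu> \<in> E_plus \<alpha>" "dist2 \<mu> \<nu> = 0" shows "\<mu> = \<nu>"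
proof (rule measure_determined)
  fix l :: "'a measure" assume l: "l \<in> E_plus \<alpha>"
  have "ip l \<mu> = ip l \<nu>" using ip_CS[OF l assms(1,2)] assms(3) by simp
  then show "mutual_energy \<alpha> \<mu> l = mutual_energy \<alpha> \<nu> l"
    by (simp add: mutual_energy_ip assms l ip_commute[OF _ l])
qed (use assms E_plus_radon nn_integral_W_finite in auto)

text \<open>Equality on the whole cone makes the difference of \<open>L\<close> and \<open>P\<close>
  orthogonal to the closure, and to \<open>P\<close> in particular. The resulting Pythagorean
  identity gives minimality and uniqueness at once.\<close>

theorem inner_balayage_eq:
  assumes L: "L \<in> E_plus \<alpha>" and P: "P \<in> E_plus \<alpha>"
    and \<nu>: "\<And>j. \<nu> (j::nat) \<in> E_plus_on \<alpha> (A :: 'a set)" and lim: "(\<lambda>j. dist2 (\<nu> j) P) \<longlonglongrightarrow> 0"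
    and eq: "\<And>k. k \<in> E_plus_on \<alpha> A \<Longrightarrow> ip k P = ip k L"
  shows "inner_balayage \<alpha> A L = P"
proof -
  define f where "f = (\<lambda>p. \<Phi> L p - \<Phi> P p)"
  have f: "f \<in> L2 SM" using L2_add[OF \<Phi>_L2[OF L] \<Phi>_L2[OF P], of "-1"] by (simp add: f_def)
  have fint: "(\<integral>p. f p * g p \<partial>SM) = (\<integral>p. \<Phi> L p * g p \<partial>SM) - (\<integral>p. \<Phi> P p * g p \<partial>SM)" if "g \<in> L2 SM" for g
    using L2_mult[OF \<Phi>_L2[OF L] that] L2_mult[OF \<Phi>_L2[OF P] that] by (simp add: f_def left_diff_distrib)
  have orth: "(\<integral>p. f p * \<Psi> k p \<partial>SM) = 0" if "k \<in> E_closure \<alpha> A" for k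
  proof (rule E_closure_orthogonal[OF f that])
    fix \<nu> assume \<nu>: "\<nu> \<in> E_plus_on \<alpha> A"
    note E = E_plus_on_E_plus[OF \<nu>]
    show "(\<integral>p. f p * \<Phi> \<nu> p \<partial>SM) = 0"
      using eq[OF \<nu>] by (simp add: fint[OF \<Phi>_L2[OF E]] ip_\<Phi>[symmetric] L P E ip_commute[OF E])
  qed
  have Pc: "of_positive P \<in> E_closure \<alpha> A" by (rule of_positive_E_closure[OF P \<nu> lim])
  have pyth: "(\<integral>p. (\<Phi> L p - \<Psi> k p)\<^sup>2 \<partial>SM) = (\<integral>p. (\<Phi> L p - \<Phi> P p)\<^sup>2 \<partial>SM) + (\<integral>p. (\<Phi> P p - \<Psi> k p)\<^sup>2 \<partial>SM)"
    if k: "k \<in> E_closure \<alpha> A" for k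
  proof -
    have K: "\<Psi> k \<in> L2 SM" using k by (intro \<Psi>_L2) (simp add: E_closure_def)
    have "(\<integral>p. f p * \<Psi> k p \<partial>SM) = 0" "(\<integral>p. f p * \<Phi> P p \<partial>SM) = 0" using orth[OF k] orth[OF Pc] by simp_all
    then show ?thesis
      unfolding fint[OF K] fint[OF \<Phi>_L2[OF P]] L2_diff_square[OF \<Phi>_L2[OF L] K] L2_diff_square[OF \<Phi>_L2[OF P] K]
        L2_diff_square[OF \<Phi>_L2[OF L] \<Phi>_L2[OF P]] by (simp add: power2_eq_square)
  qed
  have dist: "strong_dist \<alpha> (of_positive L) k = sqrt (\<integral>p. (\<Phi> L p - \<Psi> k p)\<^sup>2 \<partial>SM)" if "k \<in> E_closure \<alpha> A" for k
    using that by (simp add: strong_dist_\<Psi> of_positive_E_space L E_closure_def)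
  show ?thesis
    unfolding inner_balayage_def
  proof (rule the_equality)
    have "strong_dist \<alpha> (of_positive L) (of_positive P) \<le> strong_dist \<alpha> (of_positive L) k" if k: "k \<in> E_closure \<alpha> A" for k
    proof -
      have "0 \<le> (\<integral>p. (\<Phi> P p - \<Psi> k p)\<^sup>2 \<partial>SM)" by (intro integral_nonneg_AE) auto
      then show ?thesis unfolding dist[OF k] dist[OF Pc] pyth[OF k] by simp
    qed
    then show "P \<in> E_plus \<alpha> \<and> of_positive P \<in> E_closure \<alpha> A \<and>
        (\<forall>\<nu>\<in>E_closure \<alpha> A. strong_dist \<alpha> (of_positive L) (of_positive P) \<le> strong_dist \<alpha> (of_positive L) \<nu>)"
      using P Pc by blast
  next
    fix Q assume Q: "Q \<in> E_plus \<alpha> \<and> of_positive Q \<in> E_closure \<alpha> A \<and>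
        (\<forall>\<nu>\<in>E_closure \<alpha> A. strong_dist \<alpha> (of_positive L) (of_positive Q) \<le> strong_dist \<alpha> (of_positive L) \<nu>)"
    then have Qc: "of_positive Q \<in> E_closure \<alpha> A" and QE: "Q \<in> E_plus \<alpha>" by auto
    have "strong_dist \<alpha> (of_positive L) (of_positive Q) \<le> strong_dist \<alpha> (of_positive L) (of_positive P)"
      using Q Pc by blast
    then have "dist2 P Q \<le> 0"
      unfolding dist[OF Qc] dist[OF Pc] pyth[OF Qc] by (simp add: dist2_\<Phi> P QE)
    then show "Q = P" using dist2_nonneg[OF P QE] eq_if_dist2_eq_0[OF P QE] by simp
  qed
qed

end

theorem corollary3p7:
  fixes \<alpha> :: real and A :: "'a::euclidean_space set" and \<mu> :: "'a measure"
  assumes "DIM('a) \<ge> 3"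
    and "0 < \<alpha>" and "\<alpha> \<le> 2"
    and "A \<subset> UNIV"
    and "inner_capacity \<alpha> A > 0"
    and "\<mu> \<in> E_plus \<alpha>"
  shows "(\<forall>l\<in>E_plus \<alpha>.
            mutual_energy \<alpha> \<mu> (inner_balayage \<alpha> A l) = mutual_energy \<alpha> (inner_balayage \<alpha> A \<mu>) l) \<and>
         (\<forall>\<nu>\<in>M_plus \<alpha>.
            (\<forall>l\<in>E_plus \<alpha>. mutual_energy \<alpha> \<mu> (inner_balayage \<alpha> A l) = mutual_energy \<alpha> \<nu> l)
              \<longrightarrow> \<nu> = inner_balayage \<alpha> A \<mu>)"
proof -
  interpret riesz \<alpha> "TYPE('a)" using assms by unfold_locales auto
  \<comment> \<open>One of the two balayages may be replaced by the unswept measure. The energy of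
    both balayages is symmetric, so exchanging the roles of \<open>l\<close> and \<open>m\<close>
    yields the asserted identity.\<close>
  have half: "ip (inner_balayage \<alpha> A l) (inner_balayage \<alpha> A m) = ip (inner_balayage \<alpha> A l) m"
    and bal: "inner_balayage \<alpha> A l \<in> E_plus \<alpha>" if l: "l \<in> E_plus \<alpha>" and m: "m \<in> E_plus \<alpha>" for l m :: "'a measure"
  proof -
    obtain P \<nu> where P: "P \<in> E_plus \<alpha>" "\<And>j. \<nu> (j::nat) \<in> E_plus_on \<alpha> A" "(\<lambda>j. dist2 (\<nu> j) P) \<longlonglongrightarrow> 0"
      "\<And>k. k \<in> E_plus_on \<alpha> A \<Longrightarrow> ip k P = ip k l"
      using projection[OF l, of A] by metis
    obtain Q \<nu>' where Q: "Q \<in> E_plus \<alpha>" "\<And>j. \<nu>' (j::nat) \<in> E_plus_on \<alpha> A" "(\<lambda>j. dist2 (\<nu>' j) Q) \<longlonglongrightarrow> 0"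
      "\<And>k. k \<in> E_plus_on \<alpha> A \<Longrightarrow> ip k Q = ip k m"
      using projection[OF m, of A] by metis
    have PA: "inner_balayage \<alpha> A l = P" by (rule inner_balayage_eq[OF l P])
    have QA: "inner_balayage \<alpha> A m = Q" by (rule inner_balayage_eq[OF m Q])
    note PQ = PA QA
    show "inner_balayage \<alpha> A l \<in> E_plus \<alpha>" unfolding PQ by (rule P)
    have lim: "(\<lambda>j. ip \<rho> (\<nu> j)) \<longlonglongrightarrow> ip \<rho> P" if "\<rho> \<in> E_plus \<alpha>" for \<rho>
      by (rule ip_tendsto[OF that E_plus_on_E_plus[OF P(2)] P(1,3)])
    \<comment> \<open>The equation for \<open>Q\<close> is available for measures carried by
      \<open>A\<close> only; it reaches \<open>P\<close> through the sequence approximating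
      \<open>P\<close>.\<close>
    have "ip Q (\<nu> j) = ip m (\<nu> j)" for j
      using Q(4)[OF P(2)[of j]] E_plus_on_E_plus[OF P(2)[of j]] by (simp add: ip_commute Q(1) m)
    then have "ip Q P = ip m P" using LIMSEQ_unique[OF lim[OF Q(1)]] lim[OF m] by simp
    then show "ip (inner_balayage \<alpha> A l) (inner_balayage \<alpha> A m) = ip (inner_balayage \<alpha> A l) m"
      unfolding PQ using ip_commute[OF P(1) Q(1)] ip_commute[OF P(1) m] by simp
  qed
  have eq: "mutual_energy \<alpha> \<mu> (inner_balayage \<alpha> A l) = mutual_energy \<alpha> (inner_balayage \<alpha> A \<mu>) l"
    if l: "l \<in> E_plus \<alpha>" for l
  proof -
    note \<mu> = assms(6)
    have "ip \<mu> (inner_balayage \<alpha> A l) = ip (inner_balayage \<alpha> A \<mu>) l"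
      using half[OF l \<mu>] half[OF \<mu> l] ip_commute[OF bal[OF l \<mu>] bal[OF \<mu> l]] ip_commute[OF \<mu> bal[OF l \<mu>]] by simp
    then show ?thesis by (simp add: mutual_energy_ip l \<mu> bal[OF _ \<mu>])
  qed
  have "\<nu> = inner_balayage \<alpha> A \<mu>"
    if "\<nu> \<in> M_plus \<alpha>" and \<nu>: "\<forall>l\<in>E_plus \<alpha>. mutual_energy \<alpha> \<mu> (inner_balayage \<alpha> A l) = mutual_energy \<alpha> \<nu> l" for \<nu>
  proof -
    \<comment> \<open>The balayage serves as the first measure in \<open>measure_determined\<close>,
      since for it the integral of \<open>W\<close> is finite from the outset.\<close>
    note b = bal[OF assms(6) assms(6)]
    have "inner_balayage \<alpha> A \<mu> = \<nu>"
      using that eq by (intro measure_determined E_plus_radon[OF b] nn_integral_W_finite[OF b]) (auto simp: M_plus_def)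
    then show ?thesis by simp
  qed
  with eq show ?thesis by blast
qed

end
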